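(* Let $N,k\ge1$ be integers, $\rho>1$, $1\le p<\infty$ with $p>\frac{N+2k}{2}(\rho-1)$, and $u_0\in L^p(\mathbb{R}^{N+k})$. Then there exist $T>0$ and a unique $L^p$-mild solution $u$, in $X_\alpha\cap E$, of $$u_t-\Delta_{\mathcal G}u=|u|^{\rho-1}u\ \text{ in }\mathbb{R}^{N+k}\times(0,T],\qquad u(0)=u_0 .$$ Moreover, if $u(t)$ and $v(t)$ are mild solutions of this problem with initial data $u_0$ and $v_0$, respectively, then $$\|u(t)-v(t)\|_{L^p}\le C\|u_0-v_0\|_{L^p}\quad\text{for all } t\in[0,T].$$
   Context: Here $\Delta_{\mathcal G}=\frac12(\Delta_x+|x|^2\Delta_y)$ is the Grushin operator, with $x\in\mathbb{R}^N$, $y\in\mathbb{R}^k$. Its heat semigroup is $S_{\mathcal G}(0)=I$ and, for $t>0$, $S_{\mathcal G}(t)\varphi(x,y)=\int_{\mathbb{R}^{N+k}}K(x,w,y-z;t)\varphi(w,z)\,d(w,z)$, where $$K(x,w,y;t)=\frac{1}{(2\pi)^{\frac{N+2k}{2}}}\int_{\mathbb{R}^k}\left(\frac{|\xi|}{\sinh(|\xi|t)}\right)^{\frac N2}e^{\,i\xi\cdot y-\frac{|\xi|}{2}\left((|x|^2+|w|^2)\coth(|\xi|t)-2x\cdot w\,\operatorname{csch}(|\xi|t)\right)}\,d\xi ,\quad \operatorname{csch}=1/\sinh.$$ For $T>0$ put $\alpha=\frac{N+2k}{2\rho p}(\rho-1)$, $E=C([0,T];L^p(\mathbb{R}^{N+k}))$,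 and $$X_\alpha=\Big\{u\in C((0,T];L^{\rho p}(\mathbb{R}^{N+k})):\ \|u\|_{X_\alpha}=\sup_{t\in(0,T]}t^\alpha\|u(t)\|_{L^{\rho p}}<\infty\Big\}.$$ An $L^p$-mild solution (here also called simply a mild solution) with initial datum $u_0\in L^p(\mathbb{R}^{N+k})$ is a continuous function $u:[0,T]\to L^p(\mathbb{R}^{N+k})$ satisfying $$u(t)=S_{\mathcal G}(t)u_0+\int_0^tS_{\mathcal G}(t-s)|u(s)|^{\rho-1}u(s)\,ds .$$
   Formalization: A mild solution is also required to have |u|^{ρ-1}u in L^1(0,T;L^q) for some q≥1, so that the integral equation makes sense when p<ρ (automatic if p≥ρ or u in X_α∩E); C depends on T, u_0 and a common bound for the L^p norms of u(t) and v(t). *)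

theory Defs
  imports "HOL-Analysis.Analysis"
begin

section \<open>Lebesgue spaces and Lebesgue-space-valued functions\<close>

text \<open>
  Elements of \<open>L\<^sup>p\<close> (\<open>1 \<le> p < \<infinity>\<close>) are represented by Borel functions; two representatives
  stand for the same element iff they agree almost everywhere. All notions below respect
  this identification.
\<close>

definition Lp :: "real \<Rightarrow> ('a::euclidean_space \<Rightarrow> real) set" where
  "Lp p = {f \<in> borel_measurable lborel. integrable lborel (\<lambda>z. \<bar>f z\<bar> powr p)}"

definition Lp_norm :: "real \<Rightarrow> ('a::euclidean_space \<Rightarrow> real) \<Rightarrow> real" where
  "Lp_norm p f = (\<integral>z. \<bar>f z\<bar> powr p \<partial>lborel) powr (1 / p)"

definition Lp_continuous_on :: "real \<Rightarrow> real set \<Rightarrow> (real \<Rightarrow> 'a::euclidean_space \<Rightarrow> real) \<Rightarrow> bool" where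
  "Lp_continuous_on p A u \<longleftrightarrow>
     (\<forall>t\<in>A. u t \<in> Lp p) \<and>
     (\<forall>t\<in>A. ((\<lambda>s. Lp_norm p (\<lambda>z. u s z - u t z)) \<longlongrightarrow> 0) (at t within A))"

text \<open>
  The Bochner integral in \<open>L\<^sup>p\<close>. The constant \<open>has_bochner_integral\<close> needs a Banach space as
  the value type, and \<open>L\<^sup>p\<close> is not a type, so its definition by simple functions is repeated
  here. The almost everywhere convergence expresses strong measurability of \<open>g\<close>.
\<close>

definition Lp_simple_integral ::
  "'i measure \<Rightarrow> ('i \<Rightarrow> 'a::euclidean_space \<Rightarrow> real) \<Rightarrow> 'a \<Rightarrow> real" where
  "Lp_simple_integral M s =
     (\<lambda>z. \<Sum>\<phi>\<in>s ` space M. measure M {\<tau> \<in> space M. s \<tau> = \<phi>} * \<phi> z)"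

definition has_Lp_integral ::
  "real \<Rightarrow> 'i measure \<Rightarrow> ('i \<Rightarrow> 'a::euclidean_space \<Rightarrow> real) \<Rightarrow> ('a \<Rightarrow> real) \<Rightarrow> bool" where
  "has_Lp_integral p M g I \<longleftrightarrow>
     (AE \<tau> in M. g \<tau> \<in> Lp p) \<and> I \<in> Lp p \<and>
     (\<exists>s :: nat \<Rightarrow> 'i \<Rightarrow> 'a \<Rightarrow> real.
        (\<forall>n. simple_function M (s n) \<and> (\<forall>\<tau>\<in>space M. s n \<tau> \<in> Lp p) \<and>
             emeasure M {\<tau> \<in> space M. s n \<tau> \<noteq> (\<lambda>_. 0)} \<noteq> \<infinity>) \<and>
        (AE \<tau> in M. (\<lambda>n. Lp_norm p (\<lambda>z. g \<tau> z - s n \<tau> z)) \<longlonglongrightarrow> 0) \<and>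
        (\<lambda>n. \<integral>\<^sup>+\<tau>. ennreal (Lp_norm p (\<lambda>z. g \<tau> z - s n \<tau> z)) \<partial>M) \<longlonglongrightarrow> 0 \<and>
        (\<lambda>n. Lp_norm p (\<lambda>z. I z - Lp_simple_integral M (s n) z)) \<longlonglongrightarrow> 0)"


section \<open>The Grushin heat semigroup\<close>

text \<open>
  The imaginary part of the \<open>\<xi>\<close>-integrand is odd in \<open>\<xi>\<close>, so the integral is real and \<open>Re\<close>
  discards nothing.
\<close>

definition grushin_kernel ::
  "real^'n \<Rightarrow> real^'n \<Rightarrow> real^'k \<Rightarrow> real \<Rightarrow> real" where
  "grushin_kernel x w y t =
     1 / (2 * pi) powr ((real CARD('n) + 2 * real CARD('k)) / 2) *
     Re (\<integral>\<xi>. of_real ((norm \<xi> / sinh (norm \<xi> * t)) powr (real CARD('n) / 2)) *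
              exp (\<i> * of_real (\<xi> \<bullet> y) -
                   of_real (norm \<xi> / 2 *
                     (((norm x)\<^sup>2 + (norm w)\<^sup>2) * (cosh (norm \<xi> * t) / sinh (norm \<xi> * t))
                      - 2 * (x \<bullet> w) * (1 / sinh (norm \<xi> * t)))))
          \<partial>lborel)"

definition grushin_semigroup ::
  "real \<Rightarrow> ((real^'n) \<times> (real^'k) \<Rightarrow> real) \<Rightarrow> (real^'n) \<times> (real^'k) \<Rightarrow> real" where
  "grushin_semigroup t \<phi> =
     (if t = 0 then \<phi>
      else (\<lambda>(x, y). \<integral>(w, z). grushin_kernel x w (y - z) t * \<phi> (w, z) \<partial>lborel))"


section \<open>Mild solutions and the solution spaces\<close>

definition nonlinearity :: "real \<Rightarrow> ('a \<Rightarrow> real) \<Rightarrow> 'a \<Rightarrow> real" where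
  "nonlinearity \<rho> v = (\<lambda>z. \<bar>v z\<bar> powr (\<rho> - 1) * v z)"

text \<open>
  The semigroup acts on \<open>L\<^sup>q\<close> for \<open>q \<ge> 1\<close>, so for the integral equation to make sense the source
  term has to belong to \<open>L\<^sup>1(0,T;L\<^sup>q)\<close> for some \<open>q \<ge> 1\<close>. If \<open>p \<ge> \<rho>\<close>, this holds with \<open>q = p/\<rho>\<close>
  for every \<open>u \<in> C([0,T];L\<^sup>p)\<close>. If \<open>p < \<rho>\<close>, membership of \<open>u(s)\<close> in \<open>L\<^sup>p\<close> alone does not even make
  the source term locally integrable. For \<open>p > (N+2k)(\<rho>-1)/2\<close> every \<open>u \<in> X_space \<inter> E_space\<close>
  satisfies it with \<open>q = p\<close>.
\<close>

definition admissible_source ::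
  "real \<Rightarrow> real \<Rightarrow> (real \<Rightarrow> 'a::euclidean_space \<Rightarrow> real) \<Rightarrow> bool" where
  "admissible_source \<rho> T u \<longleftrightarrow>
     (\<exists>q\<ge>1. (AE s in restrict_space lborel {0..T}. nonlinearity \<rho> (u s) \<in> Lp q) \<and>
            (\<integral>\<^sup>+s. ennreal (Lp_norm q (nonlinearity \<rho> (u s))) \<partial>restrict_space lborel {0..T}) < \<infinity>)"

definition E_space :: "real \<Rightarrow> real \<Rightarrow> (real \<Rightarrow> 'a::euclidean_space \<Rightarrow> real) set" where
  "E_space p T = {u. Lp_continuous_on p {0..T} u}"

definition mild_solution ::
  "real \<Rightarrow> real \<Rightarrow> real \<Rightarrow> ((real^'n) \<times> (real^'k) \<Rightarrow> real) \<Rightarrow>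
   (real \<Rightarrow> (real^'n) \<times> (real^'k) \<Rightarrow> real) \<Rightarrow> bool" where
  "mild_solution p \<rho> T u0 u \<longleftrightarrow>
     u \<in> E_space p T \<and> admissible_source \<rho> T u \<and>
     (\<forall>t\<in>{0..T}. \<exists>I.
        has_Lp_integral p (restrict_space lborel {0..t})
          (\<lambda>s. grushin_semigroup (t - s) (nonlinearity \<rho> (u s))) I \<and>
        (AE z in lborel. u t z = grushin_semigroup t u0 z + I z))"

definition grushin_alpha :: "'n itself \<Rightarrow> 'k itself \<Rightarrow> real \<Rightarrow> real \<Rightarrow> real" where
  "grushin_alpha _ _ p \<rho> = (real CARD('n) + 2 * real CARD('k)) / (2 * \<rho> * p) * (\<rho> - 1)"

definition X_space ::
  "real \<Rightarrow> real \<Rightarrow> real \<Rightarrow> (real \<Rightarrow> (real^'n) \<times> (real^'k) \<Rightarrow> real) set" where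
  "X_space p \<rho> T =
     {u. Lp_continuous_on (\<rho> * p) {0<..T} u \<and>
         bdd_above ((\<lambda>t. t powr grushin_alpha TYPE('n) TYPE('k) p \<rho> * Lp_norm (\<rho> * p) (u t)) ` {0<..T})}"

end

theory Submission
  imports Defs "HOL-Probability.Probability"
begin

text \<open>
  Writing \<open>D = (N + 2k)/2\<close>, all that is used about the Grushin kernel is that it is a symmetric Markov
  kernel, bounded by \<open>c t\<^bsup>-D\<^esup>\<close>, continuous in \<open>t\<close> and concentrating on the diagonal as \<open>t \<rightarrow> 0\<close>. Jensen's
  inequality then gives the smoothing estimates \<open>L\<^sup>a \<rightarrow> L\<^sup>b\<close>, and since
  \<open>\<beta> = D(\<rho> - 1)/p < 1\<close> the Duhamel term is a contraction of \<open>X\<^sub>\<alpha>\<close> for small \<open>T\<close>.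

  For the continuous dependence a mild solution is only known to be bounded in \<open>L\<^sup>p\<close>. The difference of two
  solutions satisfies a weakly singular integral inequality with the source measured in \<open>L\<^sup>q\<close>,
  \<open>q = max(1, p/\<rho>)\<close>, which is closed by a Gronwall lemma with an explicit supersolution.

  In the variable \<open>y\<close> the kernel is the Fourier transform of \<open>\<xi> \<mapsto>\<close> the Mehler kernel of frequency \<open>|\<xi>|\<close>. Its
  positivity comes from a discrete Trotter formula: the Mehler kernel is a limit of
  compositions of the free heat kernel in \<open>x\<close> with multiplication by \<open>exp (-\<epsilon> |x|\<^sup>2 |\<xi>|\<^sup>2)\<close>, and both factors are
  positive definite in \<open>\<xi>\<close>. Mass and concentration are read off by testing with Gaussians in \<open>y\<close>.
\<close>

section \<open>Lebesgue norms of extended nonnegative functions\<close>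

text \<open>The obstacle that shapes the first half is that L^p consists of classes of functions. A
  curve in L^p fixes each \<open>u t\<close> only up to a null set that may vary with
  \<open>t\<close>, so Fubini and Minkowski do not apply to it directly. Every curve is therefore
  replaced by a jointly measurable version, on which the abstract time integral is an ordinary
  integral at almost every point. Norms take values in \<open>ennreal\<close>, so that estimates can
  be chained before finiteness is known. For p < \<rho> a bound in L^p says nothing about
  |u|^\<rho>. Admissibility supplies some integrable norm of the source, and interpolation against
  the L^p bound turns it into integrability in L^1(0,T;L^1), the a priori finiteness from which the
  Gronwall argument starts. In the second half the kernel is an oscillatory integral, so its sign is
  invisible. The Mehler kernel contains sinh and cosh of |\<xi>|, whereas one splitting step
  contains \<xi> only through a Gaussian, whose Fourier transform is known to be positive; hence the
  detour through the discrete product.\<close>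

definition epowr :: "ennreal \<Rightarrow> real \<Rightarrow> ennreal" where
  "epowr x r = (if x = \<top> then \<top> else ennreal (enn2real x powr r))"

lemma epowr_ennreal [simp]: "0 \<le> x \<Longrightarrow> epowr (ennreal x) r = ennreal (x powr r)"
  by (simp add: epowr_def)

lemma epowr_top [simp]: "epowr \<top> r = \<top>"
  by (simp add: epowr_def)

text \<open>Zero and infinity are fixed by every exponent, also by zero and negative ones. With this
  convention the laws for products, iterated powers and sums of exponents hold without side
  conditions.\<close>

lemma epowr_0 [simp]: "epowr 0 r = 0"
  by (simp add: epowr_def)

lemma epowr_1 [simp]: "epowr 1 r = 1"
  by (simp add: epowr_def)

lemma epowr_one [simp]: "epowr x 1 = x"
  by (cases x) (auto simp: powr_one')

lemma epowr_eq_0_iff [simp]: "epowr x r = 0 \<longleftrightarrow> x = 0"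
  by (cases x) auto

lemma epowr_eq_top_iff [simp]: "epowr x r = \<top> \<longleftrightarrow> x = \<top>"
  by (cases x) auto

lemma epowr_less_top_iff [simp]: "epowr x r < \<top> \<longleftrightarrow> x < \<top>"
  by (simp add: less_top[symmetric])

lemma epowr_mono: "x \<le> y \<Longrightarrow> 0 \<le> r \<Longrightarrow> epowr x r \<le> epowr y r"
  by (cases x; cases y) (auto simp: powr_mono2 top_unique)

lemma epowr_mult: "epowr (x * y) r = epowr x r * epowr y r"
  by (cases x; cases y)
     (auto simp: ennreal_mult[symmetric] powr_mult ennreal_mult_top ennreal_top_mult ennreal_mult_eq_top_iff)

lemma epowr_epowr: "epowr (epowr x r) s = epowr x (r * s)"
  by (cases x) (auto simp: powr_powr)

lemma epowr_add: "epowr x (r + s) = epowr x r * epowr x s"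
  by (cases x) (auto simp: powr_add ennreal_mult)

lemma epowr_inverse [simp]: "r \<noteq> 0 \<Longrightarrow> epowr (epowr x r) (1 / r) = x" "r \<noteq> 0 \<Longrightarrow> epowr (epowr x (1 / r)) r = x"
  by (simp_all add: epowr_epowr)

lemma ennreal_mult_inverse: "x \<noteq> 0 \<Longrightarrow> x < \<top> \<Longrightarrow> x * inverse x = (1::ennreal)"
  by (cases x) (auto simp: inverse_ennreal ennreal_mult[symmetric])

lemma measurable_epowr [measurable]: "(\<lambda>x. epowr x r) \<in> borel_measurable borel"
  unfolding epowr_def by measurable

text \<open>A monotone map onto a linear order leaves no room for jumps, and the root
  \<open>epowr _ (1 / r)\<close> shows that the map is onto. Continuity at infinity is included; the
  truncation in Minkowski's inequality relies on it.\<close>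

lemma continuous_on_epowr: "0 < r \<Longrightarrow> continuous_on UNIV (\<lambda>x. epowr x r)"
proof (rule continuous_onI_mono)
  assume "0 < r"
  then have "(\<lambda>x. epowr x r) ` UNIV = UNIV"
    by (intro surjI[of _ "\<lambda>x. epowr x (1 / r)"]) simp
  then show "open ((\<lambda>x. epowr x r) ` UNIV)" by simp
qed (auto intro: epowr_mono)

lemma tendsto_epowr: "(f \<longlongrightarrow> x) F \<Longrightarrow> 0 < r \<Longrightarrow> ((\<lambda>n. epowr (f n) r) \<longlongrightarrow> epowr x r) F"
  using continuous_on_tendsto_compose[OF continuous_on_epowr, of r f x F] by simp

section \<open>The L^p functional on extended nonnegative functions\<close>

definition eLnorm :: "real \<Rightarrow> ('a::euclidean_space \<Rightarrow> ennreal) \<Rightarrow> ennreal" where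
  "eLnorm p f = epowr (\<integral>\<^sup>+z. epowr (f z) p \<partial>lborel) (1 / p)"

lemma epowr_eLnorm: "p \<noteq> 0 \<Longrightarrow> epowr (eLnorm p f) p = (\<integral>\<^sup>+z. epowr (f z) p \<partial>lborel)"
  by (simp add: eLnorm_def)

lemma eLnorm_mono_AE: "AE z in lborel. f z \<le> g z \<Longrightarrow> 0 \<le> p \<Longrightarrow> eLnorm p f \<le> eLnorm p g"
  unfolding eLnorm_def by (intro epowr_mono nn_integral_mono_AE) (auto intro: epowr_mono)

lemma eLnorm_mono: "(\<And>z. f z \<le> g z) \<Longrightarrow> 0 \<le> p \<Longrightarrow> eLnorm p f \<le> eLnorm p g"
  by (intro eLnorm_mono_AE) auto

lemma eLnorm_cong_AE: "AE z in lborel. f z = g z \<Longrightarrow> eLnorm p f = eLnorm p g"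
  unfolding eLnorm_def by (intro arg_cong[where f="\<lambda>x. epowr x _"] nn_integral_cong_AE) auto

lemma eLnorm_cmult:
  assumes [measurable]: "f \<in> borel_measurable borel" and "0 < p"
  shows "eLnorm p (\<lambda>z. c * f z) = c * eLnorm p f"
  using assms(2) by (simp add: eLnorm_def epowr_mult nn_integral_cmult)

lemma eLnorm_0 [simp]: "eLnorm p (\<lambda>_. 0) = 0"
  by (simp add: eLnorm_def)

lemma eLnorm_eq_0D:
  assumes [measurable]: "f \<in> borel_measurable borel" and "eLnorm p f = 0"
  shows "AE z in lborel. f z = 0"
  using assms(2) by (simp add: eLnorm_def nn_integral_0_iff_AE)

lemma eLnorm_finite_AE:
  assumes [measurable]: "f \<in> borel_measurable borel" and "eLnorm p f < \<top>"
  shows "AE z in lborel. f z < \<top>"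
proof -
  have "(\<integral>\<^sup>+z. epowr (f z) p \<partial>lborel) \<noteq> \<infinity>" using assms(2) by (simp add: eLnorm_def)
  then show ?thesis
    using nn_integral_PInf_AE[of "\<lambda>z. epowr (f z) p" lborel] by (auto simp: less_top)
qed

lemma measurable_eLnorm [measurable (raw)]:
  assumes [measurable]: "(\<lambda>x. f (fst x) (snd x)) \<in> borel_measurable (M \<Otimes>\<^sub>M borel)"
  shows "(\<lambda>s. eLnorm p (f s)) \<in> borel_measurable M"
  unfolding eLnorm_def by (simp cong: measurable_cong_sets) measurable

lemma Young_ennreal:
  assumes "1 < r" "1 / r + 1 / s = 1"
  shows "x * y \<le> ennreal (1 / r) * epowr x r + ennreal (1 / s) * epowr y s"
proof -
  have s: "1 < s"
  proof -
    have "1 / r < 1" "0 < 1 / r" using assms by auto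
    then have "0 < 1 / s" "1 / s < 1" using assms by linarith+
    then show ?thesis by (auto simp: divide_less_eq split: if_splits)
  qed
  show ?thesis
  proof (cases x; cases y)
    fix a b assume *: "0 \<le> a" "x = ennreal a" "0 \<le> b" "y = ennreal b"
    have "a * b \<le> 1 / r * a powr r + 1 / s * b powr s"
      using Youngs_inequality[of r s a b] assms s * by (simp add: add.commute)
    then show ?thesis using * assms s
      by (simp add: ennreal_mult[symmetric] ennreal_plus[symmetric] del: ennreal_plus)
  qed (use assms s in \<open>auto simp: ennreal_mult_top\<close>)
qed


section \<open>The inequalities of Hoelder, Jensen and Minkowski, and interpolation\<close>

lemma conjugate_exponent:
  fixes r s :: real
  assumes "1 < r" "1 / r + 1 / s = 1" shows "1 < s"
proof -
  have "1 / r < 1" "0 < 1 / r" using assms by auto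
  then have "0 < 1 / s" "1 / s < 1" using assms by linarith+
  then show ?thesis by (auto simp: divide_less_eq split: if_splits)
qed

text \<open>Both factors are normalised to norm 1 and Young's inequality is integrated. A vanishing
  norm makes the product null and an infinite one makes the bound trivial; only the remaining case
  permits the division.\<close>

lemma nn_integral_Holder:
  assumes [measurable]: "f \<in> borel_measurable M" "g \<in> borel_measurable M"
    and rs: "1 < r" "1 / r + 1 / s = 1"
  shows "(\<integral>\<^sup>+z. f z * g z \<partial>M) \<le>
    epowr (\<integral>\<^sup>+z. epowr (f z) r \<partial>M) (1 / r) * epowr (\<integral>\<^sup>+z. epowr (g z) s \<partial>M) (1 / s)"
proof -
  have s: "1 < s" using conjugate_exponent[OF rs] .
  define F where "F = (\<integral>\<^sup>+z. epowr (f z) r \<partial>M)"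
  define G where "G = (\<integral>\<^sup>+z. epowr (g z) s \<partial>M)"
  consider "F = 0 \<or> G = 0" | "F \<noteq> 0" "G \<noteq> 0" "F = \<top> \<or> G = \<top>" | "F \<noteq> 0" "G \<noteq> 0" "F < \<top>" "G < \<top>"
    using top.not_eq_extremum by blast
  then show ?thesis
  proof cases
    case 1
    then have "AE z in M. f z * g z = 0"
      unfolding F_def G_def by (auto simp: nn_integral_0_iff_AE)
    then have "(\<integral>\<^sup>+z. f z * g z \<partial>M) = (\<integral>\<^sup>+z. 0 \<partial>M)" by (rule nn_integral_cong_AE)
    then show ?thesis by simp
  next
    case 2
    then show ?thesis unfolding F_def[symmetric] G_def[symmetric]
      by (auto simp: ennreal_mult_top ennreal_top_mult)
  next
    case 3
    define a where "a = epowr F (1 / r)"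
    define b where "b = epowr G (1 / s)"
    have ab: "a \<noteq> 0" "b \<noteq> 0" "a \<noteq> \<top>" "b \<noteq> \<top>" using 3 by (auto simp: a_def b_def)
    have ar: "epowr a r = F" "epowr b s = G" using rs s by (simp_all add: a_def b_def)
    have inv: "x = a * (inverse a * x)" "x = b * (inverse b * x)" for x
      using ab by (simp_all add: mult.assoc[symmetric] ennreal_mult_inverse less_top)
    have inv_pow: "epowr (inverse a) r * F = 1" "epowr (inverse b) s * G = 1"
      unfolding ar[symmetric] epowr_mult[symmetric] using ab
      by (simp_all add: ennreal_inverse_mult less_top mult.commute[of "inverse _"] ennreal_mult_inverse)
    have "(\<integral>\<^sup>+z. f z * g z \<partial>M) = (\<integral>\<^sup>+z. (a * b) * ((inverse a * f z) * (inverse b * g z)) \<partial>M)"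
    proof (intro nn_integral_cong)
      fix z show "f z * g z = (a * b) * ((inverse a * f z) * (inverse b * g z))"
        using inv(1)[of "f z"] inv(2)[of "g z"] by (metis mult.assoc mult.left_commute)
    qed
    also have "\<dots> = (a * b) * (\<integral>\<^sup>+z. (inverse a * f z) * (inverse b * g z) \<partial>M)"
      by (rule nn_integral_cmult) simp
    also have "(\<integral>\<^sup>+z. (inverse a * f z) * (inverse b * g z) \<partial>M) \<le>
        (\<integral>\<^sup>+z. ennreal (1 / r) * epowr (inverse a * f z) r + ennreal (1 / s) * epowr (inverse b * g z) s \<partial>M)"
      by (intro nn_integral_mono Young_ennreal rs)
    also have "\<dots> = ennreal (1 / r) * (epowr (inverse a) r * F) + ennreal (1 / s) * (epowr (inverse b) s * G)"
      by (simp add: nn_integral_add nn_integral_cmult epowr_mult F_def G_def)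
    also have "\<dots> = ennreal (1 / r + 1 / s)"
      unfolding inv_pow using rs s by (subst ennreal_plus) auto
    also have "\<dots> = 1" using rs by simp
    finally show ?thesis by (simp add: a_def b_def F_def G_def mult_left_mono)
  qed
qed

text \<open>The conjugate version is applied to the powers \<open>epowr _ q\<close> with exponents a
  / q and b / q. Since no triangle inequality enters, \<open>q\<close> may also lie below 1.\<close>

lemma eLnorm_Holder:
  assumes [measurable]: "f \<in> borel_measurable borel" "g \<in> borel_measurable borel"
    and q: "0 < q" "0 < a" "0 < b" "1 / q = 1 / a + 1 / b"
  shows "eLnorm q (\<lambda>z. f z * g z) \<le> eLnorm a f * eLnorm b g"
proof -
  have "1 / a < 1 / q" using q by simp
  then have "q < a" using q(1,2) by (simp add: field_simps)
  then have 1: "1 < a / q" using q by simp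
  have "q / a + q / b = q * (1 / a + 1 / b)" by (simp add: distrib_left)
  also have "\<dots> = 1" using q by (simp flip: q(4))
  finally have 2: "1 / (a / q) + 1 / (b / q) = 1" by simp
  have "(\<integral>\<^sup>+z. epowr (f z) q * epowr (g z) q \<partial>lborel) \<le>
     epowr (\<integral>\<^sup>+z. epowr (epowr (f z) q) (a / q) \<partial>lborel) (1 / (a / q)) *
     epowr (\<integral>\<^sup>+z. epowr (epowr (g z) q) (b / q) \<partial>lborel) (1 / (b / q))"
    by (rule nn_integral_Holder[OF _ _ 1 2]) auto
  then have le: "(\<integral>\<^sup>+z. epowr (f z) q * epowr (g z) q \<partial>lborel) \<le>
     epowr (\<integral>\<^sup>+z. epowr (f z) a \<partial>lborel) (q / a) * epowr (\<integral>\<^sup>+z. epowr (g z) b \<partial>lborel) (q / b)"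
    using q by (simp add: epowr_epowr)
  have "eLnorm q (\<lambda>z. f z * g z) \<le> epowr (epowr (\<integral>\<^sup>+z. epowr (f z) a \<partial>lborel) (q / a) *
     epowr (\<integral>\<^sup>+z. epowr (g z) b \<partial>lborel) (q / b)) (1 / q)"
    unfolding eLnorm_def epowr_mult[of _ _ q] using q le by (intro epowr_mono) auto
  also have "\<dots> = eLnorm a f * eLnorm b g"
    using q(1-3) by (simp add: epowr_mult epowr_epowr eLnorm_def)
  finally show ?thesis .
qed

text \<open>The weight is split as w^(1/a) * w^(1/s), and Hoelder's inequality leaves the total mass
  as a second factor, so mass at most 1 suffices. Besides Markov kernels this covers half the
  difference of two of them.\<close>

lemma Jensen_epowr:
  assumes [measurable]: "w \<in> borel_measurable M" "f \<in> borel_measurable M"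
    and w: "(\<integral>\<^sup>+z. w z \<partial>M) \<le> 1" and a: "1 \<le> a"
  shows "epowr (\<integral>\<^sup>+z. w z * f z \<partial>M) a \<le> (\<integral>\<^sup>+z. w z * epowr (f z) a \<partial>M)"
proof (cases "a = 1")
  case False
  then have a: "1 < a" using a by simp
  define s where "s = a / (a - 1)"
  have s: "1 / a + 1 / s = 1" using a by (simp add: s_def field_simps)
  have "(\<integral>\<^sup>+z. w z * f z \<partial>M) = (\<integral>\<^sup>+z. (epowr (w z) (1 / a) * f z) * epowr (w z) (1 / s) \<partial>M)"
    by (intro nn_integral_cong) (simp add: mult.assoc mult.left_commute[of "f _"] flip: epowr_add, simp add: s mult.commute mult.left_commute
       mult.assoc[symmetric] flip: epowr_add)
  also have "\<dots> \<le> epowr (\<integral>\<^sup>+z. epowr (epowr (w z) (1 / a) * f z) a \<partial>M) (1 / a) *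
      epowr (\<integral>\<^sup>+z. epowr (epowr (w z) (1 / s)) s \<partial>M) (1 / s)"
    by (rule nn_integral_Holder[OF _ _ a s]) auto
  also have "\<dots> \<le> epowr (\<integral>\<^sup>+z. w z * epowr (f z) a \<partial>M) (1 / a) * epowr 1 (1 / s)"
    using a w s by (intro mult_mono epowr_mono) (auto simp: epowr_mult s_def epowr_epowr)
  finally have "epowr (\<integral>\<^sup>+z. w z * f z \<partial>M) a \<le> epowr (epowr (\<integral>\<^sup>+z. w z * epowr (f z) a \<partial>M) (1 / a)) a"
    using a by (intro epowr_mono) auto
  then show ?thesis using a by simp
qed simp

text \<open>Writing G^p = G * G^(p-1) and applying Fubini and Hoelder gives A \<le> B * A^(1/s),
  with A the p-th power of the norm. Cancelling requires A to be finite, which truncation provides.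
  Over counting measures the statement becomes the triangle inequality for finitely or countably
  many functions.\<close>

lemma Minkowski_integral:
  fixes F :: "'s \<Rightarrow> 'a::euclidean_space \<Rightarrow> ennreal"
  assumes "sigma_finite_measure M" and F [measurable]: "(\<lambda>x. F (fst x) (snd x)) \<in> borel_measurable (M \<Otimes>\<^sub>M borel)"
    and p: "1 \<le> p"
  shows "eLnorm p (\<lambda>z. \<integral>\<^sup>+s. F s z \<partial>M) \<le> (\<integral>\<^sup>+s. eLnorm p (F s) \<partial>M)"
proof -
  interpret sigma_finite_measure M by fact
  interpret pair_sigma_finite M lborel ..
  have F' [measurable]: "(\<lambda>x. F (fst x) (snd x)) \<in> borel_measurable (M \<Otimes>\<^sub>M lborel)"
    using F by (simp cong: measurable_cong_sets)
  show ?thesis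
  proof (cases "p = 1")
    case True
    then show ?thesis
      using Fubini'[of "\<lambda>s z. F s z"] F' by (simp add: eLnorm_def case_prod_beta')
  next
    case False
    then have p: "1 < p" using p by simp
    define s where "s = p / (p - 1)"
    have s: "1 / p + 1 / s = 1" "(p - 1) * s = p" "0 < s" using p by (simp_all add: s_def field_simps)
    have s': "1 / s + 1 / p = 1" "1 < s" using s p by (simp_all add: s_def)
    define G where "G z = (\<integral>\<^sup>+s. F s z \<partial>M)" for z
    have [measurable]: "(\<lambda>x. F (snd x) (fst x)) \<in> borel_measurable (borel \<Otimes>\<^sub>M M)"
      using measurable_compose[OF measurable_pair_swap' F] by (simp add: case_prod_beta')
    have [measurable]: "(\<lambda>s. F s z) \<in> borel_measurable M" for z
      using measurable_compose[OF measurable_Pair2'[of z borel M] F] by simp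
    have [measurable]: "G \<in> borel_measurable borel" unfolding G_def by measurable
    define B where "B = (\<integral>\<^sup>+s. eLnorm p (F s) \<partial>M)"
    \<comment> \<open>The cut-off in height and in space makes the p-th power integrable; monotone
      convergence removes it at the end.\<close>
    define H where "H n z = min (G z) (of_nat n) * indicator (ball 0 (real n)) z" for n :: nat and z
    have [measurable]: "ball 0 (real n) \<in> sets (borel :: 'a measure)" for n by simp
    have [measurable]: "H n \<in> borel_measurable borel" for n unfolding H_def by measurable
    have HG: "H n z \<le> G z" for n z by (auto simp: H_def indicator_def)
    have H_mono: "H n z \<le> H (Suc n) z" for n z
      unfolding H_def by (intro mult_mono min.mono of_nat_mono order_refl) (auto simp: indicator_def)
    have bound: "eLnorm p (H n) \<le> B" for n
    proof -
      define A where "A = (\<integral>\<^sup>+z. epowr (H n z) p \<partial>lborel)"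
      have "A \<le> (\<integral>\<^sup>+(z::'a). ennreal (real n powr p) * indicator (ball 0 (real n)) z \<partial>lborel)"
        unfolding A_def
      proof (intro nn_integral_mono)
        fix z show "epowr (H n z) p \<le> ennreal (real n powr p) * indicator (ball 0 (real n)) z"
          using epowr_mono[of "min (G z) (of_nat n)" "ennreal (real n)" p] p
          by (auto simp: H_def indicator_def ennreal_of_nat_eq_real_of_nat)
      qed
      also have "\<dots> < \<top>"
        using emeasure_bounded_finite[OF bounded_ball, of "0::'a" "real n"]
        by (simp add: nn_integral_cmult ennreal_mult_less_top)
      finally have fin: "A < \<top>" .
      have "A = (\<integral>\<^sup>+z. H n z * epowr (H n z) (p - 1) \<partial>lborel)"
        unfolding A_def using epowr_add[of _ 1 "p - 1"] by simp
      also have "\<dots> \<le> (\<integral>\<^sup>+z. G z * epowr (H n z) (p - 1) \<partial>lborel)"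
        by (intro nn_integral_mono mult_right_mono HG) simp
      also have "\<dots> = (\<integral>\<^sup>+z. (\<integral>\<^sup>+s. F s z * epowr (H n z) (p - 1) \<partial>M) \<partial>lborel)"
        unfolding G_def by (intro nn_integral_cong nn_integral_multc[symmetric]) measurable
      also have "\<dots> = (\<integral>\<^sup>+s. (\<integral>\<^sup>+z. F s z * epowr (H n z) (p - 1) \<partial>lborel) \<partial>M)"
        by (rule Fubini') measurable
      also have "\<dots> \<le> (\<integral>\<^sup>+t. eLnorm p (F t) * epowr A (1 / s) \<partial>M)"
      proof (intro nn_integral_mono)
        fix t assume t: "t \<in> space M"
        have [measurable]: "F t \<in> borel_measurable borel"
          using measurable_compose[OF measurable_Pair1'[OF t] F] by simp
        show "(\<integral>\<^sup>+z. F t z * epowr (H n z) (p - 1) \<partial>lborel) \<le> eLnorm p (F t) * epowr A (1 / s)"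
          using nn_integral_Holder[of "F t" lborel "\<lambda>z. epowr (H n z) (p - 1)" p s] s p
          by (simp add: eLnorm_def A_def epowr_epowr)
      qed
      also have "\<dots> = B * epowr A (1 / s)"
        unfolding B_def by (intro nn_integral_multc) measurable
      finally have le: "A \<le> B * epowr A (1 / s)" .
      show ?thesis
      proof (cases "A = 0")
        case True then show ?thesis by (simp add: eLnorm_def flip: A_def)
      next
        case False
        have nz: "epowr A (1 / s) \<noteq> 0" "epowr A (1 / s) < \<top>" using False fin by auto
        have "epowr A (1 / p) * epowr A (1 / s) \<le> B * epowr A (1 / s)"
          using le s by (simp flip: epowr_add)
        then have "epowr A (1 / p) \<le> B"
          using nz by (simp add: ennreal_mult_le_mult_iff mult.commute[of _ "epowr A (1 / s)"] less_top)
        then show ?thesis by (simp add: eLnorm_def A_def)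
      qed
    qed
    have "eLnorm p G = epowr (\<integral>\<^sup>+z. (SUP n. epowr (H n z) p) \<partial>lborel) (1 / p)"
    proof -
      have "(SUP n. epowr (H n z) p) = epowr (G z) p" for z
      proof (rule LIMSEQ_unique[OF LIMSEQ_SUP])
        show "incseq (\<lambda>n. epowr (H n z) p)"
          using p by (intro incseq_SucI epowr_mono H_mono) auto
        have "(\<lambda>n. min (G z) (of_nat n)) \<longlonglongrightarrow> min (G z) \<top>"
          by (intro tendsto_min tendsto_const of_nat_tendsto_top_ennreal)
        moreover have "eventually (\<lambda>n. min (G z) (of_nat n) = H n z) sequentially"
          using eventually_gt_at_top[of "nat \<lceil>norm z\<rceil>"]
          proof eventually_elim
          case (elim n)
          then have "norm z < real n" by linarith
          then show ?case by (simp add: H_def)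
        qed
        ultimately have "(\<lambda>n. H n z) \<longlonglongrightarrow> G z"
          by (auto intro: Lim_transform_eventually)
        then show "(\<lambda>n. epowr (H n z) p) \<longlonglongrightarrow> epowr (G z) p"
          using p by (intro tendsto_epowr) auto
      qed
      then show ?thesis by (simp add: eLnorm_def)
    qed
    also have "\<dots> = epowr (SUP n. \<integral>\<^sup>+z. epowr (H n z) p \<partial>lborel) (1 / p)"
    proof (subst nn_integral_monotone_convergence_SUP)
      show "incseq (\<lambda>n z. epowr (H n z) p)"
        using p by (intro incseq_SucI le_funI epowr_mono H_mono) auto
    qed auto
    also have "\<dots> \<le> epowr (epowr B p) (1 / p)"
    proof (intro epowr_mono SUP_least)
      fix n show "(\<integral>\<^sup>+z. epowr (H n z) p \<partial>lborel) \<le> epowr B p"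
        using epowr_mono[OF bound[of n], of p] p by (simp add: epowr_eLnorm)
    qed (use p in auto)
    finally show ?thesis using p by (simp add: G_def[abs_def] B_def)
  qed
qed


text \<open>A sum of two functions is an integral over the counting measure on
  \<open>bool\<close>.\<close>

lemma eLnorm_add_le:
  assumes [measurable]: "f \<in> borel_measurable borel" "g \<in> borel_measurable borel" and "1 \<le> p"
  shows "eLnorm p (\<lambda>z. f z + g z) \<le> eLnorm p f + eLnorm p g"
proof -
  have "eLnorm p (\<lambda>z. \<integral>\<^sup>+b. (if b then f z else g z) \<partial>count_space (UNIV :: bool set))
      \<le> (\<integral>\<^sup>+b. eLnorm p (\<lambda>z. if b then f z else g z) \<partial>count_space UNIV)"
    by (intro Minkowski_integral assms sigma_finite_measure_count_space) measurable
  then show ?thesis by (simp add: nn_integral_count_space_finite UNIV_bool add.commute)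
qed

lemma eLnorm_suminf_le:
  fixes f :: "nat \<Rightarrow> 'a::euclidean_space \<Rightarrow> ennreal"
  assumes [measurable]: "\<And>n. f n \<in> borel_measurable borel" and "1 \<le> p"
  shows "eLnorm p (\<lambda>z. \<Sum>n. f n z) \<le> (\<Sum>n. eLnorm p (f n))"
proof -
  have "eLnorm p (\<lambda>z. \<integral>\<^sup>+n. f n z \<partial>count_space (UNIV :: nat set))
      \<le> (\<integral>\<^sup>+n. eLnorm p (f n) \<partial>count_space UNIV)"
    by (intro Minkowski_integral assms sigma_finite_measure_count_space) measurable
  then show ?thesis by (simp add: nn_integral_count_space_nat)
qed

text \<open>With \<theta> solving 1/b = (1 - \<theta>)/a + \<theta>/c, Hoelder's inequality is
  applied to f = f^(1 - \<theta>) * f^\<theta>. Since \<theta> depends on the exponents alone,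
  convergence in L^a and a bound in L^c give convergence in L^b along a whole sequence; the
  continuity of the solution in L^(\<rho> p) is obtained in this way.\<close>

lemma eLnorm_interpolate:
  assumes abc: "0 < a" "a < b" "b < c"
  shows "\<exists>\<theta>\<in>{0<..<1}. \<forall>f\<in>borel_measurable (borel :: 'a::euclidean_space measure).
    eLnorm b f \<le> epowr (eLnorm a f) (1 - \<theta>) * epowr (eLnorm c f) \<theta>"
proof -
  define \<theta> where "\<theta> = (1 / a - 1 / b) / (1 / a - 1 / c)"
  have 0: "1 / c < 1 / b" "1 / b < 1 / a" using abc by (auto intro!: divide_strict_left_mono)
  then have \<theta>: "0 < \<theta>" "\<theta> < 1" 
  proof -
    have "0 < x / y \<and> x / y < 1" if "0 < x" "x < y" for x y :: real using that by simp
    from this[of "1 / a - 1 / b" "1 / a - 1 / c"] show "0 < \<theta>" "\<theta> < 1"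
      using 0 unfolding \<theta>_def by (meson diff_gt_0_iff_gt diff_strict_left_mono)+
  qed
  have "x / y * y = x" if "y \<noteq> 0" for x y :: real using that by simp
  then have "\<theta> * (1 / a - 1 / c) = 1 / a - 1 / b" using 0 unfolding \<theta>_def by (metis diff_gt_0_iff_gt less_irrefl order.strict_trans)
  then have e: "1 / b = 1 / (a / (1 - \<theta>)) + 1 / (c / \<theta>)"
    by (simp add: algebra_simps diff_divide_distrib)
  have "eLnorm b f \<le> epowr (eLnorm a f) (1 - \<theta>) * epowr (eLnorm c f) \<theta>"
    if [measurable]: "f \<in> borel_measurable (borel :: 'a measure)" for f
  proof -
    have "eLnorm b f = eLnorm b (\<lambda>z. epowr (f z) (1 - \<theta>) * epowr (f z) \<theta>)"
      by (simp flip: epowr_add)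
    also have "\<dots> \<le> eLnorm (a / (1 - \<theta>)) (\<lambda>z. epowr (f z) (1 - \<theta>)) * eLnorm (c / \<theta>) (\<lambda>z. epowr (f z) \<theta>)"
      using abc \<theta> e by (intro eLnorm_Holder) auto
    also have "\<dots> = epowr (eLnorm a f) (1 - \<theta>) * epowr (eLnorm c f) \<theta>"
      using \<theta> by (simp add: eLnorm_def epowr_epowr)
    finally show ?thesis .
  qed
  then show ?thesis using \<theta> by (intro bexI[of _ \<theta>] ballI) auto
qed

section \<open>Real-valued L^p functions, expressed by the extended norm\<close>

lemma Lp_measurable: "f \<in> Lp p \<Longrightarrow> f \<in> borel_measurable borel"
  by (simp add: Lp_def)

lemma Lp_iff_eLnorm:
  "f \<in> Lp p \<longleftrightarrow> f \<in> borel_measurable borel \<and> eLnorm p (\<lambda>z. ennreal \<bar>f z\<bar>) < \<top>"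
proof -
  have "integrable lborel (\<lambda>z. \<bar>f z\<bar> powr p) \<longleftrightarrow> eLnorm p (\<lambda>z. ennreal \<bar>f z\<bar>) < \<top>"
    if [measurable]: "f \<in> borel_measurable borel"
    by (simp add: integrable_iff_bounded eLnorm_def)
  then show ?thesis by (auto simp: Lp_def)
qed

lemma ennreal_Lp_norm:
  assumes "f \<in> Lp p" shows "ennreal (Lp_norm p f) = eLnorm p (\<lambda>z. ennreal \<bar>f z\<bar>)"
proof -
  have "ennreal (\<integral>z. \<bar>f z\<bar> powr p \<partial>lborel) = (\<integral>\<^sup>+z. ennreal (\<bar>f z\<bar> powr p) \<partial>lborel)"
    using assms by (intro nn_integral_eq_integral[symmetric]) (auto simp: Lp_def)
  then have "eLnorm p (\<lambda>z. ennreal \<bar>f z\<bar>) = epowr (ennreal (\<integral>z. \<bar>f z\<bar> powr p \<partial>lborel)) (1 / p)"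
    by (simp add: eLnorm_def)
  then show ?thesis by (simp add: Lp_norm_def)
qed

lemma Lp_norm_nonneg [simp]: "0 \<le> Lp_norm p f"
  by (simp add: Lp_norm_def)

lemma Lp_norm_eq: "f \<in> Lp p \<Longrightarrow> Lp_norm p f = enn2real (eLnorm p (\<lambda>z. ennreal \<bar>f z\<bar>))"
  by (simp flip: ennreal_Lp_norm)

lemma eLnorm_abs_add_le:
  fixes f g :: "'a::euclidean_space \<Rightarrow> real"
  assumes [measurable]: "f \<in> borel_measurable borel" "g \<in> borel_measurable borel" and "1 \<le> p"
  shows "eLnorm p (\<lambda>z. ennreal \<bar>f z + g z\<bar>) \<le> eLnorm p (\<lambda>z. ennreal \<bar>f z\<bar>) + eLnorm p (\<lambda>z. ennreal \<bar>g z\<bar>)"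
  using assms(3)
  by (intro order_trans[OF eLnorm_mono eLnorm_add_le])
     (auto simp: ennreal_plus[symmetric] simp del: ennreal_plus intro!: ennreal_leI)

lemma eLnorm_abs_minus_commute: "eLnorm p (\<lambda>z. ennreal \<bar>f z - g z :: real\<bar>) = eLnorm p (\<lambda>z. ennreal \<bar>g z - f z\<bar>)"
  by (simp add: abs_minus_commute)

lemma eLnorm_abs_triangle:
  fixes f g h :: "'a::euclidean_space \<Rightarrow> real"
  assumes [measurable]: "f \<in> borel_measurable borel" "g \<in> borel_measurable borel" "h \<in> borel_measurable borel" and "1 \<le> p"
  shows "eLnorm p (\<lambda>z. ennreal \<bar>f z - h z\<bar>) \<le> eLnorm p (\<lambda>z. ennreal \<bar>f z - g z\<bar>) + eLnorm p (\<lambda>z. ennreal \<bar>g z - h z\<bar>)"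
  using eLnorm_abs_add_le[of "\<lambda>z. f z - g z" "\<lambda>z. g z - h z" p] assms by simp

lemma eLnorm_abs_le_add_diff:
  fixes f g :: "'a::euclidean_space \<Rightarrow> real"
  assumes [measurable]: "f \<in> borel_measurable borel" "g \<in> borel_measurable borel" and "1 \<le> p"
  shows "eLnorm p (\<lambda>z. ennreal \<bar>f z\<bar>) \<le> eLnorm p (\<lambda>z. ennreal \<bar>f z - g z\<bar>) + eLnorm p (\<lambda>z. ennreal \<bar>g z\<bar>)"
  using eLnorm_abs_triangle[of f g "\<lambda>_. 0" p] assms by simp

lemma Lp_add:
  assumes "f \<in> Lp p" "g \<in> Lp p" "1 \<le> p" shows "(\<lambda>z. f z + g z) \<in> Lp p"
  using assms eLnorm_abs_add_le[of f g p]
  by (auto simp: Lp_iff_eLnorm ennreal_add_less_top less_top elim!: order.strict_trans1 neq_top_trans[rotated])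

lemma Lp_cmult:
  assumes "f \<in> Lp p" "0 < p" shows "(\<lambda>z. c * f z) \<in> Lp p"
proof -
  have [measurable]: "f \<in> borel_measurable borel" using assms by (simp add: Lp_iff_eLnorm)
  show ?thesis using assms eLnorm_cmult[of "\<lambda>z. ennreal \<bar>f z\<bar>" p "ennreal \<bar>c\<bar>"]
    by (auto simp: Lp_iff_eLnorm abs_mult ennreal_mult ennreal_mult_less_top)
qed

lemma Lp_diff:
  assumes "f \<in> Lp p" "g \<in> Lp p" "1 \<le> p" shows "(\<lambda>z. f z - g z) \<in> Lp p"
  using Lp_add[OF assms(1) Lp_cmult[OF assms(2), of "-1"]] assms(3) by simp

lemma Lp_cong_AE:
  assumes "f \<in> Lp p" "g \<in> borel_measurable borel" "AE z in lborel. f z = g z"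
  shows "g \<in> Lp p"
proof -
  have "AE z in lborel. ennreal \<bar>f z\<bar> = ennreal \<bar>g z\<bar>" using assms(3) by eventually_elim simp
  then show ?thesis using assms eLnorm_cong_AE[of "\<lambda>z. ennreal \<bar>f z\<bar>" "\<lambda>z. ennreal \<bar>g z\<bar>" p]
    by (auto simp: Lp_iff_eLnorm)
qed

lemma Lp_norm_cong_AE:
  assumes "f \<in> Lp p" "g \<in> borel_measurable borel" "AE z in lborel. f z = g z"
  shows "Lp_norm p f = Lp_norm p g"
proof -
  have "AE z in lborel. ennreal \<bar>f z\<bar> = ennreal \<bar>g z\<bar>" using assms(3) by eventually_elim simp
  then show ?thesis using assms(1) eLnorm_cong_AE[of "\<lambda>z. ennreal \<bar>f z\<bar>" "\<lambda>z. ennreal \<bar>g z\<bar>" p] Lp_cong_AE[OF assms]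
    by (simp add: Lp_norm_eq)
qed

lemma tendsto_Lp_norm_iff:
  assumes "\<And>i. f i \<in> Lp p"
  shows "((\<lambda>i. Lp_norm p (f i)) \<longlongrightarrow> 0) F \<longleftrightarrow> ((\<lambda>i. eLnorm p (\<lambda>z. ennreal \<bar>f i z\<bar>)) \<longlongrightarrow> 0) F"
  using tendsto_ennreal_iff[of "\<lambda>i. Lp_norm p (f i)" F 0] assms by (simp add: ennreal_Lp_norm)

text \<open>The Riesz-Fischer argument: the sum of the absolute increments has finite norm, hence is
  finite almost everywhere and dominates the telescoping series. The limit is the pointwise
  \<open>lim\<close>, so it remains jointly measurable when the sequence also depends on
  time.\<close>

lemma Lp_complete:
  fixes u :: "nat \<Rightarrow> 'a::euclidean_space \<Rightarrow> real"
  assumes [measurable]: "\<And>n. u n \<in> borel_measurable borel" and p: "1 \<le> p"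
    and c: "\<And>n. eLnorm p (\<lambda>z. ennreal \<bar>u (Suc n) z - u n z\<bar>) \<le> ennreal (c n)" "\<And>n. 0 \<le> c n" "summable c"
  shows "AE z in lborel. convergent (\<lambda>n. u n z)"
    and "eLnorm p (\<lambda>z. ennreal \<bar>lim (\<lambda>n. u n z) - u n z\<bar>) \<le> ennreal (\<Sum>j. c (j + n))"
proof -
  define d where "d n z = ennreal \<bar>u (Suc n) z - u n z\<bar>" for n z
  have [measurable]: "d n \<in> borel_measurable borel" for n unfolding d_def by measurable
  have sum: "eLnorm p (\<lambda>z. \<Sum>j. d (j + n) z) \<le> ennreal (\<Sum>j. c (j + n))" for n
  proof -
    have "eLnorm p (\<lambda>z. \<Sum>j. d (j + n) z) \<le> (\<Sum>j. eLnorm p (d (j + n)))"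
      by (intro eLnorm_suminf_le p) measurable
    also have "\<dots> \<le> (\<Sum>j. ennreal (c (j + n)))"
      using c by (intro suminf_le) (auto simp: d_def[abs_def])
    also have "\<dots> = ennreal (\<Sum>j. c (j + n))"
      using c by (intro suminf_ennreal2 summable_ignore_initial_segment) auto
    finally show ?thesis .
  qed
  have "AE z in lborel. (\<Sum>j. d (j + 0) z) < \<top>"
    by (intro eLnorm_finite_AE[OF _ order.strict_trans1[OF sum]]) auto
  then have main: "AE z in lborel. convergent (\<lambda>n. u n z) \<and>
      (\<forall>n. ennreal \<bar>lim (\<lambda>n. u n z) - u n z\<bar> \<le> (\<Sum>j. d (j + n) z))"
  proof eventually_elim
    fix z assume fin: "(\<Sum>j. d (j + 0) z) < \<top>"
    have abs: "summable (\<lambda>j. \<bar>u (Suc j) z - u j z\<bar>)"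
      using fin by (intro summable_suminf_not_top) (auto simp: d_def less_top)
    then have "summable (\<lambda>j. u (Suc j) z - u j z)" by (rule summable_rabs_cancel)
    then have "convergent (\<lambda>n. \<Sum>j<n. u (Suc j) z - u j z)"
      by (simp add: summable_iff_convergent)
    then have "convergent (\<lambda>n. (u n z - u 0 z) + u 0 z)"
      by (intro convergent_add convergent_const) (simp add: sum_lessThan_telescope[of "\<lambda>n. u n z"])
    then have conv: "convergent (\<lambda>n. u n z)" by simp
    moreover have "ennreal \<bar>lim (\<lambda>n. u n z) - u n z\<bar> \<le> (\<Sum>j. d (j + n) z)" for n
    proof -
      have lim: "(\<lambda>j. u j z) \<longlonglongrightarrow> lim (\<lambda>n. u n z)"
        using conv by (simp add: convergent_LIMSEQ_iff)
      have "(\<lambda>m. \<Sum>j<m. u (Suc (j + n)) z - u (j + n) z) \<longlonglongrightarrow> lim (\<lambda>n. u n z) - u n z"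
        using tendsto_diff[OF LIMSEQ_ignore_initial_segment[OF lim, of n] tendsto_const[of "u n z"]]
          sum_lessThan_telescope[of "\<lambda>j. u (j + n) z"] by simp
      then have "(\<lambda>j. u (Suc (j + n)) z - u (j + n) z) sums (lim (\<lambda>n. u n z) - u n z)"
        by (simp add: sums_def)
      moreover have abs': "summable (\<lambda>j. \<bar>u (Suc (j + n)) z - u (j + n) z\<bar>)"
        using summable_ignore_initial_segment[OF abs, of n] by simp
      ultimately have "\<bar>lim (\<lambda>n. u n z) - u n z\<bar> \<le> (\<Sum>j. \<bar>u (Suc (j + n)) z - u (j + n) z\<bar>)"
        using summable_rabs[OF abs'] by (simp add: sums_iff)
      then show ?thesis
        using abs' by (auto simp: d_def suminf_ennreal2 intro!: ennreal_leI)
    qed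
    ultimately show "convergent (\<lambda>n. u n z) \<and>
      (\<forall>n. ennreal \<bar>lim (\<lambda>n. u n z) - u n z\<bar> \<le> (\<Sum>j. d (j + n) z))" by blast
  qed
  then show "AE z in lborel. convergent (\<lambda>n. u n z)" by auto
  have "eLnorm p (\<lambda>z. ennreal \<bar>lim (\<lambda>n. u n z) - u n z\<bar>) \<le> eLnorm p (\<lambda>z. \<Sum>j. d (j + n) z)"
    using main p by (intro eLnorm_mono_AE) auto
  also note sum
  finally show "eLnorm p (\<lambda>z. ennreal \<bar>lim (\<lambda>n. u n z) - u n z\<bar>) \<le> ennreal (\<Sum>j. c (j + n))" .
qed

section \<open>Symmetric Markov kernels\<close>

lemma nn_integral_dominated:
  assumes "\<And>i. u i \<in> borel_measurable M" "w \<in> borel_measurable M"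
    "\<And>i. AE x in M. u i x \<le> w x" "(\<integral>\<^sup>+x. w x \<partial>M) < \<top>" "AE x in M. (\<lambda>i. u i x) \<longlonglongrightarrow> (0::ennreal)"
  shows "(\<lambda>i. \<integral>\<^sup>+x. u i x \<partial>M) \<longlonglongrightarrow> 0"
  using nn_integral_dominated_convergence[of u M "\<lambda>_. 0" w] assms by simp

text \<open>\<open>c\<close> \<ge> 1 lets one constant absorb the powers c^(1/a - 1/b) of all
  smoothing estimates, and \<open>D\<close> \<ge> 1 makes (\<rho> - 1) / p < 1 follow from D *
  (\<rho> - 1) < p. Continuity and concentration are required only pointwise in space; Scheffe's
  lemma and dominated convergence turn them into statements in L^p.\<close>

locale markov_kernel =
  fixes k :: "real \<Rightarrow> 'a::euclidean_space \<Rightarrow> 'a \<Rightarrow> real" and D c :: real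
  assumes D_ge_1: "1 \<le> D" and c_ge_1: "1 \<le> c"
    and measurable_k: "(\<lambda>x. k (fst x) (fst (snd x)) (snd (snd x))) \<in> borel_measurable (borel \<Otimes>\<^sub>M (borel \<Otimes>\<^sub>M borel))"
    and k_nonneg: "\<And>t x y. 0 < t \<Longrightarrow> 0 \<le> k t x y"
    and k_sym: "\<And>t x y. k t x y = k t y x"
    and k_bound: "\<And>t x y. 0 < t \<Longrightarrow> k t x y \<le> c * t powr (- D)"
    and k_mass: "\<And>t x. 0 < t \<Longrightarrow> (\<integral>\<^sup>+y. ennreal (k t x y) \<partial>lborel) = 1"
    and k_cont: "\<And>t x y. 0 < t \<Longrightarrow> ((\<lambda>s. k s x y) \<longlongrightarrow> k t x y) (at t)"
    and k_conc: "\<And>A x. open A \<Longrightarrow> x \<in> A \<Longrightarrow>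
      ((\<lambda>t. \<integral>\<^sup>+y. ennreal (k t x y) * indicator (- A) y \<partial>lborel) \<longlongrightarrow> 0) (at_right 0)"
begin

definition S :: "real \<Rightarrow> ('a \<Rightarrow> real) \<Rightarrow> 'a \<Rightarrow> real" where
  "S t f = (if t = 0 then f else (\<lambda>x. \<integral>y. k t x y * f y \<partial>lborel))"

text \<open>The positive companion of \<open>S\<close>: estimates are proved for it, free of
  integrability questions, and transferred by \<open>abs_S_le\<close>.\<close>

definition eS :: "real \<Rightarrow> ('a \<Rightarrow> ennreal) \<Rightarrow> 'a \<Rightarrow> ennreal" where
  "eS t f x = (\<integral>\<^sup>+y. ennreal (k t x y) * f y \<partial>lborel)"

lemma k_measurable [measurable (raw)]:
  assumes "f \<in> borel_measurable M" "g \<in> measurable M borel" "h \<in> measurable M borel"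
  shows "(\<lambda>x. k (f x) (g x) (h x)) \<in> borel_measurable M"
proof -
  have "(\<lambda>x. (f x, g x, h x)) \<in> M \<rightarrow>\<^sub>M borel \<Otimes>\<^sub>M (borel \<Otimes>\<^sub>M borel)"
    using assms by measurable
  from measurable_compose[OF this measurable_k] show ?thesis by simp
qed

lemma k_mass2: "0 < t \<Longrightarrow> (\<integral>\<^sup>+x. ennreal (k t x y) \<partial>lborel) = 1"
  using k_mass[of t y] by (simp add: k_sym[of t _ y])

lemma eS_measurable [measurable (raw)]:
  assumes [measurable]: "h \<in> borel_measurable M" "g \<in> measurable M borel"
    and [measurable]: "(\<lambda>x. F (fst x) (snd x)) \<in> borel_measurable (M \<Otimes>\<^sub>M borel)"
  shows "(\<lambda>x. eS (h x) (F x) (g x)) \<in> borel_measurable M"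
proof -
  have [measurable]: "(\<lambda>x. F (fst x) (snd x)) \<in> borel_measurable (M \<Otimes>\<^sub>M lborel)"
    by (simp cong: measurable_cong_sets)
  show ?thesis unfolding eS_def by measurable
qed

text \<open>Measurability is joint in time, space and the parameter of the data, as Fubini's theorem
  for Duhamel integrands demands.\<close>

lemma S_measurable [measurable (raw)]:
  assumes [measurable]: "h \<in> borel_measurable M" "g \<in> measurable M borel"
    and [measurable]: "(\<lambda>x. F (fst x) (snd x)) \<in> borel_measurable (M \<Otimes>\<^sub>M borel)"
  shows "(\<lambda>x. S (h x) (F x) (g x)) \<in> borel_measurable M"
proof -
  have [measurable]: "(\<lambda>x. F (fst x) (snd x)) \<in> borel_measurable (M \<Otimes>\<^sub>M lborel)"
    by (simp cong: measurable_cong_sets)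
  have [measurable]: "(\<lambda>x. F x (g x)) \<in> borel_measurable M"
    using measurable_compose[of "\<lambda>x. (x, g x)" M "M \<Otimes>\<^sub>M borel", OF _ assms(3)] by simp
  have "(\<lambda>x. if h x = 0 then F x (g x) else (\<integral>y. k (h x) (g x) y * F x y \<partial>lborel)) \<in> borel_measurable M"
    by measurable
  moreover have "S (h x) (F x) (g x) = (if h x = 0 then F x (g x) else (\<integral>y. k (h x) (g x) y * F x y \<partial>lborel))" for x
    by (simp add: S_def)
  ultimately show ?thesis by simp
qed

section \<open>Jensen bounds, smoothing and contraction\<close>

lemma eS_powr_le:
  assumes [measurable]: "f \<in> borel_measurable borel" and "0 < t" "1 \<le> a"
  shows "epowr (eS t f x) a \<le> eS t (\<lambda>y. epowr (f y) a) x"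
  unfolding eS_def using assms k_mass[of t x] by (intro Jensen_epowr) auto

lemma nn_integral_eS:
  assumes [measurable]: "f \<in> borel_measurable borel" and "0 < t"
  shows "(\<integral>\<^sup>+x. eS t f x \<partial>lborel) = (\<integral>\<^sup>+y. f y \<partial>lborel)"
proof -
  have "(\<integral>\<^sup>+x. eS t f x \<partial>lborel) = (\<integral>\<^sup>+y. \<integral>\<^sup>+x. ennreal (k t x y) * f y \<partial>lborel \<partial>lborel)"
    unfolding eS_def by (rule lborel_pair.Fubini') measurable
  also have "\<dots> = (\<integral>\<^sup>+y. f y \<partial>lborel)"
    using assms(2) by (simp add: nn_integral_multc k_mass2)
  finally show ?thesis .
qed

lemma eS_le_sup:
  assumes [measurable]: "f \<in> borel_measurable borel" and t: "0 < t"
  shows "eS t f x \<le> ennreal (c * t powr (- D)) * (\<integral>\<^sup>+y. f y \<partial>lborel)"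
proof -
  have "eS t f x \<le> (\<integral>\<^sup>+y. ennreal (c * t powr (- D)) * f y \<partial>lborel)"
    unfolding eS_def using t by (intro nn_integral_mono mult_right_mono ennreal_leI k_bound) auto
  then show ?thesis by (simp add: nn_integral_cmult)
qed

text \<open>Jensen bounds \<open>(S f)\<^sup>b\<close> by \<open>(S f\<^sup>a)\<^bsup>b/a\<^esup>\<close>; all but one of the factors \<open>S f\<^sup>a\<close>
  are then estimated by the supremum of the kernel.\<close>

lemma eS_smoothing:
  assumes f [measurable]: "f \<in> borel_measurable borel" and t: "0 < t" and ab: "1 \<le> a" "a \<le> b"
  shows "eLnorm b (eS t f) \<le> ennreal (c * t powr (- (D * (1 / a - 1 / b)))) * eLnorm a f"
proof -
  define m where "m = c * t powr (- D)"
  have m: "0 \<le> m" using c_ge_1 by (simp add: m_def)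
  define A where "A = (\<integral>\<^sup>+y. epowr (f y) a \<partial>lborel)"
  have "(\<integral>\<^sup>+x. epowr (eS t f x) b \<partial>lborel) \<le>
      (\<integral>\<^sup>+x. epowr (ennreal m * A) (b / a - 1) * eS t (\<lambda>y. epowr (f y) a) x \<partial>lborel)"
  proof (intro nn_integral_mono)
    fix x
    have "epowr (eS t f x) b = epowr (epowr (eS t f x) a) (b / a)"
      using ab by (simp add: epowr_epowr)
    also have "\<dots> \<le> epowr (eS t (\<lambda>y. epowr (f y) a) x) (b / a)"
      using ab t by (intro epowr_mono eS_powr_le) auto
    also have "\<dots> = epowr (eS t (\<lambda>y. epowr (f y) a) x) (b / a - 1) * eS t (\<lambda>y. epowr (f y) a) x"
      using epowr_add[of _ "b / a - 1" 1] by simp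
    also have "\<dots> \<le> epowr (ennreal m * A) (b / a - 1) * eS t (\<lambda>y. epowr (f y) a) x"
      unfolding A_def m_def using ab t
      by (intro mult_right_mono epowr_mono eS_le_sup) auto
    finally show "epowr (eS t f x) b \<le> \<dots>" .
  qed
  also have "\<dots> = epowr (ennreal m * A) (b / a - 1) * A"
    using t by (simp add: nn_integral_cmult nn_integral_eS A_def)
  also have "\<dots> = epowr (ennreal m) (b / a - 1) * epowr A (b / a)"
    using epowr_add[of A "b / a - 1" 1] by (simp add: epowr_mult mult.assoc)
  finally have "eLnorm b (eS t f) \<le> epowr (epowr (ennreal m) (b / a - 1) * epowr A (b / a)) (1 / b)"
    unfolding eLnorm_def using ab by (intro epowr_mono) auto
  also have "\<dots> = ennreal (m powr (1 / a - 1 / b)) * eLnorm a f"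
    using ab m by (simp add: epowr_mult epowr_epowr A_def eLnorm_def powr_powr diff_divide_distrib)
  also have "m powr (1 / a - 1 / b) \<le> c * t powr (- (D * (1 / a - 1 / b)))"
  proof -
    have "1 / a \<le> 1" "0 < 1 / b" "1 / b \<le> 1 / a" using ab by (auto simp: frac_le)
    then have "c powr (1 / a - 1 / b) \<le> c powr 1" using c_ge_1 by (intro powr_mono) linarith+
    then show ?thesis using c_ge_1 by (simp add: m_def powr_mult powr_powr mult_right_mono)
  qed
  finally show ?thesis by (simp add: mult_right_mono ennreal_leI)
qed

text \<open>Jensen's inequality and conservation of mass give the constant 1, where the smoothing
  estimate with equal exponents would give \<open>c\<close>.\<close>

lemma eS_contraction:
  assumes [measurable]: "f \<in> borel_measurable borel" and t: "0 < t" and p: "1 \<le> p"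
  shows "eLnorm p (eS t f) \<le> eLnorm p f"
proof -
  have "(\<integral>\<^sup>+x. epowr (eS t f x) p \<partial>lborel) \<le> (\<integral>\<^sup>+x. eS t (\<lambda>y. epowr (f y) p) x \<partial>lborel)"
    using t p by (intro nn_integral_mono eS_powr_le) auto
  also have "\<dots> = (\<integral>\<^sup>+y. epowr (f y) p \<partial>lborel)"
    using t by (simp add: nn_integral_eS)
  finally show ?thesis unfolding eLnorm_def using p by (intro epowr_mono) auto
qed

text \<open>Jensen bounds the a-th power of the absolute integral by the supremum of the kernel
  times the a-th power of the norm. The integral therefore converges at every point, not merely at
  almost every point.\<close>

lemma integrable_k_mult:
  assumes "f \<in> Lp a" "1 \<le> a" "0 < t"
  shows "integrable lborel (\<lambda>y. k t x y * f y)"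
proof -
  have [measurable]: "f \<in> borel_measurable borel" using assms by (simp add: Lp_iff_eLnorm)
  have "epowr (eS t (\<lambda>y. ennreal \<bar>f y\<bar>) x) a \<le> eS t (\<lambda>y. epowr (ennreal \<bar>f y\<bar>) a) x"
    using assms by (intro eS_powr_le) auto
  also have "\<dots> \<le> ennreal (c * t powr (- D)) * (\<integral>\<^sup>+y. epowr (ennreal \<bar>f y\<bar>) a \<partial>lborel)"
    using assms by (intro eS_le_sup) auto
  also have "\<dots> < \<top>" using assms by (simp add: Lp_iff_eLnorm eLnorm_def ennreal_mult_less_top)
  finally have "eS t (\<lambda>y. ennreal \<bar>f y\<bar>) x < \<top>" by simp
  moreover have "eS t (\<lambda>y. ennreal \<bar>f y\<bar>) x = (\<integral>\<^sup>+y. ennreal (norm (k t x y * f y)) \<partial>lborel)"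
    unfolding eS_def using assms k_nonneg by (intro nn_integral_cong) (simp add: abs_mult ennreal_mult)
  ultimately show ?thesis by (intro integrableI_bounded) auto
qed

text \<open>Holds for every f: where the product with the kernel is not integrable, the Bochner
  integral takes the default value 0.\<close>

lemma abs_S_le:
  assumes "0 < t"
  shows "ennreal \<bar>S t f x\<bar> \<le> eS t (\<lambda>y. ennreal \<bar>f y\<bar>) x"
proof (cases "integrable lborel (\<lambda>y. k t x y * f y)")
  case True
  have "ennreal (norm (S t f x)) \<le> (\<integral>\<^sup>+y. ennreal (norm (k t x y * f y)) \<partial>lborel)"
    using assms integral_norm_bound_ennreal[OF True] by (simp add: S_def)
  also have "\<dots> = eS t (\<lambda>y. ennreal \<bar>f y\<bar>) x"
    unfolding eS_def using assms k_nonneg by (intro nn_integral_cong) (simp add: abs_mult ennreal_mult)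
  finally show ?thesis by simp
qed (use assms in \<open>simp add: S_def not_integrable_integral_eq\<close>)

lemma S_0 [simp]: "S 0 f = f"
  by (simp add: S_def)

lemma S_cong_AE:
  assumes "0 < t" "AE y in lborel. f y = g y" and [measurable]: "f \<in> borel_measurable borel" "g \<in> borel_measurable borel"
  shows "S t f = S t g"
  using assms by (auto simp: S_def fun_eq_iff intro!: integral_cong_AE)

lemma S_add:
  assumes "f \<in> Lp a" "g \<in> Lp b" "1 \<le> a" "1 \<le> b" "0 \<le> t"
  shows "S t (\<lambda>y. f y + g y) x = S t f x + S t g x"
  using assms by (auto simp: S_def distrib_left intro!: Bochner_Integration.integral_add integrable_k_mult)

lemma S_diff:
  assumes "f \<in> Lp a" "g \<in> Lp b" "1 \<le> a" "1 \<le> b" "0 \<le> t"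
  shows "S t (\<lambda>y. f y - g y) x = S t f x - S t g x"
  using assms by (auto simp: S_def right_diff_distrib intro!: Bochner_Integration.integral_diff integrable_k_mult)

lemma S_cmult: "S t (\<lambda>y. r * f y) x = r * S t f x"
  by (simp add: S_def mult.left_commute[of _ r])

lemma eLnorm_S_smoothing:
  assumes f [measurable]: "f \<in> borel_measurable borel" and t: "0 < t" and ab: "1 \<le> a" "a \<le> b"
  shows "eLnorm b (\<lambda>x. ennreal \<bar>S t f x\<bar>) \<le>
    ennreal (c * t powr (- (D * (1 / a - 1 / b)))) * eLnorm a (\<lambda>x. ennreal \<bar>f x\<bar>)"
  using assms by (intro order_trans[OF eLnorm_mono eS_smoothing] abs_S_le) auto

lemma eLnorm_S_le:
  assumes f [measurable]: "f \<in> borel_measurable borel" and t: "0 \<le> t" and p: "1 \<le> p"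
  shows "eLnorm p (\<lambda>x. ennreal \<bar>S t f x\<bar>) \<le> eLnorm p (\<lambda>x. ennreal \<bar>f x\<bar>)"
proof (cases "t = 0")
  case False
  then show ?thesis
    using assms by (intro order_trans[OF eLnorm_mono eS_contraction[where t=t]] abs_S_le) auto
qed simp

lemma S_Lp: "f \<in> Lp p \<Longrightarrow> 1 \<le> p \<Longrightarrow> 0 \<le> t \<Longrightarrow> S t f \<in> Lp p"
  using eLnorm_S_le[of f t p] by (auto simp: Lp_iff_eLnorm intro: order.strict_trans1)

section \<open>Strong continuity at positive times\<close>

lemma k_diff_tendsto:
  assumes t: "0 < t" and s: "\<And>n. 0 < s n" "s \<longlonglongrightarrow> t"
  shows "(\<lambda>n. \<integral>\<^sup>+y. ennreal \<bar>k (s n) x y - k t x y\<bar> \<partial>lborel) \<longlonglongrightarrow> 0"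
proof -
  have "(\<lambda>n. k (s n) x y) \<longlonglongrightarrow> k t x y" for y
    using k_cont[OF t, of x y] by (intro isCont_tendsto_compose[OF _ s(2), of "\<lambda>s. k s x y"]) (simp add: isCont_def)
  moreover have "integrable lborel (\<lambda>y. k t x y)"
    using t k_mass[OF t, of x] k_nonneg by (intro integrableI_nonneg) auto
  ultimately have "(\<lambda>n. \<integral>\<^sup>+y. norm (k (s n) x y - k t x y) \<partial>lborel) \<longlonglongrightarrow> 0"
    using s t k_mass k_nonneg by (intro Scheffe_lemma2) auto
  then show ?thesis by simp
qed

text \<open>Half of |k_s - k_t| is a kernel of mass at most 1, so Jensen's inequality bounds the
  p-th power of the difference by the integral of |2 f|^p against the column masses
  \<open>e n\<close>. These are at most 1 and tend to 0 pointwise, because kernels of equal mass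
  that converge pointwise converge in L^1; symmetry turns row masses into column masses.\<close>

lemma S_continuous_pos:
  assumes f: "f \<in> Lp p" and p: "1 \<le> p" and t: "0 < t" and s: "\<And>n. 0 < s n" "s \<longlonglongrightarrow> t"
  shows "(\<lambda>n. eLnorm p (\<lambda>x. ennreal \<bar>S (s n) f x - S t f x\<bar>)) \<longlonglongrightarrow> 0"
proof -
  have [measurable]: "f \<in> borel_measurable borel" using f by (simp add: Lp_iff_eLnorm)
  define d where "d n x y = ennreal (\<bar>k (s n) x y - k t x y\<bar> / 2)" for n x y
  have dm: "(\<integral>\<^sup>+y. d n x y \<partial>lborel) \<le> 1" for n x
  proof -
    have half: "(\<integral>\<^sup>+y. ennreal (k r x y / 2) \<partial>lborel) = ennreal (1 / 2)" if "0 < r" for r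
      using that k_mass[OF that, of x] nn_integral_cmult[of "\<lambda>y. ennreal (k r x y)" lborel "ennreal (1 / 2)"]
      by (simp only: ennreal_mult'[symmetric]) simp
    have "(\<integral>\<^sup>+y. d n x y \<partial>lborel) \<le> (\<integral>\<^sup>+y. ennreal (k (s n) x y / 2) + ennreal (k t x y / 2) \<partial>lborel)"
      unfolding d_def using k_nonneg[OF s(1)] k_nonneg[OF t]
      by (intro nn_integral_mono) (auto simp: ennreal_plus[symmetric] abs_if simp del: ennreal_plus intro!: ennreal_leI)
    also have "\<dots> = ennreal (1 / 2) + ennreal (1 / 2)"
      using half[OF s(1)] half[OF t] by (simp add: nn_integral_add)
    also have "\<dots> = 1" by (subst ennreal_plus[symmetric]) auto
    finally show ?thesis .
  qed
  have [measurable]: "(\<lambda>x. d n (fst x) (snd x)) \<in> borel_measurable (borel \<Otimes>\<^sub>M borel)"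
    "(\<lambda>x. d n (snd x) (fst x)) \<in> borel_measurable (borel \<Otimes>\<^sub>M borel)" for n
    unfolding d_def by measurable
  have [measurable]: "d n x \<in> borel_measurable borel" "(\<lambda>x. d n x y) \<in> borel_measurable borel" for n x y
    unfolding d_def by measurable
  define e where "e n y = (\<integral>\<^sup>+x. d n x y \<partial>lborel)" for n y
  have d_sym: "d n x y = d n y x" for n x y by (simp add: d_def k_sym[of _ x y])
  have e_eq: "e n y = (\<integral>\<^sup>+x. d n y x \<partial>lborel)" for n y by (simp add: e_def d_sym[of n _ y])
  have e0: "(\<lambda>n. e n y) \<longlonglongrightarrow> 0" for y
  proof -
    have "e n y = ennreal (1 / 2) * (\<integral>\<^sup>+x. ennreal \<bar>k (s n) y x - k t y x\<bar> \<partial>lborel)" for n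
      unfolding e_eq d_def by (subst nn_integral_cmult[symmetric]) (auto simp del: ennreal_half simp: ennreal_mult'[symmetric] intro!: nn_integral_cong)
    then show ?thesis
      using ennreal_tendsto_cmult[OF _ k_diff_tendsto[OF t s, of y], of "ennreal (1 / 2)"] by (simp del: ennreal_half)
  qed
  have [measurable]: "e n \<in> borel_measurable borel" for n unfolding e_def by measurable
  have le: "(\<integral>\<^sup>+x. epowr (ennreal \<bar>S (s n) f x - S t f x\<bar>) p \<partial>lborel)
      \<le> (\<integral>\<^sup>+y. e n y * epowr (ennreal (2 * \<bar>f y\<bar>)) p \<partial>lborel)" for n
  proof -
    have "(\<integral>\<^sup>+x. epowr (ennreal \<bar>S (s n) f x - S t f x\<bar>) p \<partial>lborel)
        \<le> (\<integral>\<^sup>+x. \<integral>\<^sup>+y. d n x y * epowr (ennreal (2 * \<bar>f y\<bar>)) p \<partial>lborel \<partial>lborel)"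
    proof (intro nn_integral_mono)
      fix x
      have "S (s n) f x - S t f x = (\<integral>y. k (s n) x y * f y - k t x y * f y \<partial>lborel)"
        using s(1)[of n] t integrable_k_mult[OF f p] by (simp add: S_def)
      also have "ennreal \<bar>\<dots>\<bar> \<le> (\<integral>\<^sup>+y. ennreal (norm (k (s n) x y * f y - k t x y * f y)) \<partial>lborel)"
        using s(1)[of n] t integrable_k_mult[OF f p]
        by (subst real_norm_def[symmetric], intro integral_norm_bound_ennreal) auto
      also have "\<dots> = (\<integral>\<^sup>+y. d n x y * ennreal (2 * \<bar>f y\<bar>) \<partial>lborel)"
        by (intro nn_integral_cong) (simp add: d_def ennreal_mult[symmetric] abs_mult left_diff_distrib[symmetric])
      finally have "epowr (ennreal \<bar>S (s n) f x - S t f x\<bar>) p \<le> epowr (\<integral>\<^sup>+y. d n x y * ennreal (2 * \<bar>f y\<bar>) \<partial>lborel) p"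
        using p by (intro epowr_mono) auto
      also have "\<dots> \<le> (\<integral>\<^sup>+y. d n x y * epowr (ennreal (2 * \<bar>f y\<bar>)) p \<partial>lborel)"
        using p dm by (intro Jensen_epowr) auto
      finally show "epowr (ennreal \<bar>S (s n) f x - S t f x\<bar>) p \<le> \<dots>" .
    qed
    also have "\<dots> = (\<integral>\<^sup>+y. \<integral>\<^sup>+x. d n x y * epowr (ennreal (2 * \<bar>f y\<bar>)) p \<partial>lborel \<partial>lborel)"
      by (rule lborel_pair.Fubini') (simp add: case_prod_beta')
    also have "\<dots> = (\<integral>\<^sup>+y. e n y * epowr (ennreal (2 * \<bar>f y\<bar>)) p \<partial>lborel)"
      unfolding e_def by (intro nn_integral_cong nn_integral_multc) auto
    finally show ?thesis .
  qed
  have "(\<lambda>n. \<integral>\<^sup>+y. e n y * epowr (ennreal (2 * \<bar>f y\<bar>)) p \<partial>lborel) \<longlonglongrightarrow> 0"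
  proof (rule nn_integral_dominated[where w="\<lambda>y. epowr (ennreal (2 * \<bar>f y\<bar>)) p"])
    show "AE y in lborel. e n y * epowr (ennreal (2 * \<bar>f y\<bar>)) p \<le> epowr (ennreal (2 * \<bar>f y\<bar>)) p" for n
      using mult_right_mono[OF dm[of n]] by (simp add: e_eq)
    have "(\<lambda>y. 2 * f y) \<in> Lp p" using f p by (intro Lp_cmult) auto
    then show "(\<integral>\<^sup>+y. epowr (ennreal (2 * \<bar>f y\<bar>)) p \<partial>lborel) < \<top>"
      by (simp add: Lp_iff_eLnorm eLnorm_def abs_mult)
    show "AE y in lborel. (\<lambda>n. e n y * epowr (ennreal (2 * \<bar>f y\<bar>)) p) \<longlonglongrightarrow> 0"
      using ennreal_tendsto_cmult[OF _ e0] by (simp add: mult.commute[of "e _ _"])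
  qed auto
  then have "(\<lambda>n. \<integral>\<^sup>+x. epowr (ennreal \<bar>S (s n) f x - S t f x\<bar>) p \<partial>lborel) \<longlonglongrightarrow> 0"
    by (rule tendsto_sandwich[OF _ _ tendsto_const, rotated 2]) (use le in auto)
  then show ?thesis
    unfolding eLnorm_def using tendsto_epowr[of _ 0 _ "1 / p"] p by fastforce
qed

section \<open>Strong continuity at time 0: from open sets to indicators, simple functions and
  L^p\<close>

lemma S_continuous_0_approx:
  assumes f: "f \<in> Lp p" and p: "1 \<le> p"
    and approx: "\<And>\<epsilon>. 0 < \<epsilon> \<Longrightarrow> \<exists>g\<in>Lp p. eLnorm p (\<lambda>x. ennreal \<bar>f x - g x\<bar>) \<le> ennreal \<epsilon> \<and>
      ((\<lambda>s. eLnorm p (\<lambda>x. ennreal \<bar>S s g x - g x\<bar>)) \<longlongrightarrow> 0) (at_right 0)"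
  shows "((\<lambda>s. eLnorm p (\<lambda>x. ennreal \<bar>S s f x - f x\<bar>)) \<longlongrightarrow> 0) (at_right 0)"
proof (rule order_tendstoI)
  fix a :: ennreal assume "0 < a"
  \<comment> \<open>The given bound \<open>a\<close> may be infinite; a finite one leaves room for a
    real \<epsilon> with 3 * \<epsilon> below it.\<close>
  define b where "b = min a 1"
  have b: "0 < b" "b \<le> a" using \<open>0 < a\<close> by (auto simp: b_def min_def)
  have "b < \<top>" by (rule order.strict_trans1[OF _ ennreal_one_less_top]) (simp add: b_def)
  define \<epsilon> where "\<epsilon> = enn2real b / 4"
  obtain r where r: "b = ennreal r" "0 < r"
    using b(1) \<open>b < \<top>\<close> by (cases b) auto
  have \<epsilon>: "0 < \<epsilon>" "ennreal (3 * \<epsilon>) < b"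
    using r by (auto simp: \<epsilon>_def intro!: ennreal_lessI)
  obtain g where g: "g \<in> Lp p" "eLnorm p (\<lambda>x. ennreal \<bar>f x - g x\<bar>) \<le> ennreal \<epsilon>"
    and conv: "((\<lambda>s. eLnorm p (\<lambda>x. ennreal \<bar>S s g x - g x\<bar>)) \<longlongrightarrow> 0) (at_right 0)"
    using approx[OF \<epsilon>(1)] by blast
  note [measurable] = Lp_measurable[OF f] Lp_measurable[OF g(1)]
  have "\<forall>\<^sub>F s in at_right 0. eLnorm p (\<lambda>x. ennreal \<bar>S s g x - g x\<bar>) < ennreal \<epsilon>"
    using \<epsilon>(1) by (intro order_tendstoD(2)[OF conv]) auto
  moreover have "\<forall>\<^sub>F s in at_right (0::real). 0 < s" by (simp add: eventually_at_right_less)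
  ultimately show "\<forall>\<^sub>F s in at_right 0. eLnorm p (\<lambda>x. ennreal \<bar>S s f x - f x\<bar>) < a"
  proof eventually_elim
    case (elim s)
    have "eLnorm p (\<lambda>x. ennreal \<bar>S s f x - f x\<bar>)
        \<le> eLnorm p (\<lambda>x. ennreal \<bar>S s f x - S s g x\<bar>) + eLnorm p (\<lambda>x. ennreal \<bar>S s g x - f x\<bar>)"
      using p by (intro eLnorm_abs_triangle) auto
    also have "\<dots> \<le> ennreal \<epsilon> + (ennreal \<epsilon> + ennreal \<epsilon>)"
    proof (rule add_mono)
      have "eLnorm p (\<lambda>x. ennreal \<bar>S s f x - S s g x\<bar>) = eLnorm p (\<lambda>x. ennreal \<bar>S s (\<lambda>x. f x - g x) x\<bar>)"
        using elim S_diff[OF f g(1) p p, of s] by simp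
      also have "\<dots> \<le> eLnorm p (\<lambda>x. ennreal \<bar>f x - g x\<bar>)"
        using elim p by (intro eLnorm_S_le) auto
      also note g(2)
      finally show "eLnorm p (\<lambda>x. ennreal \<bar>S s f x - S s g x\<bar>) \<le> ennreal \<epsilon>" .
      have "eLnorm p (\<lambda>x. ennreal \<bar>S s g x - f x\<bar>)
          \<le> eLnorm p (\<lambda>x. ennreal \<bar>S s g x - g x\<bar>) + eLnorm p (\<lambda>x. ennreal \<bar>g x - f x\<bar>)"
        using p by (intro eLnorm_abs_triangle) auto
      also have "\<dots> \<le> ennreal \<epsilon> + ennreal \<epsilon>"
        using elim(1) g(2) by (intro add_mono) (simp_all add: eLnorm_abs_minus_commute[of p g f])
      finally show "eLnorm p (\<lambda>x. ennreal \<bar>S s g x - f x\<bar>) \<le> ennreal \<epsilon> + ennreal \<epsilon>" .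
    qed
    also have "\<dots> = ennreal (3 * \<epsilon>)" using \<epsilon> by (simp add: ennreal_plus[symmetric] del: ennreal_plus)
    also have "\<dots> < a" using \<epsilon>(2) b(2) by (rule order.strict_trans2)
    finally show ?case .
  qed
qed simp

text \<open>Inside A the error is the mass that escapes from A, outside it is the mass that enters.
  By symmetry of the kernel both have the same total \<open>E s\<close>. Concentration makes the
  escaping mass tend to 0 at each point of the open set A, and the indicator of A is a
  majorant.\<close>

lemma S_continuous_0_open:
  assumes A: "open A" "emeasure lborel A < \<top>" and p: "1 \<le> p"
  shows "((\<lambda>s. eLnorm p (\<lambda>x. ennreal \<bar>S s (indicator A) x - indicator A x\<bar>)) \<longlongrightarrow> 0) (at_right 0)"
proof -
  have [measurable]: "A \<in> sets borel" using A by auto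
  have IA: "(indicator A :: 'a \<Rightarrow> real) \<in> Lp 1"
    using A by (simp add: Lp_def)
  define E where "E s = (\<integral>\<^sup>+x. indicator A x * (\<integral>\<^sup>+y. ennreal (k s x y) * indicator (- A) y \<partial>lborel) \<partial>lborel)" for s
  have le: "(\<integral>\<^sup>+x. epowr (ennreal \<bar>S s (indicator A) x - indicator A x\<bar>) p \<partial>lborel) \<le> E s + E s" if s: "0 < s" for s
  proof -
    have 1: "epowr (ennreal \<bar>S s (indicator A) x - indicator A x\<bar>) p \<le>
      indicator A x * (\<integral>\<^sup>+y. ennreal (k s x y) * indicator (- A) y \<partial>lborel) +
      (\<integral>\<^sup>+y. ennreal (k s x y) * (indicator A y * indicator (- A) x) \<partial>lborel)" for x
    proof -
      have int: "integrable lborel (\<lambda>y. k s x y * indicator A y)"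
        using integrable_k_mult[OF IA _ s] by simp
      have SA: "ennreal (S s (indicator A) x) = (\<integral>\<^sup>+y. ennreal (k s x y) * indicator A y \<partial>lborel)"
        using s int k_nonneg[OF s]
        by (simp add: S_def nn_integral_eq_integral[symmetric] ennreal_mult'' ennreal_indicator)
      have nn: "0 \<le> S s (indicator A) x"
        using s k_nonneg[OF s] by (auto simp: S_def intro!: integral_nonneg)
      have "(\<integral>\<^sup>+y. ennreal (k s x y) * indicator A y \<partial>lborel) + (\<integral>\<^sup>+y. ennreal (k s x y) * indicator (- A) y \<partial>lborel)
         = (\<integral>\<^sup>+y. ennreal (k s x y) * indicator A y + ennreal (k s x y) * indicator (- A) y \<partial>lborel)"
        by (rule nn_integral_add[symmetric]) auto
      also have "\<dots> = (\<integral>\<^sup>+y. ennreal (k s x y) \<partial>lborel)"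
        by (intro nn_integral_cong) (auto simp: indicator_def)
      finally have sum: "ennreal (S s (indicator A) x) + (\<integral>\<^sup>+y. ennreal (k s x y) * indicator (- A) y \<partial>lborel) = 1"
        using k_mass[OF s] SA by simp
      then have le1: "S s (indicator A) x \<le> 1"
        by (metis ennreal_le_1 le_iff_add)
      \<comment> \<open>The difference has absolute value at most 1, so its p-th power is at most
        the absolute value itself.\<close>
      have "epowr (ennreal \<bar>S s (indicator A) x - indicator A x\<bar>) p \<le> epowr (ennreal \<bar>S s (indicator A) x - indicator A x\<bar>) 1"
        using nn le1 p powr_mono'[of 1 p "\<bar>S s (indicator A) x - indicator A x\<bar>"]
        by (auto simp: indicator_def intro!: ennreal_leI)
      also have "\<dots> = ennreal \<bar>S s (indicator A) x - indicator A x\<bar>" by (rule epowr_one)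
      also have "\<dots> \<le> indicator A x * (\<integral>\<^sup>+y. ennreal (k s x y) * indicator (- A) y \<partial>lborel) +
        (\<integral>\<^sup>+y. ennreal (k s x y) * (indicator A y * indicator (- A) x) \<partial>lborel)"
      proof (cases "x \<in> A")
        case True
        have "ennreal (1 - S s (indicator A) x) = 1 - ennreal (S s (indicator A) x)"
          using nn by (simp add: ennreal_minus[symmetric])
        also have "\<dots> \<le> (\<integral>\<^sup>+y. ennreal (k s x y) * indicator (- A) y \<partial>lborel)"
          unfolding sum[symmetric] by (simp add: ennreal_minus_le_iff)
        finally show ?thesis using True le1 by (simp add: abs_if)
      next
        case False
        then show ?thesis using SA nn by simp
      qed
      finally show ?thesis .
    qed
    have "(\<integral>\<^sup>+x. \<integral>\<^sup>+y. ennreal (k s x y) * (indicator A y * indicator (- A) x) \<partial>lborel \<partial>lborel) =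
      (\<integral>\<^sup>+y. \<integral>\<^sup>+x. ennreal (k s x y) * (indicator A y * indicator (- A) x) \<partial>lborel \<partial>lborel)"
      by (rule lborel_pair.Fubini') (simp add: case_prod_beta')
    also have "\<dots> = E s"
      unfolding E_def
      by (intro nn_integral_cong) (simp add: nn_integral_cmult[symmetric] k_sym[of s] mult_ac)
    finally have 2: "(\<integral>\<^sup>+x. \<integral>\<^sup>+y. ennreal (k s x y) * (indicator A y * indicator (- A) x) \<partial>lborel \<partial>lborel) = E s" .
    have "(\<integral>\<^sup>+x. epowr (ennreal \<bar>S s (indicator A) x - indicator A x\<bar>) p \<partial>lborel) \<le>
      (\<integral>\<^sup>+x. indicator A x * (\<integral>\<^sup>+y. ennreal (k s x y) * indicator (- A) y \<partial>lborel) +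
      (\<integral>\<^sup>+y. ennreal (k s x y) * (indicator A y * indicator (- A) x) \<partial>lborel) \<partial>lborel)"
      by (intro nn_integral_mono 1)
    also have "\<dots> = E s + E s"
      by (subst nn_integral_add) (simp_all add: E_def[symmetric] 2)
    finally show ?thesis .
  qed
  have "(E \<longlongrightarrow> 0) (at_right 0)"
    unfolding tendsto_at_iff_sequentially
  proof (intro allI impI)
    fix X :: "nat \<Rightarrow> real" assume X: "\<forall>i. X i \<in> {0<..} - {0}" "X \<longlonglongrightarrow> 0"
    have "(\<lambda>i. E (X i)) \<longlonglongrightarrow> 0"
      unfolding E_def
    proof (rule nn_integral_dominated[where w="indicator A"])
      show "AE x in lborel. indicator A x * (\<integral>\<^sup>+y. ennreal (k (X i) x y) * indicator (- A) y \<partial>lborel) \<le> indicator A x" for i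
      proof (intro AE_I2)
        fix x
        have "(\<integral>\<^sup>+y. ennreal (k (X i) x y) * indicator (- A) y \<partial>lborel) \<le> (\<integral>\<^sup>+y. ennreal (k (X i) x y) \<partial>lborel)"
          by (intro nn_integral_mono) (auto simp: indicator_def)
        also have "\<dots> = 1" using X k_mass by auto
        finally show "indicator A x * (\<integral>\<^sup>+y. ennreal (k (X i) x y) * indicator (- A) y \<partial>lborel) \<le> indicator A x"
          by (simp add: indicator_def)
      qed
      show "AE x in lborel. (\<lambda>i. indicator A x * (\<integral>\<^sup>+y. ennreal (k (X i) x y) * indicator (- A) y \<partial>lborel)) \<longlonglongrightarrow> 0"
      proof (intro AE_I2)
        fix x show "(\<lambda>i. indicator A x * (\<integral>\<^sup>+y. ennreal (k (X i) x y) * indicator (- A) y \<partial>lborel)) \<longlonglongrightarrow> 0"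
        proof (cases "x \<in> A")
          case True
          then show ?thesis
            using k_conc[OF A(1) True] X unfolding tendsto_at_iff_sequentially by (auto simp: o_def)
        qed simp
      qed
    qed (use A in auto)
    then show "(E \<circ> X) \<longlonglongrightarrow> 0" by (simp add: o_def)
  qed
  then have E0: "((\<lambda>s. E s + E s) \<longlongrightarrow> 0) (at_right 0)"
    using tendsto_add[of E 0 "at_right 0" E 0] by simp
  have "\<forall>\<^sub>F s in at_right (0::real). 0 < s" by (simp add: eventually_at_right_less)
  then have "\<forall>\<^sub>F s in at_right 0. (\<integral>\<^sup>+x. epowr (ennreal \<bar>S s (indicator A) x - indicator A x\<bar>) p \<partial>lborel) \<le> E s + E s"
    by eventually_elim (rule le)
  then have "((\<lambda>s. \<integral>\<^sup>+x. epowr (ennreal \<bar>S s (indicator A) x - indicator A x\<bar>) p \<partial>lborel) \<longlongrightarrow> 0) (at_right 0)"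
    by (intro tendsto_sandwich[OF _ _ tendsto_const E0]) auto
  from tendsto_epowr[OF this, of "1 / p"] p show ?thesis unfolding eLnorm_def by simp
qed

lemma eLnorm_indicator: "A \<in> sets borel \<Longrightarrow> eLnorm p (\<lambda>x. ennreal (indicator A x)) = epowr (emeasure lborel A) (1 / p)"
proof -
  assume [measurable]: "A \<in> sets borel"
  have "(\<integral>\<^sup>+x. epowr (ennreal (indicator A x)) p \<partial>lborel) = (\<integral>\<^sup>+x. indicator A x \<partial>lborel)"
    by (intro nn_integral_cong) (auto simp: indicator_def)
  then show ?thesis by (simp add: eLnorm_def)
qed

lemma indicator_in_Lp:
  assumes A: "A \<in> sets borel" "emeasure lborel A < \<top>"
  shows "indicator A \<in> Lp p"
  using assms by (simp add: Lp_iff_eLnorm eLnorm_indicator[OF A(1)])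

text \<open>Outer regularity provides an open superset with excess measure below \<epsilon>^p, hence
  at L^p distance at most \<epsilon>.\<close>

lemma S_continuous_0_indicator:
  assumes A [measurable]: "A \<in> sets borel" and fin: "emeasure lborel A < \<top>" and p: "1 \<le> p"
  shows "((\<lambda>s. eLnorm p (\<lambda>x. ennreal \<bar>S s (indicator A) x - indicator A x\<bar>)) \<longlongrightarrow> 0) (at_right 0)"
proof (rule S_continuous_0_approx[OF indicator_in_Lp[OF A fin] p])
  fix \<epsilon> :: real assume \<epsilon>: "0 < \<epsilon>"
  obtain U where U: "open U" "A \<subseteq> U" "emeasure lborel (U - A) < ennreal (\<epsilon> powr p)"
    using outer_regular_lborel[OF A, of "\<epsilon> powr p"] \<epsilon> by auto
  have [measurable]: "U \<in> sets borel" using U by auto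
  have "emeasure lborel U \<le> emeasure lborel A + emeasure lborel (U - A)"
    using U by (subst plus_emeasure) (auto simp: Un_absorb1)
  also have "\<dots> < \<top>" using fin order.strict_trans[OF U(3) ennreal_less_top] by simp
  finally have Ufin: "emeasure lborel U < \<top>" .
  have "eLnorm p (\<lambda>x. ennreal \<bar>indicator A x - indicator U x\<bar>) = eLnorm p (\<lambda>x. ennreal (indicator (U - A) x))"
    using U by (intro arg_cong[where f="eLnorm p"]) (auto simp: indicator_def fun_eq_iff)
  also have "\<dots> \<le> epowr (ennreal (\<epsilon> powr p)) (1 / p)"
    using p epowr_mono[OF less_imp_le[OF U(3)], of "1 / p"] by (subst eLnorm_indicator) auto
  also have "\<dots> = ennreal \<epsilon>" using p \<epsilon> by (simp add: powr_powr)
  finally show "\<exists>g\<in>Lp p. eLnorm p (\<lambda>x. ennreal \<bar>indicator A x - g x\<bar>) \<le> ennreal \<epsilon> \<and>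
      ((\<lambda>s. eLnorm p (\<lambda>x. ennreal \<bar>S s g x - g x\<bar>)) \<longlongrightarrow> 0) (at_right 0)"
    using indicator_in_Lp[OF _ Ufin, of p] S_continuous_0_open[OF U(1) Ufin p] by (intro bexI[of _ "indicator U"]) auto
qed

text \<open>In L^p the level set of a nonzero value has finite measure. The value 0 is left out of
  the sum, because its level set may have infinite measure.\<close>

lemma S_continuous_0_simple:
  assumes f: "f \<in> Lp p" and p: "1 \<le> p" and simple: "simple_function lborel f"
  shows "((\<lambda>s. eLnorm p (\<lambda>x. ennreal \<bar>S s f x - f x\<bar>)) \<longlongrightarrow> 0) (at_right 0)"
proof -
  note [measurable] = Lp_measurable[OF f]
  define B where "B v = f -` {v}" for v
  have B [measurable]: "B v \<in> sets borel" for v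
    unfolding B_def using measurable_sets[OF Lp_measurable[OF f], of "{v}"] by simp
  have fin: "emeasure lborel (B v) < \<top>" if "v \<noteq> 0" for v
  proof -
    have "ennreal (\<bar>v\<bar> powr p) * emeasure lborel (B v) = (\<integral>\<^sup>+x. ennreal (\<bar>v\<bar> powr p) * indicator (B v) x \<partial>lborel)"
      by (simp add: nn_integral_cmult)
    also have "\<dots> \<le> (\<integral>\<^sup>+x. epowr (ennreal \<bar>f x\<bar>) p \<partial>lborel)"
      by (intro nn_integral_mono) (auto simp: indicator_def B_def)
    also have "\<dots> < \<top>" using f by (simp add: Lp_iff_eLnorm eLnorm_def)
    finally show ?thesis using that by (auto simp: ennreal_mult_less_top)
  qed
  have *: "(\<lambda>x. \<Sum>v\<in>V. v * indicator (B v) x) \<in> Lp p \<and>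
     ((\<lambda>s. eLnorm p (\<lambda>x. ennreal \<bar>S s (\<lambda>x. \<Sum>v\<in>V. v * indicator (B v) x) x - (\<Sum>v\<in>V. v * indicator (B v) x)\<bar>)) \<longlongrightarrow> 0) (at_right 0)"
    if "finite V" "0 \<notin> V" for V
    using that
  proof (induction V)
    case empty
    have "(\<lambda>_. 0) \<in> (Lp p :: ('a \<Rightarrow> real) set)" by (simp add: Lp_iff_eLnorm)
    moreover have "S s (\<lambda>x. 0) x = 0" for s x by (simp add: S_def)
    ultimately show ?case by simp
  next
    case (insert v V)
    define g where "g x = (\<Sum>v\<in>V. v * indicator (B v) x)" for x
    define h :: "'a \<Rightarrow> real" where "h x = v * indicator (B v) x" for x
    have g: "g \<in> Lp p" "((\<lambda>s. eLnorm p (\<lambda>x. ennreal \<bar>S s g x - g x\<bar>)) \<longlongrightarrow> 0) (at_right 0)"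
      using insert by (simp_all add: g_def[abs_def])
    have v: "v \<noteq> 0" using insert by auto
    have h: "h \<in> Lp p" unfolding h_def using p fin[OF v] by (intro Lp_cmult indicator_in_Lp) auto
    note [measurable] = Lp_measurable[OF g(1)] Lp_measurable[OF h]
    have h0: "((\<lambda>s. eLnorm p (\<lambda>x. ennreal \<bar>S s h x - h x\<bar>)) \<longlongrightarrow> 0) (at_right 0)"
    proof -
      have "eLnorm p (\<lambda>x. ennreal \<bar>S s h x - h x\<bar>) = ennreal \<bar>v\<bar> * eLnorm p (\<lambda>x. ennreal \<bar>S s (indicator (B v)) x - indicator (B v) x\<bar>)" for s
      proof -
        have "eLnorm p (\<lambda>x. ennreal \<bar>S s h x - h x\<bar>) = eLnorm p (\<lambda>x. ennreal \<bar>v\<bar> * ennreal \<bar>S s (indicator (B v)) x - indicator (B v) x\<bar>)"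
          unfolding h_def S_cmult by (simp add: right_diff_distrib[symmetric] abs_mult ennreal_mult)
        also have "\<dots> = ennreal \<bar>v\<bar> * eLnorm p (\<lambda>x. ennreal \<bar>S s (indicator (B v)) x - indicator (B v) x\<bar>)"
          using p by (intro eLnorm_cmult) auto
        finally show ?thesis .
      qed
      then show ?thesis
        using ennreal_tendsto_cmult[OF _ S_continuous_0_indicator[OF B fin[OF v] p], of "ennreal \<bar>v\<bar>"] by simp
    qed
    have "\<forall>\<^sub>F s in at_right (0::real). 0 < s" by (simp add: eventually_at_right_less)
    then have ev: "\<forall>\<^sub>F s in at_right 0. eLnorm p (\<lambda>x. ennreal \<bar>S s (\<lambda>x. h x + g x) x - (h x + g x)\<bar>) \<le>
      eLnorm p (\<lambda>x. ennreal \<bar>S s h x - h x\<bar>) + eLnorm p (\<lambda>x. ennreal \<bar>S s g x - g x\<bar>)"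
    proof eventually_elim
      case (elim s)
      then have "S s (\<lambda>x. h x + g x) x - (h x + g x) = (S s h x - h x) + (S s g x - g x)" for x
        using S_add[OF h g(1) p p, of s x] by simp
      then show ?case using p by (simp only:) (intro eLnorm_abs_add_le; simp)
    qed
    have "((\<lambda>s. eLnorm p (\<lambda>x. ennreal \<bar>S s h x - h x\<bar>) + eLnorm p (\<lambda>x. ennreal \<bar>S s g x - g x\<bar>)) \<longlongrightarrow> 0) (at_right 0)"
      using tendsto_add[OF h0 g(2)] by simp
    from tendsto_sandwich[OF _ ev tendsto_const this]
    have "((\<lambda>s. eLnorm p (\<lambda>x. ennreal \<bar>S s (\<lambda>x. h x + g x) x - (h x + g x)\<bar>)) \<longlongrightarrow> 0) (at_right 0)" by simp
    moreover have "(\<lambda>x. h x + g x) \<in> Lp p" by (intro Lp_add h g p)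
    moreover have "(\<Sum>v\<in>insert v V. v * indicator (B v) x) = h x + g x" for x
      unfolding h_def g_def using insert(1,2) by (rule sum.insert)
    ultimately show ?case by (simp only:)
  qed
  have fsum: "(\<Sum>v\<in>range f - {0}. v * indicator (B v) x) = f x" for x
  proof -
    have "(\<Sum>v\<in>range f - {0}. v * indicator (B v) x) = (\<Sum>v\<in>range f - {0}. if v = f x then v else 0)"
      by (intro sum.cong) (auto simp: B_def indicator_def)
    also have "\<dots> = f x"
      using simple by (auto simp: simple_function_def sum.delta)
    finally show ?thesis .
  qed
  have "finite (range f)" using simple by (simp add: simple_function_def)
  then show ?thesis using *[of "range f - {0}"] unfolding fsum by simp
qed

lemma S_continuous_0:
  assumes f: "f \<in> Lp p" and p: "1 \<le> p"
  shows "((\<lambda>s. eLnorm p (\<lambda>x. ennreal \<bar>S s f x - f x\<bar>)) \<longlongrightarrow> 0) (at_right 0)"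
proof (rule S_continuous_0_approx[OF f p])
  fix \<epsilon> :: real assume \<epsilon>: "0 < \<epsilon>"
  note [measurable] = Lp_measurable[OF f]
  have "f \<in> borel_measurable lborel" by simp
  from borel_measurable_implies_sequence_metric[OF this, of 0] obtain g where
    g: "\<And>i. simple_function lborel (g i)" "\<And>x. (\<lambda>i. g i x) \<longlonglongrightarrow> f x" "\<And>i x. \<bar>g i x\<bar> \<le> 2 * \<bar>f x\<bar>"
    by auto
  have [measurable]: "g i \<in> borel_measurable borel" for i
    using borel_measurable_simple_function[OF g(1)[of i]] by simp
  have f2: "eLnorm p (\<lambda>x. ennreal \<bar>r * f x\<bar>) < \<top>" for r
    using Lp_cmult[OF f, of r] p by (simp add: Lp_iff_eLnorm)
  have gL: "g i \<in> Lp p" for i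
  proof -
    have "eLnorm p (\<lambda>x. ennreal \<bar>g i x\<bar>) \<le> eLnorm p (\<lambda>x. ennreal \<bar>2 * f x\<bar>)"
      using g(3)[of i] p by (intro eLnorm_mono ennreal_leI) (auto simp: abs_mult)
    also have "\<dots> < \<top>" by (rule f2)
    finally show ?thesis by (simp add: Lp_iff_eLnorm)
  qed
  have "(\<lambda>i. \<integral>\<^sup>+x. epowr (ennreal \<bar>f x - g i x\<bar>) p \<partial>lborel) \<longlonglongrightarrow> 0"
  proof (rule nn_integral_dominated[where w="\<lambda>x. epowr (ennreal \<bar>3 * f x\<bar>) p"])
    show "AE x in lborel. epowr (ennreal \<bar>f x - g i x\<bar>) p \<le> epowr (ennreal \<bar>3 * f x\<bar>) p" for i
    proof (intro AE_I2 epowr_mono ennreal_leI)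
      fix x show "\<bar>f x - g i x\<bar> \<le> \<bar>3 * f x\<bar>" using g(3)[of i x] by linarith
    qed (use p in auto)
    show "(\<integral>\<^sup>+x. epowr (ennreal \<bar>3 * f x\<bar>) p \<partial>lborel) < \<top>" using f2[of 3] by (simp add: eLnorm_def)
    show "AE x in lborel. (\<lambda>i. epowr (ennreal \<bar>f x - g i x\<bar>) p) \<longlonglongrightarrow> 0"
    proof (intro AE_I2)
      fix x
      have "(\<lambda>i. \<bar>f x - g i x\<bar>) \<longlonglongrightarrow> \<bar>f x - f x\<bar>" by (intro tendsto_intros g)
      then have "(\<lambda>i. ennreal \<bar>f x - g i x\<bar>) \<longlonglongrightarrow> ennreal 0" by (intro tendsto_ennrealI) simp
      from tendsto_epowr[OF this, of p] p show "(\<lambda>i. epowr (ennreal \<bar>f x - g i x\<bar>) p) \<longlonglongrightarrow> 0" by simp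
    qed
  qed auto
  from tendsto_epowr[OF this, of "1 / p"] p have "(\<lambda>i. eLnorm p (\<lambda>x. ennreal \<bar>f x - g i x\<bar>)) \<longlonglongrightarrow> 0"
    by (simp add: eLnorm_def)
  then have "\<forall>\<^sub>F i in sequentially. eLnorm p (\<lambda>x. ennreal \<bar>f x - g i x\<bar>) < ennreal \<epsilon>"
    using \<epsilon> by (intro order_tendstoD(2)) auto
  then obtain i where "eLnorm p (\<lambda>x. ennreal \<bar>f x - g i x\<bar>) < ennreal \<epsilon>"
    by (auto simp: eventually_sequentially)
  then show "\<exists>g\<in>Lp p. eLnorm p (\<lambda>x. ennreal \<bar>f x - g x\<bar>) \<le> ennreal \<epsilon> \<and>
      ((\<lambda>s. eLnorm p (\<lambda>x. ennreal \<bar>S s g x - g x\<bar>)) \<longlongrightarrow> 0) (at_right 0)"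
    using gL S_continuous_0_simple[OF gL p g(1)] by (intro bexI[of _ "g i"]) auto
qed

end

section \<open>The Bochner integral in \<open>L\<^sup>p\<close>\<close>

lemma floor_step:
  fixes t r :: real
  assumes "0 < r" shows "\<lfloor>t * r\<rfloor> / r \<le> t" "t - \<lfloor>t * r\<rfloor> / r \<le> 1 / r"
proof -
  have "\<lfloor>t * r\<rfloor> \<le> t * r" "t * r - \<lfloor>t * r\<rfloor> \<le> 1" by linarith+
  from divide_right_mono[OF this(1), of r] divide_right_mono[OF this(2), of r] assms
  show "\<lfloor>t * r\<rfloor> / r \<le> t" "t - \<lfloor>t * r\<rfloor> / r \<le> 1 / r"
    by (simp_all add: diff_divide_distrib)
qed

lemma measurable_step_floor:
  fixes w :: "int \<Rightarrow> 'a::euclidean_space \<Rightarrow> real" and r :: real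
  assumes [measurable]: "\<And>i. w i \<in> borel_measurable borel"
  shows "(\<lambda>x. w \<lfloor>fst x * r\<rfloor> (snd x)) \<in> borel_measurable (borel \<Otimes>\<^sub>M borel)"
proof -
  have "(\<lambda>x. \<lfloor>fst x * r\<rfloor>) \<in> measurable (borel \<Otimes>\<^sub>M borel :: (real \<times> 'a) measure) (count_space UNIV)"
    by measurable
  moreover have "(\<lambda>x. w i (snd x)) \<in> borel_measurable (borel \<Otimes>\<^sub>M borel :: (real \<times> 'a) measure)" for i
    by measurable
  ultimately show ?thesis
    using measurable_compose_countable[of "\<lambda>i x. w i (snd x)" _ borel "\<lambda>x. \<lfloor>fst x * r\<rfloor>"] by simp
qed

text \<open>The Heine-Cantor argument for a seminorm: two sequences that violate uniformity have a
  common limit time, where continuity and the triangle inequality contradict the gap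
  \<epsilon>.\<close>

lemma Lp_uniformly_continuous:
  assumes u: "Lp_continuous_on p {a..b} u" and p: "1 \<le> p" and \<epsilon>: "0 < \<epsilon>"
  shows "\<exists>\<delta>>0. \<forall>s\<in>{a..b}. \<forall>t\<in>{a..b}. \<bar>s - t\<bar> < \<delta> \<longrightarrow> Lp_norm p (\<lambda>z. u s z - u t z) < \<epsilon>"
proof (rule ccontr)
  assume neg: "\<not> ?thesis"
  have "\<forall>n. \<exists>s t. s \<in> {a..b} \<and> t \<in> {a..b} \<and> \<bar>s - t\<bar> < 1 / Suc n \<and> \<epsilon> \<le> Lp_norm p (\<lambda>z. u s z - u t z)"
  proof (intro allI)
    fix n :: nat
    have "0 < 1 / real (Suc n)" by simp
    with neg show "\<exists>s t. s \<in> {a..b} \<and> t \<in> {a..b} \<and> \<bar>s - t\<bar> < 1 / Suc n \<and> \<epsilon> \<le> Lp_norm p (\<lambda>z. u s z - u t z)"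
      by (meson not_less)
  qed
  then obtain s t where st: "\<And>n. s n \<in> {a..b}" "\<And>n. t n \<in> {a..b}" "\<And>n. \<bar>s n - t n\<bar> < 1 / Suc n"
    "\<And>n. \<epsilon> \<le> Lp_norm p (\<lambda>z. u (s n) z - u (t n) z)"
    by metis
  obtain l r where l: "l \<in> {a..b}" "strict_mono r" "(s \<circ> r) \<longlonglongrightarrow> l"
    using compact_Icc[of a b, unfolded compact_def, rule_format, of s] st(1) by blast
  have L: "u x \<in> Lp p" if "x \<in> {a..b}" for x using u that by (simp add: Lp_continuous_on_def)
  have d0: "(\<lambda>n. s (r n) - t (r n)) \<longlonglongrightarrow> 0"
  proof (rule LIMSEQ_subseq_LIMSEQ[OF _ l(2), unfolded o_def])
    show "(\<lambda>n. s n - t n) \<longlonglongrightarrow> 0"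
      by (rule LIMSEQ_norm_0) (use st(3) in \<open>auto intro: less_imp_le\<close>)
  qed
  have tl: "(t \<circ> r) \<longlonglongrightarrow> l"
    using tendsto_diff[OF l(3) d0] by (simp add: o_def)
  have conv: "(\<lambda>n. eLnorm p (\<lambda>z. ennreal \<bar>u (X n) z - u l z\<bar>)) \<longlonglongrightarrow> 0" if X: "X \<longlonglongrightarrow> l" "\<And>n. X n \<in> {a..b}" for X
  proof -
    have "((\<lambda>x. Lp_norm p (\<lambda>z. u x z - u l z)) \<longlongrightarrow> 0) (at l within {a..b})"
      using u l(1) by (simp add: Lp_continuous_on_def)
    then have "continuous (at l within {a..b}) (\<lambda>x. Lp_norm p (\<lambda>z. u x z - u l z))"
      by (simp add: continuous_within Lp_norm_def)
    then have "(\<lambda>n. Lp_norm p (\<lambda>z. u (X n) z - u l z)) \<longlonglongrightarrow> Lp_norm p (\<lambda>z. u l z - u l z)"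
      unfolding continuous_within_sequentially o_def using X by blast
    then have "(\<lambda>n. Lp_norm p (\<lambda>z. u (X n) z - u l z)) \<longlonglongrightarrow> 0"
      by (simp add: Lp_norm_def)
    then show ?thesis
      using X l(1) p by (subst (asm) tendsto_Lp_norm_iff) (auto intro!: Lp_diff L)
  qed
  have "(\<lambda>n. eLnorm p (\<lambda>z. ennreal \<bar>u (s (r n)) z - u l z\<bar>) + eLnorm p (\<lambda>z. ennreal \<bar>u (t (r n)) z - u l z\<bar>)) \<longlonglongrightarrow> 0 + 0"
    using conv[OF l(3)] conv[OF tl] st by (intro tendsto_add) (auto simp: o_def)
  moreover have "ennreal \<epsilon> \<le> eLnorm p (\<lambda>z. ennreal \<bar>u (s (r n)) z - u l z\<bar>) + eLnorm p (\<lambda>z. ennreal \<bar>u (t (r n)) z - u l z\<bar>)" for n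
  proof -
    have "ennreal \<epsilon> \<le> ennreal (Lp_norm p (\<lambda>z. u (s (r n)) z - u (t (r n)) z))"
      using st(4) by (intro ennreal_leI)
    also have "\<dots> = eLnorm p (\<lambda>z. ennreal \<bar>u (s (r n)) z - u (t (r n)) z\<bar>)"
      using st p by (intro ennreal_Lp_norm Lp_diff L)
    also have "\<dots> \<le> eLnorm p (\<lambda>z. ennreal \<bar>u (s (r n)) z - u l z\<bar>) + eLnorm p (\<lambda>z. ennreal \<bar>u l z - u (t (r n)) z\<bar>)"
      using p by (intro eLnorm_abs_triangle Lp_measurable[of _ p] L st l)
    finally show ?thesis by (simp add: eLnorm_abs_minus_commute[of p "u l"])
  qed
  ultimately have "ennreal \<epsilon> \<le> 0 + 0"
    by (intro tendsto_lowerbound[where F=sequentially]) auto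
  then show False using \<epsilon> by simp
qed

text \<open>Uniform continuity yields step functions in time that are within 2^(-n) of the curve at
  all times simultaneously. Their pointwise limit is measurable in both variables and, by
  completeness, a representative at each time.\<close>

lemma Lp_continuous_measurable_version:
  fixes u :: "real \<Rightarrow> 'a::euclidean_space \<Rightarrow> real"
  assumes u: "Lp_continuous_on p {0..T} u" and p: "1 \<le> p" and T: "0 \<le> T"
  obtains v where "(\<lambda>x. v (fst x) (snd x)) \<in> borel_measurable (borel \<Otimes>\<^sub>M borel)"
    "\<And>t. t \<in> {0..T} \<Longrightarrow> AE z in lborel. v t z = u t z"
proof -
  have L: "u x \<in> Lp p" if "x \<in> {0..T}" for x using u that by (simp add: Lp_continuous_on_def)
  have "\<forall>n. \<exists>N::nat. 0 < N \<and> (\<forall>s\<in>{0..T}. \<forall>t\<in>{0..T}. \<bar>s - t\<bar> \<le> 1 / N \<longrightarrow> Lp_norm p (\<lambda>z. u s z - u t z) < (1 / 2) ^ n)"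
  proof
    fix n :: nat
    obtain \<delta> where \<delta>: "0 < \<delta>" "\<And>s t. s \<in> {0..T} \<Longrightarrow> t \<in> {0..T} \<Longrightarrow> \<bar>s - t\<bar> < \<delta> \<Longrightarrow> Lp_norm p (\<lambda>z. u s z - u t z) < (1 / 2) ^ n"
      using Lp_uniformly_continuous[OF u p, of "(1 / 2) ^ n"] by auto
    obtain N :: nat where N: "1 / \<delta> < N" using reals_Archimedean2 by blast
    moreover have "0 < 1 / \<delta>" using \<delta>(1) by simp
    ultimately have "0 < real N" by linarith
    then have "1 / N < \<delta>" using N \<delta>(1) by (simp add: field_simps)
    with \<delta>(2) \<open>0 < real N\<close> show "\<exists>N::nat. 0 < N \<and> (\<forall>s\<in>{0..T}. \<forall>t\<in>{0..T}. \<bar>s - t\<bar> \<le> 1 / N \<longrightarrow> Lp_norm p (\<lambda>z. u s z - u t z) < (1 / 2) ^ n)"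
      by (intro exI[of _ N]) auto
  qed
  from choice[OF this] obtain N :: "nat \<Rightarrow> nat" where N': "\<forall>n. 0 < N n \<and> (\<forall>s\<in>{0..T}. \<forall>t\<in>{0..T}. \<bar>s - t\<bar> \<le> 1 / N n \<longrightarrow>
      Lp_norm p (\<lambda>z. u s z - u t z) < (1 / 2) ^ n)"
    by (elim exE) simp
  then have N: "0 < N n" "s \<in> {0..T} \<Longrightarrow> t \<in> {0..T} \<Longrightarrow> \<bar>s - t\<bar> \<le> 1 / N n \<Longrightarrow>
      Lp_norm p (\<lambda>z. u s z - u t z) < (1 / 2) ^ n" for n s t
    by blast+
  \<comment> \<open>Grid points are clamped to the interval, so that every sampled value is a value
    of \<open>u\<close> in L^p.\<close>
  define w where "w n i = u (max 0 (min T (real_of_int i / N n)))" for n i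
  have wL: "w n i \<in> Lp p" for n i unfolding w_def using T by (intro L) auto
  define v where "v n t = w n \<lfloor>t * real (N n)\<rfloor>" for n and t :: real
  note [measurable] = Lp_measurable[OF wL]
  have v_meas: "(\<lambda>x. v n (fst x) (snd x)) \<in> borel_measurable (borel \<Otimes>\<^sub>M borel)" for n
    unfolding v_def by (rule measurable_step_floor) measurable
  have vu: "eLnorm p (\<lambda>z. ennreal \<bar>v n t z - u t z\<bar>) \<le> ennreal ((1 / 2) ^ n)" if t: "t \<in> {0..T}" for n t
  proof -
    define i where "i = real_of_int \<lfloor>t * real (N n)\<rfloor> / real (N n)"
    have pos: "0 < real (N n)" using N(1) by simp
    have "0 \<le> i" using t pos by (simp add: i_def)
    moreover have "i \<le> t" "t - i \<le> 1 / N n" using floor_step[OF pos, of t] by (simp_all add: i_def)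
    ultimately have i: "0 \<le> i" "i \<le> T" "\<bar>i - t\<bar> \<le> 1 / N n"
      using t by auto
    then have "v n t = u i" "i \<in> {0..T}" "\<bar>i - t\<bar> \<le> 1 / N n"
      by (simp_all add: v_def w_def flip: i_def)
    then have "eLnorm p (\<lambda>z. ennreal \<bar>v n t z - u t z\<bar>) = ennreal (Lp_norm p (\<lambda>z. u i z - u t z))"
      using t by (simp add: ennreal_Lp_norm[OF Lp_diff[OF L L p]])
    also have "\<dots> \<le> ennreal ((1 / 2) ^ n)"
      using N(2)[of i t n] t \<open>i \<in> {0..T}\<close> \<open>\<bar>i - t\<bar> \<le> 1 / N n\<close> by (intro ennreal_leI less_imp_le) auto
    finally show ?thesis .
  qed
  have vv: "eLnorm p (\<lambda>z. ennreal \<bar>v (Suc n) t z - v n t z\<bar>) \<le> ennreal (2 * (1 / 2) ^ n)" if t: "t \<in> {0..T}" for n t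
  proof -
    have "eLnorm p (\<lambda>z. ennreal \<bar>v (Suc n) t z - v n t z\<bar>) \<le>
        eLnorm p (\<lambda>z. ennreal \<bar>v (Suc n) t z - u t z\<bar>) + eLnorm p (\<lambda>z. ennreal \<bar>u t z - v n t z\<bar>)"
      using p by (intro eLnorm_abs_triangle Lp_measurable[of _ p] L t) (auto simp: v_def wL)
    also have "\<dots> \<le> ennreal ((1 / 2) ^ Suc n) + ennreal ((1 / 2) ^ n)"
      using vu[OF t, of "Suc n"] vu[OF t, of n] by (intro add_mono) (simp_all add: eLnorm_abs_minus_commute[of p "u t"])
    also have "\<dots> \<le> ennreal (2 * (1 / 2) ^ n)"
      by (subst ennreal_plus[symmetric]) (auto intro!: ennreal_leI)
    finally show ?thesis .
  qed
  have summ: "summable (\<lambda>n. 2 * (1 / 2 :: real) ^ n)" by (intro summable_mult summable_geometric) auto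
  define V where "V t z = lim (\<lambda>n. v n t z)" for t z
  have "(\<lambda>x. V (fst x) (snd x)) \<in> borel_measurable (borel \<Otimes>\<^sub>M borel)"
    unfolding V_def by (intro borel_measurable_lim_metric v_meas)
  moreover have "AE z in lborel. V t z = u t z" if t: "t \<in> {0..T}" for t
  proof -
    have vL: "v n t \<in> Lp p" for n by (simp add: v_def wL)
    note [measurable] = Lp_measurable[OF vL] Lp_measurable[OF L[OF t]]
    have [measurable]: "V t \<in> borel_measurable borel"
      unfolding V_def by measurable
    have le: "eLnorm p (\<lambda>z. ennreal \<bar>V t z - v n t z\<bar>) \<le> ennreal (\<Sum>j. 2 * (1 / 2) ^ (j + n))" for n
      unfolding V_def by (intro Lp_complete(2) p vv t summ) auto
    have "(\<Sum>j. 2 * (1 / 2 :: real) ^ (j + n)) = 4 * (1 / 2) ^ n" for n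
      using suminf_geometric[of "1 / 2 :: real"] suminf_mult[of "\<lambda>j. (1 / 2 :: real) ^ j" "2 * (1 / 2) ^ n"]
      by (simp add: power_add mult_ac summable_geometric)
    with le have le': "eLnorm p (\<lambda>z. ennreal \<bar>V t z - v n t z\<bar>) \<le> ennreal (4 * (1 / 2) ^ n)" for n by simp
    have "eLnorm p (\<lambda>z. ennreal \<bar>V t z - u t z\<bar>) \<le> ennreal (5 * (1 / 2) ^ n)" for n
    proof -
      have "eLnorm p (\<lambda>z. ennreal \<bar>V t z - u t z\<bar>) \<le>
        eLnorm p (\<lambda>z. ennreal \<bar>V t z - v n t z\<bar>) + eLnorm p (\<lambda>z. ennreal \<bar>v n t z - u t z\<bar>)"
        using p by (intro eLnorm_abs_triangle) auto
      also have "\<dots> \<le> ennreal (4 * (1 / 2) ^ n) + ennreal ((1 / 2) ^ n)"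
        by (intro add_mono le' vu t)
      also have "\<dots> = ennreal (5 * (1 / 2) ^ n)"
        by (subst ennreal_plus[symmetric]) auto
      finally show ?thesis .
    qed
    moreover have "(\<lambda>n. ennreal (5 * (1 / 2) ^ n)) \<longlonglongrightarrow> ennreal (5 * 0)"
      by (intro tendsto_ennrealI tendsto_intros LIMSEQ_power_zero) auto
    ultimately have "eLnorm p (\<lambda>z. ennreal \<bar>V t z - u t z\<bar>) \<le> ennreal (5 * 0)"
      by (intro tendsto_lowerbound[where F=sequentially]) auto
    then have "AE z in lborel. ennreal \<bar>V t z - u t z\<bar> = 0"
      by (intro eLnorm_eq_0D) auto
    then show ?thesis by eventually_elim simp
  qed
  ultimately show ?thesis using that by blast
qed

section \<open>Bochner integrals in L^p as pointwise time integrals\<close>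

lemma eLnorm_integral_le:
  fixes g :: "'s \<Rightarrow> 'a::euclidean_space \<Rightarrow> real"
  assumes M: "sigma_finite_measure M" and g [measurable]: "(\<lambda>x. g (fst x) (snd x)) \<in> borel_measurable (M \<Otimes>\<^sub>M borel)"
    and p: "1 \<le> p" and fin: "(\<integral>\<^sup>+\<tau>. eLnorm p (\<lambda>z. ennreal \<bar>g \<tau> z\<bar>) \<partial>M) < \<top>"
  shows "AE z in lborel. integrable M (\<lambda>\<tau>. g \<tau> z)"
    and "eLnorm p (\<lambda>z. ennreal \<bar>\<integral>\<tau>. g \<tau> z \<partial>M\<bar>) \<le> (\<integral>\<^sup>+\<tau>. eLnorm p (\<lambda>z. ennreal \<bar>g \<tau> z\<bar>) \<partial>M)"
proof -
  interpret sigma_finite_measure M by fact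
  have [measurable]: "(\<lambda>x. g (snd x) (fst x)) \<in> borel_measurable (borel \<Otimes>\<^sub>M M)"
    using measurable_compose[OF measurable_pair_swap' g] by (simp add: case_prod_beta')
  have [measurable]: "(\<lambda>\<tau>. g \<tau> z) \<in> borel_measurable M" for z
    using measurable_compose[OF measurable_Pair2'[of z borel M] g] by simp
  have le: "eLnorm p (\<lambda>z. \<integral>\<^sup>+\<tau>. ennreal \<bar>g \<tau> z\<bar> \<partial>M) \<le> (\<integral>\<^sup>+\<tau>. eLnorm p (\<lambda>z. ennreal \<bar>g \<tau> z\<bar>) \<partial>M)"
    by (intro Minkowski_integral M p) measurable
  have "AE z in lborel. (\<integral>\<^sup>+\<tau>. ennreal \<bar>g \<tau> z\<bar> \<partial>M) < \<top>"
    by (rule eLnorm_finite_AE[OF _ order.strict_trans1[OF le fin]]) measurable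
  then show int: "AE z in lborel. integrable M (\<lambda>\<tau>. g \<tau> z)"
    by eventually_elim (simp add: integrable_iff_bounded)
  from int have "AE z in lborel. ennreal \<bar>\<integral>\<tau>. g \<tau> z \<partial>M\<bar> \<le> (\<integral>\<^sup>+\<tau>. ennreal \<bar>g \<tau> z\<bar> \<partial>M)"
    by eventually_elim (use integral_norm_bound_ennreal in force)
  then show "eLnorm p (\<lambda>z. ennreal \<bar>\<integral>\<tau>. g \<tau> z \<partial>M\<bar>) \<le> (\<integral>\<^sup>+\<tau>. eLnorm p (\<lambda>z. ennreal \<bar>g \<tau> z\<bar>) \<partial>M)"
    using p le by (intro order_trans[OF eLnorm_mono_AE le]) auto
qed

text \<open>Ties the formal sum over the values of a simple function to a pointwise time integral.
  Level sets of nonzero values have finite measure by assumption; the value 0 contributes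
  nothing.\<close>

lemma Lp_simple_function:
  fixes s :: "'s \<Rightarrow> 'a::euclidean_space \<Rightarrow> real"
  assumes s: "simple_function M s" "\<And>\<tau>. \<tau> \<in> space M \<Longrightarrow> s \<tau> \<in> Lp p"
    and fin: "emeasure M {\<tau> \<in> space M. s \<tau> \<noteq> (\<lambda>_. 0)} \<noteq> \<infinity>"
  shows "(\<lambda>x. s (fst x) (snd x)) \<in> borel_measurable (M \<Otimes>\<^sub>M borel)"
    and "(\<integral>\<^sup>+\<tau>. eLnorm p (\<lambda>z. ennreal \<bar>s \<tau> z\<bar>) \<partial>M) < \<top>"
    and "integrable M (\<lambda>\<tau>. s \<tau> z)" and "Lp_simple_integral M s z = (\<integral>\<tau>. s \<tau> z \<partial>M)"
proof -
  define R where "R = s ` space M"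
  have R: "finite R" using s(1) by (simp add: simple_function_def R_def)
  define B where "B f = {\<tau> \<in> space M. s \<tau> = f}" for f
  have B [measurable]: "B f \<in> sets M" if "f \<in> R" for f
  proof -
    have "B f = s -` {f} \<inter> space M" by (auto simp: B_def)
    moreover have "\<forall>f\<in>R. s -` {f} \<inter> space M \<in> sets M" using s(1) unfolding simple_function_def R_def by blast
    ultimately show ?thesis using that by simp
  qed
  have RL: "f \<in> Lp p" if "f \<in> R" for f using s(2) that by (auto simp: R_def)
  have Bfin: "emeasure M (B f) < \<infinity>" if "f \<in> R" "f \<noteq> (\<lambda>_. 0)" for f
  proof -
    have "{\<tau> \<in> space M. s \<tau> \<noteq> (\<lambda>_. 0)} = (\<Union>f\<in>R - {\<lambda>_. 0}. B f)" by (auto simp: B_def R_def)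
    then have "{\<tau> \<in> space M. s \<tau> \<noteq> (\<lambda>_. 0)} \<in> sets M" using R B by auto
    then have "emeasure M (B f) \<le> emeasure M {\<tau> \<in> space M. s \<tau> \<noteq> (\<lambda>_. 0)}"
      using that by (intro emeasure_mono) (auto simp: B_def)
    then show ?thesis using fin by (auto simp: less_top top_unique)
  qed
  have rep: "s \<tau> z = (\<Sum>f\<in>R. indicator (B f) \<tau> * f z)" if "\<tau> \<in> space M" for \<tau> z
  proof -
    have "(\<Sum>f\<in>R. indicator (B f) \<tau> * f z) = (\<Sum>f\<in>R. if f = s \<tau> then f z else 0)"
      using that by (intro sum.cong) (auto simp: B_def indicator_def)
    also have "\<dots> = s \<tau> z" using R that by (simp add: R_def)
    finally show ?thesis by simp
  qed
  have "(\<lambda>x. \<Sum>f\<in>R. indicator (B f) (fst x) * f (snd x)) \<in> borel_measurable (M \<Otimes>\<^sub>M borel)"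
  proof (intro borel_measurable_sum borel_measurable_times)
    fix f assume f: "f \<in> R"
    note [measurable] = B[OF f] Lp_measurable[OF RL[OF f]]
    show "(\<lambda>x. indicator (B f) (fst x) :: real) \<in> borel_measurable (M \<Otimes>\<^sub>M (borel :: 'a measure))" by measurable
    show "(\<lambda>x. f (snd x)) \<in> borel_measurable (M \<Otimes>\<^sub>M borel)" by measurable
  qed
  then show "(\<lambda>x. s (fst x) (snd x)) \<in> borel_measurable (M \<Otimes>\<^sub>M borel)"
    by (rule measurable_cong[THEN iffD1, rotated]) (simp add: rep space_pair_measure mem_Times_iff)
  have "(\<integral>\<^sup>+\<tau>. eLnorm p (\<lambda>z. ennreal \<bar>s \<tau> z\<bar>) \<partial>M) \<le> (\<integral>\<^sup>+\<tau>. (\<Sum>f\<in>R. eLnorm p (\<lambda>z. ennreal \<bar>f z\<bar>) * indicator (B f) \<tau>) \<partial>M)"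
  proof (intro nn_integral_mono)
    fix \<tau> assume t: "\<tau> \<in> space M"
    have "(\<Sum>f\<in>R. eLnorm p (\<lambda>z. ennreal \<bar>f z\<bar>) * indicator (B f) \<tau>) = (\<Sum>f\<in>R. if f = s \<tau> then eLnorm p (\<lambda>z. ennreal \<bar>f z\<bar>) else 0)"
      using t by (intro sum.cong) (auto simp: B_def indicator_def)
    also have "\<dots> = eLnorm p (\<lambda>z. ennreal \<bar>s \<tau> z\<bar>)" using R t by (simp add: R_def)
    finally show "eLnorm p (\<lambda>z. ennreal \<bar>s \<tau> z\<bar>) \<le> (\<Sum>f\<in>R. eLnorm p (\<lambda>z. ennreal \<bar>f z\<bar>) * indicator (B f) \<tau>)" by simp
  qed
  also have "\<dots> = (\<Sum>f\<in>R. eLnorm p (\<lambda>z. ennreal \<bar>f z\<bar>) * emeasure M (B f))"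
    by (subst nn_integral_sum) (auto intro!: sum.cong nn_integral_cmult_indicator)
  also have "\<dots> < \<top>"
  proof (subst ennreal_sum_less_top[OF R], intro ballI)
    fix f assume f: "f \<in> R"
    show "eLnorm p (\<lambda>z. ennreal \<bar>f z\<bar>) * emeasure M (B f) < \<top>"
      using Bfin[OF f] RL[OF f] by (cases "f = (\<lambda>_. 0)") (auto simp: ennreal_mult_less_top Lp_iff_eLnorm)
  qed
  finally show "(\<integral>\<^sup>+\<tau>. eLnorm p (\<lambda>z. ennreal \<bar>s \<tau> z\<bar>) \<partial>M) < \<top>" .
  have int: "integrable M (\<lambda>\<tau>. indicator (B f) \<tau> * f z)" if "f \<in> R" for f
    using Bfin[OF that] B[OF that] by (cases "f = (\<lambda>_. 0)") (auto intro!: integrable_mult_left)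
  have "integrable M (\<lambda>\<tau>. \<Sum>f\<in>R. indicator (B f) \<tau> * f z)"
    using int by (intro Bochner_Integration.integrable_sum)
  then show "integrable M (\<lambda>\<tau>. s \<tau> z)"
    by (rule Bochner_Integration.integrable_cong[THEN iffD1, rotated 2]) (auto simp: rep)
  have "(\<integral>\<tau>. s \<tau> z \<partial>M) = (\<integral>\<tau>. (\<Sum>f\<in>R. indicator (B f) \<tau> * f z) \<partial>M)"
    by (intro Bochner_Integration.integral_cong) (auto simp: rep)
  also have "\<dots> = (\<Sum>f\<in>R. measure M (B f) * f z)"
    using int B by (subst Bochner_Integration.integral_sum) (auto intro!: sum.cong simp: sets.Int_space_eq2)
  finally show "Lp_simple_integral M s z = (\<integral>\<tau>. s \<tau> z \<partial>M)"
    by (simp add: Lp_simple_integral_def R_def B_def)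
qed


lemma eLnorm_integral_diff_simple:
  fixes g s :: "'s \<Rightarrow> 'a::euclidean_space \<Rightarrow> real"
  assumes M: "sigma_finite_measure M" and g [measurable]: "(\<lambda>x. g (fst x) (snd x)) \<in> borel_measurable (M \<Otimes>\<^sub>M borel)"
    and p: "1 \<le> p" and fin: "(\<integral>\<^sup>+\<tau>. eLnorm p (\<lambda>z. ennreal \<bar>g \<tau> z\<bar>) \<partial>M) < \<top>"
    and s: "simple_function M s" "\<And>\<tau>. \<tau> \<in> space M \<Longrightarrow> s \<tau> \<in> Lp p"
    "emeasure M {\<tau> \<in> space M. s \<tau> \<noteq> (\<lambda>_. 0)} \<noteq> \<infinity>"
  shows "eLnorm p (\<lambda>z. ennreal \<bar>(\<integral>\<tau>. g \<tau> z \<partial>M) - Lp_simple_integral M s z\<bar>)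
    \<le> (\<integral>\<^sup>+\<tau>. eLnorm p (\<lambda>z. ennreal \<bar>g \<tau> z - s \<tau> z\<bar>) \<partial>M)"
proof (cases "(\<integral>\<^sup>+\<tau>. eLnorm p (\<lambda>z. ennreal \<bar>g \<tau> z - s \<tau> z\<bar>) \<partial>M) < \<top>")
  case True
  note S [measurable] = Lp_simple_function(1)[OF s]
  have meas: "(\<lambda>x. g (fst x) (snd x) - s (fst x) (snd x)) \<in> borel_measurable (M \<Otimes>\<^sub>M borel)"
    by measurable
  have "AE z in lborel. integrable M (\<lambda>\<tau>. g \<tau> z)"
    by (rule eLnorm_integral_le(1)[OF M g p fin])
  then have "AE z in lborel. (\<integral>\<tau>. g \<tau> z \<partial>M) - Lp_simple_integral M s z = (\<integral>\<tau>. g \<tau> z - s \<tau> z \<partial>M)"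
    by eventually_elim (simp add: Lp_simple_function(3,4)[OF s])
  then have "AE z in lborel. ennreal \<bar>(\<integral>\<tau>. g \<tau> z \<partial>M) - Lp_simple_integral M s z\<bar> = ennreal \<bar>\<integral>\<tau>. g \<tau> z - s \<tau> z \<partial>M\<bar>"
    by eventually_elim simp
  from eLnorm_cong_AE[OF this, of p]
  show ?thesis using eLnorm_integral_le(2)[OF M meas p True] by simp
qed (simp add: less_top[symmetric])

text \<open>\<open>I\<close> and the pointwise integral of \<open>h\<close> are approximated by the
  integrals of the same simple functions, the former by definition and the latter by Minkowski's
  inequality. Passing from \<open>g\<close> to \<open>h\<close> is harmless, because the norms in
  the definition do not see null sets.\<close>

lemma has_Lp_integralD:
  fixes g h :: "'s \<Rightarrow> 'a::euclidean_space \<Rightarrow> real"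
  assumes I: "has_Lp_integral p M g I" and M: "sigma_finite_measure M" and p: "1 \<le> p"
    and h [measurable]: "(\<lambda>x. h (fst x) (snd x)) \<in> borel_measurable (M \<Otimes>\<^sub>M borel)"
    and gh: "AE \<tau> in M. AE z in lborel. g \<tau> z = h \<tau> z"
  shows "(\<integral>\<^sup>+\<tau>. eLnorm p (\<lambda>z. ennreal \<bar>h \<tau> z\<bar>) \<partial>M) < \<top>"
    and "AE z in lborel. I z = (\<integral>\<tau>. h \<tau> z \<partial>M)"
proof -
  interpret sigma_finite_measure M by fact
  from I have gL: "AE \<tau> in M. g \<tau> \<in> Lp p" and IL: "I \<in> Lp p" by (auto simp: has_Lp_integral_def)
  from I obtain s where s: "\<And>n. simple_function M (s n)" "\<And>n \<tau>. \<tau> \<in> space M \<Longrightarrow> s n \<tau> \<in> Lp p"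
    "\<And>n. emeasure M {\<tau> \<in> space M. s n \<tau> \<noteq> (\<lambda>_. 0)} \<noteq> \<infinity>"
    and conv: "(\<lambda>n. \<integral>\<^sup>+\<tau>. ennreal (Lp_norm p (\<lambda>z. g \<tau> z - s n \<tau> z)) \<partial>M) \<longlonglongrightarrow> 0"
      "(\<lambda>n. Lp_norm p (\<lambda>z. I z - Lp_simple_integral M (s n) z)) \<longlonglongrightarrow> 0"
    by (auto simp: has_Lp_integral_def)
  note sL = Lp_simple_function[OF s]
  note [measurable] = sL(1) Lp_measurable[OF IL]
  have hm [measurable]: "h \<tau> \<in> borel_measurable borel" if "\<tau> \<in> space M" for \<tau>
    using measurable_compose[OF measurable_Pair1'[OF that] h] by simp
  have "AE \<tau> in M. ennreal (Lp_norm p (\<lambda>z. g \<tau> z - s n \<tau> z)) = eLnorm p (\<lambda>z. ennreal \<bar>h \<tau> z - s n \<tau> z\<bar>)" for n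
    using gL gh AE_space
  proof eventually_elim
    case (elim \<tau>)
    have "ennreal (Lp_norm p (\<lambda>z. g \<tau> z - s n \<tau> z)) = eLnorm p (\<lambda>z. ennreal \<bar>g \<tau> z - s n \<tau> z\<bar>)"
      using elim p s by (intro ennreal_Lp_norm Lp_diff) auto
    also have "\<dots> = eLnorm p (\<lambda>z. ennreal \<bar>h \<tau> z - s n \<tau> z\<bar>)"
      by (rule eLnorm_cong_AE) (use elim(2) in \<open>eventually_elim, simp\<close>)
    finally show ?case .
  qed
  then have "(\<integral>\<^sup>+\<tau>. ennreal (Lp_norm p (\<lambda>z. g \<tau> z - s n \<tau> z)) \<partial>M) = (\<integral>\<^sup>+\<tau>. eLnorm p (\<lambda>z. ennreal \<bar>h \<tau> z - s n \<tau> z\<bar>) \<partial>M)" for n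
    by (rule nn_integral_cong_AE)
  with conv(1) have e0: "(\<lambda>n. \<integral>\<^sup>+\<tau>. eLnorm p (\<lambda>z. ennreal \<bar>h \<tau> z - s n \<tau> z\<bar>) \<partial>M) \<longlonglongrightarrow> 0" by simp
  then have "\<forall>\<^sub>F n in sequentially. (\<integral>\<^sup>+\<tau>. eLnorm p (\<lambda>z. ennreal \<bar>h \<tau> z - s n \<tau> z\<bar>) \<partial>M) < 1"
    by (intro order_tendstoD(2)) auto
  \<comment> \<open>One approximant at distance less than 1 suffices for finiteness, since the norm
    of a simple function is integrable in time.\<close>
  then obtain n where n: "(\<integral>\<^sup>+\<tau>. eLnorm p (\<lambda>z. ennreal \<bar>h \<tau> z - s n \<tau> z\<bar>) \<partial>M) < 1"
    by (auto simp: eventually_sequentially)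
  have "(\<integral>\<^sup>+\<tau>. eLnorm p (\<lambda>z. ennreal \<bar>h \<tau> z\<bar>) \<partial>M) \<le>
      (\<integral>\<^sup>+\<tau>. eLnorm p (\<lambda>z. ennreal \<bar>h \<tau> z - s n \<tau> z\<bar>) + eLnorm p (\<lambda>z. ennreal \<bar>s n \<tau> z\<bar>) \<partial>M)"
    using p s by (intro nn_integral_mono eLnorm_abs_le_add_diff hm Lp_measurable[of _ p]) auto
  also have "\<dots> = (\<integral>\<^sup>+\<tau>. eLnorm p (\<lambda>z. ennreal \<bar>h \<tau> z - s n \<tau> z\<bar>) \<partial>M) + (\<integral>\<^sup>+\<tau>. eLnorm p (\<lambda>z. ennreal \<bar>s n \<tau> z\<bar>) \<partial>M)"
    by (intro nn_integral_add) measurable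
  also have "\<dots> < \<top>" using order.strict_trans[OF n ennreal_one_less_top] sL(2)[of n] by simp
  finally show fin: "(\<integral>\<^sup>+\<tau>. eLnorm p (\<lambda>z. ennreal \<bar>h \<tau> z\<bar>) \<partial>M) < \<top>" .
  have [measurable]: "(\<lambda>x. h (snd x) (fst x)) \<in> borel_measurable (borel \<Otimes>\<^sub>M M)"
    "(\<lambda>x. s n (snd x) (fst x)) \<in> borel_measurable (borel \<Otimes>\<^sub>M M)" for n
    using measurable_compose[OF measurable_pair_swap' h] measurable_compose[OF measurable_pair_swap' sL(1)[of n]]
    by (simp_all add: case_prod_beta')
  have simp_int: "Lp_simple_integral M (s n) = (\<lambda>z. \<integral>\<tau>. s n \<tau> z \<partial>M)" for n
    using sL(4)[of n] by blast
  have [measurable]: "Lp_simple_integral M (s n) \<in> borel_measurable borel" for n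
    unfolding simp_int by measurable
  have SL: "Lp_simple_integral M (s n) \<in> Lp p" for n
    unfolding simp_int using eLnorm_integral_le(2)[OF M sL(1) p sL(2), of n] sL(2)[of n]
    by (auto simp: Lp_iff_eLnorm intro: order.strict_trans1)
  have "eLnorm p (\<lambda>z. ennreal \<bar>I z - (\<integral>\<tau>. h \<tau> z \<partial>M)\<bar>) \<le>
     ennreal (Lp_norm p (\<lambda>z. I z - Lp_simple_integral M (s n) z)) + (\<integral>\<^sup>+\<tau>. eLnorm p (\<lambda>z. ennreal \<bar>h \<tau> z - s n \<tau> z\<bar>) \<partial>M)" for n
  proof -
    have "eLnorm p (\<lambda>z. ennreal \<bar>I z - (\<integral>\<tau>. h \<tau> z \<partial>M)\<bar>) \<le>
      eLnorm p (\<lambda>z. ennreal \<bar>I z - Lp_simple_integral M (s n) z\<bar>) + eLnorm p (\<lambda>z. ennreal \<bar>Lp_simple_integral M (s n) z - (\<integral>\<tau>. h \<tau> z \<partial>M)\<bar>)"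
      using p by (intro eLnorm_abs_triangle) measurable
    also have "\<dots> \<le> ennreal (Lp_norm p (\<lambda>z. I z - Lp_simple_integral M (s n) z)) + (\<integral>\<^sup>+\<tau>. eLnorm p (\<lambda>z. ennreal \<bar>h \<tau> z - s n \<tau> z\<bar>) \<partial>M)"
      using eLnorm_integral_diff_simple[OF M h p fin s, of n] ennreal_Lp_norm[OF Lp_diff[OF IL SL p], of n]
      by (intro add_mono) (simp_all add: eLnorm_abs_minus_commute[of p "Lp_simple_integral M _"])
    finally show ?thesis .
  qed
  moreover have "(\<lambda>n. ennreal (Lp_norm p (\<lambda>z. I z - Lp_simple_integral M (s n) z)) + (\<integral>\<^sup>+\<tau>. eLnorm p (\<lambda>z. ennreal \<bar>h \<tau> z - s n \<tau> z\<bar>) \<partial>M)) \<longlonglongrightarrow> ennreal 0 + 0"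
    by (intro tendsto_add tendsto_ennrealI conv e0)
  ultimately have "eLnorm p (\<lambda>z. ennreal \<bar>I z - (\<integral>\<tau>. h \<tau> z \<partial>M)\<bar>) \<le> ennreal 0 + 0"
    by (intro tendsto_lowerbound[where F=sequentially]) auto
  then have "AE z in lborel. ennreal \<bar>I z - (\<integral>\<tau>. h \<tau> z \<partial>M)\<bar> = 0"
    by (intro eLnorm_eq_0D[of _ p]) auto
  then show "AE z in lborel. I z = (\<integral>\<tau>. h \<tau> z \<partial>M)" by eventually_elim simp
qed

lemma nn_integral_powr_finite:
  fixes a t :: real
  assumes "-1 < a" "0 \<le> t"
  shows "(\<integral>\<^sup>+s. ennreal (s powr a) * indicator {0..t} s \<partial>lborel) = ennreal (t powr (a + 1) / (a + 1))"
proof -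
  have "((\<lambda>x. x powr a) has_integral (t powr (a + 1) / (a + 1))) {0..t}"
    using assms by (intro has_integral_powr_from_0)
  moreover have "(\<integral>\<^sup>+s. ennreal (s powr a) * indicator {0..t} s \<partial>lborel) = (\<integral>\<^sup>+s. ennreal (indicator {0..t} s * s powr a) \<partial>lborel)"
    by (intro nn_integral_cong) (auto simp: indicator_def)
  ultimately show ?thesis
    using assms nn_integral_has_integral_lebesgue[of "{0..t}" "\<lambda>x. x powr a" "t powr (a + 1) / (a + 1)"]
    by (simp add: nn_integral_completion)
qed

text \<open>Step functions sampled at left grid points converge at interior times by continuity.
  They stay below a fixed multiple of \<tau>^(-\<beta>), which is integrable for \<beta> < 1, so
  dominated convergence works despite the singularity at 0.\<close>

lemma has_Lp_integralI:
  fixes g :: "real \<Rightarrow> 'a::euclidean_space \<Rightarrow> real"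
  assumes g [measurable]: "(\<lambda>x. g (fst x) (snd x)) \<in> borel_measurable (borel \<Otimes>\<^sub>M borel)"
    and p: "1 \<le> p" and t: "0 \<le> t" and gL: "\<And>\<tau>. \<tau> \<in> {0<..<t} \<Longrightarrow> g \<tau> \<in> Lp p"
    and cont: "\<And>\<tau> X. \<tau> \<in> {0<..<t} \<Longrightarrow> (\<And>n. X n \<in> {0<..<t}) \<Longrightarrow> X \<longlonglongrightarrow> \<tau> \<Longrightarrow>
       (\<lambda>n. eLnorm p (\<lambda>z. ennreal \<bar>g (X n) z - g \<tau> z\<bar>)) \<longlonglongrightarrow> 0"
    and bound: "\<And>\<tau>. \<tau> \<in> {0<..<t} \<Longrightarrow> eLnorm p (\<lambda>z. ennreal \<bar>g \<tau> z\<bar>) \<le> ennreal (H * \<tau> powr (- \<beta>))"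
    and \<beta>: "0 \<le> \<beta>" "\<beta> < 1" and H: "0 \<le> H"
  shows "has_Lp_integral p (restrict_space lborel {0..t}) g (\<lambda>z. \<integral>\<tau>. g \<tau> z \<partial>restrict_space lborel {0..t})"
proof -
  define M where "M = restrict_space lborel {0..t :: real}"
  have spM: "space M = {0..t}" by (simp add: M_def space_restrict_space)
  have sf: "sigma_finite_measure M"
    unfolding M_def by (intro sigma_finite_measure_restrict_space sigma_finite_lborel) auto
  interpret sigma_finite_measure M by fact
  have idM: "(\<lambda>x. x) \<in> M \<rightarrow>\<^sub>M borel" unfolding M_def by (intro measurable_restrict_space1) simp
  have [measurable]: "(\<lambda>x. g (fst x) (snd x)) \<in> borel_measurable (M \<Otimes>\<^sub>M borel)"
  proof -
    have "(\<lambda>x. (fst x, snd x)) \<in> M \<Otimes>\<^sub>M (borel :: 'a measure) \<rightarrow>\<^sub>M borel \<Otimes>\<^sub>M borel"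
      by (intro measurable_Pair measurable_compose[OF measurable_fst idM] measurable_snd)
    from measurable_compose[OF this g] show ?thesis by simp
  qed
  have AE_M: "AE \<tau> in M. \<tau> \<in> {0<..<t}"
  proof -
    have "AE \<tau> in lborel. \<tau> \<noteq> 0 \<and> \<tau> \<noteq> t" using AE_lborel_singleton[of 0] AE_lborel_singleton[of t] by eventually_elim auto
    then have "AE \<tau> in lborel. \<tau> \<in> {0..t} \<longrightarrow> \<tau> \<in> {0<..<t}" by eventually_elim auto
    then show ?thesis unfolding M_def by (subst AE_restrict_space_iff) auto
  qed
  have [measurable]: "g \<tau> \<in> borel_measurable borel" for \<tau>
    using measurable_compose[OF measurable_Pair1'[of \<tau> borel borel] g] by simp
  \<comment> \<open>Samples outside the open interval are set to 0: at the end points neither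
    membership in L^p nor the bound is assumed.\<close>
  define w where "w n i = (if real_of_int i / Suc n \<in> {0<..<t} then g (real_of_int i / Suc n) else (\<lambda>_. 0))" for n :: nat and i
  define s where "s n \<tau> = w n \<lfloor>\<tau> * Suc n\<rfloor>" for n and \<tau> :: real
  have wL: "w n i \<in> Lp p" for n i using gL by (auto simp: w_def Lp_iff_eLnorm)
  note [measurable] = Lp_measurable[OF wL]
  have simple: "simple_function M (s n)" for n
  proof -
    have "simple_function M (\<lambda>\<tau>. \<lfloor>\<tau> * Suc n\<rfloor>)"
      unfolding simple_function_def
    proof (intro conjI ballI)
      show "finite ((\<lambda>\<tau>. \<lfloor>\<tau> * Suc n\<rfloor>) ` space M)"
      proof (rule finite_subset)
        show "(\<lambda>\<tau>. \<lfloor>\<tau> * Suc n\<rfloor>) ` space M \<subseteq> {0..\<lfloor>t * Suc n\<rfloor>}"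
          by (auto simp: spM intro!: floor_mono mult_right_mono)
      qed simp
      fix i show "(\<lambda>\<tau>. \<lfloor>\<tau> * Suc n\<rfloor>) -` {i} \<inter> space M \<in> sets M"
        by (intro measurable_sets[of _ M "count_space UNIV"] measurable_compose[OF idM]) measurable
    qed
    from simple_function_compose[OF this, of "w n"] show ?thesis by (simp add: s_def[abs_def] o_def)
  qed
  have fin: "emeasure M {\<tau> \<in> space M. s n \<tau> \<noteq> (\<lambda>_. 0)} \<noteq> \<infinity>" for n
  proof -
    have "emeasure M {\<tau> \<in> space M. s n \<tau> \<noteq> (\<lambda>_. 0)} \<le> emeasure M (space M)"
      by (intro emeasure_space)
    also have "\<dots> = ennreal t" unfolding spM using t by (simp add: M_def emeasure_restrict_space)
    also have "\<dots> < \<infinity>" by simp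
    finally show ?thesis by simp
  qed
  have sL: "s n \<tau> \<in> Lp p" for n \<tau> by (simp add: s_def wL)
  note S = Lp_simple_function[OF simple sL fin]
  have [measurable]: "(\<lambda>x. s n (fst x) (snd x)) \<in> borel_measurable (M \<Otimes>\<^sub>M borel)" for n by (rule S)
  have conv: "(\<lambda>n. eLnorm p (\<lambda>z. ennreal \<bar>g \<tau> z - s n \<tau> z\<bar>)) \<longlonglongrightarrow> 0" if \<tau>: "\<tau> \<in> {0<..<t}" for \<tau>
  proof -
    define X where "X n = real_of_int \<lfloor>\<tau> * Suc n\<rfloor> / Suc n" for n
    have X: "X n \<le> \<tau>" "\<tau> - X n \<le> 1 / Suc n" for n
      using floor_step[of "Suc n" \<tau>] by (simp_all add: X_def)
    have Xlim: "X \<longlonglongrightarrow> \<tau>"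
    proof (rule tendsto_sandwich[of "\<lambda>n. \<tau> - 1 / Suc n" _ _ "\<lambda>_. \<tau>"])
      show "(\<lambda>n. \<tau> - 1 / Suc n) \<longlonglongrightarrow> \<tau>"
        using tendsto_diff[OF tendsto_const[of \<tau>] LIMSEQ_inverse_real_of_nat] by (simp add: inverse_eq_divide)
    qed (use X(1) X(2) in \<open>auto simp: algebra_simps\<close>)
    \<comment> \<open>Continuity is assumed along sequences inside the interval only, so the
      finitely many samples that fall outside are replaced by \<tau>.\<close>
    define Y where "Y n = (if X n \<in> {0<..<t} then X n else \<tau>)" for n
    have ev: "\<forall>\<^sub>F n in sequentially. Y n = X n \<and> X n \<in> {0<..<t}"
      using order_tendstoD(1)[OF Xlim, of 0] order_tendstoD(2)[OF Xlim, of t] \<tau>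
      by (auto elim: eventually_elim2 simp: Y_def)
    have Y: "Y \<longlonglongrightarrow> \<tau>"
      by (rule Lim_transform_eventually[OF Xlim]) (use ev in \<open>auto elim: eventually_mono\<close>)
    have "(\<lambda>n. eLnorm p (\<lambda>z. ennreal \<bar>g (Y n) z - g \<tau> z\<bar>)) \<longlonglongrightarrow> 0"
      using \<tau> by (intro cont[OF \<tau> _ Y]) (auto simp: Y_def)
    then show ?thesis
    proof (rule Lim_transform_eventually)
      show "\<forall>\<^sub>F n in sequentially. eLnorm p (\<lambda>z. ennreal \<bar>g (Y n) z - g \<tau> z\<bar>) = eLnorm p (\<lambda>z. ennreal \<bar>g \<tau> z - s n \<tau> z\<bar>)"
        using ev by eventually_elim (simp add: s_def w_def X_def eLnorm_abs_minus_commute[of p "g \<tau>"] del: of_nat_Suc)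
    qed
  qed
  have le: "eLnorm p (\<lambda>z. ennreal \<bar>g \<tau> z - s n \<tau> z\<bar>) \<le> ennreal (H * (1 + 2 powr \<beta>)) * ennreal (\<tau> powr (- \<beta>))" if \<tau>: "\<tau> \<in> {0<..<t}" for n \<tau>
  proof -
    define x where "x = real_of_int \<lfloor>\<tau> * Suc n\<rfloor> / Suc n"
    have sle: "eLnorm p (\<lambda>z. ennreal \<bar>s n \<tau> z\<bar>) \<le> ennreal (H * 2 powr \<beta> * \<tau> powr (- \<beta>))"
    proof (cases "x \<in> {0<..<t}")
      case True
      \<comment> \<open>A positive grid point has index at least 1, so rounding down loses at most
        half of \<tau>. This is the origin of the factor 2^\<beta>.\<close>
      then have "1 \<le> \<lfloor>\<tau> * Suc n\<rfloor>" by (auto simp: x_def zero_less_divide_iff)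
      then have "\<tau> * Suc n \<le> 2 * real_of_int \<lfloor>\<tau> * Suc n\<rfloor>" by linarith
      then have "\<tau> / 2 \<le> x" by (simp add: x_def field_simps del: of_nat_Suc)
      then have "x powr (- \<beta>) \<le> (\<tau> / 2) powr (- \<beta>)" using \<tau> \<beta> by (intro powr_mono2') auto
      also have "\<dots> = 2 powr \<beta> * \<tau> powr (- \<beta>)" using \<tau> by (simp add: powr_divide powr_minus divide_simps)
      finally have "H * x powr (- \<beta>) \<le> H * 2 powr \<beta> * \<tau> powr (- \<beta>)" using H by (simp add: mult.assoc mult_left_mono)
      moreover have "s n \<tau> = g x" using True by (simp add: s_def w_def x_def)
      ultimately show ?thesis using bound[OF True] by (auto intro: order_trans ennreal_leI)
    next
      case False
      then have "s n \<tau> = (\<lambda>_. 0)" unfolding s_def w_def x_def by (rule if_not_P)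
      then show ?thesis by simp
    qed
    have "eLnorm p (\<lambda>z. ennreal \<bar>g \<tau> z - s n \<tau> z\<bar>) \<le> eLnorm p (\<lambda>z. ennreal \<bar>g \<tau> z\<bar>) + eLnorm p (\<lambda>z. ennreal \<bar>- s n \<tau> z\<bar>)"
      using eLnorm_abs_add_le[of "g \<tau>" "\<lambda>z. - s n \<tau> z" p] p by (simp add: s_def)
    also have "\<dots> \<le> ennreal (H * \<tau> powr (- \<beta>)) + ennreal (H * 2 powr \<beta> * \<tau> powr (- \<beta>))"
      using sle by (intro add_mono bound \<tau>) simp
    also have "\<dots> = ennreal (H * (1 + 2 powr \<beta>)) * ennreal (\<tau> powr (- \<beta>))"
      using H by (subst ennreal_plus[symmetric]) (auto simp: ennreal_mult[symmetric] algebra_simps)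
    finally show ?thesis .
  qed
  have bfin: "(\<integral>\<^sup>+\<tau>. c * ennreal (\<tau> powr (- \<beta>)) \<partial>M) < \<top>" if "c < \<top>" for c
    using nn_integral_powr_finite[of "- \<beta>" t] \<beta> t that
    by (simp add: M_def nn_integral_restrict_space mult.assoc nn_integral_cmult ennreal_mult_less_top)
  have e0: "(\<lambda>n. \<integral>\<^sup>+\<tau>. eLnorm p (\<lambda>z. ennreal \<bar>g \<tau> z - s n \<tau> z\<bar>) \<partial>M) \<longlonglongrightarrow> 0"
  proof (rule nn_integral_dominated[where w="\<lambda>\<tau>. ennreal (H * (1 + 2 powr \<beta>)) * ennreal (\<tau> powr (- \<beta>))"])
    show "(\<lambda>\<tau>. ennreal (H * (1 + 2 powr \<beta>)) * ennreal (\<tau> powr (- \<beta>))) \<in> borel_measurable M"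
      by (rule measurable_compose[OF idM]) measurable
    show "AE \<tau> in M. eLnorm p (\<lambda>z. ennreal \<bar>g \<tau> z - s n \<tau> z\<bar>) \<le> ennreal (H * (1 + 2 powr \<beta>)) * ennreal (\<tau> powr (- \<beta>))" for n
      using AE_M by eventually_elim (rule le)
    show "AE \<tau> in M. (\<lambda>n. eLnorm p (\<lambda>z. ennreal \<bar>g \<tau> z - s n \<tau> z\<bar>)) \<longlonglongrightarrow> 0"
      using AE_M by eventually_elim (rule conv)
    show "(\<integral>\<^sup>+\<tau>. ennreal (H * (1 + 2 powr \<beta>)) * ennreal (\<tau> powr (- \<beta>)) \<partial>M) < \<top>"
      by (rule bfin) simp
  qed measurable
  have gfin: "(\<integral>\<^sup>+\<tau>. eLnorm p (\<lambda>z. ennreal \<bar>g \<tau> z\<bar>) \<partial>M) < \<top>"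
  proof -
    have "(\<integral>\<^sup>+\<tau>. eLnorm p (\<lambda>z. ennreal \<bar>g \<tau> z\<bar>) \<partial>M) \<le> (\<integral>\<^sup>+\<tau>. ennreal H * ennreal (\<tau> powr (- \<beta>)) \<partial>M)"
      by (rule nn_integral_mono_AE) (use AE_M in \<open>eventually_elim, use bound H in \<open>simp add: ennreal_mult[symmetric]\<close>\<close>)
    also have "\<dots> < \<top>" by (rule bfin) simp
    finally show ?thesis .
  qed
  define I where "I z = (\<integral>\<tau>. g \<tau> z \<partial>M)" for z
  have [measurable]: "(\<lambda>x. g (snd x) (fst x)) \<in> borel_measurable (borel \<Otimes>\<^sub>M M)"
    using measurable_compose[OF measurable_pair_swap', of "\<lambda>x. g (fst x) (snd x)" M borel borel] by (simp add: case_prod_beta')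
  have [measurable]: "I \<in> borel_measurable borel" unfolding I_def by measurable
  have IL: "I \<in> Lp p"
    using order.strict_trans1[OF eLnorm_integral_le(2)[OF sf _ p gfin] gfin] by (simp add: Lp_iff_eLnorm I_def)
  have simp_int: "Lp_simple_integral M (s n) = (\<lambda>z. \<integral>\<tau>. s n \<tau> z \<partial>M)" for n
    using S(4)[of n] by blast
  have SL: "Lp_simple_integral M (s n) \<in> Lp p" for n
  proof -
    have [measurable]: "(\<lambda>x. s n (snd x) (fst x)) \<in> borel_measurable (borel \<Otimes>\<^sub>M M)"
      using measurable_compose[OF measurable_pair_swap', of "\<lambda>x. s n (fst x) (snd x)" M borel borel] by (simp add: case_prod_beta')
    show ?thesis
      unfolding simp_int using order.strict_trans1[OF eLnorm_integral_le(2)[OF sf S(1) p S(2)] S(2), of n]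
      by (simp add: Lp_iff_eLnorm)
  qed
  have "has_Lp_integral p M g I"
    unfolding has_Lp_integral_def
  proof (intro conjI exI[of _ s] allI ballI simple sL fin IL)
    show "AE \<tau> in M. g \<tau> \<in> Lp p" using AE_M by eventually_elim (rule gL)
    show "AE \<tau> in M. (\<lambda>n. Lp_norm p (\<lambda>z. g \<tau> z - s n \<tau> z)) \<longlonglongrightarrow> 0"
      using AE_M by eventually_elim (subst tendsto_Lp_norm_iff, auto intro!: Lp_diff gL sL p conv)
    have "(\<integral>\<^sup>+\<tau>. ennreal (Lp_norm p (\<lambda>z. g \<tau> z - s n \<tau> z)) \<partial>M) = (\<integral>\<^sup>+\<tau>. eLnorm p (\<lambda>z. ennreal \<bar>g \<tau> z - s n \<tau> z\<bar>) \<partial>M)" for n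
      by (rule nn_integral_cong_AE) (use AE_M in \<open>eventually_elim, intro ennreal_Lp_norm Lp_diff gL sL p\<close>)
    with e0 show "(\<lambda>n. \<integral>\<^sup>+\<tau>. ennreal (Lp_norm p (\<lambda>z. g \<tau> z - s n \<tau> z)) \<partial>M) \<longlonglongrightarrow> 0" by simp
    show "(\<lambda>n. Lp_norm p (\<lambda>z. I z - Lp_simple_integral M (s n) z)) \<longlonglongrightarrow> 0"
    proof (subst tendsto_Lp_norm_iff)
      show "(\<lambda>n. eLnorm p (\<lambda>z. ennreal \<bar>I z - Lp_simple_integral M (s n) z\<bar>)) \<longlonglongrightarrow> 0"
        by (rule tendsto_sandwich[OF _ _ tendsto_const e0])
           (auto simp: I_def intro!: always_eventually eLnorm_integral_diff_simple sf p gfin simple sL fin)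
    qed (intro Lp_diff IL SL p)
  qed
  then show ?thesis by (simp add: M_def I_def[abs_def])
qed

section \<open>A singular Gronwall inequality\<close>

lemma measurable_indicator_Icc [measurable (raw)]:
  fixes f g h :: "'b \<Rightarrow> real"
  assumes [measurable]: "f \<in> borel_measurable M" "g \<in> borel_measurable M" "h \<in> borel_measurable M"
  shows "(\<lambda>x. indicator {f x..g x} (h x) :: ennreal) \<in> borel_measurable M"
proof -
  have "(\<lambda>x. if f x \<le> h x \<and> h x \<le> g x then 1 else 0 :: ennreal) \<in> borel_measurable M" by measurable
  then show ?thesis by (simp add: indicator_def of_bool_def)
qed

text \<open>The substitution s = t * x reduces to the unit interval and extracts the power 1 - a - b
  of t, the net gain or loss of a Duhamel integral that is singular at both ends.\<close>

lemma nn_integral_Beta: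
  fixes a b t :: real
  assumes "a < 1" "b < 1" "0 < t"
  shows "(\<integral>\<^sup>+s. ennreal ((t - s) powr (- a) * s powr (- b)) * indicator {0..t} s \<partial>lborel) =
    ennreal (Beta (1 - b) (1 - a) * t powr (1 - a - b))"
proof -
  have Beta: "((\<lambda>x. x powr (- b) * (1 - x) powr (- a)) has_integral Beta (1 - b) (1 - a)) {0..1}"
    using has_integral_Beta_real[of "1 - b" "1 - a"] assms by simp
  have pt: "ennreal ((t - t * x) powr (- a) * (t * x) powr (- b)) * indicator {0..t} (t * x) =
      ennreal (t powr (- a - b)) * ennreal (indicator {0..1} x * (x powr (- b) * (1 - x) powr (- a)))" for x :: real
  proof (cases "x \<in> {0..1}")
    case True
    have "t - t * x = t * (1 - x)" by (simp add: algebra_simps)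
    then have "(t - t * x) powr (- a) * (t * x) powr (- b) = t powr (- a - b) * (x powr (- b) * (1 - x) powr (- a))"
      using assms True powr_add[of t "- a" "- b"] by (simp add: powr_mult mult_ac)
    then show ?thesis using True assms by (simp add: ennreal_mult)
  next
    case False
    then have "t * x \<notin> {0..t}" using assms by (auto simp: zero_le_mult_iff)
    then show ?thesis using False by simp
  qed
  have "(\<integral>\<^sup>+s. ennreal ((t - s) powr (- a) * s powr (- b)) * indicator {0..t} s \<partial>lborel) =
    ennreal t * (\<integral>\<^sup>+x. ennreal ((t - t * x) powr (- a) * (t * x) powr (- b)) * indicator {0..t} (t * x) \<partial>lborel)"
    using assms by (subst nn_integral_real_affine[of _ t 0]) auto
  also have "\<dots> = ennreal t * (\<integral>\<^sup>+x. ennreal (t powr (- a - b)) * ennreal (indicator {0..1} x * (x powr (- b) * (1 - x) powr (- a))) \<partial>lborel)"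
    unfolding pt ..
  also have "\<dots> = ennreal t * (ennreal (t powr (- a - b)) * ennreal (Beta (1 - b) (1 - a)))"
    using nn_integral_has_integral_lebesgue[OF _ Beta] by (simp add: nn_integral_completion nn_integral_cmult)
  also have "\<dots> = ennreal (t * t powr (- a - b) * Beta (1 - b) (1 - a))"
    using assms has_integral_nonneg[OF Beta] by (simp add: ennreal_mult[symmetric] mult.assoc)
  also have "t * t powr (- a - b) = t powr (1 - a - b)"
    using assms powr_add[of t 1 "- a - b"] by (simp add: algebra_simps)
  finally show ?thesis by (simp add: mult.commute)
qed

lemma exp_minus_le_powr:
  fixes x \<theta> :: real
  assumes "0 < x" "0 \<le> \<theta>" "\<theta> \<le> 1" shows "exp (- x) \<le> x powr (- \<theta>)"
proof -
  have "x powr \<theta> \<le> exp x"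
  proof (cases "x \<le> 1")
    case True
    then have "x powr \<theta> \<le> 1" using assms by (simp add: powr_le1)
    also have "1 \<le> exp x" using assms by simp
    finally show ?thesis .
  next
    case False
    then have "x powr \<theta> \<le> x powr 1" using assms by (intro powr_mono) auto
    also have "\<dots> \<le> exp x" using assms exp_ge_add_one_self[of x] by (simp, linarith)
    finally show ?thesis .
  qed
  then show ?thesis using assms by (simp add: exp_minus powr_minus le_imp_inverse_le)
qed

text \<open>The bound \<open>exp (-x) \<le> x\<^bsup>-\<theta>\<^esup>\<close> trades a little of the integrability at \<open>s = t\<close>
  for a negative power of \<open>\<lambda>\<close>.\<close>

lemma weighted_Beta_small:
  fixes \<beta> \<gamma> T \<eta> :: real
  assumes \<beta>: "0 \<le> \<beta>" "\<beta> < 1" and \<gamma>: "0 \<le> \<gamma>" "\<gamma> < 1" and T: "0 < T" and \<eta>: "0 < \<eta>"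
  shows "\<exists>l\<ge>0. (\<forall>t\<in>{0<..T}. (\<integral>\<^sup>+s. ennreal ((t - s) powr (- \<beta>) * (exp (l * s) * s powr (- \<gamma>))) * indicator {0..t} s \<partial>lborel)
      \<le> ennreal (\<eta> * (exp (l * t) * t powr (- \<gamma>)))) \<and>
    (\<integral>\<^sup>+s. ennreal (exp (- (l * s)) * s powr (- \<beta>)) * indicator {0..T} s \<partial>lborel) \<le> ennreal \<eta>"
proof -
  \<comment> \<open>Half of the spare integrability at s = t: \<beta> + \<theta> is still below 1,
    and the factor l^(-\<theta>) is gained.\<close>
  define \<theta> where "\<theta> = (1 - \<beta>) / 2"
  have \<theta>: "0 < \<theta>" "\<theta> \<le> 1" "\<beta> + \<theta> < 1" using \<beta> by (auto simp: \<theta>_def field_simps)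
  \<comment> \<open>After t^(-\<gamma>) is split off, \<open>C1\<close> bounds the Beta integral for
    all t \<le> T; \<open>C2\<close> is the integral of s^(-(\<beta> + \<theta>)) up to T. Both get
    multiplied by l^(-\<theta>), so one large l serves both claims.\<close>
  define C1 where "C1 = Beta (1 - \<gamma>) (1 - (\<beta> + \<theta>)) * T powr (1 - (\<beta> + \<theta>))"
  define C2 where "C2 = T powr (1 - (\<beta> + \<theta>)) / (1 - (\<beta> + \<theta>))"
  have B0: "0 \<le> Beta (1 - \<gamma>) (1 - (\<beta> + \<theta>))"
    using \<gamma> \<theta> by (intro has_integral_nonneg[OF has_integral_Beta_real]) auto
  have "((\<lambda>l. max C1 C2 * l powr (- \<theta>)) \<longlongrightarrow> max C1 C2 * 0) at_top"
    using \<theta> by (intro tendsto_mult tendsto_const tendsto_neg_powr filterlim_ident) auto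
  then have "\<forall>\<^sub>F l in at_top. max C1 C2 * l powr (- \<theta>) < \<eta>"
    using \<eta> by (intro order_tendstoD(2)) auto
  then have "\<forall>\<^sub>F l in at_top. max C1 C2 * l powr (- \<theta>) < \<eta> \<and> 0 < l"
    using eventually_gt_at_top[of 0] by eventually_elim auto
  then obtain l where l: "max C1 C2 * l powr (- \<theta>) < \<eta>" "0 < l"
    by (auto simp: eventually_at_top_linorder)
  have C: "C1 * l powr (- \<theta>) \<le> \<eta>" "C2 * l powr (- \<theta>) \<le> \<eta>"
    using l(1) mult_right_mono[of C1 "max C1 C2" "l powr (- \<theta>)"] mult_right_mono[of C2 "max C1 C2" "l powr (- \<theta>)"] by auto
  have decay: "exp (- (l * x)) * x powr (- \<beta>) \<le> l powr (- \<theta>) * x powr (- (\<beta> + \<theta>))" if "0 \<le> x" for x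
  proof (cases "x = 0")
    case False
    then have x: "0 < x" using that by simp
    have "exp (- (l * x)) * x powr (- \<beta>) \<le> (l * x) powr (- \<theta>) * x powr (- \<beta>)"
      using l x \<theta> by (intro mult_right_mono exp_minus_le_powr) auto
    also have "\<dots> = l powr (- \<theta>) * x powr (- (\<beta> + \<theta>))"
      using l x powr_add[of x "- \<theta>" "- \<beta>"] by (simp add: powr_mult mult.assoc add.commute[of \<beta>])
    finally show ?thesis .
  qed simp
  have 1: "(\<integral>\<^sup>+s. ennreal ((t - s) powr (- \<beta>) * (exp (l * s) * s powr (- \<gamma>))) * indicator {0..t} s \<partial>lborel)
      \<le> ennreal (\<eta> * (exp (l * t) * t powr (- \<gamma>)))" if t: "t \<in> {0<..T}" for t
  proof -
    have "(\<integral>\<^sup>+s. ennreal ((t - s) powr (- \<beta>) * (exp (l * s) * s powr (- \<gamma>))) * indicator {0..t} s \<partial>lborel) \<le>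
      (\<integral>\<^sup>+s. ennreal (exp (l * t) * l powr (- \<theta>)) * (ennreal ((t - s) powr (- (\<beta> + \<theta>)) * s powr (- \<gamma>)) * indicator {0..t} s) \<partial>lborel)"
    proof (intro nn_integral_mono)
      fix s
      have "(t - s) powr (- \<beta>) * (exp (l * s) * s powr (- \<gamma>)) \<le> exp (l * t) * l powr (- \<theta>) * ((t - s) powr (- (\<beta> + \<theta>)) * s powr (- \<gamma>))"
        if "s \<in> {0..t}"
      proof -
        have "(t - s) powr (- \<beta>) * (exp (l * s) * s powr (- \<gamma>)) = exp (l * t) * (exp (- (l * (t - s))) * (t - s) powr (- \<beta>)) * s powr (- \<gamma>)"
          by (simp add: algebra_simps exp_diff exp_minus field_simps)
        also have "\<dots> \<le> exp (l * t) * (l powr (- \<theta>) * (t - s) powr (- (\<beta> + \<theta>))) * s powr (- \<gamma>)"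
          using that by (intro mult_right_mono mult_left_mono decay) auto
        finally show ?thesis by (simp add: mult_ac)
      qed
      then show "ennreal ((t - s) powr (- \<beta>) * (exp (l * s) * s powr (- \<gamma>))) * indicator {0..t} s \<le>
        ennreal (exp (l * t) * l powr (- \<theta>)) * (ennreal ((t - s) powr (- (\<beta> + \<theta>)) * s powr (- \<gamma>)) * indicator {0..t} s)"
        by (auto simp: indicator_def ennreal_mult[symmetric] intro!: ennreal_leI)
    qed
    also have "\<dots> = ennreal (exp (l * t) * l powr (- \<theta>)) * ennreal (Beta (1 - \<gamma>) (1 - (\<beta> + \<theta>)) * t powr (1 - (\<beta> + \<theta>) - \<gamma>))"
      using t \<theta> \<gamma> nn_integral_Beta[of "\<beta> + \<theta>" \<gamma> t] by (subst nn_integral_cmult) auto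
    also have "\<dots> = ennreal (exp (l * t) * l powr (- \<theta>) * (Beta (1 - \<gamma>) (1 - (\<beta> + \<theta>)) * t powr (1 - (\<beta> + \<theta>) - \<gamma>)))"
      using B0 by (simp add: ennreal_mult)
    also have "\<dots> \<le> ennreal (\<eta> * (exp (l * t) * t powr (- \<gamma>)))"
    proof (intro ennreal_leI)
      have "t powr (1 - (\<beta> + \<theta>) - \<gamma>) = t powr (1 - (\<beta> + \<theta>)) * t powr (- \<gamma>)"
        by (simp add: powr_add[symmetric])
      moreover have "t powr (1 - (\<beta> + \<theta>)) \<le> T powr (1 - (\<beta> + \<theta>))" using t \<theta> by (intro powr_mono2) auto
      then have "Beta (1 - \<gamma>) (1 - (\<beta> + \<theta>)) * t powr (1 - (\<beta> + \<theta>)) \<le> C1" using B0 by (simp add: C1_def mult_left_mono)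
      then have "Beta (1 - \<gamma>) (1 - (\<beta> + \<theta>)) * t powr (1 - (\<beta> + \<theta>)) * l powr (- \<theta>) \<le> \<eta>"
        using C(1) by (meson mult_right_mono order_trans powr_ge_zero)
      then have "(Beta (1 - \<gamma>) (1 - (\<beta> + \<theta>)) * t powr (1 - (\<beta> + \<theta>)) * l powr (- \<theta>)) * (exp (l * t) * t powr (- \<gamma>)) \<le> \<eta> * (exp (l * t) * t powr (- \<gamma>))"
        by (intro mult_right_mono) auto
      ultimately show "exp (l * t) * l powr (- \<theta>) * (Beta (1 - \<gamma>) (1 - (\<beta> + \<theta>)) * t powr (1 - (\<beta> + \<theta>) - \<gamma>)) \<le> \<eta> * (exp (l * t) * t powr (- \<gamma>))"
        by (simp add: mult_ac)
    qed
    finally show ?thesis .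
  qed
  have e: "- (\<beta> + \<theta>) + 1 = 1 - (\<beta> + \<theta>)" by simp
  have "(\<integral>\<^sup>+s. ennreal (exp (- (l * s)) * s powr (- \<beta>)) * indicator {0..T} s \<partial>lborel) \<le>
     (\<integral>\<^sup>+s. ennreal (l powr (- \<theta>)) * (ennreal (s powr (- (\<beta> + \<theta>))) * indicator {0..T} s) \<partial>lborel)"
    using decay by (intro nn_integral_mono) (auto simp: indicator_def ennreal_mult[symmetric] intro!: ennreal_leI)
  also have "\<dots> = ennreal (l powr (- \<theta>)) * ennreal C2"
    using T \<theta> nn_integral_powr_finite[of "- (\<beta> + \<theta>)" T, unfolded e] by (subst nn_integral_cmult) (auto simp: C2_def)
  also have "\<dots> \<le> ennreal \<eta>"
    using C(2) \<theta> by (auto simp: ennreal_mult[symmetric] C2_def mult.commute intro!: ennreal_leI)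
  finally show ?thesis using 1 l by (intro exI[of _ l]) auto
qed

text \<open>The function \<open>g\<close> below is a supersolution; the excess \<open>w\<close> of \<open>b\<close> over it satisfies the
  homogeneous inequality, which is a strict contraction in the weighted \<open>L\<^sup>1\<close> norm.\<close>

lemma singular_Gronwall:
  fixes \<beta> \<gamma> T B :: real
  assumes \<beta>: "0 \<le> \<beta>" "\<beta> < 1" and \<gamma>: "0 \<le> \<gamma>" "\<gamma> < 1" and T: "0 < T" and B: "0 \<le> B"
  shows "\<exists>L\<ge>0. \<forall>A b. A < \<top> \<longrightarrow> b \<in> borel_measurable borel \<longrightarrow> (\<integral>\<^sup>+s. b s * indicator {0..T} s \<partial>lborel) < \<top> \<longrightarrow>
    (\<forall>s\<in>{0<..T}. b s \<le> A * ennreal (s powr (- \<gamma>)) +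
        (\<integral>\<^sup>+r. ennreal (B * (s - r) powr (- \<beta>)) * b r * indicator {0..s} r \<partial>lborel)) \<longrightarrow>
    (AE s in lborel. s \<in> {0<..T} \<longrightarrow> b s \<le> A * ennreal (L * s powr (- \<gamma>)))"
proof -
  \<comment> \<open>Chosen to make B * \<eta> at most 1/2; the summand 1 covers B = 0.\<close>
  define \<eta> where "\<eta> = 1 / (2 * (B + 1))"
  have \<eta>: "0 < \<eta>" "B * \<eta> \<le> 1 / 2" using B by (auto simp: \<eta>_def field_simps)
  obtain l where l: "0 \<le> l"
    and l1: "\<And>t. t \<in> {0<..T} \<Longrightarrow> (\<integral>\<^sup>+s. ennreal ((t - s) powr (- \<beta>) * (exp (l * s) * s powr (- \<gamma>))) * indicator {0..t} s \<partial>lborel)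
      \<le> ennreal (\<eta> * (exp (l * t) * t powr (- \<gamma>)))"
    and l2: "(\<integral>\<^sup>+s. ennreal (exp (- (l * s)) * s powr (- \<beta>)) * indicator {0..T} s \<partial>lborel) \<le> ennreal \<eta>"
    using weighted_Beta_small[OF \<beta> \<gamma> T \<eta>(1)] by blast
  \<comment> \<open>Of the factor 2, one half absorbs the forcing term, since exp (l * s) \<ge> 1,
    and the other half absorbs the integral term, since 2 * B * \<eta> \<le> 1.\<close>
  define g where "g s = 2 * (exp (l * s) * s powr (- \<gamma>))" for s
  have [measurable]: "g \<in> borel_measurable borel" unfolding g_def by measurable
  have main: "AE s in lborel. s \<in> {0<..T} \<longrightarrow> b s \<le> A * ennreal (2 * exp (l * T) * s powr (- \<gamma>))"
    if A: "A < \<top>" and [measurable]: "b \<in> borel_measurable borel" and fin: "(\<integral>\<^sup>+s. b s * indicator {0..T} s \<partial>lborel) < \<top>"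
      and ineq: "\<And>s. s \<in> {0<..T} \<Longrightarrow> b s \<le> A * ennreal (s powr (- \<gamma>)) +
        (\<integral>\<^sup>+r. ennreal (B * (s - r) powr (- \<beta>)) * b r * indicator {0..s} r \<partial>lborel)" for A b
  proof -
    define w where "w s = b s - A * ennreal (g s)" for s
    have [measurable]: "w \<in> borel_measurable borel" unfolding w_def by measurable
    have bw: "b s \<le> A * ennreal (g s) + w s" for s
      using ennreal_minus_le_iff[of "b s" "A * ennreal (g s)" "w s"] by (simp add: w_def)
    have w_ineq: "w s \<le> (\<integral>\<^sup>+r. ennreal (B * (s - r) powr (- \<beta>)) * w r * indicator {0..s} r \<partial>lborel)" if s: "s \<in> {0<..T}" for s
    proof -
      have "(\<integral>\<^sup>+r. ennreal (B * (s - r) powr (- \<beta>)) * b r * indicator {0..s} r \<partial>lborel) \<le>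
        (\<integral>\<^sup>+r. A * ennreal (2 * B) * (ennreal ((s - r) powr (- \<beta>) * (exp (l * r) * r powr (- \<gamma>))) * indicator {0..s} r) +
          ennreal (B * (s - r) powr (- \<beta>)) * w r * indicator {0..s} r \<partial>lborel)"
      proof (intro nn_integral_mono)
        fix r
        have "ennreal (B * (s - r) powr (- \<beta>)) * b r \<le> ennreal (B * (s - r) powr (- \<beta>)) * (A * ennreal (g r) + w r)"
          by (intro mult_left_mono bw) simp
        also have "\<dots> = A * ennreal (2 * B) * ennreal ((s - r) powr (- \<beta>) * (exp (l * r) * r powr (- \<gamma>))) + ennreal (B * (s - r) powr (- \<beta>)) * w r"
          using B by (simp add: g_def distrib_left ennreal_mult mult_ac)
        finally show "ennreal (B * (s - r) powr (- \<beta>)) * b r * indicator {0..s} r \<le>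
          A * ennreal (2 * B) * (ennreal ((s - r) powr (- \<beta>) * (exp (l * r) * r powr (- \<gamma>))) * indicator {0..s} r) +
          ennreal (B * (s - r) powr (- \<beta>)) * w r * indicator {0..s} r"
          by (simp add: indicator_def)
      qed
      also have "\<dots> = A * ennreal (2 * B) * (\<integral>\<^sup>+r. ennreal ((s - r) powr (- \<beta>) * (exp (l * r) * r powr (- \<gamma>))) * indicator {0..s} r \<partial>lborel) +
          (\<integral>\<^sup>+r. ennreal (B * (s - r) powr (- \<beta>)) * w r * indicator {0..s} r \<partial>lborel)"
        by (subst nn_integral_add) (auto simp: nn_integral_cmult)
      also have "\<dots> \<le> A * ennreal (2 * B) * ennreal (\<eta> * (exp (l * s) * s powr (- \<gamma>))) +
          (\<integral>\<^sup>+r. ennreal (B * (s - r) powr (- \<beta>)) * w r * indicator {0..s} r \<partial>lborel)"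
        by (intro add_right_mono mult_left_mono l1 s) simp
      finally have "b s \<le> (A * ennreal (s powr (- \<gamma>)) + A * ennreal (2 * B) * ennreal (\<eta> * (exp (l * s) * s powr (- \<gamma>)))) +
          (\<integral>\<^sup>+r. ennreal (B * (s - r) powr (- \<beta>)) * w r * indicator {0..s} r \<partial>lborel)"
        using ineq[OF s] by (auto simp: add.assoc intro: order_trans add_left_mono)
      also have "A * ennreal (s powr (- \<gamma>)) + A * ennreal (2 * B) * ennreal (\<eta> * (exp (l * s) * s powr (- \<gamma>)))
        = A * ennreal (s powr (- \<gamma>) + 2 * B * (\<eta> * (exp (l * s) * s powr (- \<gamma>))))"
        using B \<eta> by (simp add: mult.assoc distrib_left[symmetric] ennreal_mult[symmetric] ennreal_plus[symmetric] del: ennreal_plus)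
      also have "\<dots> \<le> A * ennreal (g s)"
      proof (intro mult_left_mono ennreal_leI)
        define X where "X = exp (l * s) * s powr (- \<gamma>)"
        have "1 \<le> exp (l * s)" using l s by simp
        then have "s powr (- \<gamma>) \<le> X" using mult_right_mono[of 1 "exp (l * s)" "s powr (- \<gamma>)"] by (simp add: X_def)
        moreover have "2 * (B * \<eta>) * X \<le> 1 * X"
          using \<eta> by (intro mult_right_mono) (auto simp: X_def)
        ultimately have "s powr (- \<gamma>) + 2 * B * (\<eta> * X) \<le> 2 * X" by (simp add: mult_ac)
        then show "s powr (- \<gamma>) + 2 * B * (\<eta> * (exp (l * s) * s powr (- \<gamma>))) \<le> g s"
          by (simp add: g_def X_def)
      qed simp
      finally show ?thesis
        unfolding w_def[of s] using A by (auto simp: ennreal_minus_le_iff add_mono ennreal_mult_eq_top_iff)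
    qed
    \<comment> \<open>The weight exp (- l * s) makes the homogeneous inequality contract by 1/2.
      Finiteness of J, which comes from w \<le> b and the integrability of b, is what lets J \<le> J
      / 2 force J = 0.\<close>
    define J where "J = (\<integral>\<^sup>+s. ennreal (exp (- (l * s))) * w s * indicator {0..T} s \<partial>lborel)"
    have "J \<le> (\<integral>\<^sup>+s. b s * indicator {0..T} s \<partial>lborel)"
      unfolding J_def
    proof (intro nn_integral_mono)
      fix s
      have "ennreal (exp (- (l * s))) * w s \<le> 1 * b s" if "0 \<le> s"
        using that l by (intro mult_mono) (auto simp: w_def ennreal_le_1 diff_le_self_ennreal)
      then show "ennreal (exp (- (l * s))) * w s * indicator {0..T} s \<le> b s * indicator {0..T} s"
        by (auto simp: indicator_def)
    qed
    with fin have Jfin: "J < \<top>" by (rule order.strict_trans1[rotated])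
    have "J \<le> (\<integral>\<^sup>+s. (\<integral>\<^sup>+r. ennreal (exp (- (l * s))) * (ennreal (B * (s - r) powr (- \<beta>)) * w r * indicator {0..s} r) * indicator {0..T} s \<partial>lborel) \<partial>lborel)"
      unfolding J_def
    proof (intro nn_integral_mono_AE)
      have "AE s in lborel. s \<noteq> (0 :: real)" by (rule AE_lborel_singleton)
      then show "AE s in lborel. ennreal (exp (- (l * s))) * w s * indicator {0..T} s \<le>
        (\<integral>\<^sup>+r. ennreal (exp (- (l * s))) * (ennreal (B * (s - r) powr (- \<beta>)) * w r * indicator {0..s} r) * indicator {0..T} s \<partial>lborel)"
      proof eventually_elim
        case (elim s)
        show ?case
          using w_ineq[of s] elim by (cases "s \<in> {0..T}") (auto simp: nn_integral_cmult intro!: mult_left_mono)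
      qed
    qed
    also have "\<dots> = (\<integral>\<^sup>+r. (\<integral>\<^sup>+s. ennreal (exp (- (l * s))) * (ennreal (B * (s - r) powr (- \<beta>)) * w r * indicator {0..s} r) * indicator {0..T} s \<partial>lborel) \<partial>lborel)"
      by (rule lborel_pair.Fubini') (simp add: case_prod_beta', measurable)
    also have "\<dots> \<le> (\<integral>\<^sup>+r. ennreal (1 / 2) * (ennreal (exp (- (l * r))) * w r * indicator {0..T} r) \<partial>lborel)"
    proof (intro nn_integral_mono)
      fix r :: real
      show "(\<integral>\<^sup>+s. ennreal (exp (- (l * s))) * (ennreal (B * (s - r) powr (- \<beta>)) * w r * indicator {0..s} r) * indicator {0..T} s \<partial>lborel)
        \<le> ennreal (1 / 2) * (ennreal (exp (- (l * r))) * w r * indicator {0..T} r)"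
      proof (cases "r \<in> {0..T}")
        \<comment> \<open>After the shift s = r + x the exponential factorises, and the inner
          integral is the one bounded in \<open>l2\<close>.\<close>
        case True
        have "(\<integral>\<^sup>+s. ennreal (exp (- (l * s))) * (ennreal (B * (s - r) powr (- \<beta>)) * w r * indicator {0..s} r) * indicator {0..T} s \<partial>lborel)
          = (\<integral>\<^sup>+x. ennreal (exp (- (l * (r + x)))) * (ennreal (B * x powr (- \<beta>)) * w r * indicator {0..r + x} r) * indicator {0..T} (r + x) \<partial>lborel)"
          by (subst nn_integral_real_affine[of _ 1 r]) auto
        also have "\<dots> \<le> (\<integral>\<^sup>+x. (ennreal (exp (- (l * r))) * w r * ennreal B) * (ennreal (exp (- (l * x)) * x powr (- \<beta>)) * indicator {0..T} x) \<partial>lborel)"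
        proof (intro nn_integral_mono)
          fix x :: real
          have "exp (- (l * (r + x))) = exp (- (l * r)) * exp (- (l * x))" by (simp add: distrib_left exp_add[symmetric])
          then show "ennreal (exp (- (l * (r + x)))) * (ennreal (B * x powr (- \<beta>)) * w r * indicator {0..r + x} r) * indicator {0..T} (r + x)
            \<le> (ennreal (exp (- (l * r))) * w r * ennreal B) * (ennreal (exp (- (l * x)) * x powr (- \<beta>)) * indicator {0..T} x)"
            using True B by (auto simp: indicator_def ennreal_mult mult_ac)
        qed
        also have "\<dots> = (ennreal (exp (- (l * r))) * w r * ennreal B) * (\<integral>\<^sup>+x. ennreal (exp (- (l * x)) * x powr (- \<beta>)) * indicator {0..T} x \<partial>lborel)"
          by (rule nn_integral_cmult) measurable
        also have "\<dots> \<le> (ennreal (exp (- (l * r))) * w r * ennreal B) * ennreal \<eta>"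
          by (intro mult_left_mono l2) simp
        also have "\<dots> = (ennreal (exp (- (l * r))) * w r) * ennreal (B * \<eta>)"
          using B \<eta> by (simp add: ennreal_mult mult_ac)
        also have "\<dots> \<le> (ennreal (exp (- (l * r))) * w r) * ennreal (1 / 2)"
          using \<eta> by (intro mult_left_mono ennreal_leI) auto
        finally show ?thesis using True by (simp add: mult_ac)
      next
        case False
        then have zero: "ennreal (exp (- (l * s))) * (ennreal (B * (s - r) powr (- \<beta>)) * w r * indicator {0..s} r) * indicator {0..T} s = 0" for s
          by (auto simp: indicator_def)
        show ?thesis unfolding zero by simp
      qed
    qed
    also have "\<dots> = ennreal (1 / 2) * J"
      unfolding J_def by (rule nn_integral_cmult) measurable
    finally have "J \<le> ennreal (1 / 2) * J" .
    with Jfin have "J = 0"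
      by (cases J) (auto simp: ennreal_mult[symmetric] simp del: ennreal_half)
    then have "AE s in lborel. ennreal (exp (- (l * s))) * w s * indicator {0..T} s = 0"
      unfolding J_def by (subst (asm) nn_integral_0_iff_AE) auto
    then show ?thesis
    proof eventually_elim
      case (elim s)
      show ?case
      proof
        assume s: "s \<in> {0<..T}"
        then have "w s = 0" using elim by (auto simp: ennreal_eq_0_iff)
        then have "b s \<le> A * ennreal (g s)" using bw[of s] by simp
        also have "\<dots> \<le> A * ennreal (2 * exp (l * T) * s powr (- \<gamma>))"
          using s l by (intro mult_left_mono ennreal_leI) (auto simp: g_def mult.assoc intro!: mult_left_mono mult_right_mono)
        finally show "b s \<le> A * ennreal (2 * exp (l * T) * s powr (- \<gamma>))" .
      qed
    qed
  qed
  then show ?thesis by (intro exI[of _ "2 * exp (l * T)"]) auto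
qed

text \<open>For equal signs this is the tangent inequality for the convex power \<rho>. For opposite
  signs the difference becomes a sum of powers, and |x - y| = |x| + |y| makes a direct comparison
  possible.\<close>

lemma nonlinearity_diff_le:
  fixes x y \<rho> :: real
  assumes \<rho>: "1 < \<rho>"
  shows "\<bar>\<bar>x\<bar> powr (\<rho> - 1) * x - \<bar>y\<bar> powr (\<rho> - 1) * y\<bar> \<le> \<rho> * (\<bar>x\<bar> + \<bar>y\<bar>) powr (\<rho> - 1) * \<bar>x - y\<bar>"
proof -
  have pos: "\<bar>x powr (\<rho> - 1) * x - y powr (\<rho> - 1) * y\<bar> \<le> \<rho> * (x + y) powr (\<rho> - 1) * \<bar>x - y\<bar>" if xy: "0 \<le> y" "y \<le> x" for x y
  proof -
    have e: "z powr (\<rho> - 1) * z = z powr \<rho>" if "0 \<le> z" for z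
      using that powr_add[of z "\<rho> - 1" 1] by (cases "z = 0") auto
    \<comment> \<open>Young's inequality with exponents \<rho>/(\<rho> - 1) and \<rho> gives
      x^\<rho> - y^\<rho> \<le> \<rho> * x^(\<rho> - 1) * (x - y) without differentiation, hence
      also at the origin.\<close>
    have "(x powr (\<rho> - 1)) * y \<le> (x powr (\<rho> - 1)) powr (\<rho> / (\<rho> - 1)) / (\<rho> / (\<rho> - 1)) + y powr \<rho> / \<rho>"
      using \<rho> xy by (intro Youngs_inequality) (auto simp: field_simps)
    then have "(x powr (\<rho> - 1)) * y \<le> x powr \<rho> * (\<rho> - 1) / \<rho> + y powr \<rho> / \<rho>"
      using \<rho> by (simp add: powr_powr)
    then have "\<rho> * (x powr (\<rho> - 1) * y) \<le> x powr \<rho> * (\<rho> - 1) + y powr \<rho>"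
      using \<rho> by (simp add: field_simps)
    then have "x powr \<rho> - y powr \<rho> \<le> \<rho> * (x powr (\<rho> - 1) * x) - \<rho> * (x powr (\<rho> - 1) * y)"
      using e[of x] xy by (simp add: algebra_simps)
    also have "\<dots> = \<rho> * x powr (\<rho> - 1) * (x - y)" by (simp add: algebra_simps)
    also have "\<dots> \<le> \<rho> * (x + y) powr (\<rho> - 1) * (x - y)"
      using \<rho> xy by (intro mult_right_mono mult_left_mono powr_mono2) auto
    finally show ?thesis
      using xy \<rho> e[of x] e[of y] powr_mono2[of \<rho> y x] by (auto simp: abs_if)
  qed
  have mixed: "x powr (\<rho> - 1) * x + y powr (\<rho> - 1) * y \<le> \<rho> * (x + y) powr (\<rho> - 1) * (x + y)" if xy: "0 \<le> x" "0 \<le> y" for x y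
  proof -
    have "x powr (\<rho> - 1) * x + y powr (\<rho> - 1) * y \<le> (x + y) powr (\<rho> - 1) * x + (x + y) powr (\<rho> - 1) * y"
      using \<rho> xy by (intro add_mono mult_right_mono powr_mono2) auto
    also have "\<dots> = 1 * ((x + y) powr (\<rho> - 1) * (x + y))" by (simp add: distrib_left)
    also have "\<dots> \<le> \<rho> * ((x + y) powr (\<rho> - 1) * (x + y))"
      using \<rho> xy by (intro mult_right_mono) auto
    finally show ?thesis by (simp add: mult.assoc)
  qed
  consider "0 \<le> x" "0 \<le> y" | "x \<le> 0" "y \<le> 0" | "0 \<le> x" "y \<le> 0" | "x \<le> 0" "0 \<le> y" by linarith
  then show ?thesis
  proof cases
    case 1
    then show ?thesis using pos[of x y] pos[of y x] by (cases "y \<le> x") (auto simp: abs_minus_commute add.commute)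
  next
    case 2
    then show ?thesis using pos[of "- x" "- y"] pos[of "- y" "- x"] by (cases "y \<le> x") (auto simp: abs_minus_commute add.commute)
  next
    case 3
    moreover have "0 \<le> x powr (\<rho> - 1) * x + (- y) powr (\<rho> - 1) * (- y)" using 3 by (intro add_nonneg_nonneg mult_nonneg_nonneg) auto
    ultimately show ?thesis using mixed[of x "- y"] by simp
  next
    case 4
    moreover have "0 \<le> (- x) powr (\<rho> - 1) * (- x) + y powr (\<rho> - 1) * y" using 4 by (intro add_nonneg_nonneg mult_nonneg_nonneg) auto
    ultimately show ?thesis using mixed[of "- x" y] by (simp add: abs_minus_commute add.commute)
  qed
qed

section \<open>Continuous dependence and uniqueness\<close>

lemma joint_measurable_compose:
  assumes "(\<lambda>x. v (fst x) (snd x)) \<in> borel_measurable (borel \<Otimes>\<^sub>M borel)" "f \<in> measurable M borel" "g \<in> measurable M borel"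
  shows "(\<lambda>x. v (f x) (g x)) \<in> borel_measurable M"
  using measurable_compose[OF measurable_Pair[OF assms(2,3)] assms(1)] by simp

lemma nonlinearity_measurable [measurable (raw)]:
  assumes [measurable]: "(\<lambda>x. F x (g x)) \<in> borel_measurable M"
  shows "(\<lambda>x. nonlinearity \<rho> (F x) (g x)) \<in> borel_measurable M"
  unfolding nonlinearity_def by measurable

lemma abs_nonlinearity: "\<bar>nonlinearity \<rho> v z\<bar> = \<bar>v z\<bar> powr \<rho>"
  using powr_add[of "\<bar>v z\<bar>" "\<rho> - 1" 1] by (cases "v z = 0") (simp_all add: nonlinearity_def abs_mult)

lemma eLnorm_nonlinearity:
  assumes "0 < q" "0 < \<rho>"
  shows "eLnorm q (\<lambda>z. ennreal \<bar>nonlinearity \<rho> v z\<bar>) = epowr (eLnorm (\<rho> * q) (\<lambda>z. ennreal \<bar>v z\<bar>)) \<rho>"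
  using assms by (simp add: abs_nonlinearity eLnorm_def epowr_epowr powr_powr field_simps)

text \<open>The pointwise Lipschitz bound carries a weight of power \<rho> - 1. Measured in
  L^(a/(\<rho> - 1)) it is a power of an L^a norm, and Hoelder pairs it with the difference in L^m.
  The contraction argument takes a = m = \<rho> * p, stability takes a = p.\<close>

lemma eLnorm_nonlinearity_diff:
  fixes u v :: "'a::euclidean_space \<Rightarrow> real"
  assumes [measurable]: "u \<in> borel_measurable borel" "v \<in> borel_measurable borel"
    and \<rho>: "1 < \<rho>" and e: "0 < q" "0 < a" "0 < m" "1 / q = (\<rho> - 1) / a + 1 / m" and a: "1 \<le> a"
  shows "eLnorm q (\<lambda>z. ennreal \<bar>nonlinearity \<rho> u z - nonlinearity \<rho> v z\<bar>) \<le>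
    ennreal \<rho> * epowr (eLnorm a (\<lambda>z. ennreal \<bar>u z\<bar>) + eLnorm a (\<lambda>z. ennreal \<bar>v z\<bar>)) (\<rho> - 1) *
      eLnorm m (\<lambda>z. ennreal \<bar>u z - v z\<bar>)"
proof -
  define U where "U z = ennreal \<bar>u z\<bar> + ennreal \<bar>v z\<bar>" for z
  have [measurable]: "U \<in> borel_measurable borel" unfolding U_def by measurable
  have "eLnorm q (\<lambda>z. ennreal \<bar>nonlinearity \<rho> u z - nonlinearity \<rho> v z\<bar>) \<le>
      eLnorm q (\<lambda>z. ennreal \<rho> * (epowr (U z) (\<rho> - 1) * ennreal \<bar>u z - v z\<bar>))"
  proof (intro eLnorm_mono)
    fix z
    have "epowr (U z) (\<rho> - 1) = ennreal ((\<bar>u z\<bar> + \<bar>v z\<bar>) powr (\<rho> - 1))"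
      by (simp add: U_def ennreal_plus[symmetric] del: ennreal_plus)
    then have "ennreal \<rho> * (epowr (U z) (\<rho> - 1) * ennreal \<bar>u z - v z\<bar>) = ennreal (\<rho> * (\<bar>u z\<bar> + \<bar>v z\<bar>) powr (\<rho> - 1) * \<bar>u z - v z\<bar>)"
      using \<rho> by (simp add: ennreal_mult mult.assoc)
    then show "ennreal \<bar>nonlinearity \<rho> u z - nonlinearity \<rho> v z\<bar> \<le> ennreal \<rho> * (epowr (U z) (\<rho> - 1) * ennreal \<bar>u z - v z\<bar>)"
      using nonlinearity_diff_le[OF \<rho>, of "u z" "v z"] by (simp add: nonlinearity_def ennreal_leI)
  qed (use e in auto)
  also have "\<dots> = ennreal \<rho> * eLnorm q (\<lambda>z. epowr (U z) (\<rho> - 1) * ennreal \<bar>u z - v z\<bar>)"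
    using e by (intro eLnorm_cmult) auto
  also have "\<dots> \<le> ennreal \<rho> * (eLnorm (a / (\<rho> - 1)) (\<lambda>z. epowr (U z) (\<rho> - 1)) * eLnorm m (\<lambda>z. ennreal \<bar>u z - v z\<bar>))"
  proof (intro mult_left_mono eLnorm_Holder e(1,3))
    show "1 / q = 1 / (a / (\<rho> - 1)) + 1 / m" unfolding e(4) by simp
    show "0 < a / (\<rho> - 1)" using e(2) \<rho> by simp
  qed auto
  also have "eLnorm (a / (\<rho> - 1)) (\<lambda>z. epowr (U z) (\<rho> - 1)) = epowr (eLnorm a U) (\<rho> - 1)"
    using \<rho> e(2) by (simp add: eLnorm_def epowr_epowr)
  also have "ennreal \<rho> * (epowr (eLnorm a U) (\<rho> - 1) * eLnorm m (\<lambda>z. ennreal \<bar>u z - v z\<bar>)) \<le>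
     ennreal \<rho> * (epowr (eLnorm a (\<lambda>z. ennreal \<bar>u z\<bar>) + eLnorm a (\<lambda>z. ennreal \<bar>v z\<bar>)) (\<rho> - 1) * eLnorm m (\<lambda>z. ennreal \<bar>u z - v z\<bar>))"
    unfolding U_def using \<rho> a by (intro mult_left_mono mult_right_mono epowr_mono eLnorm_add_le) auto
  finally show ?thesis by (simp add: mult.assoc)
qed

text \<open>When solutions are bounded only in L^p, Hoelder's inequality maps a difference in L^m to
  a source difference in L^q. The products with \<open>D\<close> are the orders of the time
  singularities: data from L^p to L^m, source from L^q to L^m, source from L^q to L^p. Since 1/q -
  1/m = (\<rho> - 1)/p, each of them, and the sum of the first and the third, is at most D * (\<rho>
  - 1) / p < 1.\<close>

lemma critical_exponents:
  fixes D \<rho> p :: real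
  assumes \<rho>: "1 < \<rho>" and p: "1 \<le> p" "D * (\<rho> - 1) < p" and D: "1 \<le> D"
  obtains q m where "1 \<le> q" "q \<le> p" "p \<le> m" "1 / q = (\<rho> - 1) / p + 1 / m" "q = p / \<rho> \<or> p < \<rho> \<and> q = 1"
    "0 \<le> D * (1 / p - 1 / m)" "D * (1 / p - 1 / m) < 1"
    "0 \<le> D * (1 / q - 1 / m)" "D * (1 / q - 1 / m) < 1"
    "0 \<le> D * (1 / q - 1 / p)" "D * (1 / q - 1 / p) < 1" "D * (1 / q - 1 / p) + D * (1 / p - 1 / m) < 1"
proof -
  define q where "q = max 1 (p / \<rho>)"
  have q: "1 \<le> q" "q \<le> p" "p / \<rho> \<le> q" "q = p / \<rho> \<or> p < \<rho> \<and> q = 1"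
    using \<rho> p by (auto simp: q_def max_def field_simps)
  define i where "i = 1 / q - (\<rho> - 1) / p"
  have iq: "1 / q \<le> 1" "1 / p \<le> 1 / q" "1 / q \<le> \<rho> / p"
    using q \<rho> p by (auto simp: field_simps)
  have rp: "D * ((\<rho> - 1) / p) < 1" "0 < (\<rho> - 1) / p" using p \<rho> by (auto simp: field_simps)
  \<comment> \<open>Here \<open>D\<close> \<ge> 1 enters: for q = 1 it is what keeps 1/m = 1 -
    (\<rho> - 1)/p positive.\<close>
  have "(\<rho> - 1) / p \<le> D * ((\<rho> - 1) / p)" using rp D mult_right_mono[of 1 D "(\<rho> - 1) / p"] by simp
  then have small: "(\<rho> - 1) / p < 1" using rp by linarith
  have i: "0 < i"
  proof (cases "p < \<rho> \<and> q = 1")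
    case True then show ?thesis using small by (simp add: i_def)
  next
    case False
    then have "q = p / \<rho>" using q by auto
    then have "i = 1 / p" using p by (simp add: i_def diff_divide_distrib)
    then show ?thesis using p by simp
  qed
  define m where "m = 1 / i"
  have im: "1 / m = i" using i by (simp add: m_def)
  have "i \<le> 1 / p" using iq by (simp add: i_def diff_divide_distrib)
  then have pm: "p \<le> m" using i p by (simp add: m_def field_simps)
  have qm: "1 / q - 1 / m = (\<rho> - 1) / p" by (simp add: im i_def)
  have "1 / p - 1 / m \<le> (\<rho> - 1) / p" "0 \<le> 1 / p - 1 / m" using iq \<open>i \<le> 1 / p\<close> unfolding im by (auto simp: i_def)
  then have 1: "D * (1 / p - 1 / m) \<le> D * ((\<rho> - 1) / p)" "0 \<le> D * (1 / p - 1 / m)"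
    using D by (intro mult_left_mono mult_nonneg_nonneg; simp)+
  have "1 / q - 1 / p \<le> (\<rho> - 1) / p" "0 \<le> 1 / q - 1 / p" using iq by (auto simp: diff_divide_distrib)
  then have 2: "D * (1 / q - 1 / p) \<le> D * ((\<rho> - 1) / p)" "0 \<le> D * (1 / q - 1 / p)"
    using D by (intro mult_left_mono mult_nonneg_nonneg; simp)+
  have 3: "D * (1 / q - 1 / p) + D * (1 / p - 1 / m) = D * (1 / q - 1 / m)"
    by (simp add: algebra_simps)
  show ?thesis
  proof (rule that[of q m])
    show "1 / q = (\<rho> - 1) / p + 1 / m" using qm by linarith
    show "0 \<le> D * (1 / q - 1 / m)" "D * (1 / q - 1 / m) < 1" unfolding qm using rp D by (auto intro!: mult_nonneg_nonneg simp del: times_divide_eq_right)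
    show "D * (1 / p - 1 / m) < 1" "D * (1 / q - 1 / p) < 1" using 1(1) 2(1) rp(1) by linarith+
    show "D * (1 / q - 1 / p) + D * (1 / p - 1 / m) < 1" unfolding 3 qm by (rule rp(1))
  qed (use q pm 1(2) 2(2) in auto)
qed

section \<open>Mild solutions of the abstract equation: source integrability, differences,
  stability\<close>

context markov_kernel
begin

definition mild :: "real \<Rightarrow> real \<Rightarrow> real \<Rightarrow> ('a \<Rightarrow> real) \<Rightarrow> (real \<Rightarrow> 'a \<Rightarrow> real) \<Rightarrow> bool" where
  "mild p \<rho> T u0 u \<longleftrightarrow>
     u \<in> E_space p T \<and> admissible_source \<rho> T u \<and>
     (\<forall>t\<in>{0..T}. \<exists>I.
        has_Lp_integral p (restrict_space lborel {0..t}) (\<lambda>s. S (t - s) (nonlinearity \<rho> (u s))) I \<and>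
        (AE z in lborel. u t z = S t u0 z + I z))"

text \<open>For q = p / \<rho> the norm of the source is at most M^\<rho> at every time. For p <
  \<rho> and q = 1, admissibility provides a time-integrable norm in some L^r, and the L^1 norm is
  interpolated between it and the L^p bound, with only linear growth in the L^r norm so that time
  integrability survives.\<close>

lemma source_time_integrable:
  assumes u: "Lp_continuous_on p {0..T} u" and adm: "admissible_source \<rho> T u"
    and v [measurable]: "(\<lambda>x. v (fst x) (snd x)) \<in> borel_measurable (borel \<Otimes>\<^sub>M (borel :: 'a measure))"
    and uv: "\<And>t. t \<in> {0..T} \<Longrightarrow> AE z in lborel. v t z = u t z"
    and M: "\<And>t. t \<in> {0..T} \<Longrightarrow> Lp_norm p (u t) \<le> M" "0 \<le> M"
    and p: "1 \<le> p" and \<rho>: "1 < \<rho>" and q: "1 \<le> q" "q = p / \<rho> \<or> p < \<rho> \<and> q = 1"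
  shows "(\<integral>\<^sup>+s. eLnorm q (\<lambda>z. ennreal \<bar>nonlinearity \<rho> (v s) z\<bar>) * indicator {0..T} s \<partial>lborel) < \<top>"
proof -
  note [measurable (raw)] = joint_measurable_compose[OF v]
  have [measurable]: "v t \<in> borel_measurable borel" for t
    using measurable_compose[OF measurable_Pair1'[of t borel borel] v] by simp
  have uL: "u t \<in> Lp p" if "t \<in> {0..T}" for t using u that by (simp add: Lp_continuous_on_def)
  have vM: "eLnorm p (\<lambda>z. ennreal \<bar>v t z\<bar>) \<le> ennreal M" if "t \<in> {0..T}" for t
  proof -
    have "AE z in lborel. ennreal \<bar>v t z\<bar> = ennreal \<bar>u t z\<bar>" using uv[OF that] by eventually_elim simp
    then have "eLnorm p (\<lambda>z. ennreal \<bar>v t z\<bar>) = eLnorm p (\<lambda>z. ennreal \<bar>u t z\<bar>)" by (rule eLnorm_cong_AE)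
    then show ?thesis using ennreal_Lp_norm[OF uL[OF that]] M(1)[OF that] by (metis ennreal_leI)
  qed
  show ?thesis
  proof (cases "p < \<rho> \<and> q = 1")
    case False
    then have q': "q = p / \<rho>" using q by auto
    have "(\<integral>\<^sup>+s. eLnorm q (\<lambda>z. ennreal \<bar>nonlinearity \<rho> (v s) z\<bar>) * indicator {0..T} s \<partial>lborel) \<le>
       (\<integral>\<^sup>+s. ennreal (M powr \<rho>) * indicator {0..T} s \<partial>lborel)"
    proof (intro nn_integral_mono)
      fix s
      show "eLnorm q (\<lambda>z. ennreal \<bar>nonlinearity \<rho> (v s) z\<bar>) * indicator {0..T} s \<le> ennreal (M powr \<rho>) * indicator {0..T} s"
        using vM[of s] M(2) \<rho> q p epowr_mono[OF vM[of s], of \<rho>]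
        by (auto simp: indicator_def eLnorm_nonlinearity q')
    qed
    also have "\<dots> < \<top>" by (simp add: nn_integral_cmult ennreal_mult_less_top emeasure_lborel_Icc_eq)
    finally show ?thesis .
  next
    case True
    obtain r where r: "1 \<le> r" "AE s in restrict_space lborel {0..T}. nonlinearity \<rho> (u s) \<in> Lp r"
      "(\<integral>\<^sup>+s. ennreal (Lp_norm r (nonlinearity \<rho> (u s))) \<partial>restrict_space lborel {0..T}) < \<infinity>"
      using adm by (auto simp: admissible_source_def)
    define F where "F s = eLnorm r (\<lambda>z. ennreal \<bar>nonlinearity \<rho> (v s) z\<bar>)" for s
    have [measurable]: "F \<in> borel_measurable borel" unfolding F_def by measurable
    have "AE s in restrict_space lborel {0..T}. ennreal (Lp_norm r (nonlinearity \<rho> (u s))) = F s"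
      using r(2) AE_space
    proof eventually_elim
      case (elim s)
      then have "s \<in> {0..T}" by (simp add: space_restrict_space)
      from uv[OF this] have "AE z in lborel. ennreal \<bar>nonlinearity \<rho> (v s) z\<bar> = ennreal \<bar>nonlinearity \<rho> (u s) z\<bar>"
        by eventually_elim (simp add: nonlinearity_def)
      from eLnorm_cong_AE[OF this, of r] show ?case using ennreal_Lp_norm[OF elim(1)] by (simp add: F_def)
    qed
    from nn_integral_cong_AE[OF this] r(3)
    have Ffin: "(\<integral>\<^sup>+s. F s * indicator {0..T} s \<partial>lborel) < \<top>"
      by (simp add: nn_integral_restrict_space)
    have "(\<integral>\<^sup>+s. eLnorm q (\<lambda>z. ennreal \<bar>nonlinearity \<rho> (v s) z\<bar>) * indicator {0..T} s \<partial>lborel) \<le>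
      (\<integral>\<^sup>+s. ennreal (M powr p + 1) * (indicator {0..T} s + F s * indicator {0..T} s) \<partial>lborel)"
    proof (intro nn_integral_mono)
      fix s
      have "eLnorm q (\<lambda>z. ennreal \<bar>nonlinearity \<rho> (v s) z\<bar>) \<le> ennreal (M powr p + 1) * (1 + F s)" if s: "s \<in> {0..T}"
      proof (cases "F s")
        case (real f)
        \<comment> \<open>The threshold at which |v|^\<rho> is split: below it a power of X and
          |v|^p are used, above it the r-th power of the source. With X of the size of the L^r norm
          f, both parts are at most a multiple of X.\<close>
        define X where "X = max 1 f"
        have X: "1 \<le> X" "f \<le> X" "X \<le> 1 + f" using real by (auto simp: X_def)
        have pt: "x powr \<rho> \<le> X powr (1 - p / \<rho>) * x powr p + X powr (1 - r) * (x powr \<rho>) powr r" if x: "0 \<le> x" for x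
        proof (cases "x powr \<rho> \<le> X")
          case True
          have "x powr \<rho> = (x powr \<rho>) powr (1 - p / \<rho>) * x powr p"
            using \<rho> x by (cases "x = 0") (auto simp: powr_powr powr_add[symmetric] right_diff_distrib)
          also have "\<dots> \<le> X powr (1 - p / \<rho>) * x powr p"
            using True \<open>p < \<rho> \<and> q = 1\<close> \<rho> by (intro mult_right_mono powr_mono2) auto
          also have "\<dots> \<le> X powr (1 - p / \<rho>) * x powr p + X powr (1 - r) * (x powr \<rho>) powr r" by simp
          finally show ?thesis .
        next
          case False
          then have pos: "0 < x powr \<rho>" using X by linarith
          have "x powr \<rho> = (x powr \<rho>) powr (1 - r) * (x powr \<rho>) powr r"
            using pos by (simp add: powr_add[symmetric])
          also have "\<dots> \<le> X powr (1 - r) * (x powr \<rho>) powr r"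
            using False X r(1) by (intro mult_right_mono powr_mono2') auto
          also have "\<dots> \<le> X powr (1 - p / \<rho>) * x powr p + X powr (1 - r) * (x powr \<rho>) powr r" by simp
          finally show ?thesis .
        qed
        have "eLnorm q (\<lambda>z. ennreal \<bar>nonlinearity \<rho> (v s) z\<bar>) = (\<integral>\<^sup>+z. ennreal (\<bar>v s z\<bar> powr \<rho>) \<partial>lborel)"
          using True by (simp add: eLnorm_def abs_nonlinearity)
        also have "\<dots> \<le> (\<integral>\<^sup>+z. ennreal (X powr (1 - p / \<rho>)) * epowr (ennreal \<bar>v s z\<bar>) p +
            ennreal (X powr (1 - r)) * epowr (ennreal \<bar>nonlinearity \<rho> (v s) z\<bar>) r \<partial>lborel)"
          using pt by (intro nn_integral_mono) (auto simp: abs_nonlinearity ennreal_mult[symmetric] ennreal_plus[symmetric] simp del: ennreal_plus intro!: ennreal_leI)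
        also have "\<dots> = ennreal (X powr (1 - p / \<rho>)) * epowr (eLnorm p (\<lambda>z. ennreal \<bar>v s z\<bar>)) p + ennreal (X powr (1 - r)) * epowr (F s) r"
          using p r(1) by (subst nn_integral_add) (auto simp: nn_integral_cmult epowr_eLnorm F_def)
        also have "\<dots> \<le> ennreal (X powr (1 - p / \<rho>)) * epowr (ennreal M) p + ennreal (X powr (1 - r)) * epowr (ennreal X) r"
          using p r(1) X real by (intro add_mono mult_left_mono epowr_mono vM s) (auto intro: ennreal_leI)
        also have "\<dots> = ennreal (X powr (1 - p / \<rho>) * M powr p + X powr (1 - r) * X powr r)"
          using M(2) X by (simp add: ennreal_mult[symmetric] ennreal_plus[symmetric] del: ennreal_plus)
        also have "X powr (1 - r) * X powr r = X" using X by (simp add: powr_add[symmetric])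
        also have "ennreal (X powr (1 - p / \<rho>) * M powr p + X) \<le> ennreal ((M powr p + 1) * (1 + f))"
        proof (intro ennreal_leI)
          have "X powr (1 - p / \<rho>) \<le> X powr 1" using X p \<rho> by (intro powr_mono) auto
          then have "X powr (1 - p / \<rho>) * M powr p \<le> X * M powr p" using X by (intro mult_right_mono) auto
          moreover have "X * (M powr p + 1) \<le> (1 + f) * (M powr p + 1)" using X by (intro mult_right_mono) auto
          ultimately show "X powr (1 - p / \<rho>) * M powr p + X \<le> (M powr p + 1) * (1 + f)" by (simp add: algebra_simps)
        qed
        also have "\<dots> = ennreal (M powr p + 1) * (1 + F s)" using real by (simp add: ennreal_mult)
        finally show ?thesis .
      qed (simp add: ennreal_mult_top)
      then show "eLnorm q (\<lambda>z. ennreal \<bar>nonlinearity \<rho> (v s) z\<bar>) * indicator {0..T} s \<le> ennreal (M powr p + 1) * (indicator {0..T} s + F s * indicator {0..T} s)"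
        by (auto simp: indicator_def)
    qed
    also have "\<dots> = ennreal (M powr p + 1) * (emeasure lborel {0..T} + (\<integral>\<^sup>+s. F s * indicator {0..T} s \<partial>lborel))"
      by (simp add: nn_integral_cmult nn_integral_add)
    also have "\<dots> < \<top>" using Ffin by (simp add: ennreal_mult_less_top emeasure_lborel_Icc_eq)
    finally show ?thesis .
  qed
qed

lemma AE_restrict_Icc:
  fixes t :: real
  assumes "AE s in lborel. s \<in> {0<..<t} \<longrightarrow> P s"
  shows "AE s in restrict_space lborel {0..t}. P s"
proof -
  have "AE s in lborel. s \<noteq> 0 \<and> s \<noteq> t" using AE_lborel_singleton[of 0] AE_lborel_singleton[of t] by eventually_elim auto
  with assms have "AE s in lborel. s \<in> {0..t} \<longrightarrow> P s" by eventually_elim auto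
  then show ?thesis by (subst AE_restrict_space_iff) auto
qed

text \<open>Evaluates the abstract Duhamel integral on a jointly measurable version. Exchanging
  \<open>u s\<close> for \<open>v s\<close> inside the semigroup changes nothing for s < t, because
  at positive times \<open>S\<close> does not see null sets.\<close>

lemma mild_pointwise:
  assumes u: "mild p \<rho> T u0 u" and p: "1 \<le> p" and t: "t \<in> {0..T}"
    and v [measurable]: "(\<lambda>x. v (fst x) (snd x)) \<in> borel_measurable (borel \<Otimes>\<^sub>M (borel :: 'a measure))"
    and uv: "\<And>t. t \<in> {0..T} \<Longrightarrow> AE z in lborel. v t z = u t z"
  shows "AE z in lborel. integrable (restrict_space lborel {0..t}) (\<lambda>s. S (t - s) (nonlinearity \<rho> (v s)) z)"
    and "AE z in lborel. u t z = S t u0 z + (\<integral>s. S (t - s) (nonlinearity \<rho> (v s)) z \<partial>restrict_space lborel {0..t})"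
proof -
  define M where "M = restrict_space lborel {0..t}"
  have sf: "sigma_finite_measure M"
    unfolding M_def by (intro sigma_finite_measure_restrict_space sigma_finite_lborel) auto
  have idM: "(\<lambda>x. x) \<in> M \<rightarrow>\<^sub>M borel" unfolding M_def by (intro measurable_restrict_space1) simp
  have [measurable]: "v s \<in> borel_measurable borel" for s
    using measurable_compose[OF measurable_Pair1'[of s borel borel] v] by simp
  have uL: "u s \<in> Lp p" if "s \<in> {0..T}" for s using u that by (simp add: mild_def E_space_def Lp_continuous_on_def)
  note [measurable (raw)] = joint_measurable_compose[OF v]
  have h: "(\<lambda>x. S (t - fst x) (nonlinearity \<rho> (v (fst x))) (snd x)) \<in> borel_measurable (borel \<Otimes>\<^sub>M borel)"
    unfolding nonlinearity_def by measurable
  have h': "(\<lambda>x. S (t - fst x) (nonlinearity \<rho> (v (fst x))) (snd x)) \<in> borel_measurable (M \<Otimes>\<^sub>M borel)"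
  proof -
    have "(\<lambda>x. (fst x, snd x)) \<in> M \<Otimes>\<^sub>M (borel :: 'a measure) \<rightarrow>\<^sub>M borel \<Otimes>\<^sub>M borel"
      by (intro measurable_Pair measurable_compose[OF measurable_fst idM] measurable_snd)
    from measurable_compose[OF this h] show ?thesis by simp
  qed
  obtain I where I: "has_Lp_integral p M (\<lambda>s. S (t - s) (nonlinearity \<rho> (u s))) I" "AE z in lborel. u t z = S t u0 z + I z"
    using u t unfolding mild_def M_def by blast
  have "AE s in M. AE z in lborel. S (t - s) (nonlinearity \<rho> (u s)) z = S (t - s) (nonlinearity \<rho> (v s)) z"
    unfolding M_def
  proof (rule AE_restrict_Icc, rule AE_I2, rule impI)
    fix s assume s: "s \<in> {0<..<t}"
    then have sT: "s \<in> {0..T}" using t by auto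
    note [measurable] = Lp_measurable[OF uL[OF sT]]
    have "AE z in lborel. nonlinearity \<rho> (u s) z = nonlinearity \<rho> (v s) z"
      using uv[OF sT] by eventually_elim (simp add: nonlinearity_def)
    then have "S (t - s) (nonlinearity \<rho> (u s)) = S (t - s) (nonlinearity \<rho> (v s))"
      using s by (intro S_cong_AE) auto
    then show "AE z in lborel. S (t - s) (nonlinearity \<rho> (u s)) z = S (t - s) (nonlinearity \<rho> (v s)) z" by simp
  qed
  note * = has_Lp_integralD[OF I(1) sf p h' this]
  show "AE z in lborel. integrable (restrict_space lborel {0..t}) (\<lambda>s. S (t - s) (nonlinearity \<rho> (v s)) z)"
    using eLnorm_integral_le(1)[OF sf h' p *(1)] by (simp add: M_def)
  show "AE z in lborel. u t z = S t u0 z + (\<integral>s. S (t - s) (nonlinearity \<rho> (v s)) z \<partial>restrict_space lborel {0..t})"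
    using I(2) *(2) by eventually_elim (simp add: M_def)
qed

text \<open>Minkowski's inequality moves the norm under the time integral. Smoothing needs a
  positive time, but s = t is a null set.\<close>

lemma eLnorm_Duhamel_le:
  assumes d [measurable]: "(\<lambda>x. d (fst x) (snd x)) \<in> borel_measurable (borel \<Otimes>\<^sub>M (borel :: 'a measure))"
    and q: "1 \<le> q" "q \<le> e"
  shows "eLnorm e (\<lambda>z. \<integral>\<^sup>+s. eS (t - s) (d s) z * indicator {0..t} s \<partial>lborel) \<le>
    (\<integral>\<^sup>+s. ennreal (c * (t - s) powr (- (D * (1 / q - 1 / e)))) * eLnorm q (d s) * indicator {0..t} s \<partial>lborel)"
proof -
  have [measurable]: "d s \<in> borel_measurable borel" for s
    using measurable_compose[OF measurable_Pair1'[of s borel borel] d] by simp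
  note [measurable (raw)] = joint_measurable_compose[OF d]
  have m: "(\<lambda>x. eS (t - fst x) (d (fst x)) (snd x) * indicator {0..t} (fst x)) \<in> borel_measurable (lborel \<Otimes>\<^sub>M borel)"
  proof -
    have "(\<lambda>x. eS (t - fst x) (d (fst x)) (snd x) * indicator {0..t} (fst x)) \<in> borel_measurable (borel \<Otimes>\<^sub>M borel)"
      by measurable
    then show ?thesis by (simp cong: measurable_cong_sets)
  qed
  have "eLnorm e (\<lambda>z. \<integral>\<^sup>+s. eS (t - s) (d s) z * indicator {0..t} s \<partial>lborel) \<le>
    (\<integral>\<^sup>+s. eLnorm e (\<lambda>z. eS (t - s) (d s) z * indicator {0..t} s) \<partial>lborel)"
    using q m by (intro Minkowski_integral sigma_finite_lborel) auto
  also have "\<dots> \<le> (\<integral>\<^sup>+s. ennreal (c * (t - s) powr (- (D * (1 / q - 1 / e)))) * eLnorm q (d s) * indicator {0..t} s \<partial>lborel)"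
  proof (rule nn_integral_mono_AE)
    have "AE s in lborel. s \<noteq> t" by (rule AE_lborel_singleton)
    then show "AE s in lborel. eLnorm e (\<lambda>z. eS (t - s) (d s) z * indicator {0..t} s) \<le>
       ennreal (c * (t - s) powr (- (D * (1 / q - 1 / e)))) * eLnorm q (d s) * indicator {0..t} s"
    proof eventually_elim
      case (elim s)
      then show ?case using eS_smoothing[of "d s" "t - s" q e] q by (auto simp: indicator_def)
    qed
  qed
  finally show ?thesis .
qed

text \<open>Splitting \<open>S\<close> of a difference requires both sources in some L^q. They are
  known to lie there only for almost every time, which is enough under the time integral.\<close>

lemma mild_difference_le:
  assumes u: "mild p \<rho> T u0 u" and v: "mild p \<rho> T v0 v" and u0: "u0 \<in> Lp p" and v0: "v0 \<in> Lp p"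
    and p: "1 \<le> p" and q: "1 \<le> q" and t: "t \<in> {0<..T}"
    and x [measurable]: "(\<lambda>z. x (fst z) (snd z)) \<in> borel_measurable (borel \<Otimes>\<^sub>M (borel :: 'a measure))"
    and ux: "\<And>t. t \<in> {0..T} \<Longrightarrow> AE z in lborel. x t z = u t z"
    and y [measurable]: "(\<lambda>z. y (fst z) (snd z)) \<in> borel_measurable (borel \<Otimes>\<^sub>M (borel :: 'a measure))"
    and vy: "\<And>t. t \<in> {0..T} \<Longrightarrow> AE z in lborel. y t z = v t z"
    and xL: "AE s in lborel. s \<in> {0..T} \<longrightarrow> nonlinearity \<rho> (x s) \<in> Lp q"
    and yL: "AE s in lborel. s \<in> {0..T} \<longrightarrow> nonlinearity \<rho> (y s) \<in> Lp q"
  shows "AE z in lborel. ennreal \<bar>u t z - v t z\<bar> \<le> eS t (\<lambda>z. ennreal \<bar>u0 z - v0 z\<bar>) z +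
     (\<integral>\<^sup>+s. eS (t - s) (\<lambda>z. ennreal \<bar>nonlinearity \<rho> (x s) z - nonlinearity \<rho> (y s) z\<bar>) z * indicator {0..t} s \<partial>lborel)"
proof -
  have t': "t \<in> {0..T}" "0 < t" "0 \<le> t" using t by auto
  have "AE z in lborel. integrable (restrict_space lborel {0..t}) (\<lambda>s. S (t - s) (nonlinearity \<rho> (x s)) z)"
    using ux by (rule mild_pointwise(1)[OF u p t'(1) x])
  moreover have "AE z in lborel. u t z = S t u0 z + (\<integral>s. S (t - s) (nonlinearity \<rho> (x s)) z \<partial>restrict_space lborel {0..t})"
    using ux by (rule mild_pointwise(2)[OF u p t'(1) x])
  moreover have "AE z in lborel. integrable (restrict_space lborel {0..t}) (\<lambda>s. S (t - s) (nonlinearity \<rho> (y s)) z)"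
    using vy by (rule mild_pointwise(1)[OF v p t'(1) y])
  moreover have "AE z in lborel. v t z = S t v0 z + (\<integral>s. S (t - s) (nonlinearity \<rho> (y s)) z \<partial>restrict_space lborel {0..t})"
    using vy by (rule mild_pointwise(2)[OF v p t'(1) y])
  ultimately show ?thesis
  proof eventually_elim
    case (elim z)
    define f where "f s = S (t - s) (nonlinearity \<rho> (x s)) z - S (t - s) (nonlinearity \<rho> (y s)) z" for s
    have int: "integrable (restrict_space lborel {0..t}) f"
      unfolding f_def using elim by (intro Bochner_Integration.integrable_diff)
    have "u t z - v t z = S t (\<lambda>z. u0 z - v0 z) z + (\<integral>s. f s \<partial>restrict_space lborel {0..t})"
      using elim S_diff[OF u0 v0 p p t'(3), of z] by (simp add: f_def)
    then have "\<bar>u t z - v t z\<bar> \<le> \<bar>S t (\<lambda>z. u0 z - v0 z) z\<bar> + \<bar>\<integral>s. f s \<partial>restrict_space lborel {0..t}\<bar>"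
      by simp
    then have "ennreal \<bar>u t z - v t z\<bar> \<le> ennreal \<bar>S t (\<lambda>z. u0 z - v0 z) z\<bar> + ennreal \<bar>\<integral>s. f s \<partial>restrict_space lborel {0..t}\<bar>"
      by (simp add: ennreal_plus[symmetric] del: ennreal_plus)
    also have "\<dots> \<le> eS t (\<lambda>z. ennreal \<bar>u0 z - v0 z\<bar>) z + (\<integral>\<^sup>+s. eS (t - s) (\<lambda>z. ennreal \<bar>nonlinearity \<rho> (x s) z - nonlinearity \<rho> (y s) z\<bar>) z * indicator {0..t} s \<partial>lborel)"
    proof (intro add_mono abs_S_le t')
      have "ennreal \<bar>\<integral>s. f s \<partial>restrict_space lborel {0..t}\<bar> \<le> (\<integral>\<^sup>+s. ennreal \<bar>f s\<bar> \<partial>restrict_space lborel {0..t})"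
        using integral_norm_bound_ennreal[OF int] by simp
      also have "\<dots> = (\<integral>\<^sup>+s. ennreal \<bar>f s\<bar> * indicator {0..t} s \<partial>lborel)"
        by (subst nn_integral_restrict_space) auto
      also have "\<dots> \<le> (\<integral>\<^sup>+s. eS (t - s) (\<lambda>z. ennreal \<bar>nonlinearity \<rho> (x s) z - nonlinearity \<rho> (y s) z\<bar>) z * indicator {0..t} s \<partial>lborel)"
      proof (rule nn_integral_mono_AE)
        have "AE s in lborel. s \<noteq> t" by (rule AE_lborel_singleton)
        with xL yL show "AE s in lborel. ennreal \<bar>f s\<bar> * indicator {0..t} s \<le>
          eS (t - s) (\<lambda>z. ennreal \<bar>nonlinearity \<rho> (x s) z - nonlinearity \<rho> (y s) z\<bar>) z * indicator {0..t} s"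
        proof eventually_elim
          case (elim s)
          show ?case
          proof (cases "s \<in> {0..t}")
            case True
            then have s: "nonlinearity \<rho> (x s) \<in> Lp q" "nonlinearity \<rho> (y s) \<in> Lp q" "0 < t - s" using elim t' by auto
            then have "f s = S (t - s) (\<lambda>z. nonlinearity \<rho> (x s) z - nonlinearity \<rho> (y s) z) z"
              using q unfolding f_def by (intro S_diff[symmetric]) auto
            then show ?thesis using abs_S_le[OF s(3)] True by simp
          qed simp
        qed
      qed
      finally show "ennreal \<bar>\<integral>s. f s \<partial>restrict_space lborel {0..t}\<bar> \<le> (\<integral>\<^sup>+s. eS (t - s) (\<lambda>z. ennreal \<bar>nonlinearity \<rho> (x s) z - nonlinearity \<rho> (y s) z\<bar>) z * indicator {0..t} s \<partial>lborel)" .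
    qed
    finally show ?case .
  qed
qed

text \<open>The unknown of the Gronwall inequality is the L^q norm \<open>bb\<close> of the source
  difference. Hoelder bounds it by the L^m norm of u - v, the mild formula bounds that norm by the
  data and a singular integral of \<open>bb\<close>, and the resulting bound on \<open>bb\<close> is
  inserted once more into the mild formula, now in L^p. The solutions enter the constant only
  through M.\<close>

lemma mild_stability:
  fixes T M :: real
  assumes \<rho>: "1 < \<rho>" and p: "1 \<le> p" "D * (\<rho> - 1) < p" and u0: "u0 \<in> Lp p" and T: "0 < T"
  shows "\<exists>C. \<forall>v0\<in>Lp p. \<forall>u v. mild p \<rho> T u0 u \<and> mild p \<rho> T v0 v \<and>
      (\<forall>t\<in>{0..T}. Lp_norm p (u t) \<le> M \<and> Lp_norm p (v t) \<le> M) \<longrightarrow>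
      (\<forall>t\<in>{0..T}. Lp_norm p (\<lambda>z. u t z - v t z) \<le> C * Lp_norm p (\<lambda>z. u0 z - v0 z))"
proof -
  obtain q m where q: "1 \<le> q" "q \<le> p" and m: "p \<le> m" and qm: "1 / q = (\<rho> - 1) / p + 1 / m"
    and qc: "q = p / \<rho> \<or> p < \<rho> \<and> q = 1"
    and g: "0 \<le> D * (1 / p - 1 / m)" "D * (1 / p - 1 / m) < 1"
    and b: "0 \<le> D * (1 / q - 1 / m)" "D * (1 / q - 1 / m) < 1"
    and d: "0 \<le> D * (1 / q - 1 / p)" "D * (1 / q - 1 / p) < 1" "D * (1 / q - 1 / p) + D * (1 / p - 1 / m) < 1"
    by (rule critical_exponents[OF \<rho> p D_ge_1])
  define \<gamma> where "\<gamma> = D * (1 / p - 1 / m)"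
  define \<beta> where "\<beta> = D * (1 / q - 1 / m)"
  define \<delta> where "\<delta> = D * (1 / q - 1 / p)"
  \<comment> \<open>The Lipschitz weight is controlled by the two L^p norms, together at most 2 * M.
    The absolute value is there because M is known to be nonnegative only once a solution with this
    bound is given.\<close>
  define K where "K = \<rho> * (2 * \<bar>M\<bar>) powr (\<rho> - 1)"
  have K: "0 \<le> K" using \<rho> by (simp add: K_def)
  have c0: "0 \<le> c" using c_ge_1 by simp
  obtain L where L: "0 \<le> L" and Gronwall: "\<And>A b. A < \<top> \<Longrightarrow> b \<in> borel_measurable borel \<Longrightarrow> (\<integral>\<^sup>+s. b s * indicator {0..T} s \<partial>lborel) < \<top> \<Longrightarrow>
    (\<And>s. s \<in> {0<..T} \<Longrightarrow> b s \<le> A * ennreal (s powr (- \<gamma>)) +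
        (\<integral>\<^sup>+r. ennreal (K * c * (s - r) powr (- \<beta>)) * b r * indicator {0..s} r \<partial>lborel)) \<Longrightarrow>
    (AE s in lborel. s \<in> {0<..T} \<longrightarrow> b s \<le> A * ennreal (L * s powr (- \<gamma>)))"
    using singular_Gronwall[of \<beta> \<gamma> T "K * c"] b g K c0 T unfolding \<beta>_def \<gamma>_def by auto
  define R where "R = Beta (1 - \<gamma>) (1 - \<delta>) * T powr (1 - \<delta> - \<gamma>)"
  have B0: "0 \<le> Beta (1 - \<gamma>) (1 - \<delta>)"
    using g d by (intro has_integral_nonneg[OF has_integral_Beta_real]) (auto simp: \<gamma>_def \<delta>_def)
  then have R: "0 \<le> R" by (simp add: R_def)
  \<comment> \<open>The summand \<open>c\<close> belongs to the data term. In the other one, K * c *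
    L is the Gronwall bound of the source difference and c * R comes from its Duhamel
    integral.\<close>
  define C where "C = c + K * c * L * c * R"
  have "0 \<le> K * c * L * c * R" using c0 K L R by simp
  then have C0: "1 \<le> C" using c_ge_1 unfolding C_def by linarith
  have main: "Lp_norm p (\<lambda>z. u t z - v t z) \<le> C * Lp_norm p (\<lambda>z. u0 z - v0 z)"
    if v0: "v0 \<in> Lp p" and u: "mild p \<rho> T u0 u" and v: "mild p \<rho> T v0 v"
      and M: "\<And>t. t \<in> {0..T} \<Longrightarrow> Lp_norm p (u t) \<le> M" "\<And>t. t \<in> {0..T} \<Longrightarrow> Lp_norm p (v t) \<le> M"
      and t: "t \<in> {0..T}" for v0 u v t
  proof -
    have M0: "0 \<le> M" using M(1)[OF t] Lp_norm_nonneg[of p "u t"] by linarith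
    have uC: "Lp_continuous_on p {0..T} u" and vC: "Lp_continuous_on p {0..T} v"
      and ua: "admissible_source \<rho> T u" and va: "admissible_source \<rho> T v"
      using u v by (auto simp: mild_def E_space_def)
    have uL: "u s \<in> Lp p" and vL: "v s \<in> Lp p" if "s \<in> {0..T}" for s
      using uC vC that by (auto simp: Lp_continuous_on_def)
    obtain x where x: "(\<lambda>z. x (fst z) (snd z)) \<in> borel_measurable (borel \<Otimes>\<^sub>M (borel :: 'a measure))"
      and ux: "\<And>t. t \<in> {0..T} \<Longrightarrow> AE z in lborel. x t z = u t z"
      using Lp_continuous_measurable_version[OF uC p(1)] T by auto
    obtain y where y: "(\<lambda>z. y (fst z) (snd z)) \<in> borel_measurable (borel \<Otimes>\<^sub>M (borel :: 'a measure))"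
      and vy: "\<And>t. t \<in> {0..T} \<Longrightarrow> AE z in lborel. y t z = v t z"
      using Lp_continuous_measurable_version[OF vC p(1)] T by auto
    note [measurable (raw)] = joint_measurable_compose[OF x] joint_measurable_compose[OF y]
    note [measurable] = x y
    have xm [measurable]: "x s \<in> borel_measurable borel" and ym [measurable]: "y s \<in> borel_measurable borel" for s
      using measurable_compose[OF measurable_Pair1'[of s borel borel] x] measurable_compose[OF measurable_Pair1'[of s borel borel] y] by simp_all
    have xL: "x s \<in> Lp p" and xM: "eLnorm p (\<lambda>z. ennreal \<bar>x s z\<bar>) \<le> ennreal M"
      and yL: "y s \<in> Lp p" and yM: "eLnorm p (\<lambda>z. ennreal \<bar>y s z\<bar>) \<le> ennreal M" if s: "s \<in> {0..T}" for s
    proof -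
      have "AE z in lborel. u s z = x s z" "AE z in lborel. v s z = y s z" using ux[OF s] vy[OF s] by auto
      note * = Lp_cong_AE[OF uL[OF s] xm this(1)] Lp_norm_cong_AE[OF uL[OF s] xm this(1)]
        Lp_cong_AE[OF vL[OF s] ym this(2)] Lp_norm_cong_AE[OF vL[OF s] ym this(2)]
      show "x s \<in> Lp p" "y s \<in> Lp p" by fact+
      then show "eLnorm p (\<lambda>z. ennreal \<bar>x s z\<bar>) \<le> ennreal M" "eLnorm p (\<lambda>z. ennreal \<bar>y s z\<bar>) \<le> ennreal M"
        using * M[OF s] by (simp_all flip: ennreal_Lp_norm add: ennreal_leI)
    qed
    define f where "f s = eLnorm q (\<lambda>z. ennreal \<bar>nonlinearity \<rho> (x s) z\<bar>)" for s
    define h where "h s = eLnorm q (\<lambda>z. ennreal \<bar>nonlinearity \<rho> (y s) z\<bar>)" for s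
    have [measurable]: "f \<in> borel_measurable borel" "h \<in> borel_measurable borel" unfolding f_def h_def by measurable
    have ffin: "(\<integral>\<^sup>+s. f s * indicator {0..T} s \<partial>lborel) < \<top>"
      unfolding f_def using ux M(1) by (rule source_time_integrable[OF uC ua x _ _ M0 p(1) \<rho> q(1) qc])
    have hfin: "(\<integral>\<^sup>+s. h s * indicator {0..T} s \<partial>lborel) < \<top>"
      unfolding h_def using vy M(2) by (rule source_time_integrable[OF vC va y _ _ M0 p(1) \<rho> q(1) qc])
    have AEL: "AE s in lborel. s \<in> {0..T} \<longrightarrow> w s < \<top>"
      if "(\<integral>\<^sup>+s. w s * indicator {0..T} s \<partial>lborel) < \<top>" and [measurable]: "w \<in> borel_measurable borel" for w :: "real \<Rightarrow> ennreal"
    proof -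
      have "AE s in lborel. w s * indicator {0..T} s \<noteq> \<infinity>" using that by (intro nn_integral_PInf_AE) auto
      then show ?thesis by eventually_elim (auto simp: less_top)
    qed
    have fL: "AE s in lborel. s \<in> {0..T} \<longrightarrow> nonlinearity \<rho> (x s) \<in> Lp q"
      using AEL[OF ffin] by (simp add: Lp_iff_eLnorm f_def)
    have hL: "AE s in lborel. s \<in> {0..T} \<longrightarrow> nonlinearity \<rho> (y s) \<in> Lp q"
      using AEL[OF hfin] by (simp add: Lp_iff_eLnorm h_def)
    define dd where "dd s z = ennreal \<bar>nonlinearity \<rho> (x s) z - nonlinearity \<rho> (y s) z\<bar>" for s z
    have ddm [measurable]: "(\<lambda>z. dd (fst z) (snd z)) \<in> borel_measurable (borel \<Otimes>\<^sub>M (borel :: 'a measure))"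
      unfolding dd_def by measurable
    note [measurable (raw)] = joint_measurable_compose[OF ddm]
    define W where "W = eLnorm p (\<lambda>z. ennreal \<bar>u0 z - v0 z\<bar>)"
    have W: "W = ennreal (Lp_norm p (\<lambda>z. u0 z - v0 z))"
      unfolding W_def by (rule ennreal_Lp_norm[symmetric]) (intro Lp_diff u0 v0 p)
    define bb where "bb s = eLnorm q (dd s)" for s
    have [measurable]: "bb \<in> borel_measurable borel" unfolding bb_def by measurable
    note [measurable] = Lp_measurable[OF u0] Lp_measurable[OF v0]
    have diff: "eLnorm e (\<lambda>z. ennreal \<bar>u s z - v s z\<bar>) \<le> ennreal (c * s powr (- (D * (1 / p - 1 / e)))) * W +
        (\<integral>\<^sup>+r. ennreal (c * (s - r) powr (- (D * (1 / q - 1 / e)))) * bb r * indicator {0..s} r \<partial>lborel)"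
      if s: "s \<in> {0<..T}" and e: "p \<le> e" for s e
    proof -
      have "AE z in lborel. ennreal \<bar>u s z - v s z\<bar> \<le> eS s (\<lambda>z. ennreal \<bar>u0 z - v0 z\<bar>) z +
        (\<integral>\<^sup>+r. eS (s - r) (dd r) z * indicator {0..s} r \<partial>lborel)"
        unfolding dd_def using ux vy by (intro mild_difference_le[OF u v u0 v0 p(1) q(1) s x _ y _ fL hL])
      then have "eLnorm e (\<lambda>z. ennreal \<bar>u s z - v s z\<bar>) \<le> eLnorm e (\<lambda>z. eS s (\<lambda>z. ennreal \<bar>u0 z - v0 z\<bar>) z +
        (\<integral>\<^sup>+r. eS (s - r) (dd r) z * indicator {0..s} r \<partial>lborel))"
        using p e by (intro eLnorm_mono_AE) auto
      also have "\<dots> \<le> eLnorm e (eS s (\<lambda>z. ennreal \<bar>u0 z - v0 z\<bar>)) + eLnorm e (\<lambda>z. \<integral>\<^sup>+r. eS (s - r) (dd r) z * indicator {0..s} r \<partial>lborel)"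
      proof (intro eLnorm_add_le)
        have "(\<lambda>z. eS s (\<lambda>z. ennreal \<bar>u0 z - v0 z\<bar>) z) \<in> borel_measurable borel" by measurable
        then show "eS s (\<lambda>z. ennreal \<bar>u0 z - v0 z\<bar>) \<in> borel_measurable borel" by simp
        have "(\<lambda>x. eS (s - snd x) (dd (snd x)) (fst x) * indicator {0..s} (snd x)) \<in> borel_measurable (borel \<Otimes>\<^sub>M borel)"
          by measurable
        then have [measurable]: "(\<lambda>x. eS (s - snd x) (dd (snd x)) (fst x) * indicator {0..s} (snd x)) \<in> borel_measurable (borel \<Otimes>\<^sub>M lborel)"
          by (simp cong: measurable_cong_sets)
        show "(\<lambda>z. \<integral>\<^sup>+r. eS (s - r) (dd r) z * indicator {0..s} r \<partial>lborel) \<in> borel_measurable borel"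
          by measurable
      qed (use p e in auto)
      also have "\<dots> \<le> ennreal (c * s powr (- (D * (1 / p - 1 / e)))) * W +
        (\<integral>\<^sup>+r. ennreal (c * (s - r) powr (- (D * (1 / q - 1 / e)))) * bb r * indicator {0..s} r \<partial>lborel)"
        unfolding W_def bb_def using s e p q by (intro add_mono eS_smoothing eLnorm_Duhamel_le ddm) auto
      finally show ?thesis .
    qed
    have bb_le: "bb s \<le> ennreal K * eLnorm m (\<lambda>z. ennreal \<bar>u s z - v s z\<bar>)" if s: "s \<in> {0..T}" for s
    proof -
      have "bb s \<le> ennreal \<rho> * epowr (eLnorm p (\<lambda>z. ennreal \<bar>x s z\<bar>) + eLnorm p (\<lambda>z. ennreal \<bar>y s z\<bar>)) (\<rho> - 1) * eLnorm m (\<lambda>z. ennreal \<bar>x s z - y s z\<bar>)"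
        unfolding bb_def dd_def using \<rho> p q m qm by (intro eLnorm_nonlinearity_diff) auto
      also have "\<dots> \<le> ennreal \<rho> * epowr (ennreal M + ennreal M) (\<rho> - 1) * eLnorm m (\<lambda>z. ennreal \<bar>x s z - y s z\<bar>)"
        using \<rho> by (intro mult_right_mono mult_left_mono epowr_mono add_mono xM yM s) auto
      also have "ennreal \<rho> * epowr (ennreal M + ennreal M) (\<rho> - 1) = ennreal K"
        using M0 \<rho> by (simp add: K_def ennreal_plus[symmetric] ennreal_mult[symmetric] del: ennreal_plus)
      also have "eLnorm m (\<lambda>z. ennreal \<bar>x s z - y s z\<bar>) = eLnorm m (\<lambda>z. ennreal \<bar>u s z - v s z\<bar>)"
      proof (rule eLnorm_cong_AE)
        show "AE z in lborel. ennreal \<bar>x s z - y s z\<bar> = ennreal \<bar>u s z - v s z\<bar>"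
          using ux[OF s] vy[OF s] by eventually_elim simp
      qed
      finally show ?thesis .
    qed
    \<comment> \<open>The a priori finiteness demanded by the Gronwall lemma; it comes from the
      integrability of each source separately, not from their closeness.\<close>
    have bbfin: "(\<integral>\<^sup>+s. bb s * indicator {0..T} s \<partial>lborel) < \<top>"
    proof -
      have "(\<integral>\<^sup>+s. bb s * indicator {0..T} s \<partial>lborel) \<le> (\<integral>\<^sup>+s. f s * indicator {0..T} s + h s * indicator {0..T} s \<partial>lborel)"
      proof (intro nn_integral_mono)
        fix s
        have "bb s \<le> f s + h s"
          using eLnorm_abs_add_le[of "nonlinearity \<rho> (x s)" "\<lambda>z. - nonlinearity \<rho> (y s) z" q] q
          by (simp add: bb_def dd_def[abs_def] f_def h_def)
        then show "bb s * indicator {0..T} s \<le> f s * indicator {0..T} s + h s * indicator {0..T} s"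
          by (auto simp: indicator_def)
      qed
      also have "\<dots> < \<top>" using ffin hfin by (subst nn_integral_add) auto
      finally show ?thesis .
    qed
    have "AE s in lborel. s \<in> {0<..T} \<longrightarrow> bb s \<le> ennreal (K * c) * W * ennreal (L * s powr (- \<gamma>))"
    proof (rule Gronwall[OF _ _ bbfin])
      show "ennreal (K * c) * W < \<top>" by (simp add: W ennreal_mult_less_top)
      fix s assume s: "s \<in> {0<..T}"
      have "bb s \<le> ennreal K * (ennreal (c * s powr (- \<gamma>)) * W +
        (\<integral>\<^sup>+r. ennreal (c * (s - r) powr (- \<beta>)) * bb r * indicator {0..s} r \<partial>lborel))"
        using order_trans[OF bb_le[of s] mult_left_mono[OF diff[OF s m]]] s by (simp add: \<beta>_def \<gamma>_def)
      also have "\<dots> = ennreal (K * c) * W * ennreal (s powr (- \<gamma>)) +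
        (\<integral>\<^sup>+r. ennreal K * (ennreal (c * (s - r) powr (- \<beta>)) * bb r * indicator {0..s} r) \<partial>lborel)"
        using K c0 by (subst nn_integral_cmult) (auto simp: distrib_left ennreal_mult mult_ac)
      also have "(\<lambda>r. ennreal K * (ennreal (c * (s - r) powr (- \<beta>)) * bb r * indicator {0..s} r)) = (\<lambda>r. ennreal (K * c * (s - r) powr (- \<beta>)) * bb r * indicator {0..s} r)"
        using K c0 by (simp add: ennreal_mult mult_ac fun_eq_iff)
      finally show "bb s \<le> ennreal (K * c) * W * ennreal (s powr (- \<gamma>)) + (\<integral>\<^sup>+r. ennreal (K * c * (s - r) powr (- \<beta>)) * bb r * indicator {0..s} r \<partial>lborel)" .
    qed measurable
    note bb_bound = this
    have "eLnorm p (\<lambda>z. ennreal \<bar>u t z - v t z\<bar>) \<le> ennreal C * W"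
    proof (cases "t = 0")
      case True
      \<comment> \<open>The singular estimates exclude t = 0. There the time integral runs over a
        null set, so both solutions coincide with their data.\<close>
      have "AE s in restrict_space lborel {0..0 :: real}. P s" for P
        by (rule AE_restrict_Icc) simp
      then have int0: "(\<integral>s. F s \<partial>restrict_space lborel {0..0 :: real}) = 0" for F :: "real \<Rightarrow> real"
        by (intro integral_eq_zero_AE) blast
      have "AE z in lborel. u t z = S t u0 z + (\<integral>s. S (t - s) (nonlinearity \<rho> (x s)) z \<partial>restrict_space lborel {0..t})"
        using ux by (rule mild_pointwise(2)[OF u p(1) t x])
      then have "AE z in lborel. u t z = u0 z" unfolding True int0 by simp
      moreover have "AE z in lborel. v t z = S t v0 z + (\<integral>s. S (t - s) (nonlinearity \<rho> (y s)) z \<partial>restrict_space lborel {0..t})"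
        using vy by (rule mild_pointwise(2)[OF v p(1) t y])
      then have "AE z in lborel. v t z = v0 z" unfolding True int0 by simp
      ultimately have "AE z in lborel. ennreal \<bar>u t z - v t z\<bar> = ennreal \<bar>u0 z - v0 z\<bar>"
        by eventually_elim simp
      then have "eLnorm p (\<lambda>z. ennreal \<bar>u t z - v t z\<bar>) = 1 * W" unfolding W_def by (simp add: eLnorm_cong_AE)
      also have "\<dots> \<le> ennreal C * W" using C0 by (intro mult_right_mono) (auto simp: ennreal_leI simp flip: ennreal_1)
      finally show ?thesis .
    next
      case False
      then have t': "t \<in> {0<..T}" using t by auto
      have "(\<integral>\<^sup>+r. ennreal (c * (t - r) powr (- \<delta>)) * bb r * indicator {0..t} r \<partial>lborel) \<le>
        (\<integral>\<^sup>+r. (ennreal (K * c * L * c) * W) * (ennreal ((t - r) powr (- \<delta>) * r powr (- \<gamma>)) * indicator {0..t} r) \<partial>lborel)"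
      proof (rule nn_integral_mono_AE)
        have "AE r in lborel. r \<noteq> (0::real)" by (rule AE_lborel_singleton)
        with bb_bound show "AE r in lborel. ennreal (c * (t - r) powr (- \<delta>)) * bb r * indicator {0..t} r \<le>
          (ennreal (K * c * L * c) * W) * (ennreal ((t - r) powr (- \<delta>) * r powr (- \<gamma>)) * indicator {0..t} r)"
        proof eventually_elim
          case (elim r)
          show ?case
          proof (cases "r \<in> {0..t}")
            case True
            then have "bb r \<le> ennreal (K * c) * W * ennreal (L * r powr (- \<gamma>))" using elim t' by auto
            then have "ennreal (c * (t - r) powr (- \<delta>)) * bb r \<le> ennreal (c * (t - r) powr (- \<delta>)) * (ennreal (K * c) * W * ennreal (L * r powr (- \<gamma>)))"
              by (intro mult_left_mono) auto
            also have "\<dots> = (ennreal (K * c * L * c) * W) * ennreal ((t - r) powr (- \<delta>) * r powr (- \<gamma>))"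
              using K c0 L by (simp add: ennreal_mult mult_ac)
            finally show ?thesis using True by simp
          qed simp
        qed
      qed
      also have "\<dots> = (ennreal (K * c * L * c) * W) * ennreal (Beta (1 - \<gamma>) (1 - \<delta>) * t powr (1 - \<delta> - \<gamma>))"
        using nn_integral_Beta[of \<delta> \<gamma> t] t' d g by (subst nn_integral_cmult) (auto simp: \<delta>_def \<gamma>_def)
      \<comment> \<open>Replacing t by T is monotone, because \<delta> + \<gamma> < 1 keeps the
        exponent 1 - \<delta> - \<gamma> positive.\<close>
      also have "\<dots> \<le> (ennreal (K * c * L * c) * W) * ennreal R"
        unfolding R_def using t' d B0 by (intro mult_left_mono ennreal_leI powr_mono2) (auto simp: \<delta>_def \<gamma>_def)
      finally have "eLnorm p (\<lambda>z. ennreal \<bar>u t z - v t z\<bar>) \<le> ennreal (c * t powr (- (D * (1 / p - 1 / p)))) * W + (ennreal (K * c * L * c) * W) * ennreal R"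
        by (intro order_trans[OF diff[OF t' order_refl] add_left_mono]) (simp add: \<delta>_def)
      also have "\<dots> = ennreal C * W"
        using t' c0 K L R by (simp add: C_def ennreal_mult ennreal_plus distrib_left distrib_right mult_ac)
      finally show ?thesis .
    qed
    moreover have "eLnorm p (\<lambda>z. ennreal \<bar>u t z - v t z\<bar>) = ennreal (Lp_norm p (\<lambda>z. u t z - v t z))"
      by (rule ennreal_Lp_norm[symmetric]) (intro Lp_diff uL vL t p)
    ultimately have "ennreal (Lp_norm p (\<lambda>z. u t z - v t z)) \<le> ennreal (C * Lp_norm p (\<lambda>z. u0 z - v0 z))"
      using C0 by (simp add: W ennreal_mult)
    then show ?thesis using C0 by (subst (asm) ennreal_le_iff) auto
  qed
  then show ?thesis by (intro exI[of _ C]) blast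
qed

lemma Lp_continuous_bounded:
  assumes u: "Lp_continuous_on p {a..b} (u :: real \<Rightarrow> 'a \<Rightarrow> real)" and p: "1 \<le> p"
  shows "\<exists>M. \<forall>t\<in>{a..b}. Lp_norm p (u t) \<le> M"
proof -
  have L: "u x \<in> Lp p" if "x \<in> {a..b}" for x using u that by (simp add: Lp_continuous_on_def)
  have tri: "Lp_norm p f \<le> Lp_norm p (\<lambda>z. f z - g z) + Lp_norm p g" if "f \<in> Lp p" "g \<in> Lp p" for f g :: "'a \<Rightarrow> real"
  proof -
    have "ennreal (Lp_norm p f) \<le> ennreal (Lp_norm p (\<lambda>z. f z - g z)) + ennreal (Lp_norm p g)"
      using that p by (simp add: ennreal_Lp_norm Lp_diff eLnorm_abs_le_add_diff Lp_measurable)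
    then show ?thesis by (simp add: ennreal_plus[symmetric] del: ennreal_plus)
  qed
  have "continuous_on {a..b} (\<lambda>t. Lp_norm p (u t))"
    unfolding continuous_on_def
  proof
    fix t assume t: "t \<in> {a..b}"
    have "\<bar>Lp_norm p (u s) - Lp_norm p (u t)\<bar> \<le> Lp_norm p (\<lambda>z. u s z - u t z)" if s: "s \<in> {a..b}" for s
    proof -
      have "Lp_norm p (\<lambda>z. u t z - u s z) = Lp_norm p (\<lambda>z. u s z - u t z)" by (simp add: Lp_norm_def abs_minus_commute)
      then show ?thesis using tri[OF L[OF s] L[OF t]] tri[OF L[OF t] L[OF s]] by linarith
    qed
    then have "\<forall>\<^sub>F s in at t within {a..b}. norm (Lp_norm p (u s) - Lp_norm p (u t)) \<le> Lp_norm p (\<lambda>z. u s z - u t z)"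
      by (auto simp: eventually_at_filter)
    moreover have "((\<lambda>s. Lp_norm p (\<lambda>z. u s z - u t z)) \<longlongrightarrow> 0) (at t within {a..b})"
      using u t by (simp add: Lp_continuous_on_def)
    ultimately have "((\<lambda>s. Lp_norm p (u s) - Lp_norm p (u t)) \<longlongrightarrow> 0) (at t within {a..b})"
      by (rule Lim_null_comparison)
    then show "((\<lambda>s. Lp_norm p (u s)) \<longlongrightarrow> Lp_norm p (u t)) (at t within {a..b})"
      by (simp add: LIM_zero_iff)
  qed
  then have "compact ((\<lambda>t. Lp_norm p (u t)) ` {a..b})" by (intro compact_continuous_image) auto
  then have "bounded ((\<lambda>t. Lp_norm p (u t)) ` {a..b})" by (rule compact_imp_bounded)
  then show ?thesis unfolding bounded_iff by (metis imageI norm_ge_zero abs_le_D1 real_norm_def)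
qed

text \<open>Continuity on a compact interval bounds each solution in L^p, so the stability estimate
  applies with equal data. Uniqueness thus holds among all mild solutions, without reference to the
  weighted space.\<close>

lemma mild_unique:
  assumes \<rho>: "1 < \<rho>" and p: "1 \<le> p" "D * (\<rho> - 1) < p" and u0: "u0 \<in> Lp p" and T: "0 < T"
    and u: "mild p \<rho> T u0 u" and v: "mild p \<rho> T u0 v" and t: "t \<in> {0..T}"
  shows "AE z in lborel. v t z = u t z"
proof -
  have uC: "Lp_continuous_on p {0..T} u" and vC: "Lp_continuous_on p {0..T} v"
    using u v by (auto simp: mild_def E_space_def)
  have uL: "u t \<in> Lp p" and vL: "v t \<in> Lp p" using uC vC t by (auto simp: Lp_continuous_on_def)
  note [measurable] = Lp_measurable[OF uL] Lp_measurable[OF vL]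
  obtain A where A: "\<forall>t\<in>{0..T}. Lp_norm p (u t) \<le> A" using Lp_continuous_bounded[OF uC p(1)] ..
  obtain B where B: "\<forall>t\<in>{0..T}. Lp_norm p (v t) \<le> B" using Lp_continuous_bounded[OF vC p(1)] ..
  have "\<forall>t\<in>{0..T}. Lp_norm p (u t) \<le> max A B \<and> Lp_norm p (v t) \<le> max A B"
    using A B by (auto intro: max.coboundedI1 max.coboundedI2)
  then obtain C where "Lp_norm p (\<lambda>z. u t z - v t z) \<le> C * Lp_norm p (\<lambda>z. u0 z - u0 z)"
    using mild_stability[OF \<rho> p u0 T, of "max A B"] u v u0 t by meson
  then have "Lp_norm p (\<lambda>z. u t z - v t z) = 0"
    using Lp_norm_nonneg[of p "\<lambda>z. u t z - v t z"] by (simp add: Lp_norm_def)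
  then have "eLnorm p (\<lambda>z. ennreal \<bar>u t z - v t z\<bar>) = 0"
    using ennreal_Lp_norm[OF Lp_diff[OF uL vL p(1)]] by simp
  then have "AE z in lborel. ennreal \<bar>u t z - v t z\<bar> = 0" by (intro eLnorm_eq_0D) auto
  then show ?thesis by eventually_elim simp
qed

end

section \<open>Local existence\<close>

lemma Lp_continuous_onI:
  fixes u :: "real \<Rightarrow> 'a::euclidean_space \<Rightarrow> real"
  assumes L: "\<And>t. t \<in> A \<Longrightarrow> u t \<in> Lp p" and p: "1 \<le> p"
    and conv: "\<And>t X. t \<in> A \<Longrightarrow> (\<And>n. X n \<in> A) \<Longrightarrow> X \<longlonglongrightarrow> t \<Longrightarrow> (\<lambda>n. eLnorm p (\<lambda>z. ennreal \<bar>u (X n) z - u t z\<bar>)) \<longlonglongrightarrow> 0"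
  shows "Lp_continuous_on p A u"
  unfolding Lp_continuous_on_def tendsto_at_iff_sequentially o_def
proof (intro conjI ballI allI impI L)
  fix t X assume t: "t \<in> A" and X: "\<forall>i. X i \<in> A - {t}" "X \<longlonglongrightarrow> t"
  then show "(\<lambda>i. Lp_norm p (\<lambda>z. u (X i) z - u t z)) \<longlonglongrightarrow> 0"
    using conv[OF t, of X] by (subst tendsto_Lp_norm_iff) (auto intro!: Lp_diff L p)
qed

lemma Lp_continuous_onD:
  fixes u :: "real \<Rightarrow> 'a::euclidean_space \<Rightarrow> real"
  assumes u: "Lp_continuous_on p A u" and p: "1 \<le> p" and X: "t \<in> A" "\<And>n. X n \<in> A" "X \<longlonglongrightarrow> t"
  shows "(\<lambda>n. eLnorm p (\<lambda>z. ennreal \<bar>u (X n) z - u t z\<bar>)) \<longlonglongrightarrow> 0"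
proof -
  have L: "u x \<in> Lp p" if "x \<in> A" for x using u that by (simp add: Lp_continuous_on_def)
  have "((\<lambda>x. Lp_norm p (\<lambda>z. u x z - u t z)) \<longlongrightarrow> 0) (at t within A)"
    using u X(1) by (simp add: Lp_continuous_on_def)
  then have "continuous (at t within A) (\<lambda>x. Lp_norm p (\<lambda>z. u x z - u t z))"
    by (simp add: continuous_within Lp_norm_def)
  then have "(\<lambda>n. Lp_norm p (\<lambda>z. u (X n) z - u t z)) \<longlonglongrightarrow> Lp_norm p (\<lambda>z. u t z - u t z)"
    unfolding continuous_within_sequentially o_def using X by blast
  then have "(\<lambda>n. Lp_norm p (\<lambda>z. u (X n) z - u t z)) \<longlonglongrightarrow> 0"
    by (simp add: Lp_norm_def)
  then show ?thesis
    using X p by (subst (asm) tendsto_Lp_norm_iff) (auto intro!: Lp_diff L)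
qed

context markov_kernel
begin

lemma S_continuous_pos':
  assumes f: "f \<in> Lp p" and p: "1 \<le> p" and t: "0 < t" and s: "s \<longlonglongrightarrow> t"
  shows "(\<lambda>n. eLnorm p (\<lambda>x. ennreal \<bar>S (s n) f x - S t f x\<bar>)) \<longlonglongrightarrow> 0"
proof -
  define r where "r n = (if 0 < s n then s n else t)" for n
  have ev: "\<forall>\<^sub>F n in sequentially. r n = s n"
    using order_tendstoD(1)[OF s t] by eventually_elim (simp add: r_def)
  have "r \<longlonglongrightarrow> t"
    by (rule Lim_transform_eventually[OF s]) (use ev in \<open>eventually_elim, simp\<close>)
  moreover have "0 < r n" for n using t by (simp add: r_def)
  ultimately have "(\<lambda>n. eLnorm p (\<lambda>x. ennreal \<bar>S (r n) f x - S t f x\<bar>)) \<longlonglongrightarrow> 0"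
    using t by (intro S_continuous_pos f p) auto
  then show ?thesis
    by (rule Lim_transform_eventually) (use ev in \<open>eventually_elim, simp\<close>)
qed

lemma S_continuous:
  assumes f: "f \<in> Lp p" and p: "1 \<le> p" and t: "0 \<le> t" and s: "\<And>n. 0 \<le> s n" "s \<longlonglongrightarrow> t"
  shows "(\<lambda>n. eLnorm p (\<lambda>x. ennreal \<bar>S (s n) f x - S t f x\<bar>)) \<longlonglongrightarrow> 0"
proof (cases "t = 0")
  case True
  have "continuous (at 0 within {0..}) (\<lambda>r. eLnorm p (\<lambda>x. ennreal \<bar>S r f x - f x\<bar>))"
    unfolding continuous_within at_within_Ici_at_right using S_continuous_0[OF f p] by simp
  then have "(\<lambda>n. eLnorm p (\<lambda>x. ennreal \<bar>S (s n) f x - f x\<bar>)) \<longlonglongrightarrow> eLnorm p (\<lambda>x. ennreal \<bar>S 0 f x - f x\<bar>)"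
    unfolding continuous_within_sequentially o_def using s True by auto
  then show ?thesis using True by simp
next
  case False
  then show ?thesis using t by (intro S_continuous_pos' f p s) auto
qed

text \<open>The Duhamel operator, with the time interval encoded by an indicator so that the measure
  does not vary with \<open>t\<close>.\<close>

definition V :: "(real \<Rightarrow> 'a \<Rightarrow> real) \<Rightarrow> real \<Rightarrow> 'a \<Rightarrow> real" where
  "V h t z = (\<integral>s. indicator {0..t} s * S (t - s) (h s) z \<partial>lborel)"

lemma V_integrand_measurable:
  assumes h: "(\<lambda>x. h (fst x) (snd x)) \<in> borel_measurable (borel \<Otimes>\<^sub>M (borel :: 'a measure))"
  shows "(\<lambda>x. indicator {0..t} (fst x) * S (t - fst x) (h (fst x)) (snd x)) \<in> borel_measurable (lborel \<Otimes>\<^sub>M borel)"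
proof -
  note [measurable (raw)] = joint_measurable_compose[OF h]
  have "(\<lambda>x. indicator {0..t} (fst x) * S (t - fst x) (h (fst x)) (snd x)) \<in> borel_measurable (borel \<Otimes>\<^sub>M borel)"
    by measurable
  then show ?thesis by (simp cong: measurable_cong_sets)
qed

lemma V_measurable:
  assumes h: "(\<lambda>x. h (fst x) (snd x)) \<in> borel_measurable (borel \<Otimes>\<^sub>M (borel :: 'a measure))"
  shows "(\<lambda>x. V h (fst x) (snd x)) \<in> borel_measurable (borel \<Otimes>\<^sub>M (borel :: 'a measure))"
proof -
  note [measurable (raw)] = joint_measurable_compose[OF h]
  have ind: "(\<lambda>x. indicator {0..fst (fst x)} (snd x) :: real) \<in> borel_measurable (((borel :: real measure) \<Otimes>\<^sub>M (borel :: 'a measure)) \<Otimes>\<^sub>M borel)"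
  proof -
    have "(\<lambda>x. if 0 \<le> snd x \<and> snd x \<le> fst (fst x) then 1 else 0 :: real) \<in> borel_measurable (((borel :: real measure) \<Otimes>\<^sub>M (borel :: 'a measure)) \<Otimes>\<^sub>M borel)"
      by measurable
    then show ?thesis by (simp add: indicator_def of_bool_def)
  qed
  have "(\<lambda>x. S (fst (fst x) - snd x) (h (snd x)) (snd (fst x))) \<in> borel_measurable ((borel \<Otimes>\<^sub>M (borel :: 'a measure)) \<Otimes>\<^sub>M borel)"
    by measurable
  from borel_measurable_times[OF ind this]
  have "(\<lambda>(x, s). indicator {0..fst x} s * S (fst x - s) (h s) (snd x)) \<in> borel_measurable ((borel \<Otimes>\<^sub>M (borel :: 'a measure)) \<Otimes>\<^sub>M lborel)"
    by (simp add: case_prod_beta' cong: measurable_cong_sets)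
  then show ?thesis unfolding V_def by (rule lborel.borel_measurable_lebesgue_integral)
qed

text \<open>The smoothing singularity of order D * (1/p - 1/e) at s = t and the source singularity
  of order \<beta> at s = 0 meet in a Beta integral. Finiteness of the bound also gives convergence
  of the integral at almost every point.\<close>

lemma V_estimate:
  assumes h: "(\<lambda>x. h (fst x) (snd x)) \<in> borel_measurable (borel \<Otimes>\<^sub>M (borel :: 'a measure))"
    and H: "\<And>s. s \<in> {0<..t} \<Longrightarrow> eLnorm p (\<lambda>z. ennreal \<bar>h s z\<bar>) \<le> H * ennreal (s powr (- \<beta>))"
    and p: "1 \<le> p" "p \<le> e" and t: "0 < t" and \<beta>: "\<beta> < 1" and a: "D * (1 / p - 1 / e) < 1" and Hfin: "H < \<top>"
  shows "AE z in lborel. integrable lborel (\<lambda>s. indicator {0..t} s * S (t - s) (h s) z)"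
    and "eLnorm e (\<lambda>z. ennreal \<bar>V h t z\<bar>) \<le> H * ennreal (c * Beta (1 - \<beta>) (1 - D * (1 / p - 1 / e)) * t powr (1 - D * (1 / p - 1 / e) - \<beta>))"
proof -
  have hm [measurable]: "h s \<in> borel_measurable borel" for s
    using measurable_compose[OF measurable_Pair1'[of s borel borel] h] by simp
  define a where "a = D * (1 / p - 1 / e)"
  have c0: "0 \<le> c" using c_ge_1 by simp
  have B0: "0 \<le> Beta (1 - \<beta>) (1 - a)" using \<beta> \<open>D * (1 / p - 1 / e) < 1\<close>
    by (intro has_integral_nonneg[OF has_integral_Beta_real]) (auto simp: a_def)
  have le: "(\<integral>\<^sup>+s. eLnorm e (\<lambda>z. ennreal \<bar>indicator {0..t} s * S (t - s) (h s) z\<bar>) \<partial>lborel) \<le>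
      H * ennreal (c * Beta (1 - \<beta>) (1 - a) * t powr (1 - a - \<beta>))"
  proof -
    have "(\<integral>\<^sup>+s. eLnorm e (\<lambda>z. ennreal \<bar>indicator {0..t} s * S (t - s) (h s) z\<bar>) \<partial>lborel) \<le>
      (\<integral>\<^sup>+s. (H * ennreal c) * (ennreal ((t - s) powr (- a) * s powr (- \<beta>)) * indicator {0..t} s) \<partial>lborel)"
    proof (rule nn_integral_mono_AE)
      have "AE s in lborel. s \<noteq> 0 \<and> s \<noteq> t" using AE_lborel_singleton[of 0] AE_lborel_singleton[of t] by eventually_elim auto
      then show "AE s in lborel. eLnorm e (\<lambda>z. ennreal \<bar>indicator {0..t} s * S (t - s) (h s) z\<bar>) \<le>
        (H * ennreal c) * (ennreal ((t - s) powr (- a) * s powr (- \<beta>)) * indicator {0..t} s)"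
      proof eventually_elim
        case (elim s)
        show ?case
        proof (cases "s \<in> {0..t}")
          case True
          have "eLnorm e (\<lambda>z. ennreal \<bar>S (t - s) (h s) z\<bar>) \<le> ennreal (c * (t - s) powr (- a)) * eLnorm p (\<lambda>z. ennreal \<bar>h s z\<bar>)"
            unfolding a_def using True elim p by (intro eLnorm_S_smoothing) auto
          also have "\<dots> \<le> ennreal (c * (t - s) powr (- a)) * (H * ennreal (s powr (- \<beta>)))"
            using True elim by (intro mult_left_mono H) auto
          also have "\<dots> = (H * ennreal c) * ennreal ((t - s) powr (- a) * s powr (- \<beta>))"
            using c0 by (simp add: ennreal_mult mult_ac)
          finally show ?thesis using True by simp
        qed simp
      qed
    qed
    also have "\<dots> = (H * ennreal c) * ennreal (Beta (1 - \<beta>) (1 - a) * t powr (1 - a - \<beta>))"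
      using nn_integral_Beta[of a \<beta> t] \<beta> t \<open>D * (1 / p - 1 / e) < 1\<close> by (subst nn_integral_cmult) (auto simp: a_def)
    also have "\<dots> = H * ennreal (c * Beta (1 - \<beta>) (1 - a) * t powr (1 - a - \<beta>))"
      using c0 B0 by (simp add: ennreal_mult mult_ac)
    finally show ?thesis .
  qed
  then have fin: "(\<integral>\<^sup>+s. eLnorm e (\<lambda>z. ennreal \<bar>indicator {0..t} s * S (t - s) (h s) z\<bar>) \<partial>lborel) < \<top>"
    using Hfin by (auto simp: ennreal_mult_less_top intro: order.strict_trans1)
  have e: "1 \<le> e" using p by simp
  show "AE z in lborel. integrable lborel (\<lambda>s. indicator {0..t} s * S (t - s) (h s) z)"
    by (rule eLnorm_integral_le(1)[OF sigma_finite_lborel V_integrand_measurable[OF h] e fin])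
  show "eLnorm e (\<lambda>z. ennreal \<bar>V h t z\<bar>) \<le> H * ennreal (c * Beta (1 - \<beta>) (1 - D * (1 / p - 1 / e)) * t powr (1 - D * (1 / p - 1 / e) - \<beta>))"
    using order_trans[OF eLnorm_integral_le(2)[OF sigma_finite_lborel V_integrand_measurable[OF h] e fin] le]
    by (simp add: V_def a_def)
qed

text \<open>\<open>V\<close> is additive only where both integrals converge. The separate bounds on
  h and g secure this almost everywhere; the constant depends on the difference alone.\<close>

lemma V_diff_estimate:
  assumes h: "(\<lambda>x. h (fst x) (snd x)) \<in> borel_measurable (borel \<Otimes>\<^sub>M (borel :: 'a measure))"
    and g: "(\<lambda>x. g (fst x) (snd x)) \<in> borel_measurable (borel \<Otimes>\<^sub>M (borel :: 'a measure))"
    and H: "\<And>s. s \<in> {0<..t} \<Longrightarrow> eLnorm p (\<lambda>z. ennreal \<bar>h s z\<bar>) \<le> H * ennreal (s powr (- \<beta>))"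
    and G: "\<And>s. s \<in> {0<..t} \<Longrightarrow> eLnorm p (\<lambda>z. ennreal \<bar>g s z\<bar>) \<le> G * ennreal (s powr (- \<beta>))"
    and E: "\<And>s. s \<in> {0<..t} \<Longrightarrow> eLnorm p (\<lambda>z. ennreal \<bar>h s z - g s z\<bar>) \<le> E * ennreal (s powr (- \<beta>))"
    and p: "1 \<le> p" "p \<le> e" and t: "0 < t" and \<beta>: "\<beta> < 1" and a: "D * (1 / p - 1 / e) < 1"
    and fin: "H < \<top>" "G < \<top>" "E < \<top>"
  shows "eLnorm e (\<lambda>z. ennreal \<bar>V h t z - V g t z\<bar>) \<le> E * ennreal (c * Beta (1 - \<beta>) (1 - D * (1 / p - 1 / e)) * t powr (1 - D * (1 / p - 1 / e) - \<beta>))"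
proof -
  have hm [measurable]: "h s \<in> borel_measurable borel" "g s \<in> borel_measurable borel" for s
    using measurable_compose[OF measurable_Pair1'[of s borel borel] h] measurable_compose[OF measurable_Pair1'[of s borel borel] g] by simp_all
  have hg: "(\<lambda>x. h (fst x) (snd x) - g (fst x) (snd x)) \<in> borel_measurable (borel \<Otimes>\<^sub>M (borel :: 'a measure))"
    using h g by measurable
  have L: "h s \<in> Lp p" "g s \<in> Lp p" if "s \<in> {0<..t}" for s
    using order.strict_trans1[OF H[OF that]] order.strict_trans1[OF G[OF that]] fin by (auto simp: Lp_iff_eLnorm ennreal_mult_less_top)
  have "AE z in lborel. integrable lborel (\<lambda>s. indicator {0..t} s * S (t - s) (h s) z)"
    using H by (rule V_estimate(1)[OF h _ p t \<beta> a fin(1)])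
  moreover have "AE z in lborel. integrable lborel (\<lambda>s. indicator {0..t} s * S (t - s) (g s) z)"
    using G by (rule V_estimate(1)[OF g _ p t \<beta> a fin(2)])
  ultimately have "AE z in lborel. V (\<lambda>s z. h s z - g s z) t z = V h t z - V g t z"
  proof eventually_elim
    case (elim z)
    have "V (\<lambda>s z. h s z - g s z) t z = (\<integral>s. indicator {0..t} s * S (t - s) (h s) z - indicator {0..t} s * S (t - s) (g s) z \<partial>lborel)"
      unfolding V_def
    proof (intro integral_cong_AE)
      show "(\<lambda>s. indicator {0..t} s * S (t - s) (\<lambda>z. h s z - g s z) z) \<in> borel_measurable lborel"
        using measurable_compose[OF measurable_Pair2'[of z borel lborel] V_integrand_measurable[OF hg, of t]] by simp
      show "(\<lambda>s. indicator {0..t} s * S (t - s) (h s) z - indicator {0..t} s * S (t - s) (g s) z) \<in> borel_measurable lborel"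
        using elim by (intro borel_measurable_diff) auto
      have "AE s in lborel. s \<noteq> (0::real)" by (rule AE_lborel_singleton)
      then show "AE s in lborel. indicator {0..t} s * S (t - s) (\<lambda>z. h s z - g s z) z = indicator {0..t} s * S (t - s) (h s) z - indicator {0..t} s * S (t - s) (g s) z"
      proof eventually_elim
        case (elim s)
        then show ?case using S_diff[OF L(1) L(2) p(1) p(1), of s s "t - s" z] by (auto simp: indicator_def)
      qed
    qed
    also have "\<dots> = V h t z - V g t z" unfolding V_def using elim by (intro Bochner_Integration.integral_diff)
    finally show ?case .
  qed
  then have "AE z in lborel. ennreal \<bar>V h t z - V g t z\<bar> = ennreal \<bar>V (\<lambda>s z. h s z - g s z) t z\<bar>"
    by eventually_elim simp
  from eLnorm_cong_AE[OF this, of e] show ?thesis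
    using V_estimate(2)[OF hg _ p t \<beta> a fin(3)] E by simp
qed

lemma V_cong_AE:
  assumes h: "\<And>s. h s \<in> borel_measurable borel" and g: "\<And>s. g s \<in> borel_measurable borel"
    and hg: "\<And>s. s \<in> {0<..t} \<Longrightarrow> AE z in lborel. h s z = g s z"
    and m: "(\<lambda>x. h (fst x) (snd x)) \<in> borel_measurable (borel \<Otimes>\<^sub>M (borel :: 'a measure))"
      "(\<lambda>x. g (fst x) (snd x)) \<in> borel_measurable (borel \<Otimes>\<^sub>M (borel :: 'a measure))"
  shows "V h t z = V g t z"
  unfolding V_def
proof (intro integral_cong_AE)
  show "(\<lambda>s. indicator {0..t} s * S (t - s) (h s) z) \<in> borel_measurable lborel"
    "(\<lambda>s. indicator {0..t} s * S (t - s) (g s) z) \<in> borel_measurable lborel"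
    using measurable_compose[OF measurable_Pair2'[of z borel lborel] V_integrand_measurable[OF m(1), of t]]
      measurable_compose[OF measurable_Pair2'[of z borel lborel] V_integrand_measurable[OF m(2), of t]] by simp_all
  have "AE s in lborel. s \<noteq> 0 \<and> s \<noteq> t" using AE_lborel_singleton[of 0] AE_lborel_singleton[of t] by eventually_elim auto
  then show "AE s in lborel. indicator {0..t} s * S (t - s) (h s) z = indicator {0..t} s * S (t - s) (g s) z"
  proof eventually_elim
    case (elim s)
    show ?case
    proof (cases "s \<in> {0..t}")
      case True
      then have "S (t - s) (h s) = S (t - s) (g s)" using elim h g by (intro S_cong_AE hg) auto
      then show ?thesis by simp
    qed simp
  qed
qed

text \<open>In L^p the semigroup contracts, so the integrand is dominated by H * s^(-\<beta>)
  whatever the final time, and dominated convergence in s suffices. A higher norm would bring in a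
  second singularity that moves with t.\<close>

lemma V_continuous:
  assumes h: "(\<lambda>x. h (fst x) (snd x)) \<in> borel_measurable (borel \<Otimes>\<^sub>M (borel :: 'a measure))"
    and H: "\<And>s. s \<in> {0<..T} \<Longrightarrow> eLnorm p (\<lambda>z. ennreal \<bar>h s z\<bar>) \<le> H * ennreal (s powr (- \<beta>))"
    and p: "1 \<le> p" and \<beta>: "\<beta> < 1" and fin: "H < \<top>"
    and t: "t \<in> {0<..T}" and X: "\<And>n. X n \<in> {0<..T}" "X \<longlonglongrightarrow> t"
  shows "(\<lambda>n. eLnorm p (\<lambda>z. ennreal \<bar>V h (X n) z - V h t z\<bar>)) \<longlonglongrightarrow> 0"
proof -
  have hm [measurable]: "h s \<in> borel_measurable borel" for s
    using measurable_compose[OF measurable_Pair1'[of s borel borel] h] by simp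
  have L: "h s \<in> Lp p" if "s \<in> {0<..T}" for s
    using order.strict_trans1[OF H[OF that]] fin by (auto simp: Lp_iff_eLnorm ennreal_mult_less_top)
  define I where "I r s z = indicator {0..r} s * S (r - s) (h s) z" for r s z
  have Im: "(\<lambda>x. I r (fst x) (snd x)) \<in> borel_measurable (lborel \<Otimes>\<^sub>M borel)" for r
    unfolding I_def by (rule V_integrand_measurable[OF h])
  have Dm: "(\<lambda>x. I (X n) (fst x) (snd x) - I t (fst x) (snd x)) \<in> borel_measurable (lborel \<Otimes>\<^sub>M borel)" for n
    using Im[of "X n"] Im[of t] by measurable
  have Is: "I r s \<in> borel_measurable borel" for r s
    unfolding I_def by measurable
  define w where "w s = 2 * H * (ennreal (s powr (- \<beta>)) * indicator {0..T} s)" for s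
  have [measurable]: "w \<in> borel_measurable lborel" unfolding w_def by measurable
  have wfin: "(\<integral>\<^sup>+s. w s \<partial>lborel) < \<top>"
    using nn_integral_powr_finite[of "- \<beta>" T] \<beta> t fin unfolding w_def
    by (subst nn_integral_cmult) (auto simp: ennreal_mult_less_top)
  have Ile: "eLnorm p (\<lambda>z. ennreal \<bar>I r s z\<bar>) \<le> H * (ennreal (s powr (- \<beta>)) * indicator {0..T} s)" if "r \<in> {0<..T}" "s \<noteq> 0" for r s
  proof (cases "s \<in> {0..r}")
    case True
    have "eLnorm p (\<lambda>z. ennreal \<bar>S (r - s) (h s) z\<bar>) \<le> eLnorm p (\<lambda>z. ennreal \<bar>h s z\<bar>)"
      using True p by (intro eLnorm_S_le) auto
    also have "\<dots> \<le> H * ennreal (s powr (- \<beta>))" using True that by (intro H) auto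
    finally show ?thesis using True that by (simp add: I_def)
  qed (simp add: I_def)
  have wle: "AE s in lborel. eLnorm p (\<lambda>z. ennreal \<bar>I (X n) s z - I t s z\<bar>) \<le> w s" for n
  proof -
    have "AE s in lborel. s \<noteq> (0::real)" by (rule AE_lborel_singleton)
    then show ?thesis
    proof eventually_elim
      case (elim s)
      have "eLnorm p (\<lambda>z. ennreal \<bar>I (X n) s z - I t s z\<bar>) \<le> eLnorm p (\<lambda>z. ennreal \<bar>I (X n) s z\<bar>) + eLnorm p (\<lambda>z. ennreal \<bar>- I t s z\<bar>)"
        using eLnorm_abs_add_le[of "I (X n) s" "\<lambda>z. - I t s z" p] p Is by simp
      also have "\<dots> \<le> H * (ennreal (s powr (- \<beta>)) * indicator {0..T} s) + H * (ennreal (s powr (- \<beta>)) * indicator {0..T} s)"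
        using Ile[OF X(1)[of n] elim] Ile[OF t elim] by (intro add_mono) auto
      also have "\<dots> = w s" by (simp add: w_def mult_2 distrib_right)
      finally show ?case .
    qed
  qed
  have conv: "AE s in lborel. (\<lambda>n. eLnorm p (\<lambda>z. ennreal \<bar>I (X n) s z - I t s z\<bar>)) \<longlonglongrightarrow> 0"
  proof -
    have "AE s in lborel. s \<noteq> 0 \<and> s \<noteq> t" using AE_lborel_singleton[of 0] AE_lborel_singleton[of t] by eventually_elim auto
    then show ?thesis
    proof eventually_elim
      case (elim s)
      \<comment> \<open>Times beyond t drop out once X n < s; times before t use strong continuity
        at the positive time t - s.\<close>
      consider "s < 0 \<or> t < s" | "0 < s" "s < t" using elim by linarith
      then show ?case
      proof cases
        case 1
        have "\<forall>\<^sub>F n in sequentially. s \<notin> {0..X n}"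
        proof (cases "s < 0")
          case False
          then have "t < s" using 1 by simp
          from order_tendstoD(2)[OF X(2) this] show ?thesis by eventually_elim auto
        qed simp
        then have "\<forall>\<^sub>F n in sequentially. eLnorm p (\<lambda>z. ennreal \<bar>I (X n) s z - I t s z\<bar>) = 0"
          by eventually_elim (use 1 in \<open>auto simp: I_def indicator_def\<close>)
        then show ?thesis by (rule tendsto_eventually)
      next
        case 2
        have "(\<lambda>n. eLnorm p (\<lambda>z. ennreal \<bar>S (X n - s) (h s) z - S (t - s) (h s) z\<bar>)) \<longlonglongrightarrow> 0"
          using 2 t by (intro S_continuous_pos' L p tendsto_intros X(2)) auto
        then show ?thesis
        proof (rule Lim_transform_eventually)
          show "\<forall>\<^sub>F n in sequentially. eLnorm p (\<lambda>z. ennreal \<bar>S (X n - s) (h s) z - S (t - s) (h s) z\<bar>) = eLnorm p (\<lambda>z. ennreal \<bar>I (X n) s z - I t s z\<bar>)"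
            using order_tendstoD(1)[OF X(2) 2(2)] by eventually_elim (use 2 in \<open>simp add: I_def\<close>)
        qed
      qed
    qed
  qed
  have 0: "(\<lambda>n. \<integral>\<^sup>+s. eLnorm p (\<lambda>z. ennreal \<bar>I (X n) s z - I t s z\<bar>) \<partial>lborel) \<longlonglongrightarrow> 0"
  proof (rule nn_integral_dominated[OF _ _ wle wfin conv])
    show "(\<lambda>s. eLnorm p (\<lambda>z. ennreal \<bar>I (X n) s z - I t s z\<bar>)) \<in> borel_measurable lborel" for n
      by (rule measurable_eLnorm) (use Dm[of n] in measurable)
  qed simp
  have le: "eLnorm p (\<lambda>z. ennreal \<bar>V h (X n) z - V h t z\<bar>) \<le> (\<integral>\<^sup>+s. eLnorm p (\<lambda>z. ennreal \<bar>I (X n) s z - I t s z\<bar>) \<partial>lborel)" for n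
  proof -
    have fin': "(\<integral>\<^sup>+s. eLnorm p (\<lambda>z. ennreal \<bar>I (X n) s z - I t s z\<bar>) \<partial>lborel) < \<top>"
      using nn_integral_mono_AE[OF wle] wfin by (rule order.strict_trans1)
    have int: "AE z in lborel. integrable lborel (\<lambda>s. I r s z)" if "r \<in> {0<..T}" for r
      unfolding I_def using that H p \<beta> fin by (intro V_estimate(1)[OF h, where e=p and H=H and \<beta>=\<beta> and p=p]) auto
    have "AE z in lborel. ennreal \<bar>V h (X n) z - V h t z\<bar> = ennreal \<bar>\<integral>s. I (X n) s z - I t s z \<partial>lborel\<bar>"
      using int[OF X(1)[of n]] int[OF t] by eventually_elim (simp add: V_def I_def[symmetric])
    from eLnorm_cong_AE[OF this, of p] show ?thesis
      using eLnorm_integral_le(2)[OF sigma_finite_lborel Dm p fin'] by simp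
  qed
  show ?thesis by (rule tendsto_sandwich[OF _ _ tendsto_const 0]) (use le in auto)
qed

section \<open>Weighted bounds and the Picard iteration\<close>

lemma eLnorm_u_Duhamel_le:
  assumes "f \<in> Lp p" "1 \<le> p" "p \<le> e" "0 < t"
  shows "eLnorm e (\<lambda>z. ennreal \<bar>S t f z\<bar>) \<le> ennreal (c * Lp_norm p f * t powr (- (D * (1 / p - 1 / e))))"
proof -
  have c0: "0 \<le> c" using c_ge_1 by simp
  show ?thesis
    using eLnorm_S_smoothing[OF Lp_measurable[OF assms(1)] assms(4,2,3)] c0
    by (simp add: ennreal_Lp_norm[OF assms(1), symmetric] ennreal_mult[symmetric] mult_ac)
qed

lemma nonlinearity_joint_measurable:
  assumes "(\<lambda>x. w (fst x) (snd x)) \<in> borel_measurable (borel \<Otimes>\<^sub>M (borel :: 'a measure))"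
  shows "(\<lambda>x. nonlinearity \<rho> (w (fst x)) (snd x)) \<in> borel_measurable (borel \<Otimes>\<^sub>M (borel :: 'a measure))"
  using assms by (rule nonlinearity_measurable)

lemma eLnorm_nonlinearity_weighted:
  fixes w :: "'a \<Rightarrow> real"
  assumes w: "eLnorm (\<rho> * p) (\<lambda>z. ennreal \<bar>w z\<bar>) \<le> ennreal (R * s powr (- \<alpha>))"
    and "0 \<le> R" "0 < p" "0 < \<rho>"
  shows "eLnorm p (\<lambda>z. ennreal \<bar>nonlinearity \<rho> w z\<bar>) \<le> ennreal (R powr \<rho>) * ennreal (s powr (- (\<rho> * \<alpha>)))"
proof -
  have "eLnorm p (\<lambda>z. ennreal \<bar>nonlinearity \<rho> w z\<bar>) \<le> epowr (ennreal (R * s powr (- \<alpha>))) \<rho>"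
    using epowr_mono[OF w, of \<rho>] assms(3,4) by (simp add: eLnorm_nonlinearity)
  also have "\<dots> = ennreal (R powr \<rho>) * ennreal (s powr (- (\<rho> * \<alpha>)))"
    using assms(2) by (simp add: powr_mult powr_powr ennreal_mult epowr_mult mult.commute)
  finally show ?thesis .
qed

lemma eLnorm_nonlinearity_diff_weighted:
  fixes v w :: "'a \<Rightarrow> real"
  assumes [measurable]: "v \<in> borel_measurable borel" "w \<in> borel_measurable borel"
    and v: "eLnorm (\<rho> * p) (\<lambda>z. ennreal \<bar>v z\<bar>) \<le> ennreal (R * s powr (- \<alpha>))"
    and w: "eLnorm (\<rho> * p) (\<lambda>z. ennreal \<bar>w z\<bar>) \<le> ennreal (R * s powr (- \<alpha>))"
    and vw: "eLnorm (\<rho> * p) (\<lambda>z. ennreal \<bar>v z - w z\<bar>) \<le> ennreal (E * s powr (- \<alpha>))"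
    and R: "0 \<le> R" and E: "0 \<le> E" and p: "1 \<le> p" and \<rho>: "1 < \<rho>"
  shows "eLnorm p (\<lambda>z. ennreal \<bar>nonlinearity \<rho> v z - nonlinearity \<rho> w z\<bar>) \<le> ennreal (\<rho> * (2 * R) powr (\<rho> - 1) * E) * ennreal (s powr (- (\<rho> * \<alpha>)))"
proof -
  have "1 \<le> \<rho> * p" using mult_mono[of 1 \<rho> 1 p] p \<rho> by simp
  have "eLnorm p (\<lambda>z. ennreal \<bar>nonlinearity \<rho> v z - nonlinearity \<rho> w z\<bar>) \<le>
    ennreal \<rho> * epowr (eLnorm (\<rho> * p) (\<lambda>z. ennreal \<bar>v z\<bar>) + eLnorm (\<rho> * p) (\<lambda>z. ennreal \<bar>w z\<bar>)) (\<rho> - 1) *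
      eLnorm (\<rho> * p) (\<lambda>z. ennreal \<bar>v z - w z\<bar>)"
    using p \<rho> \<open>1 \<le> \<rho> * p\<close> by (intro eLnorm_nonlinearity_diff) (auto simp: field_simps)
  also have "\<dots> \<le> ennreal \<rho> * epowr (ennreal (R * s powr (- \<alpha>)) + ennreal (R * s powr (- \<alpha>))) (\<rho> - 1) * ennreal (E * s powr (- \<alpha>))"
    using \<rho> by (intro mult_mono epowr_mono add_mono v w vw) auto
  also have "ennreal (R * s powr (- \<alpha>)) + ennreal (R * s powr (- \<alpha>)) = ennreal ((2 * R) * s powr (- \<alpha>))"
    using R by (simp add: ennreal_plus[symmetric] del: ennreal_plus)
  also have "ennreal \<rho> * epowr (ennreal ((2 * R) * s powr (- \<alpha>))) (\<rho> - 1) * ennreal (E * s powr (- \<alpha>)) =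
     ennreal (\<rho> * (2 * R) powr (\<rho> - 1) * E * (s powr (- (\<alpha> * (\<rho> - 1))) * s powr (- \<alpha>)))"
    using R E \<rho> by (simp add: ennreal_mult[symmetric] powr_mult powr_powr mult_ac)
  also have "s powr (- (\<alpha> * (\<rho> - 1))) * s powr (- \<alpha>) = s powr (- (\<rho> * \<alpha>))"
    by (simp add: powr_add[symmetric] algebra_simps)
  finally show ?thesis using R E \<rho> by (simp add: ennreal_mult)
qed

text \<open>For \<open>t \<le> T\<close> with \<open>T\<close> small the Picard iterates contract in the norm
  \<open>sup t\<^sup>\<alpha> \<parallel>u(t)\<parallel>\<close> of \<open>L\<^bsup>\<rho>p\<^esup>\<close>; their pointwise limit exists by completeness.\<close>

lemma mild_existence_pointwise:
  assumes \<rho>: "1 < \<rho>" and p: "1 \<le> p" "D * (\<rho> - 1) < p" and u0: "u0 \<in> Lp p"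
  defines "\<alpha> \<equiv> D * (1 / p - 1 / (\<rho> * p))"
  obtains T R u where "0 < T" "0 \<le> R" "(\<lambda>x. u (fst x) (snd x)) \<in> borel_measurable (borel \<Otimes>\<^sub>M (borel :: 'a measure))"
    "\<And>t. t \<in> {0<..T} \<Longrightarrow> eLnorm (\<rho> * p) (\<lambda>z. ennreal \<bar>u t z\<bar>) \<le> ennreal (R * t powr (- \<alpha>))"
    "\<And>t z. t \<in> {0<..T} \<Longrightarrow> u t z = S t u0 z + V (\<lambda>s. nonlinearity \<rho> (u s)) t z"
    "u 0 = u0"
proof -
  define r where "r = \<rho> * p"
  have r: "p \<le> r" "1 \<le> r" using p \<rho> mult_mono[of 1 \<rho> p p] mult_mono[of 1 \<rho> 1 p] by (auto simp: r_def)
  define \<beta> where "\<beta> = D * (\<rho> - 1) / p"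
  have \<beta>: "0 < \<beta>" "\<beta> < 1" using p \<rho> D_ge_1 by (auto simp: \<beta>_def)
  have \<alpha>\<beta>: "\<rho> * \<alpha> = \<beta>" using p \<rho> by (simp add: \<alpha>_def \<beta>_def field_simps)
  have \<alpha>: "0 < \<alpha>" "\<alpha> < 1"
  proof -
    have "\<alpha> = \<beta> / \<rho>" using \<alpha>\<beta> \<rho> by (simp add: field_simps)
    moreover have "0 < \<beta> / \<rho>" "\<beta> / \<rho> < 1" using \<beta> \<rho> by simp_all
    ultimately show "0 < \<alpha>" "\<alpha> < 1" by simp_all
  qed
  have \<alpha>_eq: "D * (1 / p - 1 / r) = \<alpha>" by (simp add: \<alpha>_def r_def)
  have c0: "0 \<le> c" using c_ge_1 by simp
  define U where "U = Lp_norm p u0"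
  \<comment> \<open>Sized so that the free evolution takes up at most half of the ball, leaving the
    other half to the Duhamel term.\<close>
  define R where "R = 2 * c * U + 1"
  have U: "0 \<le> U" by (simp add: U_def)
  have R: "0 < R" "c * U \<le> R / 2" using c0 U by (auto simp: R_def add_nonneg_pos)
  define Bt where "Bt = Beta (1 - \<beta>) (1 - \<alpha>)"
  have Bt: "0 \<le> Bt" unfolding Bt_def using \<alpha> \<beta> by (intro has_integral_nonneg[OF has_integral_Beta_real]) auto
  \<comment> \<open>The Lipschitz constant of the Duhamel map without its power of T; the summand 1
    keeps it positive, so that Q * T^(1 - \<beta>) = 1/2 can be solved for T.\<close>
  define Q where "Q = c * Bt * (\<rho> * (2 * R) powr (\<rho> - 1)) + 1"
  have Q: "0 < Q" unfolding Q_def using c0 Bt \<rho> by (intro add_nonneg_pos mult_nonneg_nonneg) auto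
  define T where "T = (1 / (2 * Q)) powr (1 / (1 - \<beta>))"
  have T: "0 < T" "T powr (1 - \<beta>) = 1 / (2 * Q)" using Q \<beta> by (auto simp: T_def powr_powr)
  have QT: "Q * T powr (1 - \<beta>) = 1 / 2" using T(2) Q by simp
  have contr: "c * Bt * (\<rho> * (2 * R) powr (\<rho> - 1)) * T powr (1 - \<beta>) \<le> 1 / 2"
  proof -
    have "c * Bt * (\<rho> * (2 * R) powr (\<rho> - 1)) * T powr (1 - \<beta>) \<le> Q * T powr (1 - \<beta>)"
      by (intro mult_right_mono) (auto simp: Q_def)
    then show ?thesis using QT by simp
  qed
  have tpow: "t powr (1 - \<alpha> - \<beta>) \<le> T powr (1 - \<beta>) * t powr (- \<alpha>)" if "t \<in> {0<..T}" for t
  proof -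
    have "t powr (1 - \<alpha> - \<beta>) = t powr (1 - \<beta>) * t powr (- \<alpha>)" by (simp add: powr_add[symmetric] algebra_simps)
    also have "\<dots> \<le> T powr (1 - \<beta>) * t powr (- \<alpha>)" using that \<beta> by (intro mult_right_mono powr_mono2) auto
    finally show ?thesis .
  qed
  \<comment> \<open>The radius \<open>R'\<close> is left free: the iterates stay within R, but their
    limit is only shown to stay within 3 * R.\<close>
  have lip: "eLnorm r (\<lambda>z. ennreal \<bar>V (\<lambda>s. nonlinearity \<rho> (v s)) t z - V (\<lambda>s. nonlinearity \<rho> (w s)) t z\<bar>)
      \<le> ennreal (c * Bt * (\<rho> * (2 * R') powr (\<rho> - 1)) * T powr (1 - \<beta>) * E * t powr (- \<alpha>))"
    if v: "(\<lambda>x. v (fst x) (snd x)) \<in> borel_measurable (borel \<Otimes>\<^sub>M (borel :: 'a measure))"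
      and w: "(\<lambda>x. w (fst x) (snd x)) \<in> borel_measurable (borel \<Otimes>\<^sub>M (borel :: 'a measure))"
      and vR: "\<And>s. s \<in> {0<..T} \<Longrightarrow> eLnorm r (\<lambda>z. ennreal \<bar>v s z\<bar>) \<le> ennreal (R' * s powr (- \<alpha>))"
      and wR: "\<And>s. s \<in> {0<..T} \<Longrightarrow> eLnorm r (\<lambda>z. ennreal \<bar>w s z\<bar>) \<le> ennreal (R' * s powr (- \<alpha>))"
      and vwE: "\<And>s. s \<in> {0<..T} \<Longrightarrow> eLnorm r (\<lambda>z. ennreal \<bar>v s z - w s z\<bar>) \<le> ennreal (E * s powr (- \<alpha>))"
      and R': "0 \<le> R'" and E: "0 \<le> E" and t: "t \<in> {0<..T}" for v w R' E t
  proof -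
    have vm: "v s \<in> borel_measurable borel" and wm: "w s \<in> borel_measurable borel" for s
      using measurable_compose[OF measurable_Pair1'[of s borel borel] v] measurable_compose[OF measurable_Pair1'[of s borel borel] w] by simp_all
    have "eLnorm r (\<lambda>z. ennreal \<bar>V (\<lambda>s. nonlinearity \<rho> (v s)) t z - V (\<lambda>s. nonlinearity \<rho> (w s)) t z\<bar>) \<le>
      ennreal (\<rho> * (2 * R') powr (\<rho> - 1) * E) * ennreal (c * Beta (1 - \<beta>) (1 - D * (1 / p - 1 / r)) * t powr (1 - D * (1 / p - 1 / r) - \<beta>))"
    proof (rule V_diff_estimate[OF nonlinearity_joint_measurable[OF v] nonlinearity_joint_measurable[OF w], where p=p and e=r and \<beta>=\<beta> and H="ennreal (R' powr \<rho>)" and G="ennreal (R' powr \<rho>)"])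
      fix s assume "s \<in> {0<..t}"
      then have s: "s \<in> {0<..T}" using t by auto
      show "eLnorm p (\<lambda>z. ennreal \<bar>nonlinearity \<rho> (v s) z\<bar>) \<le> ennreal (R' powr \<rho>) * ennreal (s powr (- \<beta>))"
        "eLnorm p (\<lambda>z. ennreal \<bar>nonlinearity \<rho> (w s) z\<bar>) \<le> ennreal (R' powr \<rho>) * ennreal (s powr (- \<beta>))"
        using vR[OF s] wR[OF s] R' p \<rho> unfolding \<alpha>\<beta>[symmetric] r_def by (intro eLnorm_nonlinearity_weighted; simp)+
      show "eLnorm p (\<lambda>z. ennreal \<bar>nonlinearity \<rho> (v s) z - nonlinearity \<rho> (w s) z\<bar>) \<le> ennreal (\<rho> * (2 * R') powr (\<rho> - 1) * E) * ennreal (s powr (- \<beta>))"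
        using vR[OF s] wR[OF s] vwE[OF s] R' E p \<rho> unfolding \<alpha>\<beta>[symmetric] r_def by (intro eLnorm_nonlinearity_diff_weighted vm wm; simp)
    qed (use p r t \<beta> \<alpha> in \<open>auto simp: \<alpha>_eq\<close>)
    also have "\<dots> = ennreal (\<rho> * (2 * R') powr (\<rho> - 1) * E * (c * Bt * t powr (1 - \<alpha> - \<beta>)))"
      using \<rho> E c0 Bt unfolding \<alpha>_eq Bt_def by (intro ennreal_mult[symmetric]) auto
    also have "\<dots> \<le> ennreal (\<rho> * (2 * R') powr (\<rho> - 1) * E * (c * Bt * (T powr (1 - \<beta>) * t powr (- \<alpha>))))"
      using \<rho> E c0 Bt by (intro ennreal_leI mult_left_mono tpow t) auto
    finally show ?thesis by (simp add: mult_ac)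
  qed
  have zero: "V (\<lambda>s. nonlinearity \<rho> (\<lambda>_. 0)) t z = 0" for t z
  proof -
    have "S s (\<lambda>_. 0) = (\<lambda>_. 0)" for s by (auto simp: S_def)
    then show ?thesis by (simp add: V_def nonlinearity_def[abs_def])
  qed
  define w where "w = rec_nat (\<lambda>t. S t u0) (\<lambda>_ v t z. S t u0 z + V (\<lambda>s. nonlinearity \<rho> (v s)) t z)"
  have w0: "w 0 = (\<lambda>t. S t u0)" and wSuc: "w (Suc n) = (\<lambda>t z. S t u0 z + V (\<lambda>s. nonlinearity \<rho> (w n s)) t z)" for n
    by (simp_all add: w_def)
  have Su0: "(\<lambda>x. S (fst x) u0 (snd x)) \<in> borel_measurable (borel \<Otimes>\<^sub>M (borel :: 'a measure))"
    using Lp_measurable[OF u0] by measurable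
  have wm: "(\<lambda>x. w n (fst x) (snd x)) \<in> borel_measurable (borel \<Otimes>\<^sub>M (borel :: 'a measure))" for n
  proof (induction n)
    case (Suc n)
    then show ?case
      unfolding wSuc by (intro borel_measurable_add Su0 V_measurable nonlinearity_joint_measurable)
  qed (simp add: w0 Su0)
  have wm' [measurable]: "w n s \<in> borel_measurable borel" for n s
    using measurable_compose[OF measurable_Pair1'[of s borel borel] wm[of n]] by simp
  have Sr: "eLnorm r (\<lambda>z. ennreal \<bar>S t u0 z\<bar>) \<le> ennreal (R / 2 * t powr (- \<alpha>))" if "t \<in> {0<..T}" for t
  proof -
    have "eLnorm r (\<lambda>z. ennreal \<bar>S t u0 z\<bar>) \<le> ennreal (c * U * t powr (- \<alpha>))"
      using eLnorm_u_Duhamel_le[OF u0 p(1) r(1), of t] that by (simp add: U_def \<alpha>_eq)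
    also have "\<dots> \<le> ennreal (R / 2 * t powr (- \<alpha>))" using R by (intro ennreal_leI mult_right_mono) auto
    finally show ?thesis .
  qed
  \<comment> \<open>This is the Lipschitz estimate against the zero function, whose Duhamel term
    vanishes.\<close>
  have Vr: "eLnorm r (\<lambda>z. ennreal \<bar>V (\<lambda>s. nonlinearity \<rho> (v s)) t z\<bar>) \<le> ennreal (R / 2 * t powr (- \<alpha>))"
    if v: "(\<lambda>x. v (fst x) (snd x)) \<in> borel_measurable (borel \<Otimes>\<^sub>M (borel :: 'a measure))"
      and vR: "\<And>s. s \<in> {0<..T} \<Longrightarrow> eLnorm r (\<lambda>z. ennreal \<bar>v s z\<bar>) \<le> ennreal (R * s powr (- \<alpha>))"
      and t: "t \<in> {0<..T}" for v t
  proof -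
    have "eLnorm r (\<lambda>z. ennreal \<bar>V (\<lambda>s. nonlinearity \<rho> (v s)) t z - V (\<lambda>s. nonlinearity \<rho> (\<lambda>_. 0)) t z\<bar>)
      \<le> ennreal (c * Bt * (\<rho> * (2 * R) powr (\<rho> - 1)) * T powr (1 - \<beta>) * R * t powr (- \<alpha>))"
      using v vR t R by (intro lip[where w="\<lambda>_ _. 0"]) auto
    also have "\<dots> \<le> ennreal (1 / 2 * R * t powr (- \<alpha>))"
      using R by (intro ennreal_leI mult_right_mono contr) auto
    finally show ?thesis by (simp add: zero)
  qed
  have wR: "eLnorm r (\<lambda>z. ennreal \<bar>w n t z\<bar>) \<le> ennreal (R * t powr (- \<alpha>))" if "t \<in> {0<..T}" for n t
    using that
  proof (induction n arbitrary: t)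
    case 0
    have "R / 2 * t powr (- \<alpha>) \<le> R * t powr (- \<alpha>)" using R by (intro mult_right_mono) auto
    from order_trans[OF Sr[OF 0] ennreal_leI[OF this]] show ?case by (simp add: w0)
  next
    case (Suc n)
    have "eLnorm r (\<lambda>z. ennreal \<bar>w (Suc n) t z\<bar>) \<le> eLnorm r (\<lambda>z. ennreal \<bar>S t u0 z\<bar>) + eLnorm r (\<lambda>z. ennreal \<bar>V (\<lambda>s. nonlinearity \<rho> (w n s)) t z\<bar>)"
      unfolding wSuc
    proof (intro eLnorm_abs_add_le r)
      show "S t u0 \<in> borel_measurable borel" using Lp_measurable[OF u0] by measurable
      show "V (\<lambda>s. nonlinearity \<rho> (w n s)) t \<in> borel_measurable borel"
        using measurable_compose[OF measurable_Pair1'[of t borel borel] V_measurable[OF nonlinearity_joint_measurable[OF wm]]] by simp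
    qed
    also have "\<dots> \<le> ennreal (R / 2 * t powr (- \<alpha>)) + ennreal (R / 2 * t powr (- \<alpha>))"
      by (intro add_mono Sr Vr wm Suc)
    also have "\<dots> = ennreal (R * t powr (- \<alpha>))" using R by (subst ennreal_plus[symmetric]) auto
    finally show ?case .
  qed
  have diff: "eLnorm r (\<lambda>z. ennreal \<bar>w (Suc n) t z - w n t z\<bar>) \<le> ennreal (R * (1 / 2) ^ n * t powr (- \<alpha>))" if "t \<in> {0<..T}" for n t
    using that
  proof (induction n arbitrary: t)
    case 0
    have "R / 2 * t powr (- \<alpha>) \<le> R * t powr (- \<alpha>)" using R by (intro mult_right_mono) auto
    then have "ennreal (R / 2 * t powr (- \<alpha>)) \<le> ennreal (R * t powr (- \<alpha>))" by (rule ennreal_leI)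
    moreover have "eLnorm r (\<lambda>z. ennreal \<bar>V (\<lambda>s. nonlinearity \<rho> (w 0 s)) t z\<bar>) \<le> ennreal (R / 2 * t powr (- \<alpha>))"
      by (rule Vr[OF wm wR 0])
    ultimately show ?case
      by (simp add: wSuc w0 order_trans)
  next
    case (Suc n)
    have "eLnorm r (\<lambda>z. ennreal \<bar>w (Suc (Suc n)) t z - w (Suc n) t z\<bar>) =
      eLnorm r (\<lambda>z. ennreal \<bar>V (\<lambda>s. nonlinearity \<rho> (w (Suc n) s)) t z - V (\<lambda>s. nonlinearity \<rho> (w n s)) t z\<bar>)"
      by (simp add: wSuc[of "Suc n"] wSuc[of n])
    also have "\<dots> \<le> ennreal (c * Bt * (\<rho> * (2 * R) powr (\<rho> - 1)) * T powr (1 - \<beta>) * (R * (1 / 2) ^ n) * t powr (- \<alpha>))"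
      using R by (intro lip wm wR Suc) auto
    also have "\<dots> \<le> ennreal (1 / 2 * (R * (1 / 2) ^ n) * t powr (- \<alpha>))"
      using R by (intro ennreal_leI mult_right_mono contr) auto
    finally show ?case by simp
  qed
  define W where "W t z = lim (\<lambda>n. w n t z)" for t z
  have Wm: "(\<lambda>x. W (fst x) (snd x)) \<in> borel_measurable (borel \<Otimes>\<^sub>M (borel :: 'a measure))"
    unfolding W_def by (intro borel_measurable_lim_metric wm)
  have Wm' [measurable]: "W s \<in> borel_measurable borel" for s
    using measurable_compose[OF measurable_Pair1'[of s borel borel] Wm] by simp
  have Ww: "eLnorm r (\<lambda>z. ennreal \<bar>W t z - w n t z\<bar>) \<le> ennreal (2 * R * (1 / 2) ^ n * t powr (- \<alpha>))" if t: "t \<in> {0<..T}" for n t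
  proof -
    define cc where "cc n = R * (1 / 2) ^ n * t powr (- \<alpha>)" for n
    have cc: "cc j = R * t powr (- \<alpha>) * (1 / 2) ^ j" for j by (simp add: cc_def)
    have summ: "summable cc" unfolding cc by (intro summable_mult summable_geometric) auto
    have "eLnorm r (\<lambda>z. ennreal \<bar>W t z - w n t z\<bar>) \<le> ennreal (\<Sum>j. cc (j + n))"
      unfolding W_def using R by (intro Lp_complete(2) r summ) (auto simp: cc_def intro: diff[OF t])
    also have "(\<Sum>j. cc (j + n)) = 2 * R * (1 / 2) ^ n * t powr (- \<alpha>)"
      using suminf_geometric[of "1 / 2 :: real"] suminf_mult[of "\<lambda>j. (1 / 2 :: real) ^ j" "R * t powr (- \<alpha>) * (1 / 2) ^ n"]
      by (simp add: cc power_add mult_ac summable_geometric)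
    finally show ?thesis .
  qed
  have WR: "eLnorm r (\<lambda>z. ennreal \<bar>W t z\<bar>) \<le> ennreal (3 * R * t powr (- \<alpha>))" if t: "t \<in> {0<..T}" for t
  proof -
    have "eLnorm r (\<lambda>z. ennreal \<bar>W t z\<bar>) \<le> eLnorm r (\<lambda>z. ennreal \<bar>W t z - w 0 t z\<bar>) + eLnorm r (\<lambda>z. ennreal \<bar>w 0 t z\<bar>)"
      using r by (intro eLnorm_abs_le_add_diff) auto
    also have "\<dots> \<le> ennreal (2 * R * (1 / 2) ^ 0 * t powr (- \<alpha>)) + ennreal (R * t powr (- \<alpha>))"
      by (intro add_mono Ww wR t)
    also have "\<dots> = ennreal (3 * R * t powr (- \<alpha>))" using R by (subst ennreal_plus[symmetric]) auto
    finally show ?thesis .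
  qed
  \<comment> \<open>One further Picard step is applied to the limit W. It agrees with W almost
    everywhere at each positive time, so the equation for \<open>u\<close> holds at every point
    rather than only up to null sets.\<close>
  define u where "u t z = (if t \<le> 0 then u0 z else S t u0 z + V (\<lambda>s. nonlinearity \<rho> (W s)) t z)" for t z
  have um: "(\<lambda>x. u (fst x) (snd x)) \<in> borel_measurable (borel \<Otimes>\<^sub>M (borel :: 'a measure))"
  proof -
    note [measurable] = Lp_measurable[OF u0] Su0 V_measurable[OF nonlinearity_joint_measurable[OF Wm]]
    show ?thesis unfolding u_def by measurable
  qed
  have um' [measurable]: "u s \<in> borel_measurable borel" for s
    using measurable_compose[OF measurable_Pair1'[of s borel borel] um] by simp
  have uW: "AE z in lborel. u t z = W t z" if t: "t \<in> {0<..T}" for t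
  proof -
    define B where "B = c * Bt * (\<rho> * (2 * (3 * R)) powr (\<rho> - 1)) * T powr (1 - \<beta>)"
    have B: "0 \<le> B" using c0 Bt \<rho> by (simp add: B_def)
    have le: "eLnorm r (\<lambda>z. ennreal \<bar>u t z - W t z\<bar>) \<le> ennreal ((B * (2 * R) + R) * t powr (- \<alpha>) * (1 / 2) ^ n)" for n
    proof -
      have "eLnorm r (\<lambda>z. ennreal \<bar>u t z - W t z\<bar>) \<le> eLnorm r (\<lambda>z. ennreal \<bar>u t z - w (Suc n) t z\<bar>) + eLnorm r (\<lambda>z. ennreal \<bar>w (Suc n) t z - W t z\<bar>)"
        using r by (intro eLnorm_abs_triangle) auto
      also have "\<dots> \<le> ennreal (B * (2 * R * (1 / 2) ^ n) * t powr (- \<alpha>)) + ennreal (2 * R * (1 / 2) ^ Suc n * t powr (- \<alpha>))"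
      proof (rule add_mono)
        have "eLnorm r (\<lambda>z. ennreal \<bar>u t z - w (Suc n) t z\<bar>) = eLnorm r (\<lambda>z. ennreal \<bar>V (\<lambda>s. nonlinearity \<rho> (W s)) t z - V (\<lambda>s. nonlinearity \<rho> (w n s)) t z\<bar>)"
          using t by (simp add: u_def wSuc)
        also have "\<dots> \<le> ennreal (B * (2 * R * (1 / 2) ^ n) * t powr (- \<alpha>))"
          unfolding B_def
        proof (intro lip Wm wm WR Ww t)
          fix s assume "s \<in> {0<..T}"
          moreover have "R * s powr (- \<alpha>) \<le> 3 * R * s powr (- \<alpha>)" using R by (intro mult_right_mono) auto
          ultimately show "eLnorm r (\<lambda>z. ennreal \<bar>w n s z\<bar>) \<le> ennreal (3 * R * s powr (- \<alpha>))"
            using order_trans[OF wR ennreal_leI] by blast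
        qed (use R in auto)
        finally show "eLnorm r (\<lambda>z. ennreal \<bar>u t z - w (Suc n) t z\<bar>) \<le> ennreal (B * (2 * R * (1 / 2) ^ n) * t powr (- \<alpha>))" .
        show "eLnorm r (\<lambda>z. ennreal \<bar>w (Suc n) t z - W t z\<bar>) \<le> ennreal (2 * R * (1 / 2) ^ Suc n * t powr (- \<alpha>))"
          using Ww[OF t, of "Suc n"] by (simp add: eLnorm_abs_minus_commute[of r "w _ t"])
      qed
      also have "\<dots> = ennreal ((B * (2 * R) + R) * t powr (- \<alpha>) * (1 / 2) ^ n)"
        using B R by (subst ennreal_plus[symmetric]) (auto simp: algebra_simps)
      finally show ?thesis .
    qed
    have "(\<lambda>n. ennreal ((B * (2 * R) + R) * t powr (- \<alpha>) * (1 / 2) ^ n)) \<longlonglongrightarrow> ennreal ((B * (2 * R) + R) * t powr (- \<alpha>) * 0)"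
      by (intro tendsto_ennrealI tendsto_intros LIMSEQ_power_zero) auto
    then have "eLnorm r (\<lambda>z. ennreal \<bar>u t z - W t z\<bar>) \<le> ennreal ((B * (2 * R) + R) * t powr (- \<alpha>) * 0)"
      using le by (intro tendsto_lowerbound[where F=sequentially]) auto
    then have "AE z in lborel. ennreal \<bar>u t z - W t z\<bar> = 0" by (intro eLnorm_eq_0D) auto
    then show ?thesis by eventually_elim simp
  qed
  show thesis
  proof (rule that[of T "3 * R" u])
    fix t assume t: "t \<in> {0<..T}"
    have "AE z in lborel. ennreal \<bar>u t z\<bar> = ennreal \<bar>W t z\<bar>" using uW[OF t] by eventually_elim simp
    from eLnorm_cong_AE[OF this, of r] WR[OF t] show "eLnorm (\<rho> * p) (\<lambda>z. ennreal \<bar>u t z\<bar>) \<le> ennreal (3 * R * t powr (- \<alpha>))"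
      by (simp add: r_def)
    fix z
    have "V (\<lambda>s. nonlinearity \<rho> (W s)) t z = V (\<lambda>s. nonlinearity \<rho> (u s)) t z"
    proof (rule V_cong_AE)
      fix s assume "s \<in> {0<..t}"
      then have "s \<in> {0<..T}" using t by auto
      from uW[OF this] show "AE z in lborel. nonlinearity \<rho> (W s) z = nonlinearity \<rho> (u s) z"
        by eventually_elim (simp add: nonlinearity_def)
    qed (auto intro: nonlinearity_joint_measurable um Wm)
    then show "u t z = S t u0 z + V (\<lambda>s. nonlinearity \<rho> (u s)) t z"
      using t by (simp add: u_def)
  qed (use T R um in \<open>auto simp: u_def\<close>)
qed

text \<open>What remains is regularity. Continuity in L^p down to t = 0 uses that the Duhamel term
  vanishes there; continuity in L^(\<rho> p) follows by interpolation and makes the source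
  continuous in L^p, so that the pointwise time integral is a Bochner integral.\<close>

lemma mild_existence:
  assumes \<rho>: "1 < \<rho>" and p: "1 \<le> p" "D * (\<rho> - 1) < p" and u0: "u0 \<in> Lp p"
  shows "\<exists>T>0. \<exists>u. mild p \<rho> T u0 u \<and> Lp_continuous_on (\<rho> * p) {0<..T} u \<and>
    bdd_above ((\<lambda>t. t powr (D / (\<rho> * p) * (\<rho> - 1)) * Lp_norm (\<rho> * p) (u t)) ` {0<..T})"
proof -
  define \<alpha> where "\<alpha> = D * (1 / p - 1 / (\<rho> * p))"
  show ?thesis
  proof (rule mild_existence_pointwise[OF \<rho> p u0, folded \<alpha>_def])
  fix T R u assume T: "0 < T" and R: "0 \<le> R" and um: "(\<lambda>x. u (fst x) (snd x)) \<in> borel_measurable (borel \<Otimes>\<^sub>M (borel :: 'a measure))"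
    and uR: "\<And>t. t \<in> {0<..T} \<Longrightarrow> eLnorm (\<rho> * p) (\<lambda>z. ennreal \<bar>u t z\<bar>) \<le> ennreal (R * t powr (- \<alpha>))"
    and u_eq: "\<And>t z. t \<in> {0<..T} \<Longrightarrow> u t z = S t u0 z + V (\<lambda>s. nonlinearity \<rho> (u s)) t z"
    and u_0: "u 0 = u0"
  define r where "r = \<rho> * p"
  have r: "p < r" "1 \<le> r" using p \<rho> mult_strict_right_mono[of 1 \<rho> p] mult_mono[of 1 \<rho> 1 p] by (auto simp: r_def)
  define \<beta> where "\<beta> = D * (\<rho> - 1) / p"
  have \<beta>: "0 < \<beta>" "\<beta> < 1" using p \<rho> D_ge_1 by (auto simp: \<beta>_def)
  have \<alpha>\<beta>: "\<rho> * \<alpha> = \<beta>" using p \<rho> by (simp add: \<alpha>_def \<beta>_def field_simps)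
  have \<alpha>_eq: "D / (\<rho> * p) * (\<rho> - 1) = \<alpha>" using p \<rho> by (simp add: \<alpha>_def field_simps)
  have \<alpha>: "0 < \<alpha>" "\<alpha> < 1"
  proof -
    have "\<alpha> = \<beta> / \<rho>" using \<alpha>\<beta> \<rho> by (simp add: field_simps)
    moreover have "0 < \<beta> / \<rho>" "\<beta> / \<rho> < 1" using \<beta> \<rho> by simp_all
    ultimately show "0 < \<alpha>" "\<alpha> < 1" by simp_all
  qed
  have um' [measurable]: "u s \<in> borel_measurable borel" for s
    using measurable_compose[OF measurable_Pair1'[of s borel borel] um] by simp
  have c0: "0 \<le> c" using c_ge_1 by simp
  define h where "h s = nonlinearity \<rho> (u s)" for s
  have hm: "(\<lambda>x. h (fst x) (snd x)) \<in> borel_measurable (borel \<Otimes>\<^sub>M (borel :: 'a measure))"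
    unfolding h_def by (rule nonlinearity_joint_measurable[OF um])
  have hm' [measurable]: "h s \<in> borel_measurable borel" for s
    using measurable_compose[OF measurable_Pair1'[of s borel borel] hm] by simp
  define H where "H = R powr \<rho>"
  have H0: "0 \<le> H" by (simp add: H_def)
  have hH: "eLnorm p (\<lambda>z. ennreal \<bar>h s z\<bar>) \<le> ennreal H * ennreal (s powr (- \<beta>))" if "s \<in> {0<..T}" for s
    using eLnorm_nonlinearity_weighted[OF uR[OF that] R] p \<rho> by (simp add: h_def H_def \<alpha>\<beta>)
  have hL: "h s \<in> Lp p" if "s \<in> {0<..T}" for s
    using order.strict_trans1[OF hH[OF that]] by (simp add: Lp_iff_eLnorm ennreal_mult_less_top)
  have ur: "u t \<in> Lp r" if "t \<in> {0<..T}" for t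
    using order.strict_trans1[OF uR[OF that]] by (simp add: Lp_iff_eLnorm r_def)
  note Vm = V_measurable[OF hm]
  have Vm' [measurable]: "V h s \<in> borel_measurable borel" for s
    using measurable_compose[OF measurable_Pair1'[of s borel borel] Vm] by simp
  note [measurable] = Lp_measurable[OF u0]
  have u_eq': "u t = (\<lambda>z. S t u0 z + V h t z)" if "t \<in> {0<..T}" for t
    using u_eq[OF that] by (simp add: h_def[abs_def] fun_eq_iff)
  have Vle: "eLnorm e (\<lambda>z. ennreal \<bar>V h t z\<bar>) \<le> ennreal H * ennreal (c * Beta (1 - \<beta>) (1 - D * (1 / p - 1 / e)) * t powr (1 - D * (1 / p - 1 / e) - \<beta>))"
    if "t \<in> {0<..T}" "p \<le> e" "D * (1 / p - 1 / e) < 1" for t e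
    using that p \<beta> by (intro V_estimate(2)[OF hm hH]) auto
  have up: "u t \<in> Lp p" if "t \<in> {0..T}" for t
  proof (cases "t = 0")
    case False
    then have t: "t \<in> {0<..T}" using that by auto
    have "V h t \<in> Lp p" using order.strict_trans1[OF Vle[OF t, of p]] by (simp add: Lp_iff_eLnorm ennreal_mult_less_top)
    then show ?thesis unfolding u_eq'[OF t] using t by (intro Lp_add S_Lp u0 p) auto
  qed (simp add: u_0 u0)
  have uE: "Lp_continuous_on p {0..T} u"
  proof (rule Lp_continuous_onI[OF up p(1)])
    fix t X assume t: "t \<in> {0..T}" and X: "\<And>n. X n \<in> {0..T}" "X \<longlonglongrightarrow> t"
    \<comment> \<open>The Duhamel part is given the value 0 at time 0, so that one decomposition of
      \<open>u\<close> is valid on the closed interval.\<close>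
    define G where "G s = (if s = 0 then (\<lambda>_. 0) else V h s)" for s
    have Gm [measurable]: "G s \<in> borel_measurable borel" for s by (simp add: G_def)
    have uG: "u s = (\<lambda>z. S s u0 z + G s z)" if "s \<in> {0..T}" for s
      using that u_eq'[of s] by (cases "s = 0") (auto simp: G_def u_0)
    have "(\<lambda>n. eLnorm p (\<lambda>z. ennreal \<bar>G (X n) z - G t z\<bar>)) \<longlonglongrightarrow> 0"
    proof (cases "t = 0")
      case True
      \<comment> \<open>In L^p the Duhamel term is at most B * t^(1 - \<beta>), which tends to 0
        with t.\<close>
      define B where "B = H * (c * Beta (1 - \<beta>) 1)"
      have B0: "0 \<le> Beta (1 - \<beta>) 1" using \<beta> by (intro has_integral_nonneg[OF has_integral_Beta_real]) auto
      have le: "eLnorm p (\<lambda>z. ennreal \<bar>G (X n) z - G t z\<bar>) \<le> ennreal (B * X n powr (1 - \<beta>))" for n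
      proof (cases "X n = 0")
        case False
        then have "X n \<in> {0<..T}" using X(1)[of n] by auto
        from Vle[OF this, of p] False True show ?thesis
          using H0 c0 B0 by (simp add: G_def B_def ennreal_mult[symmetric] mult_ac)
      qed (simp add: G_def True)
      have "(\<lambda>n. ennreal (B * X n powr (1 - \<beta>))) \<longlonglongrightarrow> ennreal (B * 0 powr (1 - \<beta>))"
        using X \<beta> True by (intro tendsto_ennrealI tendsto_mult tendsto_const tendsto_powr' X(2)[unfolded True]) auto
      then have "(\<lambda>n. ennreal (B * X n powr (1 - \<beta>))) \<longlonglongrightarrow> 0" by simp
      then show ?thesis by (rule tendsto_sandwich[OF _ _ tendsto_const, rotated 2]) (use le in auto)
    next
      case False
      then have t': "t \<in> {0<..T}" "0 < t" using t by auto
      define Y where "Y n = (if 0 < X n then X n else t)" for n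
      have ev: "\<forall>\<^sub>F n in sequentially. 0 < X n" by (rule order_tendstoD(1)[OF X(2) t'(2)])
      have Y: "Y \<longlonglongrightarrow> t"
        by (rule Lim_transform_eventually[OF X(2)]) (use ev in \<open>eventually_elim, simp add: Y_def\<close>)
      have "(\<lambda>n. eLnorm p (\<lambda>z. ennreal \<bar>V h (Y n) z - V h t z\<bar>)) \<longlonglongrightarrow> 0"
        using X(1) t' \<beta> by (intro V_continuous[OF hm hH p(1) _ _ t'(1) _ Y]) (auto simp: Y_def)
      then show ?thesis
        by (rule Lim_transform_eventually) (use ev in \<open>eventually_elim, use t' in \<open>simp add: Y_def G_def\<close>\<close>)
    qed
    from tendsto_add[OF S_continuous[OF u0 p(1), of t X] this]
    have conv: "(\<lambda>n. eLnorm p (\<lambda>z. ennreal \<bar>S (X n) u0 z - S t u0 z\<bar>) + eLnorm p (\<lambda>z. ennreal \<bar>G (X n) z - G t z\<bar>)) \<longlonglongrightarrow> 0"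
      using X t by simp
    have le: "eLnorm p (\<lambda>z. ennreal \<bar>u (X n) z - u t z\<bar>) \<le> eLnorm p (\<lambda>z. ennreal \<bar>S (X n) u0 z - S t u0 z\<bar>) + eLnorm p (\<lambda>z. ennreal \<bar>G (X n) z - G t z\<bar>)" for n
    proof -
      have "u (X n) z - u t z = (S (X n) u0 z - S t u0 z) + (G (X n) z - G t z)" for z
        unfolding uG[OF X(1)[of n]] uG[OF t] by simp
      then show ?thesis using p by (simp only:) (intro eLnorm_abs_add_le; simp)
    qed
    show "(\<lambda>n. eLnorm p (\<lambda>z. ennreal \<bar>u (X n) z - u t z\<bar>)) \<longlonglongrightarrow> 0"
      by (rule tendsto_sandwich[OF _ _ tendsto_const conv]) (use le in auto)
  qed
  \<comment> \<open>An exponent slightly above r. In the minimum, 1/(2 * r) keeps 1/e positive, and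
    (1 - \<alpha>)/(2 * D) keeps D * (1/p - 1/e) at most (1 + \<alpha>)/2 < 1, so that both parts of
    the solution still lie in L^e.\<close>
  define e where "e = 1 / (1 / r - min (1 / (2 * r)) ((1 - \<alpha>) / (2 * D)))"
  have e: "r < e" "D * (1 / p - 1 / e) < 1"
  proof -
    define m where "m = min (1 / (2 * r)) ((1 - \<alpha>) / (2 * D))"
    have r0: "0 < r" using r by simp
    have m: "0 < m" "m \<le> 1 / (2 * r)" "m \<le> (1 - \<alpha>) / (2 * D)" using r \<alpha> D_ge_1 by (auto simp: m_def)
    have pos: "0 < 1 / r - m" using m(2) r0 by (simp add: field_simps)
    have ie: "1 / e = 1 / r - m" by (simp add: e_def m_def)
    have "1 / e < 1 / r" "0 < 1 / e" using ie m pos by auto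
    then have "0 < e" by simp
    then show "r < e" using \<open>1 / e < 1 / r\<close> r0 by (simp add: field_simps)
    have "D * m \<le> D * ((1 - \<alpha>) / (2 * D))" using m(3) D_ge_1 by (intro mult_left_mono) auto
    also have "\<dots> = (1 - \<alpha>) / 2" using D_ge_1 by simp
    finally have "D * m \<le> (1 - \<alpha>) / 2" .
    moreover have "D * (1 / p - 1 / e) = \<alpha> + D * m" unfolding ie by (simp add: \<alpha>_def r_def algebra_simps)
    ultimately show "D * (1 / p - 1 / e) < 1" using \<alpha> by (simp add: field_simps)
  qed
  \<comment> \<open>Near a positive time the L^e norms are bounded by the continuous function
    \<open>F\<close>; interpolation with the continuity in L^p then yields continuity in
    L^r.\<close>
  have uX: "Lp_continuous_on r {0<..T} u"
  proof (rule Lp_continuous_onI[OF ur r(2)])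
    fix t X assume t: "t \<in> {0<..T}" and X: "\<And>n. X n \<in> {0<..T}" "X \<longlonglongrightarrow> t"
    define a where "a = D * (1 / p - 1 / e)"
    define B where "B = H * (c * Beta (1 - \<beta>) (1 - a))"
    have B0: "0 \<le> Beta (1 - \<beta>) (1 - a)" using \<beta> e by (intro has_integral_nonneg[OF has_integral_Beta_real]) (auto simp: a_def)
    define F where "F s = c * Lp_norm p u0 * s powr (- a) + B * s powr (1 - a - \<beta>)" for s
    have F0: "0 \<le> F s" for s using c0 B0 H0 by (simp add: F_def B_def)
    have pe: "p \<le> e" using e r by simp
    have uF: "eLnorm e (\<lambda>z. ennreal \<bar>u s z\<bar>) \<le> ennreal (F s)" if s: "s \<in> {0<..T}" for s
    proof -
      have "eLnorm e (\<lambda>z. ennreal \<bar>u s z\<bar>) \<le> eLnorm e (\<lambda>z. ennreal \<bar>S s u0 z\<bar>) + eLnorm e (\<lambda>z. ennreal \<bar>V h s z\<bar>)"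
        unfolding u_eq'[OF s] using pe p by (intro eLnorm_abs_add_le) auto
      also have "\<dots> \<le> ennreal (c * Lp_norm p u0 * s powr (- a)) + ennreal H * ennreal (c * Beta (1 - \<beta>) (1 - a) * s powr (1 - a - \<beta>))"
        unfolding a_def using s pe p e by (intro add_mono Vle eLnorm_u_Duhamel_le u0) auto
      also have "\<dots> = ennreal (F s)"
        using c0 H0 B0 by (simp add: F_def B_def ennreal_mult[symmetric] ennreal_plus[symmetric] mult_ac del: ennreal_plus)
      finally show ?thesis .
    qed
    have "(\<lambda>n. F (X n)) \<longlonglongrightarrow> F t"
      unfolding F_def using t by (intro tendsto_intros X(2)) auto
    then have ev: "\<forall>\<^sub>F n in sequentially. F (X n) < F t + 1" by (rule order_tendstoD) simp
    obtain \<theta> where \<theta>: "\<theta> \<in> {0<..<1}" "\<And>f. f \<in> borel_measurable borel \<Longrightarrow> eLnorm r f \<le> epowr (eLnorm p f) (1 - \<theta>) * epowr (eLnorm e (f :: 'a \<Rightarrow> ennreal)) \<theta>"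
      using eLnorm_interpolate[of p r e, where 'a='a] p r e by auto
    have le: "\<forall>\<^sub>F n in sequentially. eLnorm r (\<lambda>z. ennreal \<bar>u (X n) z - u t z\<bar>) \<le> epowr (ennreal (2 * F t + 1)) \<theta> * epowr (eLnorm p (\<lambda>z. ennreal \<bar>u (X n) z - u t z\<bar>)) (1 - \<theta>)"
      using ev
    proof eventually_elim
      case (elim n)
      have "eLnorm e (\<lambda>z. ennreal \<bar>u (X n) z - u t z\<bar>) \<le> eLnorm e (\<lambda>z. ennreal \<bar>u (X n) z\<bar>) + eLnorm e (\<lambda>z. ennreal \<bar>- u t z\<bar>)"
        using eLnorm_abs_add_le[of "u (X n)" "\<lambda>z. - u t z" e] pe p by simp
      also have "\<dots> \<le> ennreal (F t + 1) + ennreal (F t)"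
        using order_trans[OF uF[OF X(1)[of n]] ennreal_leI[of "F (X n)" "F t + 1"]] uF[OF t] elim by (intro add_mono) auto
      also have "\<dots> = ennreal (2 * F t + 1)" using F0 by (subst ennreal_plus[symmetric]) auto
      finally have "epowr (eLnorm e (\<lambda>z. ennreal \<bar>u (X n) z - u t z\<bar>)) \<theta> \<le> epowr (ennreal (2 * F t + 1)) \<theta>"
        using \<theta>(1) by (intro epowr_mono) auto
      note * = this
      have "eLnorm r (\<lambda>z. ennreal \<bar>u (X n) z - u t z\<bar>) \<le> epowr (eLnorm p (\<lambda>z. ennreal \<bar>u (X n) z - u t z\<bar>)) (1 - \<theta>) * epowr (eLnorm e (\<lambda>z. ennreal \<bar>u (X n) z - u t z\<bar>)) \<theta>"
        by (rule \<theta>(2)) measurable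
      also have "\<dots> \<le> epowr (eLnorm p (\<lambda>z. ennreal \<bar>u (X n) z - u t z\<bar>)) (1 - \<theta>) * epowr (ennreal (2 * F t + 1)) \<theta>"
        using * by (rule mult_left_mono) simp
      finally show ?case by (simp add: mult.commute)
    qed
    have "(\<lambda>n. eLnorm p (\<lambda>z. ennreal \<bar>u (X n) z - u t z\<bar>)) \<longlonglongrightarrow> 0"
      using t X(1) by (intro Lp_continuous_onD[OF uE p(1) _ _ X(2)]) (auto simp: less_imp_le)
    from tendsto_epowr[OF this, of "1 - \<theta>"] have "(\<lambda>n. epowr (eLnorm p (\<lambda>z. ennreal \<bar>u (X n) z - u t z\<bar>)) (1 - \<theta>)) \<longlonglongrightarrow> 0"
      using \<theta>(1) by simp
    from ennreal_tendsto_cmult[OF _ this, of "epowr (ennreal (2 * F t + 1)) \<theta>"]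
    have conv: "(\<lambda>n. epowr (ennreal (2 * F t + 1)) \<theta> * epowr (eLnorm p (\<lambda>z. ennreal \<bar>u (X n) z - u t z\<bar>)) (1 - \<theta>)) \<longlonglongrightarrow> 0"
      using F0[of t] by simp
    show "(\<lambda>n. eLnorm r (\<lambda>z. ennreal \<bar>u (X n) z - u t z\<bar>)) \<longlonglongrightarrow> 0"
      by (rule tendsto_sandwich[OF _ le tendsto_const conv]) auto
  qed
  have bdd: "bdd_above ((\<lambda>t. t powr \<alpha> * Lp_norm r (u t)) ` {0<..T})"
  proof (rule bdd_aboveI2)
    fix t assume t: "t \<in> {0<..T}"
    have "ennreal (Lp_norm r (u t)) \<le> ennreal (R * t powr (- \<alpha>))"
      using uR[OF t] ennreal_Lp_norm[OF ur[OF t]] by (simp add: r_def)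
    then have "Lp_norm r (u t) \<le> R * t powr (- \<alpha>)" using R by (subst (asm) ennreal_le_iff) auto
    then have "t powr \<alpha> * Lp_norm r (u t) \<le> t powr \<alpha> * (R * t powr (- \<alpha>))" by (intro mult_left_mono) auto
    also have "\<dots> = R" using t by (simp add: powr_minus)
    finally show "t powr \<alpha> * Lp_norm r (u t) \<le> R" .
  qed
  \<comment> \<open>Continuity in L^(\<rho> p) is used here: the nonlinearity is locally Lipschitz
    from L^(\<rho> p) to L^p.\<close>
  have hcont: "(\<lambda>n. eLnorm p (\<lambda>z. ennreal \<bar>h (X n) z - h \<tau> z\<bar>)) \<longlonglongrightarrow> 0"
    if \<tau>: "\<tau> \<in> {0<..T}" and X: "\<And>n. X n \<in> {0<..T}" "X \<longlonglongrightarrow> \<tau>" for X \<tau>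
  proof -
    define N where "N s = R * s powr (- \<alpha>)" for s
    have N0: "0 \<le> N s" for s using R by (simp add: N_def)
    have uc: "(\<lambda>n. eLnorm r (\<lambda>z. ennreal \<bar>u (X n) z - u \<tau> z\<bar>)) \<longlonglongrightarrow> 0"
      by (rule Lp_continuous_onD[OF uX r(2) \<tau> X])
    have "(\<lambda>n. N (X n)) \<longlonglongrightarrow> N \<tau>"
      unfolding N_def using \<tau> by (intro tendsto_intros X(2)) auto
    then have ev: "\<forall>\<^sub>F n in sequentially. N (X n) < N \<tau> + 1" by (rule order_tendstoD) simp
    define Q where "Q = ennreal \<rho> * epowr (ennreal (2 * N \<tau> + 1)) (\<rho> - 1)"
    have le: "\<forall>\<^sub>F n in sequentially. eLnorm p (\<lambda>z. ennreal \<bar>h (X n) z - h \<tau> z\<bar>) \<le> Q * eLnorm r (\<lambda>z. ennreal \<bar>u (X n) z - u \<tau> z\<bar>)"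
      using ev
    proof eventually_elim
      case (elim n)
      have "eLnorm p (\<lambda>z. ennreal \<bar>h (X n) z - h \<tau> z\<bar>) \<le>
        ennreal \<rho> * epowr (eLnorm r (\<lambda>z. ennreal \<bar>u (X n) z\<bar>) + eLnorm r (\<lambda>z. ennreal \<bar>u \<tau> z\<bar>)) (\<rho> - 1) * eLnorm r (\<lambda>z. ennreal \<bar>u (X n) z - u \<tau> z\<bar>)"
        unfolding h_def using \<rho> p r by (intro eLnorm_nonlinearity_diff) (auto simp: r_def field_simps)
      also have "\<dots> \<le> ennreal \<rho> * epowr (ennreal (N \<tau> + 1) + ennreal (N \<tau>)) (\<rho> - 1) * eLnorm r (\<lambda>z. ennreal \<bar>u (X n) z - u \<tau> z\<bar>)"
        using order_trans[OF uR[OF X(1)[of n]] ennreal_leI[of "N (X n)" "N \<tau> + 1", unfolded N_def]] uR[OF \<tau>] elim \<rho> unfolding N_def r_def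
        by (intro mult_right_mono mult_left_mono epowr_mono add_mono) auto
      also have "ennreal (N \<tau> + 1) + ennreal (N \<tau>) = ennreal (2 * N \<tau> + 1)" using N0 by (subst ennreal_plus[symmetric]) auto
      finally show ?case by (simp add: Q_def)
    qed
    have "Q < \<top>" by (simp add: Q_def ennreal_mult_less_top)
    from ennreal_tendsto_cmult[OF this uc] have conv: "(\<lambda>n. Q * eLnorm r (\<lambda>z. ennreal \<bar>u (X n) z - u \<tau> z\<bar>)) \<longlonglongrightarrow> 0" by simp
    show ?thesis by (rule tendsto_sandwich[OF _ le tendsto_const conv]) auto
  qed
  \<comment> \<open>The exponent p serves as witness, since in L^p the source is bounded by a
    multiple of s^(-\<beta>).\<close>
  have adm: "admissible_source \<rho> T u"
    unfolding admissible_source_def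
  proof (intro exI[of _ p] conjI p)
    have AE1: "AE s in restrict_space lborel {0..T}. s \<in> {0<..T}"
      by (rule AE_restrict_Icc) auto
    then show "AE s in restrict_space lborel {0..T}. nonlinearity \<rho> (u s) \<in> Lp p"
      by eventually_elim (use hL in \<open>simp add: h_def\<close>)
    have "(\<integral>\<^sup>+s. ennreal (Lp_norm p (nonlinearity \<rho> (u s))) \<partial>restrict_space lborel {0..T}) \<le> (\<integral>\<^sup>+s. ennreal H * ennreal (s powr (- \<beta>)) \<partial>restrict_space lborel {0..T})"
    proof (rule nn_integral_mono_AE)
      show "AE s in restrict_space lborel {0..T}. ennreal (Lp_norm p (nonlinearity \<rho> (u s))) \<le> ennreal H * ennreal (s powr (- \<beta>))"
        using AE1 by eventually_elim (use hH hL in \<open>simp add: h_def ennreal_Lp_norm\<close>)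
    qed
    also have "\<dots> = (\<integral>\<^sup>+s. ennreal H * (ennreal (s powr (- \<beta>)) * indicator {0..T} s) \<partial>lborel)"
      by (simp add: nn_integral_restrict_space mult.assoc)
    also have "\<dots> < \<infinity>"
      using nn_integral_powr_finite[of "- \<beta>" T] \<beta> T by (subst nn_integral_cmult) (auto simp: ennreal_mult_less_top)
    finally show "(\<integral>\<^sup>+s. ennreal (Lp_norm p (nonlinearity \<rho> (u s))) \<partial>restrict_space lborel {0..T}) < \<infinity>" .
  qed
  have "mild p \<rho> T u0 u"
    unfolding mild_def E_space_def
  proof (intro conjI ballI CollectI uE adm)
    fix t assume t: "t \<in> {0..T}"
    define g where "g s = S (t - s) (h s)" for s
    have gm: "(\<lambda>x. g (fst x) (snd x)) \<in> borel_measurable (borel \<Otimes>\<^sub>M (borel :: 'a measure))"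
    proof -
      note [measurable (raw)] = joint_measurable_compose[OF hm]
      show ?thesis unfolding g_def by measurable
    qed
    have sT: "s \<in> {0<..T}" "0 < t - s" if "s \<in> {0<..<t}" for s using that t by auto
    have I: "has_Lp_integral p (restrict_space lborel {0..t}) g (\<lambda>z. \<integral>\<tau>. g \<tau> z \<partial>restrict_space lborel {0..t})"
    proof (rule has_Lp_integralI[OF gm p(1)])
      show "g \<tau> \<in> Lp p" if "\<tau> \<in> {0<..<t}" for \<tau>
        unfolding g_def using sT[OF that] by (intro S_Lp hL p) auto
      show "eLnorm p (\<lambda>z. ennreal \<bar>g \<tau> z\<bar>) \<le> ennreal (H * \<tau> powr (- \<beta>))" if "\<tau> \<in> {0<..<t}" for \<tau>
        using order_trans[OF eLnorm_S_le[of "h \<tau>" "t - \<tau>" p] hH[OF sT(1)[OF that]]] sT[OF that] p H0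
        by (simp add: g_def ennreal_mult)
      fix \<tau> X assume \<tau>: "\<tau> \<in> {0<..<t}" and X: "\<And>n. X n \<in> {0<..<t}" "X \<longlonglongrightarrow> \<tau>"
      have "(\<lambda>n. eLnorm p (\<lambda>z. ennreal \<bar>S (t - X n) (h \<tau>) z - S (t - \<tau>) (h \<tau>) z\<bar>)) \<longlonglongrightarrow> 0"
        using sT[OF \<tau>] by (intro S_continuous_pos' hL p tendsto_intros X(2)) auto
      from tendsto_add[OF hcont[OF sT(1)[OF \<tau>] sT(1)[OF X(1)] X(2)] this]
      have conv: "(\<lambda>n. eLnorm p (\<lambda>z. ennreal \<bar>h (X n) z - h \<tau> z\<bar>) + eLnorm p (\<lambda>z. ennreal \<bar>S (t - X n) (h \<tau>) z - S (t - \<tau>) (h \<tau>) z\<bar>)) \<longlonglongrightarrow> 0" by simp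
      have le: "eLnorm p (\<lambda>z. ennreal \<bar>g (X n) z - g \<tau> z\<bar>) \<le> eLnorm p (\<lambda>z. ennreal \<bar>h (X n) z - h \<tau> z\<bar>) + eLnorm p (\<lambda>z. ennreal \<bar>S (t - X n) (h \<tau>) z - S (t - \<tau>) (h \<tau>) z\<bar>)" for n
      proof -
        have tX: "0 \<le> t - X n" using sT(2)[OF X(1)[of n]] by simp
        have "eLnorm p (\<lambda>z. ennreal \<bar>g (X n) z - g \<tau> z\<bar>) \<le> eLnorm p (\<lambda>z. ennreal \<bar>S (t - X n) (h (X n)) z - S (t - X n) (h \<tau>) z\<bar>) + eLnorm p (\<lambda>z. ennreal \<bar>S (t - X n) (h \<tau>) z - S (t - \<tau>) (h \<tau>) z\<bar>)"
          unfolding g_def using p by (intro eLnorm_abs_triangle) auto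
        also have "eLnorm p (\<lambda>z. ennreal \<bar>S (t - X n) (h (X n)) z - S (t - X n) (h \<tau>) z\<bar>) = eLnorm p (\<lambda>z. ennreal \<bar>S (t - X n) (\<lambda>z. h (X n) z - h \<tau> z) z\<bar>)"
          using S_diff[OF hL[OF sT(1)[OF X(1)[of n]]] hL[OF sT(1)[OF \<tau>]] p(1) p(1) tX] by simp
        also have "\<dots> \<le> eLnorm p (\<lambda>z. ennreal \<bar>h (X n) z - h \<tau> z\<bar>)"
          using tX p by (intro eLnorm_S_le) auto
        finally show ?thesis by (simp add: add_right_mono)
      qed
      show "(\<lambda>n. eLnorm p (\<lambda>z. ennreal \<bar>g (X n) z - g \<tau> z\<bar>)) \<longlonglongrightarrow> 0"
        by (rule tendsto_sandwich[OF _ _ tendsto_const conv]) (use le in auto)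
    qed (use t \<beta> H0 in auto)
    have "u t z = S t u0 z + (\<integral>\<tau>. g \<tau> z \<partial>restrict_space lborel {0..t})" for z
    proof (cases "t = 0")
      case True
      have "AE s in restrict_space lborel {0..0 :: real}. g s z = 0"
        by (rule AE_restrict_Icc) simp
      then have "(\<integral>\<tau>. g \<tau> z \<partial>restrict_space lborel {0..0}) = 0" by (rule integral_eq_zero_AE)
      then show ?thesis using True by (simp add: u_0)
    next
      case False
      then have t': "t \<in> {0<..T}" using t by auto
      have "(\<integral>\<tau>. g \<tau> z \<partial>restrict_space lborel {0..t}) = V h t z"
        by (simp add: V_def g_def integral_restrict_space)
      then show ?thesis using u_eq'[OF t'] by simp
    qed
    then show "\<exists>I. has_Lp_integral p (restrict_space lborel {0..t}) (\<lambda>s. S (t - s) (nonlinearity \<rho> (u s))) I \<and> (AE z in lborel. u t z = S t u0 z + I z)"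
      using I unfolding g_def h_def by (intro exI conjI) auto
  qed
  then show ?thesis
    using T uX bdd unfolding \<alpha>_eq r_def by blast
  qed
qed

end

section \<open>Gaussian integrals and the Mehler kernel\<close>

lemma lborel_prod_integral:
  fixes f :: "'e::euclidean_space \<Rightarrow> real \<Rightarrow> complex"
  assumes f: "\<And>b. b \<in> Basis \<Longrightarrow> integrable lborel (f b)"
  shows "integrable lborel (\<lambda>x::'e. \<Prod>b\<in>Basis. f b (x \<bullet> b))" (is "integrable _ ?F")
    and "(\<integral>(x::'e). (\<Prod>b\<in>Basis. f b (x \<bullet> b)) \<partial>lborel) = (\<Prod>b\<in>Basis. \<integral>x. f b x \<partial>lborel)"
proof -
  interpret product_sigma_finite "\<lambda>_. lborel :: real measure" ..
  let ?P = "\<Pi>\<^sub>M b\<in>(Basis::'e set). (lborel :: real measure)"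
  let ?T = "\<lambda>g. \<Sum>b\<in>(Basis::'e set). g b *\<^sub>R b"
  have T: "?T \<in> ?P \<rightarrow>\<^sub>M borel" by measurable
  have [measurable]: "f b \<in> borel_measurable borel" if "b \<in> Basis" for b
    using borel_measurable_integrable[OF f[OF that]] by simp
  have F: "?F \<in> borel_measurable borel" by measurable
  have eq: "?F (?T g) = (\<Prod>b\<in>Basis. f b (g b))" for g
    by (intro prod.cong refl) simp
  have lb: "(lborel :: 'e measure) = distr ?P borel ?T" by (rule lborel_eq)
  have int: "integrable ?P (\<lambda>g. \<Prod>b\<in>Basis. f b (g b))"
    using f by (intro product_integrable_prod) auto
  show "integrable lborel ?F"
    unfolding lb using T F int by (subst integrable_distr_eq) (simp_all add: eq)
  have "integral\<^sup>L lborel ?F = (\<integral>g. (\<Prod>b\<in>Basis. f b (g b)) \<partial>?P)"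
    unfolding lb using T F by (subst integral_distr) (simp_all add: eq)
  also have "\<dots> = (\<Prod>b\<in>Basis. \<integral>x. f b x \<partial>lborel)"
    using f by (intro product_integral_prod) auto
  finally show "integral\<^sup>L lborel ?F = (\<Prod>b\<in>Basis. \<integral>x. f b x \<partial>lborel)" .
qed

text \<open>The characteristic function of the standard normal law, rescaled by r = sqrt (2 *
  s).\<close>

lemma gaussian_fourier_1d:
  fixes s y :: real
  assumes s: "0 < s"
  shows "integrable lborel (\<lambda>x. complex_of_real (exp (- s * x\<^sup>2)) * exp (\<i> * of_real (x * y)))"
    and "(\<integral>x. complex_of_real (exp (- s * x\<^sup>2)) * exp (\<i> * of_real (x * y)) \<partial>lborel) = of_real (sqrt (pi / s) * exp (- y\<^sup>2 / (4 * s)))"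
proof -
  define r where "r = sqrt (2 * s)"
  have r: "0 < r" "r\<^sup>2 = 2 * s" using s by (auto simp: r_def)
  define f where "f x = std_normal_density x *\<^sub>R iexp ((y / r) * x)" for x
  have f_eq: "f (r * x) = (1 / sqrt (2 * pi)) *\<^sub>R (complex_of_real (exp (- s * x\<^sup>2)) * exp (\<i> * of_real (x * y)))" for x
    using r by (simp add: f_def std_normal_density_def power_mult_distrib scaleR_conv_of_real mult_ac)
  have "integrable lborel f"
    unfolding f_def by (intro Bochner_Integration.integrable_bound[OF integrable_normal_density[of 1 0]]) (auto simp: normal_density_nonneg)
  then have "integrable lborel (\<lambda>x. f (0 + r * x))" using r by (intro lborel_integrable_real_affine) auto
  then have "integrable lborel (\<lambda>x. sqrt (2 * pi) *\<^sub>R f (r * x))" by (intro integrable_scaleR_right) simp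
  then show int: "integrable lborel (\<lambda>x. complex_of_real (exp (- s * x\<^sup>2)) * exp (\<i> * of_real (x * y)))"
    unfolding f_eq by simp
  have "complex_of_real (exp (- (y / r)\<^sup>2 / 2)) = (\<integral>x. f x \<partial>lborel)"
    using fun_cong[OF char_std_normal_distribution, of "y / r"] unfolding char_def f_def
    by (subst (asm) integral_density) (auto simp: normal_density_nonneg)
  also have "\<dots> = r *\<^sub>R (\<integral>x. f (r * x) \<partial>lborel)"
    using lborel_integral_real_affine[of r f 0] r by simp
  also have "(\<integral>x. f (r * x) \<partial>lborel) = (1 / sqrt (2 * pi)) *\<^sub>R (\<integral>x. complex_of_real (exp (- s * x\<^sup>2)) * exp (\<i> * of_real (x * y)) \<partial>lborel)"
    unfolding f_eq by (rule integral_scaleR_right)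
  finally have *: "complex_of_real (exp (- (y / r)\<^sup>2 / 2)) = (r / sqrt (2 * pi)) *\<^sub>R (\<integral>x. complex_of_real (exp (- s * x\<^sup>2)) * exp (\<i> * of_real (x * y)) \<partial>lborel)"
    by simp
  have "r / sqrt (2 * pi) * sqrt (pi / s) = 1"
    using s by (simp add: r_def real_sqrt_divide real_sqrt_mult)
  then have "(\<integral>x. complex_of_real (exp (- s * x\<^sup>2)) * exp (\<i> * of_real (x * y)) \<partial>lborel) = sqrt (pi / s) *\<^sub>R complex_of_real (exp (- (y / r)\<^sup>2 / 2))"
    unfolding * scaleR_scaleR by (simp only: mult.commute[of "sqrt (pi / s)"] scaleR_one)
  then show "(\<integral>x. complex_of_real (exp (- s * x\<^sup>2)) * exp (\<i> * of_real (x * y)) \<partial>lborel) = of_real (sqrt (pi / s) * exp (- y\<^sup>2 / (4 * s)))"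
    using r by (simp add: power_divide scaleR_conv_of_real)
qed

lemma gaussian_fourier:
  fixes y :: "'e::euclidean_space"
  assumes s: "0 < s"
  shows "integrable lborel (\<lambda>x. complex_of_real (exp (- s * (norm x)\<^sup>2)) * exp (\<i> * of_real (x \<bullet> y)))"
    and "(\<integral>x. complex_of_real (exp (- s * (norm x)\<^sup>2)) * exp (\<i> * of_real (x \<bullet> y)) \<partial>lborel) =
      of_real ((pi / s) powr (real DIM('e) / 2) * exp (- (norm y)\<^sup>2 / (4 * s)))"
proof -
  have norm_sq: "(norm x)\<^sup>2 = (\<Sum>b\<in>Basis. (x \<bullet> b)\<^sup>2)" for x :: 'e
    unfolding power2_norm_eq_inner euclidean_inner[of x x] by (simp add: power2_eq_square)
  define f where "f b x = complex_of_real (exp (- s * x\<^sup>2)) * exp (\<i> * of_real (x * (y \<bullet> b)))" for b :: 'e and x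
  have f_eq: "(\<Prod>b\<in>Basis. f b (x \<bullet> b)) = complex_of_real (exp (- s * (norm x)\<^sup>2)) * exp (\<i> * of_real (x \<bullet> y))" for x
  proof -
    have "(\<Prod>b\<in>Basis. f b (x \<bullet> b)) = complex_of_real (\<Prod>b\<in>Basis. exp (- s * (x \<bullet> b)\<^sup>2)) * (\<Prod>b\<in>Basis. exp (\<i> * of_real ((x \<bullet> b) * (y \<bullet> b))))"
      by (simp add: f_def prod.distrib)
    also have "(\<Prod>b\<in>Basis. exp (- s * (x \<bullet> b)\<^sup>2)) = exp (- s * (norm x)\<^sup>2)"
      unfolding norm_sq sum_distrib_left by (rule exp_sum[symmetric]) simp
    also have "(\<Prod>b\<in>Basis. exp (\<i> * of_real ((x \<bullet> b) * (y \<bullet> b)))) = exp (\<i> * of_real (x \<bullet> y))"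
      unfolding euclidean_inner[of x y] of_real_sum sum_distrib_left by (rule exp_sum[symmetric]) simp
    finally show ?thesis .
  qed
  have int: "integrable lborel (f b)" for b
    unfolding f_def by (rule gaussian_fourier_1d[OF s])
  show "integrable lborel (\<lambda>x. complex_of_real (exp (- s * (norm x)\<^sup>2)) * exp (\<i> * of_real (x \<bullet> y)))"
    using lborel_prod_integral(1)[of f, OF int] by (simp add: f_eq)
  have "(\<integral>x. complex_of_real (exp (- s * (norm x)\<^sup>2)) * exp (\<i> * of_real (x \<bullet> y)) \<partial>lborel) = (\<Prod>b\<in>Basis. \<integral>x. f b x \<partial>lborel)"
    using lborel_prod_integral(2)[of f, OF int] by (simp add: f_eq)
  also have "\<dots> = of_real (\<Prod>b\<in>Basis. sqrt (pi / s) * exp (- (y \<bullet> b)\<^sup>2 / (4 * s)))"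
    unfolding f_def gaussian_fourier_1d(2)[OF s] by simp
  also have "(\<Prod>b\<in>Basis. sqrt (pi / s) * exp (- (y \<bullet> b)\<^sup>2 / (4 * s))) = sqrt (pi / s) ^ DIM('e) * exp (\<Sum>b\<in>Basis. - (y \<bullet> b)\<^sup>2 / (4 * s))"
    by (simp add: prod.distrib exp_sum)
  also have "(\<Sum>b\<in>Basis. - (y \<bullet> b)\<^sup>2 / (4 * s)) = - (norm y)\<^sup>2 / (4 * s)"
    by (simp add: norm_sq sum_divide_distrib sum_negf)
  also have "sqrt (pi / s) ^ DIM('e) = (pi / s) powr (real DIM('e) / 2)"
    using s by (simp add: powr_half_sqrt[symmetric] powr_powr flip: powr_realpow)
  finally show "(\<integral>x. complex_of_real (exp (- s * (norm x)\<^sup>2)) * exp (\<i> * of_real (x \<bullet> y)) \<partial>lborel) =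
      of_real ((pi / s) powr (real DIM('e) / 2) * exp (- (norm y)\<^sup>2 / (4 * s)))" .
qed

lemma gaussian_cos:
  fixes y :: "'e::euclidean_space"
  assumes s: "0 < s"
  shows "integrable lborel (\<lambda>x. exp (- s * (norm x)\<^sup>2) * cos (x \<bullet> y))"
    and "(\<integral>x. exp (- s * (norm x)\<^sup>2) * cos (x \<bullet> y) \<partial>lborel) = (pi / s) powr (real DIM('e) / 2) * exp (- (norm y)\<^sup>2 / (4 * s))"
proof -
  have Re: "Re (complex_of_real (exp (- s * (norm x)\<^sup>2)) * exp (\<i> * of_real (x \<bullet> y))) = exp (- s * (norm x)\<^sup>2) * cos (x \<bullet> y)" for x
    by (simp add: Re_exp del: of_real_exp)
  show "integrable lborel (\<lambda>x. exp (- s * (norm x)\<^sup>2) * cos (x \<bullet> y))"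
    using integrable_Re[OF gaussian_fourier(1)[OF s, of y]] unfolding Re .
  show "(\<integral>x. exp (- s * (norm x)\<^sup>2) * cos (x \<bullet> y) \<partial>lborel) = (pi / s) powr (real DIM('e) / 2) * exp (- (norm y)\<^sup>2 / (4 * s))"
    using integral_Re[OF gaussian_fourier(1)[OF s, of y]] unfolding Re gaussian_fourier(2)[OF s] by simp
qed

lemma gaussian_integrable:
  assumes s: "0 < s" shows "integrable lborel (\<lambda>x::'e::euclidean_space. exp (- s * (norm x)\<^sup>2))"
  using gaussian_cos(1)[OF s, of "0::'e"] by simp

lemma nn_integral_lborel_shift:
  fixes f :: "'e::euclidean_space \<Rightarrow> ennreal"
  assumes [measurable]: "f \<in> borel_measurable borel"
  shows "(\<integral>\<^sup>+x. f (x + a) \<partial>lborel) = (\<integral>\<^sup>+x. f x \<partial>lborel)"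
proof -
  have "(\<integral>\<^sup>+x. f x \<partial>lborel) = (\<integral>\<^sup>+x. f x \<partial>distr lborel borel ((+) a))" by (simp add: lborel_distr_plus)
  also have "\<dots> = (\<integral>\<^sup>+x. f (a + x) \<partial>lborel)" by (rule nn_integral_distr) auto
  finally show ?thesis by (simp add: add.commute)
qed

lemma nn_integral_lborel_scale:
  fixes f :: "'e::euclidean_space \<Rightarrow> ennreal"
  assumes [measurable]: "f \<in> borel_measurable borel" and "r \<noteq> 0"
  shows "(\<integral>\<^sup>+x. f x \<partial>lborel) = ennreal (\<bar>r\<bar> ^ DIM('e)) * (\<integral>\<^sup>+x. f (a + r *\<^sub>R x) \<partial>lborel)"
  using assms(2)
  by (subst lborel_affine[OF assms(2), of a]) (simp add: nn_integral_density nn_integral_distr nn_integral_cmult)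

lemma nn_integral_lborel_reflect:
  fixes f :: "'e::euclidean_space \<Rightarrow> ennreal"
  assumes "f \<in> borel_measurable borel"
  shows "(\<integral>\<^sup>+x. f (a - x) \<partial>lborel) = (\<integral>\<^sup>+x. f x \<partial>lborel)"
  using nn_integral_lborel_scale[OF assms, of "-1" a] by simp

lemma nn_integral_cmult_ennreal:
  assumes [measurable]: "f \<in> borel_measurable M" and "0 \<le> a" "\<And>x. 0 \<le> f x"
  shows "(\<integral>\<^sup>+x. ennreal (a * f x) \<partial>M) = ennreal a * (\<integral>\<^sup>+x. ennreal (f x) \<partial>M)"
  using assms by (simp add: ennreal_mult nn_integral_cmult)

lemma nn_integral_gaussian:
  assumes s: "0 < s"
  shows "(\<integral>\<^sup>+x. ennreal (exp (- s * (norm (x::'e::euclidean_space))\<^sup>2)) \<partial>lborel) = ennreal ((pi / s) powr (real DIM('e) / 2))"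
  using nn_integral_eq_integral[OF gaussian_integrable[OF s, where 'e='e]] gaussian_cos(2)[OF s, of "0::'e"] by simp

text \<open>Completing the square about B / (2 * A) and translation invariance.\<close>

lemma nn_integral_gaussian_linear:
  fixes B :: "'e::euclidean_space"
  assumes A: "0 < A"
  shows "(\<integral>\<^sup>+v. ennreal (exp (- A * (norm v)\<^sup>2 + B \<bullet> v)) \<partial>lborel) = ennreal ((pi / A) powr (real DIM('e) / 2) * exp ((norm B)\<^sup>2 / (4 * A)))"
proof -
  define a where "a = (1 / (2 * A)) *\<^sub>R B"
  have sq: "- A * (norm v)\<^sup>2 + B \<bullet> v = - A * (norm (v + (- a)))\<^sup>2 + (norm B)\<^sup>2 / (4 * A)" for v
  proof -
    have "(norm (v + (- a)))\<^sup>2 = (norm v)\<^sup>2 - 2 * (a \<bullet> v) + (norm a)\<^sup>2"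
      by (simp add: power2_norm_eq_inner inner_simps inner_commute)
    moreover have "2 * A * (a \<bullet> v) = B \<bullet> v" "A * (norm a)\<^sup>2 = (norm B)\<^sup>2 / (4 * A)"
      using A by (simp_all add: a_def power_divide power_mult_distrib power2_eq_square)
    ultimately show ?thesis by (simp only:) (simp add: algebra_simps)
  qed
  have "(\<integral>\<^sup>+v. ennreal (exp (- A * (norm v)\<^sup>2 + B \<bullet> v)) \<partial>lborel) =
    (\<integral>\<^sup>+v. ennreal (exp ((norm B)\<^sup>2 / (4 * A))) * ennreal (exp (- A * (norm (v + (- a)))\<^sup>2)) \<partial>lborel)"
    unfolding sq exp_add by (simp add: ennreal_mult mult.commute)
  also have "\<dots> = ennreal (exp ((norm B)\<^sup>2 / (4 * A))) * (\<integral>\<^sup>+(v::'e). ennreal (exp (- A * (norm v)\<^sup>2)) \<partial>lborel)"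
    using nn_integral_lborel_shift[of "\<lambda>v. ennreal (exp (- A * (norm v)\<^sup>2))" "- a"] by (subst nn_integral_cmult) auto
  also have "\<dots> = ennreal ((pi / A) powr (real DIM('e) / 2) * exp ((norm B)\<^sup>2 / (4 * A)))"
    unfolding nn_integral_gaussian[OF A] by (simp add: ennreal_mult mult.commute)
  finally show ?thesis .
qed

text \<open>For \<theta> = t * \<kappa> this is the heat kernel at time t of the harmonic oscillator
  with generator (\<Delta> - \<kappa>^2 |x|^2) / 2. Angle and frequency are independent parameters,
  because the discrete Trotter kernels have an angle that is not exactly t * \<kappa>.\<close>

definition mehler :: "real \<Rightarrow> real \<Rightarrow> 'n::euclidean_space \<Rightarrow> 'n \<Rightarrow> real" where
  "mehler \<theta> \<kappa> x w = (\<kappa> / (2 * pi * sinh \<theta>)) powr (real DIM('n) / 2) *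
     exp (- (\<kappa> / 2) * ((((norm x)\<^sup>2 + (norm w)\<^sup>2) * cosh \<theta> - 2 * (x \<bullet> w)) / sinh \<theta>))"

lemma mehler_nonneg: "0 \<le> mehler \<theta> \<kappa> x w"
  by (simp add: mehler_def)

lemma mehler_commute: "mehler \<theta> \<kappa> x w = mehler \<theta> \<kappa> w x"
  by (simp add: mehler_def inner_commute add.commute)

lemma measurable_sinh [measurable (raw)]: "f \<in> borel_measurable M \<Longrightarrow> (\<lambda>x. sinh (f x :: real)) \<in> borel_measurable M"
  and measurable_cosh [measurable (raw)]: "f \<in> borel_measurable M \<Longrightarrow> (\<lambda>x. cosh (f x :: real)) \<in> borel_measurable M"
  by (auto intro!: borel_measurable_continuous_onI measurable_compose[of f M borel] continuous_intros simp: sinh_field_def cosh_field_def)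

lemma measurable_mehler [measurable (raw)]:
  assumes [measurable]: "a \<in> borel_measurable M" "b \<in> borel_measurable M" "f \<in> measurable M borel" "g \<in> measurable M borel"
  shows "(\<lambda>x. mehler (a x) (b x) (f x) (g x)) \<in> borel_measurable M"
  unfolding mehler_def by measurable

lemma mehler_le:
  fixes x w :: "'n::euclidean_space"
  assumes "0 < \<theta>" "0 < \<kappa>"
  shows "mehler \<theta> \<kappa> x w \<le> (\<kappa> / (2 * pi * sinh \<theta>)) powr (real DIM('n) / 2)"
proof -
  have "2 * (x \<bullet> w) \<le> ((norm x)\<^sup>2 + (norm w)\<^sup>2) * 1"
    using inner_ge_zero[of "x - w"] by (simp add: inner_simps power2_norm_eq_inner inner_commute)
  also have "\<dots> \<le> ((norm x)\<^sup>2 + (norm w)\<^sup>2) * cosh \<theta>"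
    by (intro mult_left_mono cosh_real_ge_1) auto
  finally have "0 \<le> (((norm x)\<^sup>2 + (norm w)\<^sup>2) * cosh \<theta> - 2 * (x \<bullet> w)) / sinh \<theta>"
    using assms by simp
  then have "0 \<le> (\<kappa> / 2) * ((((norm x)\<^sup>2 + (norm w)\<^sup>2) * cosh \<theta> - 2 * (x \<bullet> w)) / sinh \<theta>)"
    using assms by (intro mult_nonneg_nonneg) auto
  then have "- (\<kappa> / 2) * ((((norm x)\<^sup>2 + (norm w)\<^sup>2) * cosh \<theta> - 2 * (x \<bullet> w)) / sinh \<theta>) \<le> 0"
    by (simp only: mult_minus_left neg_le_0_iff_le)
  then show ?thesis unfolding mehler_def by (intro mult_right_le_one_le) auto
qed

text \<open>Composition at a fixed frequency adds angles. Integrating out the middle point is a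
  Gaussian integral with linear term, and the addition formulas for sinh and cosh reassemble the
  exponent.\<close>

lemma mehler_double:
  fixes x w :: "'n::euclidean_space"
  assumes \<theta>: "0 < \<theta>" and \<kappa>: "0 < \<kappa>"
  shows "(\<integral>\<^sup>+v. ennreal (mehler \<theta> \<kappa> x v * mehler \<theta> \<kappa> v w) \<partial>lborel) = ennreal (mehler (2 * \<theta>) \<kappa> x w)"
proof -
  define s where "s = sinh \<theta>"
  define h where "h = cosh \<theta>"
  have s: "0 < s" and h: "0 < h" using \<theta> by (auto simp: s_def h_def)
  have hs: "h\<^sup>2 = s\<^sup>2 + 1" by (simp add: h_def s_def cosh_square_eq)
  have s2: "sinh (2 * \<theta>) = 2 * s * h" by (simp add: s_def h_def sinh_double)
  have h2: "cosh (2 * \<theta>) = 2 * h\<^sup>2 - 1" using hs by (simp add: s_def h_def cosh_double)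
  define m where "m = real DIM('n) / 2"
  define c0 where "c0 = (\<kappa> / (2 * pi * s)) powr m"
  define N where "N = (norm x)\<^sup>2 + (norm w)\<^sup>2"
  define A where "A = \<kappa> * h / s"
  define B where "B = (\<kappa> / s) *\<^sub>R (x + w)"
  have A: "0 < A" using s h \<kappa> by (simp add: A_def)
  have pt: "mehler \<theta> \<kappa> x v * mehler \<theta> \<kappa> v w = (c0\<^sup>2 * exp (- (A / 2) * N)) * exp (- A * (norm v)\<^sup>2 + B \<bullet> v)" for v
  proof -
    have "- (\<kappa> / 2) * ((((norm x)\<^sup>2 + (norm v)\<^sup>2) * h - 2 * (x \<bullet> v)) / s) + - (\<kappa> / 2) * ((((norm v)\<^sup>2 + (norm w)\<^sup>2) * h - 2 * (v \<bullet> w)) / s)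
      = - (A / 2) * N + (- A * (norm v)\<^sup>2 + B \<bullet> v)"
      using s by (simp add: A_def B_def N_def inner_simps inner_commute field_simps)
    then show ?thesis
      unfolding mehler_def s_def[symmetric] h_def[symmetric] m_def[symmetric] c0_def[symmetric]
      by (simp add: power2_eq_square exp_add[symmetric] mult_ac)
  qed
  have "(\<integral>\<^sup>+v. ennreal (mehler \<theta> \<kappa> x v * mehler \<theta> \<kappa> v w) \<partial>lborel) =
     ennreal (c0\<^sup>2 * exp (- (A / 2) * N)) * ennreal ((pi / A) powr m * exp ((norm B)\<^sup>2 / (4 * A)))"
    unfolding pt m_def nn_integral_gaussian_linear[OF A, symmetric] by (rule nn_integral_cmult_ennreal) auto
  also have "\<dots> = ennreal ((c0\<^sup>2 * (pi / A) powr m) * exp (- (A / 2) * N + (norm B)\<^sup>2 / (4 * A)))"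
    unfolding exp_add by (simp add: ennreal_mult[symmetric] mult_ac)
  also have "c0\<^sup>2 * (pi / A) powr m = (\<kappa> / (2 * pi * sinh (2 * \<theta>))) powr m"
  proof -
    have "c0\<^sup>2 * (pi / A) powr m = (\<kappa> / (2 * pi * s) * (\<kappa> / (2 * pi * s)) * (pi / A)) powr m"
      by (simp only: c0_def power2_eq_square powr_mult)
    also have "\<kappa> / (2 * pi * s) * (\<kappa> / (2 * pi * s)) * (pi / A) = \<kappa> / (2 * pi * sinh (2 * \<theta>))"
      using \<kappa> s h unfolding s2 A_def by (simp add: field_simps)
    finally show ?thesis .
  qed
  also have "- (A / 2) * N + (norm B)\<^sup>2 / (4 * A) = - (\<kappa> / 2) * ((N * cosh (2 * \<theta>) - 2 * (x \<bullet> w)) / sinh (2 * \<theta>))"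
  proof -
    have nB: "(norm B)\<^sup>2 = (\<kappa> / s)\<^sup>2 * (N + 2 * (x \<bullet> w))"
      unfolding B_def norm_scaleR power_mult_distrib power2_abs
      by (simp add: N_def power2_norm_eq_inner inner_simps inner_commute)
    show ?thesis
      using \<kappa> s h unfolding s2 h2 nB A_def by (simp add: field_simps power2_eq_square)
  qed
  finally show ?thesis by (simp add: mehler_def m_def N_def)
qed

text \<open>A Gaussian integral, in which cosh^2 - sinh^2 = 1 collapses the exponent to tanh. The
  deficit from 1 is the loss caused by the quadratic potential.\<close>

lemma mehler_mass:
  fixes x :: "'n::euclidean_space"
  assumes \<theta>: "0 < \<theta>" and \<kappa>: "0 < \<kappa>"
  shows "(\<integral>\<^sup>+w. ennreal (mehler \<theta> \<kappa> x w) \<partial>lborel) =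
    ennreal (cosh \<theta> powr (- (real DIM('n) / 2)) * exp (- (\<kappa> / 2) * (norm x)\<^sup>2 * tanh \<theta>))"
proof -
  define s where "s = sinh \<theta>"
  define h where "h = cosh \<theta>"
  have s: "0 < s" and h: "0 < h" using \<theta> by (auto simp: s_def h_def)
  have hs: "h * h = s * s + 1" using cosh_square_eq[of \<theta>] by (simp add: h_def s_def power2_eq_square)
  define m where "m = real DIM('n) / 2"
  define c0 where "c0 = (\<kappa> / (2 * pi * s)) powr m"
  define A where "A = \<kappa> * h / (2 * s)"
  define B where "B = (\<kappa> / s) *\<^sub>R x"
  have A: "0 < A" using s h \<kappa> by (simp add: A_def)
  have pt: "mehler \<theta> \<kappa> x w = (c0 * exp (- A * (norm x)\<^sup>2)) * exp (- A * (norm w)\<^sup>2 + B \<bullet> w)" for w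
  proof -
    have "- (\<kappa> / 2) * ((((norm x)\<^sup>2 + (norm w)\<^sup>2) * h - 2 * (x \<bullet> w)) / s) = - A * (norm x)\<^sup>2 + (- A * (norm w)\<^sup>2 + B \<bullet> w)"
      using s by (simp add: A_def B_def field_simps)
    then show ?thesis
      unfolding mehler_def s_def[symmetric] h_def[symmetric] m_def[symmetric] c0_def[symmetric]
      by (simp only: exp_add mult.assoc)
  qed
  have "(\<integral>\<^sup>+w. ennreal (mehler \<theta> \<kappa> x w) \<partial>lborel) = ennreal (c0 * exp (- A * (norm x)\<^sup>2)) * ennreal ((pi / A) powr m * exp ((norm B)\<^sup>2 / (4 * A)))"
    unfolding pt m_def nn_integral_gaussian_linear[OF A, symmetric] by (rule nn_integral_cmult_ennreal) (auto simp: c0_def)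
  also have "\<dots> = ennreal ((c0 * (pi / A) powr m) * exp (- A * (norm x)\<^sup>2 + (norm B)\<^sup>2 / (4 * A)))"
    unfolding exp_add c0_def by (simp add: ennreal_mult[symmetric] mult_ac)
  also have "c0 * (pi / A) powr m = h powr (- m)"
  proof -
    have "c0 * (pi / A) powr m = (\<kappa> / (2 * pi * s) * (pi / A)) powr m"
      by (simp only: c0_def powr_mult)
    also have "\<kappa> / (2 * pi * s) * (pi / A) = 1 / h"
      using \<kappa> s h unfolding A_def by (simp add: field_simps)
    finally show ?thesis using h by (simp add: powr_divide powr_minus_divide)
  qed
  also have "- A * (norm x)\<^sup>2 + (norm B)\<^sup>2 / (4 * A) = - (\<kappa> / 2) * (norm x)\<^sup>2 * tanh \<theta>"
  proof -
    have nB: "(norm B)\<^sup>2 = (\<kappa> / s)\<^sup>2 * (norm x)\<^sup>2" unfolding B_def norm_scaleR power_mult_distrib power2_abs ..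
    have "(norm B)\<^sup>2 / (4 * A) = (\<kappa> / (2 * s * h)) * (norm x)\<^sup>2"
      using \<kappa> s h unfolding nB A_def by (simp add: field_simps power2_eq_square)
    then have "- A * (norm x)\<^sup>2 + (norm B)\<^sup>2 / (4 * A) = (\<kappa> / 2) * (norm x)\<^sup>2 * ((1 - h * h) / (s * h))"
      using s h by (simp add: A_def field_simps)
    also have "(1 - h * h) / (s * h) = - tanh \<theta>"
      using s h unfolding hs by (simp add: tanh_def s_def h_def)
    finally show ?thesis by simp
  qed
  finally show ?thesis by (simp add: h_def m_def)
qed

section \<open>Positivity\<close>

text \<open>The condition concerns functions of \<open>l = |\<xi>|\<^sup>2\<close>; the value at \<open>l = 0\<close> is irrelevant. The Gaussian
  factor makes the integral converge for every bounded \<open>g\<close>.\<close>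

definition fourier_pos :: "'d::euclidean_space itself \<Rightarrow> (real \<Rightarrow> real) \<Rightarrow> bool" where
  "fourier_pos _ g \<longleftrightarrow> g \<in> borel_measurable borel \<and> (\<exists>C. \<forall>l>0. 0 \<le> g l \<and> g l \<le> C) \<and>
    (\<forall>\<epsilon>>0. \<forall>y::'d. 0 \<le> (\<integral>\<xi>. exp (- \<epsilon> * (norm \<xi>)\<^sup>2) * g ((norm \<xi>)\<^sup>2) * cos (\<xi> \<bullet> y) \<partial>lborel))"

lemma AE_lborel_nonzero: "AE \<xi> in lborel. (\<xi>::'d::euclidean_space) \<noteq> 0"
  by (rule AE_lborel_singleton)

lemma fourier_pos_cong:
  assumes g: "fourier_pos TYPE('d::euclidean_space) g" and [measurable]: "f \<in> borel_measurable borel"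
    and fg: "\<And>l. 0 < l \<Longrightarrow> f l = g l"
  shows "fourier_pos TYPE('d) f"
proof -
  have [measurable]: "g \<in> borel_measurable borel" using g by (simp add: fourier_pos_def)
  have "(\<integral>\<xi>. exp (- \<epsilon> * (norm \<xi>)\<^sup>2) * f ((norm \<xi>)\<^sup>2) * cos (\<xi> \<bullet> y) \<partial>lborel) =
      (\<integral>\<xi>. exp (- \<epsilon> * (norm \<xi>)\<^sup>2) * g ((norm \<xi>)\<^sup>2) * cos (\<xi> \<bullet> y) \<partial>lborel)" for \<epsilon> and y :: 'd
    by (rule integral_cong_AE) (use AE_lborel_nonzero[where 'd='d] in \<open>measurable, eventually_elim, simp add: fg\<close>)
  then show ?thesis using g fg by (simp add: fourier_pos_def)
qed

lemma fourier_pos_one: "fourier_pos TYPE('d::euclidean_space) (\<lambda>_. 1)"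
  unfolding fourier_pos_def using gaussian_cos(2)[where 'e='d] by auto

text \<open>A Gaussian factor in \<xi> only increases the regularising parameter from \<epsilon> to
  \<epsilon> + s, and the condition is imposed for all positive parameters.\<close>

lemma fourier_pos_mult_exp:
  assumes g: "fourier_pos TYPE('d::euclidean_space) g" and a: "0 \<le> a" and s: "0 \<le> s"
  shows "fourier_pos TYPE('d) (\<lambda>l. g l * (a * exp (- s * l)))"
  unfolding fourier_pos_def
proof (intro conjI allI impI)
  have [measurable]: "g \<in> borel_measurable borel" using g by (simp add: fourier_pos_def)
  show "(\<lambda>l. g l * (a * exp (- s * l))) \<in> borel_measurable borel" by measurable
  obtain C where C: "\<And>l. 0 < l \<Longrightarrow> 0 \<le> g l \<and> g l \<le> C" using g by (auto simp: fourier_pos_def)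
  have "g l * (a * exp (- s * l)) \<le> C * (a * 1)" if "0 < l" for l
    using C[OF that] that a s by (intro mult_mono) auto
  then show "\<exists>C. \<forall>l>0. 0 \<le> g l * (a * exp (- s * l)) \<and> g l * (a * exp (- s * l)) \<le> C"
    using C a by (intro exI[of _ "C * (a * 1)"]) auto
  fix \<epsilon> :: real and y :: 'd assume \<epsilon>: "0 < \<epsilon>"
  have "(\<integral>\<xi>. exp (- \<epsilon> * (norm \<xi>)\<^sup>2) * (g ((norm \<xi>)\<^sup>2) * (a * exp (- s * (norm \<xi>)\<^sup>2))) * cos (\<xi> \<bullet> y) \<partial>lborel) =
    (\<integral>\<xi>. a * (exp (- (\<epsilon> + s) * (norm \<xi>)\<^sup>2) * g ((norm \<xi>)\<^sup>2) * cos (\<xi> \<bullet> y)) \<partial>lborel)"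
    by (intro Bochner_Integration.integral_cong) (simp_all add: exp_add[symmetric] exp_diff exp_minus field_simps)
  also have "\<dots> = a * (\<integral>\<xi>. exp (- (\<epsilon> + s) * (norm \<xi>)\<^sup>2) * g ((norm \<xi>)\<^sup>2) * cos (\<xi> \<bullet> y) \<partial>lborel)"
    by (rule integral_mult_right_zero)
  also have "\<dots> \<ge> 0" using g \<epsilon> s a unfolding fourier_pos_def by (intro mult_nonneg_nonneg) (auto simp del: minus_add_distrib)
  finally show "0 \<le> (\<integral>\<xi>. exp (- \<epsilon> * (norm \<xi>)\<^sup>2) * (g ((norm \<xi>)\<^sup>2) * (a * exp (- s * (norm \<xi>)\<^sup>2))) * cos (\<xi> \<bullet> y) \<partial>lborel)" .
qed

text \<open>Fubini exchanges the parameter with the frequency. Since the family is nonnegative,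
  integrating its absolute value gives \<open>g\<close> again, so the bound on \<open>g\<close>
  together with the Gaussian yields the integrability that Fubini requires.\<close>

lemma fourier_pos_integral:
  fixes G :: "'n::euclidean_space \<Rightarrow> real \<Rightarrow> real"
  assumes G: "\<And>v. fourier_pos TYPE('d::euclidean_space) (G v)"
    and m [measurable]: "(\<lambda>x. G (fst x) (snd x)) \<in> borel_measurable (borel \<Otimes>\<^sub>M borel)"
    and g [measurable]: "g \<in> borel_measurable borel"
    and gG: "\<And>l. 0 < l \<Longrightarrow> (\<integral>\<^sup>+v. ennreal (G v l) \<partial>lborel) = ennreal (g l)"
    and gC: "\<And>l. 0 < l \<Longrightarrow> 0 \<le> g l \<and> g l \<le> C"
  shows "fourier_pos TYPE('d) g"
  unfolding fourier_pos_def
proof (intro conjI allI impI g)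
  show "\<exists>C. \<forall>l>0. 0 \<le> g l \<and> g l \<le> C" using gC by blast
  fix \<epsilon> :: real and y :: 'd assume \<epsilon>: "0 < \<epsilon>"
  note [measurable (raw)] = joint_measurable_compose[OF m]
  define H where "H \<xi> v = exp (- \<epsilon> * (norm \<xi>)\<^sup>2) * G v ((norm \<xi>)\<^sup>2) * cos (\<xi> \<bullet> y)" for \<xi> :: 'd and v :: 'n
  have G0: "0 \<le> G v l" if "0 < l" for v l using G[of v] that by (auto simp: fourier_pos_def)
  have C0: "0 \<le> C" using gC[of 1] by auto
  have Hm: "(\<lambda>(\<xi>, v). H \<xi> v) \<in> borel_measurable (lborel \<Otimes>\<^sub>M lborel)"
  proof -
    have "(\<lambda>(\<xi>, v). H \<xi> v) \<in> borel_measurable (borel \<Otimes>\<^sub>M borel)"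
      unfolding H_def case_prod_beta' by measurable
    then show ?thesis by (simp cong: measurable_cong_sets)
  qed
  have int: "integrable (lborel \<Otimes>\<^sub>M lborel) (\<lambda>(\<xi>, v). H \<xi> v)"
  proof (rule integrableI_bounded[OF Hm])
    have "(\<integral>\<^sup>+x. ennreal (norm (case x of (\<xi>, v) \<Rightarrow> H \<xi> v)) \<partial>(lborel \<Otimes>\<^sub>M lborel)) = (\<integral>\<^sup>+\<xi>. \<integral>\<^sup>+v. ennreal (norm (H \<xi> v)) \<partial>lborel \<partial>lborel)"
      using Hm by (subst lborel.nn_integral_fst[symmetric]) auto
    also have "\<dots> \<le> (\<integral>\<^sup>+\<xi>. ennreal (C * exp (- \<epsilon> * (norm (\<xi>::'d))\<^sup>2)) \<partial>lborel)"
    proof (rule nn_integral_mono_AE)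
      show "AE \<xi> in lborel. (\<integral>\<^sup>+v. ennreal (norm (H \<xi> v)) \<partial>lborel) \<le> ennreal (C * exp (- \<epsilon> * (norm \<xi>)\<^sup>2))"
        using AE_lborel_nonzero
      proof eventually_elim
        case (elim \<xi>)
        have "(\<integral>\<^sup>+v. ennreal (norm (H \<xi> v)) \<partial>lborel) \<le> (\<integral>\<^sup>+v. ennreal (exp (- \<epsilon> * (norm \<xi>)\<^sup>2)) * ennreal (G v ((norm \<xi>)\<^sup>2)) \<partial>lborel)"
        proof (intro nn_integral_mono)
          fix v
          have "\<bar>H \<xi> v\<bar> \<le> exp (- \<epsilon> * (norm \<xi>)\<^sup>2) * G v ((norm \<xi>)\<^sup>2) * 1"
            unfolding H_def abs_mult using G0[of "(norm \<xi>)\<^sup>2" v] elim by (intro mult_mono) auto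
          then show "ennreal (norm (H \<xi> v)) \<le> ennreal (exp (- \<epsilon> * (norm \<xi>)\<^sup>2)) * ennreal (G v ((norm \<xi>)\<^sup>2))"
            using G0[of "(norm \<xi>)\<^sup>2" v] elim by (simp add: ennreal_mult[symmetric] ennreal_leI)
        qed
        also have "\<dots> = ennreal (exp (- \<epsilon> * (norm \<xi>)\<^sup>2)) * ennreal (g ((norm \<xi>)\<^sup>2))"
          using gG[of "(norm \<xi>)\<^sup>2"] elim by (subst nn_integral_cmult) auto
        also have "\<dots> \<le> ennreal (C * exp (- \<epsilon> * (norm \<xi>)\<^sup>2))"
          using gC[of "(norm \<xi>)\<^sup>2"] elim by (simp add: ennreal_mult[symmetric] ennreal_leI mult.commute)
        finally show ?case .
      qed
    qed
    also have "\<dots> < \<infinity>"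
      using C0 by (subst nn_integral_cmult_ennreal) (auto simp: nn_integral_gaussian[OF \<epsilon>, simplified] ennreal_mult_less_top)
    finally show "(\<integral>\<^sup>+x. ennreal (norm (case x of (\<xi>, v) \<Rightarrow> H \<xi> v)) \<partial>(lborel \<Otimes>\<^sub>M lborel)) < \<infinity>" .
  qed
  have "(\<integral>\<xi>. exp (- \<epsilon> * (norm \<xi>)\<^sup>2) * g ((norm \<xi>)\<^sup>2) * cos (\<xi> \<bullet> y) \<partial>lborel) = (\<integral>\<xi>. (\<integral>v. H \<xi> v \<partial>lborel) \<partial>lborel)"
  proof (rule integral_cong_AE)
    show "(\<lambda>\<xi>. \<integral>v. H \<xi> v \<partial>lborel) \<in> borel_measurable lborel" using Hm by measurable
    show "AE \<xi> in lborel. exp (- \<epsilon> * (norm \<xi>)\<^sup>2) * g ((norm \<xi>)\<^sup>2) * cos (\<xi> \<bullet> y) = (\<integral>v. H \<xi> v \<partial>lborel)"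
      using AE_lborel_nonzero
    proof eventually_elim
      case (elim \<xi>)
      then have l: "0 < (norm \<xi>)\<^sup>2" by simp
      have "(\<integral>v. G v ((norm \<xi>)\<^sup>2) \<partial>lborel) = g ((norm \<xi>)\<^sup>2)"
        using gG[OF l] gC[OF l] G0[OF l] by (subst integral_eq_nn_integral) auto
      moreover have "(\<integral>v. H \<xi> v \<partial>lborel) = exp (- \<epsilon> * (norm \<xi>)\<^sup>2) * (\<integral>v. G v ((norm \<xi>)\<^sup>2) \<partial>lborel) * cos (\<xi> \<bullet> y)"
        unfolding H_def by simp
      ultimately show ?case by simp
    qed
  qed measurable
  also have "\<dots> = (\<integral>v. (\<integral>\<xi>. H \<xi> v \<partial>lborel) \<partial>lborel)"
    using lborel_pair.Fubini_integral[OF int] by simp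
  also have "\<dots> \<ge> 0"
  proof (rule Bochner_Integration.integral_nonneg)
    show "0 \<le> (\<integral>\<xi>. H \<xi> v \<partial>lborel)" for v using G[of v] \<epsilon> unfolding fourier_pos_def H_def by blast
  qed
  finally show "0 \<le> (\<integral>\<xi>. exp (- \<epsilon> * (norm \<xi>)\<^sup>2) * g ((norm \<xi>)\<^sup>2) * cos (\<xi> \<bullet> y) \<partial>lborel)" .
qed

text \<open>The angle \<open>\<theta>\<close> solves \<open>cosh \<theta> = 1 + e\<^sup>2 l / 2\<close> and the frequency is \<open>sinh \<theta> / e\<close>. With this choice one Trotter
  step of length \<open>e\<close> is exactly a Mehler kernel, so the \<open>2\<^sup>n\<close>-fold composition follows by doubling the angle.\<close>

definition trotter_angle :: "real \<Rightarrow> real \<Rightarrow> real" where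
  "trotter_angle e l = 2 * arsinh (e * sqrt l / 2)"

definition trotter_freq :: "real \<Rightarrow> real \<Rightarrow> real" where
  "trotter_freq e l = sinh (trotter_angle e l) / e"

lemma trotter_measurable [measurable]: "trotter_angle e \<in> borel_measurable borel" "trotter_freq e \<in> borel_measurable borel"
  unfolding trotter_freq_def trotter_angle_def arsinh_real_def by measurable

lemma trotter_pos:
  assumes "0 < e" "0 < l" shows "0 < trotter_angle e l" "0 < trotter_freq e l"
proof -
  show *: "0 < trotter_angle e l" using assms by (simp add: trotter_angle_def)
  then show "0 < trotter_freq e l" using assms by (simp add: trotter_freq_def)
qed

text \<open>The angle is chosen so that cosh - 1 equals e^2 * l / 2. The cosh term then splits into
  the free heat kernel at time e and an exponential linear in l, that is, a Gaussian in \<xi>. The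
  weights e / 4 at both ends are the symmetric splitting of the potential.\<close>

lemma mehler_trotter:
  fixes x w :: "'n::euclidean_space"
  assumes e: "0 < e" and l: "0 < l"
  shows "mehler (trotter_angle e l) (trotter_freq e l) x w =
    ((1 / (2 * pi * e)) powr (real DIM('n) / 2) * exp (- (norm (x - w))\<^sup>2 / (2 * e))) * exp (- (e / 4 * ((norm x)\<^sup>2 + (norm w)\<^sup>2)) * l)"
proof -
  define s where "s = sinh (trotter_angle e l)"
  have s: "0 < s" using trotter_pos(1)[OF e l] by (simp add: s_def)
  have ch: "cosh (trotter_angle e l) = 1 + e\<^sup>2 * l / 2"
    using l unfolding trotter_angle_def cosh_double
    by (simp add: cosh_square_eq power_mult_distrib power_divide)
  have nxw: "(norm (x - w))\<^sup>2 = (norm x)\<^sup>2 + (norm w)\<^sup>2 - 2 * (x \<bullet> w)"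
    by (simp add: power2_norm_eq_inner inner_simps inner_commute)
  have "- (trotter_freq e l / 2) * ((((norm x)\<^sup>2 + (norm w)\<^sup>2) * cosh (trotter_angle e l) - 2 * (x \<bullet> w)) / s) =
     - (norm (x - w))\<^sup>2 / (2 * e) + (- (e / 4 * ((norm x)\<^sup>2 + (norm w)\<^sup>2)) * l)"
    unfolding ch nxw trotter_freq_def s_def[symmetric] using s e by (simp add: field_simps power2_eq_square)
  moreover have "trotter_freq e l / (2 * pi * s) = 1 / (2 * pi * e)"
    using s e by (simp add: trotter_freq_def s_def)
  ultimately show ?thesis unfolding mehler_def s_def[symmetric] by (simp only: exp_add mult.assoc)
qed

lemma sinh_power2_mult: "0 \<le> \<theta> \<Longrightarrow> 2 ^ n * sinh \<theta> \<le> sinh (2 ^ n * \<theta> :: real)"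
proof (induction n)
  case (Suc n)
  have "2 ^ Suc n * sinh \<theta> \<le> 2 * sinh (2 ^ n * \<theta>) * 1" using Suc by simp
  also have "\<dots> \<le> 2 * sinh (2 ^ n * \<theta>) * cosh (2 ^ n * \<theta>)"
    using Suc.prems by (intro mult_left_mono cosh_real_ge_1) auto
  also have "\<dots> = sinh (2 ^ Suc n * \<theta>)" using sinh_double[of "2 ^ n * \<theta>"] by (simp add: mult_ac)
  finally show ?case .
qed simp

text \<open>Because sinh grows at least linearly under doubling, the prefactor is at most that of
  the free heat kernel at time 2^n * e. The bound does not involve \<xi>, and for e = t / 2^n it
  does not involve n either, so it serves as a majorant in the limit.\<close>

lemma mehler_trotter_le:
  fixes x w :: "'n::euclidean_space"
  assumes e: "0 < e" and l: "0 < l"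
  shows "mehler (2 ^ n * trotter_angle e l) (trotter_freq e l) x w \<le> (1 / (2 * pi * (2 ^ n * e))) powr (real DIM('n) / 2)"
proof -
  note pos = trotter_pos[OF e l]
  have s: "0 < sinh (trotter_angle e l)" "0 < sinh (2 ^ n * trotter_angle e l)" using pos by auto
  have "mehler (2 ^ n * trotter_angle e l) (trotter_freq e l) x w \<le> (trotter_freq e l / (2 * pi * sinh (2 ^ n * trotter_angle e l))) powr (real DIM('n) / 2)"
    using pos by (intro mehler_le) auto
  also have "\<dots> \<le> (1 / (2 * pi * (2 ^ n * e))) powr (real DIM('n) / 2)"
  proof (rule powr_mono2)
    have "sinh (trotter_angle e l) * 2 ^ n \<le> sinh (2 ^ n * trotter_angle e l)"
      using sinh_power2_mult[of "trotter_angle e l" n] pos by (simp add: mult.commute)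
    then show "trotter_freq e l / (2 * pi * sinh (2 ^ n * trotter_angle e l)) \<le> 1 / (2 * pi * (2 ^ n * e))"
      unfolding trotter_freq_def using e s by (simp add: field_simps)
    show "0 \<le> trotter_freq e l / (2 * pi * sinh (2 ^ n * trotter_angle e l))" using pos s by (auto intro!: divide_nonneg_pos)
  qed simp
  finally show ?thesis .
qed

text \<open>The factor \<open>g\<close> is what makes the induction work: a composition contains a
  product of two kernels, and with \<open>g\<close> arbitrary the induction hypothesis can be
  applied twice, the first kernel becoming part of \<open>g\<close> for the second.\<close>

lemma fourier_pos_mult_mehler:
  fixes x w :: "'n::euclidean_space"
  assumes e: "0 < e"
  shows "fourier_pos TYPE('d::euclidean_space) g \<Longrightarrow> fourier_pos TYPE('d) (\<lambda>l. g l * mehler (2 ^ n * trotter_angle e l) (trotter_freq e l) x w)"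
proof (induction n arbitrary: g x w)
  case 0
  then have [measurable]: "g \<in> borel_measurable borel" by (simp add: fourier_pos_def)
  have "fourier_pos TYPE('d) (\<lambda>l. g l * (((1 / (2 * pi * e)) powr (real DIM('n) / 2) * exp (- (norm (x - w))\<^sup>2 / (2 * e))) * exp (- (e / 4 * ((norm x)\<^sup>2 + (norm w)\<^sup>2)) * l)))"
    using e by (intro fourier_pos_mult_exp 0) auto
  then show ?case
    by (rule fourier_pos_cong) (auto simp: mehler_trotter[OF e])
next
  case (Suc n)
  then have [measurable]: "g \<in> borel_measurable borel" by (simp add: fourier_pos_def)
  obtain C where C: "\<And>l. 0 < l \<Longrightarrow> 0 \<le> g l \<and> g l \<le> C" using Suc.prems by (auto simp: fourier_pos_def)
  show ?case
  proof (rule fourier_pos_integral)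
    show "fourier_pos TYPE('d) (\<lambda>l. (g l * mehler (2 ^ n * trotter_angle e l) (trotter_freq e l) x v) * mehler (2 ^ n * trotter_angle e l) (trotter_freq e l) v w)" for v
      by (intro Suc)
    fix l :: real assume l: "0 < l"
    have "(\<integral>\<^sup>+v. ennreal ((g l * mehler (2 ^ n * trotter_angle e l) (trotter_freq e l) x v) * mehler (2 ^ n * trotter_angle e l) (trotter_freq e l) v w) \<partial>lborel)
      = ennreal (g l) * (\<integral>\<^sup>+v. ennreal (mehler (2 ^ n * trotter_angle e l) (trotter_freq e l) x v * mehler (2 ^ n * trotter_angle e l) (trotter_freq e l) v w) \<partial>lborel)"
      unfolding mult.assoc using C[OF l] by (intro nn_integral_cmult_ennreal) (auto intro!: mult_nonneg_nonneg mehler_nonneg)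
    also have "\<dots> = ennreal (g l * mehler (2 ^ Suc n * trotter_angle e l) (trotter_freq e l) x w)"
      using trotter_pos[OF e l] C[OF l] by (subst mehler_double) (auto simp: ennreal_mult mehler_nonneg mult.assoc)
    finally show "(\<integral>\<^sup>+v. ennreal ((g l * mehler (2 ^ n * trotter_angle e l) (trotter_freq e l) x v) * mehler (2 ^ n * trotter_angle e l) (trotter_freq e l) v w) \<partial>lborel)
      = ennreal (g l * mehler (2 ^ Suc n * trotter_angle e l) (trotter_freq e l) x w)" .
    have "g l * mehler (2 ^ Suc n * trotter_angle e l) (trotter_freq e l) x w \<le> C * (1 / (2 * pi * (2 ^ Suc n * e))) powr (real DIM('n) / 2)"
      using C[OF l] by (intro mult_mono mehler_trotter_le e l mehler_nonneg) auto
    then show "0 \<le> g l * mehler (2 ^ Suc n * trotter_angle e l) (trotter_freq e l) x w \<and>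
      g l * mehler (2 ^ Suc n * trotter_angle e l) (trotter_freq e l) x w \<le> C * (1 / (2 * pi * (2 ^ Suc n * e))) powr (real DIM('n) / 2)"
      using C[OF l] by (simp add: mehler_nonneg)
  qed measurable
qed

section \<open>The limit of the discrete Mehler kernels\<close>

lemma tendsto_arsinh_quotient: "((\<lambda>u::real. arsinh u / u) \<longlongrightarrow> 1) (at 0)"
proof -
  have "((arsinh :: real \<Rightarrow> real) has_field_derivative 1 / sqrt (0\<^sup>2 + 1)) (at 0)" by (rule arsinh_real_has_field_derivative)
  then show ?thesis by (simp add: DERIV_def)
qed

lemma tendsto_sinh_quotient: "((\<lambda>u::real. u / sinh u) \<longlongrightarrow> 1) (at 0)"
proof -
  have "((sinh :: real \<Rightarrow> real) has_field_derivative cosh 0) (at 0)" by (auto intro!: derivative_eq_intros)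
  then have "((\<lambda>u::real. sinh u / u) \<longlongrightarrow> 1) (at 0)" by (simp add: DERIV_def)
  from tendsto_inverse[OF this] show ?thesis by simp
qed

lemma mehler_tendsto:
  fixes x w :: "'n::euclidean_space"
  assumes "a \<longlonglongrightarrow> \<theta>" "b \<longlonglongrightarrow> \<kappa>" "0 < \<theta>" "0 < \<kappa>"
  shows "(\<lambda>n. mehler (a n) (b n) x w) \<longlonglongrightarrow> mehler \<theta> \<kappa> x w"
  unfolding mehler_def using assms
  by (intro tendsto_mult tendsto_powr tendsto_exp tendsto_divide tendsto_diff tendsto_minus tendsto_const tendsto_sinh tendsto_cosh) auto

text \<open>With u = t * r / 2^(n+1) the angle after n doublings is t * r * arsinh u / u, and the
  frequency is r * cosh (arsinh u) by the double angle formula; both limits are then values at u =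
  0.\<close>

lemma trotter_limit:
  assumes t: "0 < t" and r: "0 < r"
  shows "(\<lambda>n. 2 ^ n * trotter_angle (t / 2 ^ n) (r\<^sup>2)) \<longlonglongrightarrow> t * r" "(\<lambda>n. trotter_freq (t / 2 ^ n) (r\<^sup>2)) \<longlonglongrightarrow> r"
proof -
  define u where "u n = t * r * (1 / 2) ^ Suc n" for n
  have u: "u n \<noteq> 0" for n using t r by (simp add: u_def)
  have ang: "trotter_angle (t / 2 ^ n) (r\<^sup>2) = 2 * arsinh (u n)" for n
    using r by (simp add: trotter_angle_def u_def power_divide mult.commute)
  have "(\<lambda>n. t * r * (1 / 2) ^ Suc n) \<longlonglongrightarrow> t * r * 0"
    by (intro tendsto_mult tendsto_const LIMSEQ_Suc[OF LIMSEQ_power_zero]) auto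
  then have u0: "u \<longlonglongrightarrow> 0" by (simp add: u_def[abs_def])
  then have "filterlim u (at 0) sequentially" using u by (simp add: filterlim_at)
  from filterlim_compose[OF tendsto_arsinh_quotient this]
  have "(\<lambda>n. t * r * (arsinh (u n) / u n)) \<longlonglongrightarrow> t * r * 1" by (intro tendsto_mult tendsto_const)
  moreover have "t * r * (arsinh (u n) / u n) = 2 ^ n * trotter_angle (t / 2 ^ n) (r\<^sup>2)" for n
    using t r unfolding ang by (simp add: u_def power_divide)
  ultimately show "(\<lambda>n. 2 ^ n * trotter_angle (t / 2 ^ n) (r\<^sup>2)) \<longlonglongrightarrow> t * r" by simp
  have "(\<lambda>n. r * cosh (arsinh (u n))) \<longlonglongrightarrow> r * cosh (arsinh 0)"
    using u0 by (intro tendsto_mult tendsto_const tendsto_cosh tendsto_arsinh)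
  moreover have "r * cosh (arsinh (u n)) = trotter_freq (t / 2 ^ n) (r\<^sup>2)" for n
    using t r unfolding trotter_freq_def ang sinh_double by (simp add: u_def power_divide)
  ultimately show "(\<lambda>n. trotter_freq (t / 2 ^ n) (r\<^sup>2)) \<longlonglongrightarrow> r" by simp
qed

section \<open>Decay and integrability in the frequency\<close>

lemma sinh_ge_self: "0 \<le> a \<Longrightarrow> a \<le> sinh (a::real)"
proof -
  assume "0 \<le> a"
  then have "(\<lambda>x. sinh x - x) 0 \<le> (\<lambda>x. sinh x - x) a"
  proof (rule DERIV_nonneg_imp_nondecreasing)
    fix x :: real
    show "\<exists>y. ((\<lambda>x. sinh x - x) has_real_derivative y) (at x) \<and> 0 \<le> y"
      by (rule exI[of _ "cosh x - 1"]) (auto intro!: derivative_eq_intros cosh_real_ge_1)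
  qed
  then show ?thesis by simp
qed

text \<open>From sinh (t * r) = 2 * sinh (t * r / 2) * cosh (t * r / 2) comes the lower bound (t * r
  / 2) * exp (t * r / 2): the linear factor cancels the frequency in the prefactor, and the
  exponential survives the power DIM/2 with rate at least t / 4, since the dimension is at least
  1.\<close>

lemma mehler_decay:
  fixes x w :: "'n::euclidean_space"
  assumes t: "0 < t" and r: "0 < r"
  shows "mehler (t * r) r x w \<le> (1 / (pi * t)) powr (real DIM('n) / 2) * exp (- (t / 4) * r)"
proof -
  have tr: "0 < t * r" using t r by simp
  have "t * r / 2 * (exp (t * r / 2) / 2) * 2 \<le> sinh (t * r / 2) * cosh (t * r / 2) * 2"
    using tr sinh_ge_self[of "t * r / 2"] by (intro mult_right_mono mult_mono) (auto simp: cosh_field_def)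
  also have "\<dots> = sinh (t * r)" using sinh_double[of "t * r / 2"] by simp
  finally have sh: "t * r / 2 * exp (t * r / 2) \<le> sinh (t * r)" by (simp add: mult_ac)
  have "mehler (t * r) r x w \<le> (r / (2 * pi * sinh (t * r))) powr (real DIM('n) / 2)"
    using tr r by (intro mehler_le)
  also have "\<dots> \<le> (1 / (pi * t) * exp (- (t * r / 2))) powr (real DIM('n) / 2)"
  proof (rule powr_mono2)
    have "r / (2 * pi * sinh (t * r)) \<le> r / (2 * pi * (t * r / 2 * exp (t * r / 2)))"
      using sh t r by (intro divide_left_mono mult_left_mono mult_pos_pos) auto
    also have "\<dots> = 1 / (pi * t) * exp (- (t * r / 2))" using t r by (simp add: exp_minus field_simps)
    finally show "r / (2 * pi * sinh (t * r)) \<le> 1 / (pi * t) * exp (- (t * r / 2))" .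
    show "0 \<le> r / (2 * pi * sinh (t * r))" using r tr by (intro divide_nonneg_nonneg) auto
  qed simp
  also have "\<dots> = (1 / (pi * t)) powr (real DIM('n) / 2) * exp (- (t * r / 2)) powr (real DIM('n) / 2)"
    by (rule powr_mult)
  also have "exp (- (t * r / 2)) powr (real DIM('n) / 2) = exp (- (t * r / 4) * real DIM('n))"
    by (simp add: powr_def)
  also have "\<dots> \<le> exp (- (t / 4) * r)"
  proof -
    have "t * r / 4 * 1 \<le> t * r / 4 * real DIM('n)" using tr DIM_positive[where 'a='n] by (intro mult_left_mono) (auto simp: Suc_le_eq)
    then show ?thesis by simp
  qed
  finally show ?thesis by (simp add: mult_left_mono)
qed

lemma nn_integral_exp_abs:
  assumes a: "0 < a" shows "(\<integral>\<^sup>+x. ennreal (exp (- a * \<bar>x\<bar>)) \<partial>lborel) = ennreal (2 / a)"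
proof -
  have I: "(\<integral>\<^sup>+x. ennreal (exp (- a * x)) * indicator {0..} x \<partial>lborel) = ennreal (1 / a)"
  proof -
    have "((\<lambda>x. - exp (- a * x) / a) \<longlongrightarrow> 0) at_top"
    proof -
      have "filterlim (\<lambda>x. a * x) at_top at_top" using a by (intro filterlim_tendsto_pos_mult_at_top[OF tendsto_const _ filterlim_ident])
      then have "((\<lambda>x. exp (- (a * x))) \<longlongrightarrow> 0) at_top" by (intro filterlim_compose[OF exp_at_bot] filterlim_uminus_at_bot_at_top[THEN filterlim_compose])
      then have "((\<lambda>x. - exp (- (a * x)) / a) \<longlongrightarrow> - 0 / a) at_top" using a by (intro tendsto_divide tendsto_minus tendsto_const) auto
      then show ?thesis by simp
    qed
    then have "(\<integral>\<^sup>+x. ennreal (exp (- a * x)) * indicator {0..} x \<partial>lborel) = ennreal (0 - (- exp (- a * 0) / a))"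
      using a by (intro nn_integral_FTC_atLeast) (auto intro!: derivative_eq_intros)
    then show ?thesis by simp
  qed
  have "(\<integral>\<^sup>+x. ennreal (exp (- a * \<bar>x\<bar>)) \<partial>lborel) = (\<integral>\<^sup>+x. ennreal (exp (- a * x)) * indicator {0..} x + ennreal (exp (- a * (- x))) * indicator {0..} (- x) \<partial>lborel)"
    by (rule nn_integral_cong_AE) (use AE_lborel_singleton[of "0::real"] in \<open>eventually_elim, auto simp: indicator_def abs_if\<close>)
  also have "\<dots> = ennreal (1 / a) + (\<integral>\<^sup>+x. ennreal (exp (- a * (- x))) * indicator {0..} (- x) \<partial>lborel)"
    unfolding I[symmetric] by (rule nn_integral_add) auto
  also have "(\<integral>\<^sup>+x. ennreal (exp (- a * (- x))) * indicator {0..} (- x) \<partial>lborel) = (\<integral>\<^sup>+x. ennreal (exp (- a * x)) * indicator {0..} x \<partial>lborel)"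
    using nn_integral_lborel_reflect[of "\<lambda>x. ennreal (exp (- a * x)) * indicator {0..} x" 0] by simp
  finally show ?thesis unfolding I using a by (simp add: ennreal_plus[symmetric] del: ennreal_plus)
qed

text \<open>The sum of the absolute coordinates is at most the dimension times the norm, so a
  product of one-dimensional exponentials with rate s / DIM is a majorant.\<close>

lemma nn_integral_exp_norm_le:
  assumes s: "0 < s"
  shows "(\<integral>\<^sup>+\<xi>. ennreal (exp (- s * norm (\<xi>::'d::euclidean_space))) \<partial>lborel) \<le> ennreal ((2 * real DIM('d) / s) ^ DIM('d))"
proof -
  define a where "a = s / real DIM('d)"
  have a: "0 < a" using s by (simp add: a_def)
  have "(\<integral>\<^sup>+\<xi>. ennreal (exp (- s * norm (\<xi>::'d))) \<partial>lborel) \<le> (\<integral>\<^sup>+\<xi>. (\<Prod>b\<in>(Basis::'d set). ennreal (exp (- a * \<bar>\<xi> \<bullet> b\<bar>))) \<partial>lborel)"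
  proof (intro nn_integral_mono)
    fix \<xi> :: 'd
    have "(\<Sum>b\<in>Basis. \<bar>\<xi> \<bullet> b\<bar>) \<le> (\<Sum>b\<in>(Basis::'d set). norm \<xi>)" by (intro sum_mono) (auto intro: Basis_le_norm)
    then have "a * (\<Sum>b\<in>Basis. \<bar>\<xi> \<bullet> b\<bar>) \<le> a * (real DIM('d) * norm \<xi>)" using a by (intro mult_left_mono) auto
    also have "\<dots> = s * norm \<xi>" by (simp add: a_def)
    finally have "exp (- s * norm \<xi>) \<le> exp (\<Sum>b\<in>(Basis::'d set). - a * \<bar>\<xi> \<bullet> b\<bar>)" by (simp add: sum_distrib_left sum_negf)
    also have "\<dots> = (\<Prod>b\<in>(Basis::'d set). exp (- a * \<bar>\<xi> \<bullet> b\<bar>))" by (rule exp_sum) simp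
    finally show "ennreal (exp (- s * norm \<xi>)) \<le> (\<Prod>b\<in>(Basis::'d set). ennreal (exp (- a * \<bar>\<xi> \<bullet> b\<bar>)))"
      by (simp add: prod_ennreal ennreal_leI)
  qed
  also have "\<dots> = (\<Prod>b\<in>(Basis::'d set). (\<integral>\<^sup>+x. ennreal (exp (- a * \<bar>x\<bar>)) \<partial>lborel))"
    by (rule nn_integral_lborel_prod) auto
  also have "\<dots> = ennreal ((2 / a) ^ DIM('d))"
    unfolding nn_integral_exp_abs[OF a] using a by (simp add: ennreal_power)
  finally show ?thesis by (simp add: a_def)
qed

lemma mehler_integrable:
  fixes x w :: "'n::euclidean_space"
  assumes t: "0 < t"
  shows "integrable lborel (\<lambda>\<xi>::'d::euclidean_space. mehler (t * norm \<xi>) (norm \<xi>) x w)"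
    and "(\<integral>(\<xi>::'d). mehler (t * norm \<xi>) (norm \<xi>) x w \<partial>lborel) \<le> (1 / (pi * t)) powr (real DIM('n) / 2) * (8 * real DIM('d) / t) ^ DIM('d)"
proof -
  have le: "(\<integral>\<^sup>+\<xi>. ennreal (mehler (t * norm (\<xi>::'d)) (norm \<xi>) x w) \<partial>lborel) \<le> ennreal ((1 / (pi * t)) powr (real DIM('n) / 2) * (8 * real DIM('d) / t) ^ DIM('d))"
  proof -
    have "(\<integral>\<^sup>+\<xi>. ennreal (mehler (t * norm (\<xi>::'d)) (norm \<xi>) x w) \<partial>lborel) \<le> (\<integral>\<^sup>+\<xi>. ennreal ((1 / (pi * t)) powr (real DIM('n) / 2) * exp (- (t / 4) * norm (\<xi>::'d))) \<partial>lborel)"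
      by (rule nn_integral_mono_AE) (use AE_lborel_nonzero[where 'd='d] in \<open>eventually_elim, intro ennreal_leI mehler_decay[OF t], simp\<close>)
    also have "\<dots> = ennreal ((1 / (pi * t)) powr (real DIM('n) / 2)) * (\<integral>\<^sup>+\<xi>. ennreal (exp (- (t / 4) * norm (\<xi>::'d))) \<partial>lborel)"
      by (rule nn_integral_cmult_ennreal) auto
    also have "\<dots> \<le> ennreal ((1 / (pi * t)) powr (real DIM('n) / 2)) * ennreal ((2 * real DIM('d) / (t / 4)) ^ DIM('d))"
      using t by (intro mult_left_mono nn_integral_exp_norm_le) auto
    finally show ?thesis using t by (simp add: ennreal_mult)
  qed
  show int: "integrable lborel (\<lambda>\<xi>::'d. mehler (t * norm \<xi>) (norm \<xi>) x w)"
    using order.strict_trans1[OF le] by (intro integrableI_nonneg) (auto simp: mehler_nonneg)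
  show "(\<integral>(\<xi>::'d). mehler (t * norm \<xi>) (norm \<xi>) x w \<partial>lborel) \<le> (1 / (pi * t)) powr (real DIM('n) / 2) * (8 * real DIM('d) / t) ^ DIM('d)"
    using le t by (subst (asm) nn_integral_eq_integral[OF int]) (auto simp: mehler_nonneg ennreal_le_iff)
qed

text \<open>The discrete Mehler kernels are Trotter products of the free heat kernel and of multiplication
  by Gaussians in \<open>\<xi>\<close>, so each of them has a nonnegative Fourier transform in \<open>\<xi>\<close>;
  this passes to the limit.\<close>

lemma mehler_fourier_nonneg:
  fixes x w :: "'n::euclidean_space" and y :: "'d::euclidean_space"
  assumes t: "0 < t"
  shows "0 \<le> (\<integral>\<xi>. mehler (t * norm \<xi>) (norm \<xi>) x w * cos (\<xi> \<bullet> y) \<partial>lborel)"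
proof -
  \<comment> \<open>The bound on the discrete kernels does not decay in \<xi>, so a Gaussian cut-off
    is kept while n tends to infinity.\<close>
  have reg: "0 \<le> (\<integral>\<xi>. exp (- \<epsilon> * (norm \<xi>)\<^sup>2) * mehler (t * norm \<xi>) (norm \<xi>) x w * cos (\<xi> \<bullet> y) \<partial>lborel)" if \<epsilon>: "0 < \<epsilon>" for \<epsilon>
  proof (rule LIMSEQ_le_const)
    define b where "b = (1 / (2 * pi * t)) powr (real DIM('n) / 2)"
    define f where "f n \<xi> = exp (- \<epsilon> * (norm \<xi>)\<^sup>2) * mehler (2 ^ n * trotter_angle (t / 2 ^ n) ((norm \<xi>)\<^sup>2)) (trotter_freq (t / 2 ^ n) ((norm \<xi>)\<^sup>2)) x w * cos (\<xi> \<bullet> y)" for n and \<xi> :: 'd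
    show "(\<lambda>n. \<integral>\<xi>. f n \<xi> \<partial>lborel) \<longlonglongrightarrow> (\<integral>\<xi>. exp (- \<epsilon> * (norm \<xi>)\<^sup>2) * mehler (t * norm \<xi>) (norm \<xi>) x w * cos (\<xi> \<bullet> y) \<partial>lborel)"
    proof (rule integral_dominated_convergence[where w="\<lambda>\<xi>. b * exp (- \<epsilon> * (norm \<xi>)\<^sup>2)"])
      show "integrable lborel (\<lambda>\<xi>::'d. b * exp (- \<epsilon> * (norm \<xi>)\<^sup>2))"
        using gaussian_integrable[OF \<epsilon>] by (intro integrable_mult_right) auto
      show "f n \<in> borel_measurable lborel" for n unfolding f_def by measurable
      show "AE \<xi> in lborel. (\<lambda>n. f n \<xi>) \<longlonglongrightarrow> exp (- \<epsilon> * (norm \<xi>)\<^sup>2) * mehler (t * norm \<xi>) (norm \<xi>) x w * cos (\<xi> \<bullet> y)"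
        using AE_lborel_nonzero
      proof eventually_elim
        case (elim \<xi>)
        then show ?case unfolding f_def using t
          by (intro tendsto_mult tendsto_const mehler_tendsto trotter_limit) auto
      qed
      show "AE \<xi> in lborel. norm (f n \<xi>) \<le> b * exp (- \<epsilon> * (norm \<xi>)\<^sup>2)" for n
        using AE_lborel_nonzero
      proof eventually_elim
        case (elim \<xi>)
        have "mehler (2 ^ n * trotter_angle (t / 2 ^ n) ((norm \<xi>)\<^sup>2)) (trotter_freq (t / 2 ^ n) ((norm \<xi>)\<^sup>2)) x w \<le> b"
          using mehler_trotter_le[of "t / 2 ^ n" "(norm \<xi>)\<^sup>2" n x w] t elim by (simp add: b_def)
        then have "norm (f n \<xi>) \<le> exp (- \<epsilon> * (norm \<xi>)\<^sup>2) * b * 1"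
          unfolding f_def real_norm_def abs_mult by (intro mult_mono) (auto simp: mehler_nonneg b_def)
        then show ?case by (simp add: mult.commute)
      qed
    qed measurable
    have "fourier_pos TYPE('d) (\<lambda>l. 1 * mehler (2 ^ n * trotter_angle (t / 2 ^ n) l) (trotter_freq (t / 2 ^ n) l) x w)" for n
      using t by (intro fourier_pos_mult_mehler fourier_pos_one) auto
    then show "\<exists>N. \<forall>n\<ge>N. 0 \<le> (\<integral>\<xi>. f n \<xi> \<partial>lborel)"
      unfolding f_def fourier_pos_def using \<epsilon> by auto
  qed
  \<comment> \<open>The limit kernel is integrable and dominates its own regularisations, so the
    cut-off can be removed.\<close>
  show ?thesis
  proof (rule LIMSEQ_le_const)
    define f where "f n \<xi> = exp (- (1 / real (Suc n)) * (norm \<xi>)\<^sup>2) * mehler (t * norm \<xi>) (norm \<xi>) x w * cos (\<xi> \<bullet> y)" for n and \<xi> :: 'd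
    show "(\<lambda>n. \<integral>\<xi>. f n \<xi> \<partial>lborel) \<longlonglongrightarrow> (\<integral>\<xi>. mehler (t * norm \<xi>) (norm \<xi>) x w * cos (\<xi> \<bullet> y) \<partial>lborel)"
    proof (rule integral_dominated_convergence[where w="\<lambda>\<xi>. mehler (t * norm \<xi>) (norm \<xi>) x w"])
      show "integrable lborel (\<lambda>\<xi>::'d. mehler (t * norm \<xi>) (norm \<xi>) x w)" by (rule mehler_integrable[OF t])
      show "f n \<in> borel_measurable lborel" for n unfolding f_def by measurable
      show "AE \<xi> in lborel. (\<lambda>n. f n \<xi>) \<longlonglongrightarrow> mehler (t * norm \<xi>) (norm \<xi>) x w * cos (\<xi> \<bullet> y)"
      proof (rule AE_I2)
        fix \<xi> :: 'd
        have "(\<lambda>n. exp (- (1 / real (Suc n)) * (norm \<xi>)\<^sup>2)) \<longlonglongrightarrow> exp (- 0 * (norm \<xi>)\<^sup>2)"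
          using LIMSEQ_inverse_real_of_nat by (intro tendsto_intros) (simp add: inverse_eq_divide)
        then have "(\<lambda>n. f n \<xi>) \<longlonglongrightarrow> exp (- 0 * (norm \<xi>)\<^sup>2) * mehler (t * norm \<xi>) (norm \<xi>) x w * cos (\<xi> \<bullet> y)"
          unfolding f_def by (intro tendsto_mult tendsto_const)
        then show "(\<lambda>n. f n \<xi>) \<longlonglongrightarrow> mehler (t * norm \<xi>) (norm \<xi>) x w * cos (\<xi> \<bullet> y)" by simp
      qed
      show "AE \<xi> in lborel. norm (f n \<xi>) \<le> mehler (t * norm \<xi>) (norm \<xi>) x w" for n
      proof (rule AE_I2)
        fix \<xi> :: 'd
        have "norm (f n \<xi>) \<le> 1 * mehler (t * norm \<xi>) (norm \<xi>) x w * 1"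
          unfolding f_def real_norm_def abs_mult by (intro mult_mono) (auto simp: mehler_nonneg)
        then show "norm (f n \<xi>) \<le> mehler (t * norm \<xi>) (norm \<xi>) x w" by simp
      qed
    qed measurable
    show "\<exists>N. \<forall>n\<ge>N. 0 \<le> (\<integral>\<xi>. f n \<xi> \<partial>lborel)"
      unfolding f_def by (intro exI allI impI reg) simp
  qed
qed

section \<open>The Grushin kernel\<close>

lemma nn_integral_lborel_pair:
  fixes F :: "'a::euclidean_space \<Rightarrow> 'b::euclidean_space \<Rightarrow> ennreal"
  assumes F: "(\<lambda>q. F (fst q) (snd q)) \<in> borel_measurable (borel \<Otimes>\<^sub>M borel)"
  shows "(\<integral>\<^sup>+q. F (fst q) (snd q) \<partial>lborel) = (\<integral>\<^sup>+w. \<integral>\<^sup>+z. F w z \<partial>lborel \<partial>lborel)"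
proof -
  have "(\<lambda>q. F (fst q) (snd q)) \<in> borel_measurable (lborel \<Otimes>\<^sub>M lborel)"
    using F by (simp cong: measurable_cong_sets)
  from lborel.nn_integral_fst[OF this] show ?thesis by (simp add: lborel_prod)
qed

text \<open>The inverse Fourier transform in y. The Mehler factor depends on \<xi> only through its
  norm, so only the cosine remains of the exponential.\<close>

definition fourier_mehler :: "real \<Rightarrow> 'n::euclidean_space \<Rightarrow> 'n \<Rightarrow> 'd::euclidean_space \<Rightarrow> real" where
  "fourier_mehler t x w y = 1 / (2 * pi) ^ DIM('d) * (\<integral>\<xi>. mehler (t * norm \<xi>) (norm \<xi>) x w * cos (\<xi> \<bullet> y) \<partial>lborel)"

lemma fourier_mehler_measurable [measurable (raw)]:
  assumes [measurable]: "a \<in> borel_measurable M" "f \<in> measurable M borel" "g \<in> measurable M borel" "h \<in> measurable M borel"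
  shows "(\<lambda>q. fourier_mehler (a q) (f q) (g q) (h q)) \<in> borel_measurable M"
  unfolding fourier_mehler_def by measurable

lemma fourier_mehler_nonneg: "0 < t \<Longrightarrow> 0 \<le> fourier_mehler t x w y"
  unfolding fourier_mehler_def by (intro mult_nonneg_nonneg mehler_fourier_nonneg) auto

lemma fourier_mehler_commute: "fourier_mehler t x w y = fourier_mehler t w x (- y)"
  by (simp add: fourier_mehler_def mehler_commute[of _ _ x w])

lemma integrable_mehler_cos:
  fixes x w :: "'n::euclidean_space" and y :: "'d::euclidean_space"
  assumes t: "0 < t"
  shows "integrable lborel (\<lambda>\<xi>. mehler (t * norm \<xi>) (norm \<xi>) x w * cos (\<xi> \<bullet> y))"
proof (rule Bochner_Integration.integrable_bound[OF mehler_integrable(1)[OF t, of x w]])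
  show "AE \<xi> in lborel. norm (mehler (t * norm \<xi>) (norm \<xi>) x w * cos (\<xi> \<bullet> y)) \<le> norm (mehler (t * norm \<xi>) (norm \<xi>) x w)"
    by (rule AE_I2) (simp add: abs_mult mehler_nonneg mult_left_le)
qed measurable

text \<open>After the cosine is dropped, the decay in frequency gives t^(-N/2) from the prefactor
  and t^(-d) from the frequency integral, with N and d the dimensions of x and y; together they are
  the power -(N + 2 d)/2.\<close>

lemma fourier_mehler_le:
  fixes x w :: "'n::euclidean_space" and y :: "'d::euclidean_space"
  assumes t: "0 < t"
  shows "fourier_mehler t x w y \<le>
    (1 / (2 * pi) ^ DIM('d) * ((1 / pi) powr (real DIM('n) / 2) * (8 * real DIM('d)) ^ DIM('d))) * t powr (- ((real DIM('n) + 2 * real DIM('d)) / 2))"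
proof -
  have "(\<integral>\<xi>. mehler (t * norm \<xi>) (norm \<xi>) x w * cos (\<xi> \<bullet> y) \<partial>lborel) \<le> (\<integral>(\<xi>::'d). mehler (t * norm \<xi>) (norm \<xi>) x w \<partial>lborel)"
    by (intro integral_mono integrable_mehler_cos mehler_integrable t) (simp add: mult_left_le mehler_nonneg)
  also have "\<dots> \<le> (1 / (pi * t)) powr (real DIM('n) / 2) * (8 * real DIM('d) / t) ^ DIM('d)"
    by (rule mehler_integrable[OF t])
  also have "\<dots> = ((1 / pi) powr (real DIM('n) / 2) * (8 * real DIM('d)) ^ DIM('d)) * (t powr (- (real DIM('n) / 2)) * t powr (- real DIM('d)))"
  proof -
    have "(1 / (pi * t)) powr (real DIM('n) / 2) = (1 / pi * (1 / t)) powr (real DIM('n) / 2)" by simp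
    also have "\<dots> = (1 / pi) powr (real DIM('n) / 2) * (1 / t) powr (real DIM('n) / 2)" by (rule powr_mult)
    also have "(1 / t) powr (real DIM('n) / 2) = t powr (- (real DIM('n) / 2))"
      unfolding powr_divide powr_minus_divide by simp
    finally have 1: "(1 / (pi * t)) powr (real DIM('n) / 2) = (1 / pi) powr (real DIM('n) / 2) * t powr (- (real DIM('n) / 2))" .
    have 2: "(8 * real DIM('d) / t) ^ DIM('d) = (8 * real DIM('d)) ^ DIM('d) * t powr (- real DIM('d))"
      unfolding power_divide powr_minus_divide powr_realpow[OF t] by simp
    show ?thesis unfolding 1 2 by (simp only: mult_ac)
  qed
  also have "t powr (- (real DIM('n) / 2)) * t powr (- real DIM('d)) = t powr (- ((real DIM('n) + 2 * real DIM('d)) / 2))"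
    unfolding powr_add[symmetric] by (rule arg_cong[where f="(powr) t"]) (simp add: field_simps)
  finally show ?thesis unfolding fourier_mehler_def mult.assoc by (intro mult_left_mono) auto
qed

section \<open>Testing with Gaussians and the mass of the kernel\<close>

lemma power2_powr_half:
  assumes "0 < (r::real)" shows "(r\<^sup>2) powr (real n / 2) = r ^ n"
proof -
  have "(r\<^sup>2) powr (real n / 2) = (r powr 2) powr (real n / 2)" using assms by simp
  also have "\<dots> = r powr (2 * (real n / 2))" by (rule powr_powr)
  also have "2 * (real n / 2) = real n" by simp
  finally show ?thesis unfolding powr_realpow[OF assms] .
qed

text \<open>Fubini puts the Gaussian's own Fourier transform on the frequency side. The substitution
  \<xi> = r * \<eta> then moves the scale r from the Gaussian into the Mehler kernel, so that r
  \<rightarrow> 0 becomes a limit of small frequencies against a fixed weight.\<close>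

lemma nn_integral_fourier_mehler_gaussian:
  fixes x w :: "'n::euclidean_space"
  assumes t: "0 < t" and r: "0 < r"
  shows "(\<integral>\<^sup>+(y::'d::euclidean_space). ennreal (fourier_mehler t x w y * exp (- r\<^sup>2 * (norm y)\<^sup>2)) \<partial>lborel) =
    ennreal (pi powr (real DIM('d) / 2) / (2 * pi) ^ DIM('d)) *
    (\<integral>\<^sup>+(\<eta>::'d). ennreal (mehler (t * (r * norm \<eta>)) (r * norm \<eta>) x w * exp (- (1 / 4) * (norm \<eta>)\<^sup>2)) \<partial>lborel)"
proof -
  define s where "s = r\<^sup>2"
  have s: "0 < s" using r by (simp add: s_def)
  define m where "m \<xi> = mehler (t * norm \<xi>) (norm \<xi>) x w" for \<xi> :: 'd
  define e where "e y = exp (- s * (norm y)\<^sup>2)" for y :: 'd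
  have [measurable]: "m \<in> borel_measurable borel" "e \<in> borel_measurable borel" unfolding m_def e_def by measurable
  have m0: "0 \<le> m \<xi>" for \<xi> by (simp add: m_def mehler_nonneg)
  have mi: "integrable lborel m" unfolding m_def by (rule mehler_integrable[OF t])
  have ei: "integrable lborel e" unfolding e_def by (rule gaussian_integrable[OF s])
  define H where "H \<xi> y = m \<xi> * cos (\<xi> \<bullet> y) * e y" for \<xi> y
  have Hm: "(\<lambda>(\<xi>, y). H \<xi> y) \<in> borel_measurable (lborel \<Otimes>\<^sub>M lborel)"
  proof -
    have "(\<lambda>(\<xi>, y). H \<xi> y) \<in> borel_measurable (borel \<Otimes>\<^sub>M borel)"
      unfolding H_def case_prod_beta' by measurable
    then show ?thesis by (simp cong: measurable_cong_sets)
  qed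
  have int: "integrable (lborel \<Otimes>\<^sub>M lborel) (\<lambda>(\<xi>, y). H \<xi> y)"
  proof (rule integrableI_bounded[OF Hm])
    have "(\<integral>\<^sup>+q. ennreal (norm (case q of (\<xi>, y) \<Rightarrow> H \<xi> y)) \<partial>(lborel \<Otimes>\<^sub>M lborel)) = (\<integral>\<^sup>+\<xi>. \<integral>\<^sup>+y. ennreal (norm (H \<xi> y)) \<partial>lborel \<partial>lborel)"
      using Hm by (subst lborel.nn_integral_fst[symmetric]) auto
    also have "\<dots> \<le> (\<integral>\<^sup>+\<xi>. \<integral>\<^sup>+y. ennreal (m \<xi>) * ennreal (e y) \<partial>lborel \<partial>lborel)"
    proof (intro nn_integral_mono)
      fix \<xi> y
      have "norm (H \<xi> y) \<le> m \<xi> * 1 * e y"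
        unfolding H_def real_norm_def abs_mult by (intro mult_mono) (auto simp: m0 e_def)
      then show "ennreal (norm (H \<xi> y)) \<le> ennreal (m \<xi>) * ennreal (e y)"
        by (simp add: ennreal_mult[symmetric] m0 e_def ennreal_leI)
    qed
    also have "\<dots> = (\<integral>\<^sup>+\<xi>. ennreal (m \<xi>) \<partial>lborel) * (\<integral>\<^sup>+y. ennreal (e y) \<partial>lborel)"
      by (simp add: nn_integral_cmult nn_integral_multc)
    also have "\<dots> < \<infinity>"
      using nn_integral_eq_integral[OF mi] nn_integral_eq_integral[OF ei] by (simp add: m0 e_def ennreal_mult_less_top)
    finally show "(\<integral>\<^sup>+q. ennreal (norm (case q of (\<xi>, y) \<Rightarrow> H \<xi> y)) \<partial>(lborel \<Otimes>\<^sub>M lborel)) < \<infinity>" .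
  qed
  have gk: "fourier_mehler t x w y * e y = 1 / (2 * pi) ^ DIM('d) * (\<integral>\<xi>. H \<xi> y \<partial>lborel)" for y :: 'd
    by (simp add: fourier_mehler_def H_def m_def)
  define b where "b = pi powr (real DIM('d) / 2) / (2 * pi) ^ DIM('d)"
  have "(\<integral>\<^sup>+y. ennreal (fourier_mehler t x w y * e y) \<partial>lborel) = ennreal (\<integral>y. fourier_mehler t x w y * e y \<partial>lborel)"
  proof (rule nn_integral_eq_integral)
    show "integrable lborel (\<lambda>y. fourier_mehler t x w y * e y)"
      unfolding gk using lborel_pair.integrable_snd[OF int] by (intro integrable_mult_right) auto
  qed (auto simp: fourier_mehler_nonneg[OF t] e_def)
  also have "(\<integral>y. fourier_mehler t x w y * e y \<partial>lborel) = 1 / (2 * pi) ^ DIM('d) * (\<integral>y. (\<integral>\<xi>. H \<xi> y \<partial>lborel) \<partial>lborel)"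
    unfolding gk by (rule integral_mult_right_zero)
  also have "(\<integral>y. (\<integral>\<xi>. H \<xi> y \<partial>lborel) \<partial>lborel) = (\<integral>\<xi>. (\<integral>y. H \<xi> y \<partial>lborel) \<partial>lborel)"
    by (rule lborel_pair.Fubini_integral[OF int])
  also have "\<dots> = (\<integral>\<xi>. m \<xi> * ((pi / s) powr (real DIM('d) / 2) * exp (- (norm \<xi>)\<^sup>2 / (4 * s))) \<partial>lborel)"
  proof (intro Bochner_Integration.integral_cong refl)
    fix \<xi> :: 'd
    have "(\<integral>y. H \<xi> y \<partial>lborel) = (\<integral>y. m \<xi> * (exp (- s * (norm y)\<^sup>2) * cos (y \<bullet> \<xi>)) \<partial>lborel)"
      by (simp add: H_def e_def inner_commute mult_ac)
    also have "\<dots> = m \<xi> * (\<integral>y. exp (- s * (norm y)\<^sup>2) * cos (y \<bullet> \<xi>) \<partial>lborel)" by (rule integral_mult_right_zero)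
    finally show "(\<integral>y. H \<xi> y \<partial>lborel) = m \<xi> * ((pi / s) powr (real DIM('d) / 2) * exp (- (norm \<xi>)\<^sup>2 / (4 * s)))"
      unfolding gaussian_cos(2)[OF s] .
  qed
  also have "ennreal (1 / (2 * pi) ^ DIM('d) * \<dots>) = ennreal (1 / (2 * pi) ^ DIM('d)) * ennreal \<dots>"
    by (rule ennreal_mult) (auto intro!: Bochner_Integration.integral_nonneg simp: m0)
  also have "ennreal (\<integral>\<xi>. m \<xi> * ((pi / s) powr (real DIM('d) / 2) * exp (- (norm \<xi>)\<^sup>2 / (4 * s))) \<partial>lborel) =
     (\<integral>\<^sup>+\<xi>. ennreal (m \<xi> * ((pi / s) powr (real DIM('d) / 2) * exp (- (norm \<xi>)\<^sup>2 / (4 * s)))) \<partial>lborel)"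
  proof (rule nn_integral_eq_integral[symmetric])
    show "integrable lborel (\<lambda>\<xi>. m \<xi> * ((pi / s) powr (real DIM('d) / 2) * exp (- (norm \<xi>)\<^sup>2 / (4 * s))))"
    proof (rule Bochner_Integration.integrable_bound)
      show "integrable lborel (\<lambda>\<xi>. m \<xi> * (pi / s) powr (real DIM('d) / 2))" using mi by (rule integrable_mult_left[rotated]) 
      show "AE \<xi> in lborel. norm (m \<xi> * ((pi / s) powr (real DIM('d) / 2) * exp (- (norm \<xi>)\<^sup>2 / (4 * s)))) \<le> norm (m \<xi> * (pi / s) powr (real DIM('d) / 2))"
      proof (rule AE_I2)
        fix \<xi> :: 'd
        have "exp (- (norm \<xi>)\<^sup>2 / (4 * s)) \<le> 1" using s by simp
        then have "(m \<xi> * (pi / s) powr (real DIM('d) / 2)) * exp (- (norm \<xi>)\<^sup>2 / (4 * s)) \<le> m \<xi> * (pi / s) powr (real DIM('d) / 2)"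
          by (intro mult_right_le_one_le) (auto simp: m0)
        then show "norm (m \<xi> * ((pi / s) powr (real DIM('d) / 2) * exp (- (norm \<xi>)\<^sup>2 / (4 * s)))) \<le> norm (m \<xi> * (pi / s) powr (real DIM('d) / 2))"
          by (simp add: m0 abs_mult mult.assoc)
      qed
    qed measurable
  qed (auto simp: m0)
  also have "\<dots> = ennreal (r ^ DIM('d)) * (\<integral>\<^sup>+\<eta>. ennreal (m (0 + r *\<^sub>R \<eta>) * ((pi / s) powr (real DIM('d) / 2) * exp (- (norm (0 + r *\<^sub>R \<eta> :: 'd))\<^sup>2 / (4 * s)))) \<partial>lborel)"
    using r by (subst nn_integral_lborel_scale[of _ r 0]) auto
  also have "(\<integral>\<^sup>+\<eta>. ennreal (m (0 + r *\<^sub>R \<eta>) * ((pi / s) powr (real DIM('d) / 2) * exp (- (norm (0 + r *\<^sub>R \<eta> :: 'd))\<^sup>2 / (4 * s)))) \<partial>lborel) =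
     (\<integral>\<^sup>+(\<eta>::'d). ennreal ((pi / s) powr (real DIM('d) / 2) * (mehler (t * (r * norm \<eta>)) (r * norm \<eta>) x w * exp (- (1 / 4) * (norm \<eta>)\<^sup>2))) \<partial>lborel)"
    using r by (intro nn_integral_cong) (simp add: m_def s_def power_mult_distrib mult_ac)
  also have "\<dots> = ennreal ((pi / s) powr (real DIM('d) / 2)) * (\<integral>\<^sup>+(\<eta>::'d). ennreal (mehler (t * (r * norm \<eta>)) (r * norm \<eta>) x w * exp (- (1 / 4) * (norm \<eta>)\<^sup>2)) \<partial>lborel)"
    by (rule nn_integral_cmult_ennreal) (auto simp: mehler_nonneg)
  also have "ennreal (1 / (2 * pi) ^ DIM('d)) * (ennreal (r ^ DIM('d)) * (ennreal ((pi / s) powr (real DIM('d) / 2)) * (\<integral>\<^sup>+(\<eta>::'d). ennreal (mehler (t * (r * norm \<eta>)) (r * norm \<eta>) x w * exp (- (1 / 4) * (norm \<eta>)\<^sup>2)) \<partial>lborel)))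
    = ennreal (1 / (2 * pi) ^ DIM('d) * (r ^ DIM('d) * (pi / s) powr (real DIM('d) / 2))) * (\<integral>\<^sup>+(\<eta>::'d). ennreal (mehler (t * (r * norm \<eta>)) (r * norm \<eta>) x w * exp (- (1 / 4) * (norm \<eta>)\<^sup>2)) \<partial>lborel)"
    using r by (simp only: ennreal_mult powr_ge_zero zero_le_power less_imp_le mult.assoc divide_nonneg_nonneg mult_nonneg_nonneg pi_ge_zero zero_le_numeral zero_le_one)
  also have "r ^ DIM('d) * (pi / s) powr (real DIM('d) / 2) = pi powr (real DIM('d) / 2)"
    unfolding s_def powr_divide power2_powr_half[OF r] using r by simp
  finally show ?thesis by (simp add: e_def s_def)
qed

text \<open>Angle and frequency vanish at the same rate, so the angle over its sinh tends to 1 and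
  the potential disappears: what is left is the free heat kernel at time t.\<close>

lemma mehler_tendsto_free:
  fixes x w :: "'n::euclidean_space"
  assumes t: "0 < t" and r: "\<And>n. 0 < r n" "r \<longlonglongrightarrow> 0"
  shows "(\<lambda>n. mehler (t * r n) (r n) x w) \<longlonglongrightarrow> (1 / (2 * pi * t)) powr (real DIM('n) / 2) * exp (- (1 / (2 * t)) * (norm (x - w))\<^sup>2)"
proof -
  define q where "q n = t * r n / sinh (t * r n)" for n
  have tr: "(\<lambda>n. t * r n) \<longlonglongrightarrow> 0" using tendsto_mult_right_zero[OF r(2)] .
  have pos: "0 < t * r n" for n using t r by simp
  have "t * r n \<noteq> 0" for n using pos[of n] by (metis less_irrefl)
  then have "filterlim (\<lambda>n. t * r n) (at 0) sequentially" using tr by (simp add: filterlim_at)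
  from filterlim_compose[OF tendsto_sinh_quotient this] have q: "q \<longlonglongrightarrow> 1" by (simp add: q_def[abs_def])
  have eq: "mehler (t * r n) (r n) x w = (q n / (2 * pi * t)) powr (real DIM('n) / 2) *
      exp (- (1 / (2 * t)) * (q n * (((norm x)\<^sup>2 + (norm w)\<^sup>2) * cosh (t * r n) - 2 * (x \<bullet> w))))" for n
  proof -
    have "r n / (2 * pi * sinh (t * r n)) = q n / (2 * pi * t)" "r n / 2 * (Y / sinh (t * r n)) = 1 / (2 * t) * (q n * Y)" for Y
      using t by (simp_all add: q_def)
    then show ?thesis unfolding mehler_def by (simp only: mult_minus_left)
  qed
  have "(\<lambda>n. mehler (t * r n) (r n) x w) \<longlonglongrightarrow> (1 / (2 * pi * t)) powr (real DIM('n) / 2) *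
      exp (- (1 / (2 * t)) * (1 * (((norm x)\<^sup>2 + (norm w)\<^sup>2) * cosh 0 - 2 * (x \<bullet> w))))"
    unfolding eq using t
    by (intro tendsto_mult tendsto_powr tendsto_exp tendsto_divide tendsto_diff tendsto_const tendsto_cosh q tr) auto
  moreover have "1 * (((norm x)\<^sup>2 + (norm w)\<^sup>2) * cosh 0 - 2 * (x \<bullet> w)) = (norm (x - w))\<^sup>2"
    by (simp add: power2_norm_eq_inner inner_simps inner_commute)
  ultimately show ?thesis by simp
qed

lemma mehler_le_const:
  fixes x w :: "'n::euclidean_space"
  assumes "0 < t" "0 < r"
  shows "mehler (t * r) r x w \<le> (1 / (pi * t)) powr (real DIM('n) / 2)"
proof -
  have "(1 / (pi * t)) powr (real DIM('n) / 2) * exp (- (t / 4) * r) \<le> (1 / (pi * t)) powr (real DIM('n) / 2)"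
    using assms by (intro mult_right_le_one_le) auto
  with mehler_decay[OF assms, of x w] show ?thesis by linarith
qed

lemma gaussian_normalization: "pi powr (real n / 2) / (2 * pi) ^ n * (pi / (1 / 4)) powr (real n / 2) = 1"
proof -
  have "pi powr (real n / 2) * (pi / (1 / 4)) powr (real n / 2) = (pi * (pi / (1 / 4))) powr (real n / 2)"
    by (rule powr_mult[symmetric])
  also have "pi * (pi / (1 / 4)) = (2 * pi)\<^sup>2" by (simp add: power2_eq_square)
  also have "((2 * pi)\<^sup>2) powr (real n / 2) = (2 * pi) ^ n" by (rule power2_powr_half) simp
  finally show ?thesis unfolding times_divide_eq_left by simp
qed

text \<open>Integrating in y evaluates the Fourier transform at frequency 0. One and the same
  sequence of Gaussian tests is computed twice: by monotone convergence in y, where positivity of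
  the kernel is essential, and by dominated convergence in \<eta>.\<close>

lemma nn_integral_fourier_mehler:
  fixes x w :: "'n::euclidean_space"
  assumes t: "0 < t"
  shows "(\<integral>\<^sup>+(y::'d::euclidean_space). ennreal (fourier_mehler t x w y) \<partial>lborel) =
    ennreal ((1 / (2 * pi * t)) powr (real DIM('n) / 2) * exp (- (1 / (2 * t)) * (norm (x - w))\<^sup>2))"
proof (rule LIMSEQ_unique)
  define r where "r n = 1 / real (Suc n)" for n
  have r: "0 < r n" for n by (simp add: r_def)
  have r0: "r \<longlonglongrightarrow> 0" using LIMSEQ_inverse_real_of_nat by (simp add: r_def[abs_def] inverse_eq_divide)
  define b where "b = pi powr (real DIM('d) / 2) / (2 * pi) ^ DIM('d)"
  define p where "p = (1 / (2 * pi * t)) powr (real DIM('n) / 2) * exp (- (1 / (2 * t)) * (norm (x - w))\<^sup>2)"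
  define B where "B = (1 / (pi * t)) powr (real DIM('n) / 2)"
  show "(\<lambda>n. \<integral>\<^sup>+(y::'d). ennreal (fourier_mehler t x w y * exp (- (r n)\<^sup>2 * (norm y)\<^sup>2)) \<partial>lborel) \<longlonglongrightarrow> (\<integral>\<^sup>+(y::'d). ennreal (fourier_mehler t x w y) \<partial>lborel)"
  proof (rule nn_integral_LIMSEQ)
    have dec: "r n \<le> r m" if "m \<le> n" for m n using that by (simp add: r_def frac_le)
    show "incseq (\<lambda>n (y::'d). ennreal (fourier_mehler t x w y * exp (- (r n)\<^sup>2 * (norm y)\<^sup>2)))"
    proof (intro incseq_SucI le_funI ennreal_leI mult_left_mono fourier_mehler_nonneg t)
      fix n and y :: 'd
      have "(r (Suc n))\<^sup>2 * (norm y)\<^sup>2 \<le> (r n)\<^sup>2 * (norm y)\<^sup>2"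
        using dec[of n "Suc n"] less_imp_le[OF r[of "Suc n"]] by (intro mult_right_mono power_mono) simp_all
      then show "exp (- (r n)\<^sup>2 * (norm y)\<^sup>2) \<le> exp (- (r (Suc n))\<^sup>2 * (norm y)\<^sup>2)" by simp
    qed
    fix y :: 'd
    have "(\<lambda>n. fourier_mehler t x w y * exp (- (r n)\<^sup>2 * (norm y)\<^sup>2)) \<longlonglongrightarrow> fourier_mehler t x w y * exp (- 0\<^sup>2 * (norm y)\<^sup>2)"
      by (intro tendsto_intros r0)
    then show "(\<lambda>n. ennreal (fourier_mehler t x w y * exp (- (r n)\<^sup>2 * (norm y)\<^sup>2))) \<longlonglongrightarrow> ennreal (fourier_mehler t x w y)"
      by (intro tendsto_ennrealI) simp
  qed measurable
  have "(\<lambda>n. \<integral>\<^sup>+(\<eta>::'d). ennreal (mehler (t * (r n * norm \<eta>)) (r n * norm \<eta>) x w * exp (- (1 / 4) * (norm \<eta>)\<^sup>2)) \<partial>lborel) \<longlonglongrightarrow>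
     (\<integral>\<^sup>+(\<eta>::'d). ennreal (p * exp (- (1 / 4) * (norm \<eta>)\<^sup>2)) \<partial>lborel)"
  proof (rule nn_integral_dominated_convergence[where w="\<lambda>\<eta>. ennreal (B * exp (- (1 / 4) * (norm \<eta>)\<^sup>2))"])
    show "AE (\<eta>::'d) in lborel. ennreal (mehler (t * (r n * norm \<eta>)) (r n * norm \<eta>) x w * exp (- (1 / 4) * (norm \<eta>)\<^sup>2)) \<le> ennreal (B * exp (- (1 / 4) * (norm \<eta>)\<^sup>2))" for n
      using AE_lborel_nonzero
    proof eventually_elim
      case (elim \<eta>)
      then have "0 < r n * norm \<eta>" using r by simp
      from mehler_le_const[OF t this, of x w] show ?case
        by (intro ennreal_leI mult_right_mono) (auto simp: B_def)
    qed
    show "AE (\<eta>::'d) in lborel. (\<lambda>n. ennreal (mehler (t * (r n * norm \<eta>)) (r n * norm \<eta>) x w * exp (- (1 / 4) * (norm \<eta>)\<^sup>2))) \<longlonglongrightarrow> ennreal (p * exp (- (1 / 4) * (norm \<eta>)\<^sup>2))"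
      using AE_lborel_nonzero
    proof eventually_elim
      case (elim \<eta>)
      have "(\<lambda>n. mehler (t * (r n * norm \<eta>)) (r n * norm \<eta>) x w) \<longlonglongrightarrow> p"
        unfolding p_def using elim r by (intro mehler_tendsto_free t) (auto intro!: tendsto_mult_left_zero r0)
      then show ?case by (intro tendsto_ennrealI tendsto_mult tendsto_const)
    qed
    have "(\<integral>\<^sup>+(\<eta>::'d). ennreal (B * exp (- (1 / 4) * (norm \<eta>)\<^sup>2)) \<partial>lborel) = ennreal B * (\<integral>\<^sup>+(\<eta>::'d). ennreal (exp (- (1 / 4) * (norm \<eta>)\<^sup>2)) \<partial>lborel)"
      by (rule nn_integral_cmult_ennreal) (auto simp: B_def)
    also have "\<dots> < \<infinity>" by (subst nn_integral_gaussian) (auto simp: ennreal_mult_less_top)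
    finally show "(\<integral>\<^sup>+(\<eta>::'d). ennreal (B * exp (- (1 / 4) * (norm \<eta>)\<^sup>2)) \<partial>lborel) < \<infinity>" .
  qed measurable
  also have "(\<integral>\<^sup>+(\<eta>::'d). ennreal (p * exp (- (1 / 4) * (norm \<eta>)\<^sup>2)) \<partial>lborel) = ennreal (p * (pi / (1 / 4)) powr (real DIM('d) / 2))"
  proof -
    have "(\<integral>\<^sup>+(\<eta>::'d). ennreal (p * exp (- (1 / 4) * (norm \<eta>)\<^sup>2)) \<partial>lborel) = ennreal p * (\<integral>\<^sup>+(\<eta>::'d). ennreal (exp (- (1 / 4) * (norm \<eta>)\<^sup>2)) \<partial>lborel)"
      by (rule nn_integral_cmult_ennreal) (auto simp: p_def)
    also have "(\<integral>\<^sup>+(\<eta>::'d). ennreal (exp (- (1 / 4) * (norm \<eta>)\<^sup>2)) \<partial>lborel) = ennreal ((pi / (1 / 4)) powr (real DIM('d) / 2))"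
      by (rule nn_integral_gaussian) simp
    finally show ?thesis by (subst ennreal_mult) (auto simp: p_def)
  qed
  finally have "(\<lambda>n. ennreal b * (\<integral>\<^sup>+(\<eta>::'d). ennreal (mehler (t * (r n * norm \<eta>)) (r n * norm \<eta>) x w * exp (- (1 / 4) * (norm \<eta>)\<^sup>2)) \<partial>lborel)) \<longlonglongrightarrow> ennreal b * ennreal (p * (pi / (1 / 4)) powr (real DIM('d) / 2))"
    by (intro ennreal_tendsto_cmult) auto
  also have "ennreal b * ennreal (p * (pi / (1 / 4)) powr (real DIM('d) / 2)) = ennreal (p * (b * (pi / (1 / 4)) powr (real DIM('d) / 2)))"
    by (subst ennreal_mult[symmetric]) (auto simp: b_def p_def)
  also have "b * (pi / (1 / 4)) powr (real DIM('d) / 2) = 1" unfolding b_def by (rule gaussian_normalization)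
  finally show "(\<lambda>n. \<integral>\<^sup>+(y::'d). ennreal (fourier_mehler t x w y * exp (- (r n)\<^sup>2 * (norm y)\<^sup>2)) \<partial>lborel) \<longlonglongrightarrow> ennreal ((1 / (2 * pi * t)) powr (real DIM('n) / 2) * exp (- (1 / (2 * t)) * (norm (x - w))\<^sup>2))"
    unfolding nn_integral_fourier_mehler_gaussian[OF t r] b_def p_def by simp
qed

lemma fourier_mehler_mass:
  fixes x :: "'n::euclidean_space" and y :: "'d::euclidean_space"
  assumes t: "0 < t"
  shows "(\<integral>\<^sup>+q. ennreal (fourier_mehler t x (fst q) (y - snd q)) \<partial>lborel) = 1"
proof -
  have "(\<integral>\<^sup>+q. ennreal (fourier_mehler t x (fst q) (y - snd q)) \<partial>lborel) = (\<integral>\<^sup>+w. \<integral>\<^sup>+z. ennreal (fourier_mehler t x w (y - z)) \<partial>lborel \<partial>lborel)"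
    by (rule nn_integral_lborel_pair[of "\<lambda>w z. ennreal (fourier_mehler t x w (y - z))"]) measurable
  also have "\<dots> = (\<integral>\<^sup>+w. ennreal ((1 / (2 * pi * t)) powr (real DIM('n) / 2) * exp (- (1 / (2 * t)) * (norm (x - w))\<^sup>2)) \<partial>lborel)"
    by (subst nn_integral_lborel_reflect[of "\<lambda>z. ennreal (fourier_mehler t x _ z)" y]) (auto simp: nn_integral_fourier_mehler[OF t])
  also have "\<dots> = (\<integral>\<^sup>+(w::'n). ennreal ((1 / (2 * pi * t)) powr (real DIM('n) / 2) * exp (- (1 / (2 * t)) * (norm w)\<^sup>2)) \<partial>lborel)"
    by (rule nn_integral_lborel_reflect) measurable
  also have "\<dots> = ennreal ((1 / (2 * pi * t)) powr (real DIM('n) / 2)) * (\<integral>\<^sup>+(w::'n). ennreal (exp (- (1 / (2 * t)) * (norm w)\<^sup>2)) \<partial>lborel)"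
    by (rule nn_integral_cmult_ennreal) auto
  also have "\<dots> = ennreal ((1 / (2 * pi * t)) powr (real DIM('n) / 2)) * ennreal ((pi / (1 / (2 * t))) powr (real DIM('n) / 2))"
    using t by (subst nn_integral_gaussian) auto
  also have "\<dots> = ennreal ((1 / (2 * pi * t) * (pi / (1 / (2 * t)))) powr (real DIM('n) / 2))"
    by (subst powr_mult) (simp add: ennreal_mult)
  also have "1 / (2 * pi * t) * (pi / (1 / (2 * t))) = 1" using t by simp
  finally show ?thesis by simp
qed

lemma fourier_mehler_tendsto:
  fixes x w :: "'n::euclidean_space" and y :: "'d::euclidean_space"
  assumes t: "0 < t"
  shows "((\<lambda>s. fourier_mehler s x w y) \<longlongrightarrow> fourier_mehler t x w y) (at t)"
  unfolding tendsto_at_iff_sequentially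
proof (intro allI impI)
  fix X :: "nat \<Rightarrow> real" assume X: "X \<longlonglongrightarrow> t"
  \<comment> \<open>Times below t / 2 occur only finitely often and are replaced by t; above t / 2
    the decay rate is at least t / 8, which gives a common majorant.\<close>
  define r where "r n = (if t / 2 < X n then X n else t)" for n
  have "t / 2 < t" using t by simp
  from order_tendstoD(1)[OF X this] have ev: "\<forall>\<^sub>F n in sequentially. X n = r n"
    by eventually_elim (simp add: r_def)
  have r: "r \<longlonglongrightarrow> t" by (rule Lim_transform_eventually[OF X ev])
  have r2: "t / 2 < r n" for n using t by (simp add: r_def)
  have rpos: "0 < r n" for n using r2[of n] t by linarith
  define B where "B = (1 / (pi * (t / 2))) powr (real DIM('n) / 2)"
  have "(\<lambda>n. fourier_mehler (r n) x w y) \<longlonglongrightarrow> fourier_mehler t x w y"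
    unfolding fourier_mehler_def
  proof (intro tendsto_mult tendsto_const)
    show "(\<lambda>n. \<integral>\<xi>. mehler (r n * norm \<xi>) (norm \<xi>) x w * cos (\<xi> \<bullet> y) \<partial>lborel) \<longlonglongrightarrow> (\<integral>\<xi>. mehler (t * norm \<xi>) (norm \<xi>) x w * cos (\<xi> \<bullet> y) \<partial>lborel)"
    proof (rule integral_dominated_convergence[where w="\<lambda>\<xi>. B * exp (- (t / 8) * norm \<xi>)"])
      have "integrable lborel (\<lambda>\<xi>::'d. exp (- (t / 8) * norm \<xi>))"
        using t by (intro integrableI_nonneg order.strict_trans1[OF nn_integral_exp_norm_le]) auto
      then show "integrable lborel (\<lambda>\<xi>::'d. B * exp (- (t / 8) * norm \<xi>))" by (intro integrable_mult_right)
      show "AE \<xi> in lborel. (\<lambda>n. mehler (r n * norm \<xi>) (norm \<xi>) x w * cos (\<xi> \<bullet> y)) \<longlonglongrightarrow> mehler (t * norm \<xi>) (norm \<xi>) x w * cos (\<xi> \<bullet> y)"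
        using AE_lborel_nonzero
      proof eventually_elim
        case (elim \<xi>)
        then show ?case using t by (intro tendsto_mult tendsto_const mehler_tendsto r) auto
      qed
      show "AE \<xi> in lborel. norm (mehler (r n * norm \<xi>) (norm \<xi>) x w * cos (\<xi> \<bullet> y)) \<le> B * exp (- (t / 8) * norm \<xi>)" for n
        using AE_lborel_nonzero
      proof eventually_elim
        case (elim \<xi>)
        have "norm (mehler (r n * norm \<xi>) (norm \<xi>) x w * cos (\<xi> \<bullet> y)) \<le> mehler (r n * norm \<xi>) (norm \<xi>) x w * 1"
          unfolding real_norm_def abs_mult by (intro mult_mono) (auto simp: mehler_nonneg)
        also have "\<dots> \<le> (1 / (pi * r n)) powr (real DIM('n) / 2) * exp (- (r n / 4) * norm \<xi>)"
          using mehler_decay[OF rpos, of "norm \<xi>" n x w] elim by simp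
        also have "\<dots> \<le> B * exp (- (t / 8) * norm \<xi>)"
        proof (rule mult_mono)
          show "(1 / (pi * r n)) powr (real DIM('n) / 2) \<le> B"
            unfolding B_def using r2[of n] rpos[of n] t by (intro powr_mono2 divide_left_mono mult_left_mono) auto
          have "t / 8 * norm \<xi> \<le> r n / 4 * norm \<xi>" using r2[of n] by (intro mult_right_mono) auto
          then show "exp (- (r n / 4) * norm \<xi>) \<le> exp (- (t / 8) * norm \<xi>)" by simp
        qed (auto simp: B_def)
        finally show ?case .
      qed
    qed measurable
  qed
  then show "((\<lambda>s. fourier_mehler s x w y) \<circ> X) \<longlonglongrightarrow> fourier_mehler t x w y"
    by (rule Lim_transform_eventually) (use ev in \<open>eventually_elim, simp\<close>)
qed

section \<open>Concentration on the diagonal as time tends to 0\<close>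

definition mehler_total :: "real \<Rightarrow> 'n::euclidean_space \<Rightarrow> real \<Rightarrow> real" where
  "mehler_total t x r = cosh (t * r) powr (- (real DIM('n) / 2)) * exp (- (r / 2) * (norm x)\<^sup>2 * tanh (t * r))"

lemma mehler_total_bounds:
  assumes "0 \<le> t" "0 \<le> r" shows "0 \<le> mehler_total t x r" "mehler_total t x r \<le> 1"
proof -
  show "0 \<le> mehler_total t x r" by (simp add: mehler_total_def)
  have "1 \<le> cosh (t * r)" by (rule cosh_real_ge_1)
  then have "cosh (t * r) powr (- (real DIM('a) / 2)) \<le> cosh (t * r) powr 0" by (intro powr_mono) auto
  then have 1: "cosh (t * r) powr (- (real DIM('a) / 2)) \<le> 1" by simp
  have "0 \<le> (r / 2) * (norm x)\<^sup>2 * tanh (t * r)" using assms by (intro mult_nonneg_nonneg) (auto simp: tanh_def)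
  then have 2: "exp (- (r / 2) * (norm x)\<^sup>2 * tanh (t * r)) \<le> 1" by simp
  have "mehler_total t x r \<le> 1 * 1" unfolding mehler_total_def by (rule mult_mono[OF 1 2]) auto
  then show "mehler_total t x r \<le> 1" by simp
qed

lemma mehler_total_measurable [measurable (raw)]:
  assumes [measurable]: "f \<in> borel_measurable M"
  shows "(\<lambda>q. mehler_total t x (f q)) \<in> borel_measurable M"
  unfolding mehler_total_def tanh_def by measurable

text \<open>Testing with a Gaussian in y and integrating in x reduces the behaviour for small times
  to the explicit function \<open>mehler_total\<close>, which tends to 1 at each frequency.\<close>

lemma nn_integral_fourier_mehler_regularized:
  fixes x :: "'n::euclidean_space" and y :: "'d::euclidean_space"
  assumes t: "0 < t"
  shows "(\<integral>\<^sup>+q. ennreal (fourier_mehler t x (fst q) (y - snd q) * exp (- (norm (y - snd q))\<^sup>2)) \<partial>lborel) =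
    ennreal (pi powr (real DIM('d) / 2) / (2 * pi) ^ DIM('d)) * (\<integral>\<^sup>+(\<eta>::'d). ennreal (mehler_total t x (norm \<eta>) * exp (- (1 / 4) * (norm \<eta>)\<^sup>2)) \<partial>lborel)"
    (is "_ = ?b * _")
proof -
  have "(\<integral>\<^sup>+q. ennreal (fourier_mehler t x (fst q) (y - snd q) * exp (- (norm (y - snd q))\<^sup>2)) \<partial>lborel) =
      (\<integral>\<^sup>+w. \<integral>\<^sup>+z. ennreal (fourier_mehler t x w (y - z) * exp (- (norm (y - z))\<^sup>2)) \<partial>lborel \<partial>lborel)"
    by (rule nn_integral_lborel_pair[of "\<lambda>w z. ennreal (fourier_mehler t x w (y - z) * exp (- (norm (y - z))\<^sup>2))"]) measurable
  also have "\<dots> = (\<integral>\<^sup>+w. ?b * (\<integral>\<^sup>+(\<eta>::'d). ennreal (mehler (t * norm \<eta>) (norm \<eta>) x w * exp (- (1 / 4) * (norm \<eta>)\<^sup>2)) \<partial>lborel) \<partial>lborel)"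
  proof (intro nn_integral_cong)
    fix w
    have "(\<integral>\<^sup>+z. ennreal (fourier_mehler t x w (y - z) * exp (- (norm (y - z))\<^sup>2)) \<partial>lborel) = (\<integral>\<^sup>+(z::'d). ennreal (fourier_mehler t x w z * exp (- (norm z)\<^sup>2)) \<partial>lborel)"
      by (rule nn_integral_lborel_reflect[of "\<lambda>z. ennreal (fourier_mehler t x w z * exp (- (norm z)\<^sup>2))"]) measurable
    also have "\<dots> = ?b * (\<integral>\<^sup>+(\<eta>::'d). ennreal (mehler (t * norm \<eta>) (norm \<eta>) x w * exp (- (1 / 4) * (norm \<eta>)\<^sup>2)) \<partial>lborel)"
      using nn_integral_fourier_mehler_gaussian[OF t zero_less_one, of x w, where 'd='d] by simp
    finally show "(\<integral>\<^sup>+z. ennreal (fourier_mehler t x w (y - z) * exp (- (norm (y - z))\<^sup>2)) \<partial>lborel) = ?b * (\<integral>\<^sup>+(\<eta>::'d). ennreal (mehler (t * norm \<eta>) (norm \<eta>) x w * exp (- (1 / 4) * (norm \<eta>)\<^sup>2)) \<partial>lborel)" .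
  qed
  also have "\<dots> = ?b * (\<integral>\<^sup>+w. \<integral>\<^sup>+(\<eta>::'d). ennreal (mehler (t * norm \<eta>) (norm \<eta>) x w * exp (- (1 / 4) * (norm \<eta>)\<^sup>2)) \<partial>lborel \<partial>lborel)"
    by (rule nn_integral_cmult) measurable
  also have "(\<integral>\<^sup>+w. \<integral>\<^sup>+(\<eta>::'d). ennreal (mehler (t * norm \<eta>) (norm \<eta>) x w * exp (- (1 / 4) * (norm \<eta>)\<^sup>2)) \<partial>lborel \<partial>lborel) =
      (\<integral>\<^sup>+(\<eta>::'d). \<integral>\<^sup>+w. ennreal (mehler (t * norm \<eta>) (norm \<eta>) x w * exp (- (1 / 4) * (norm \<eta>)\<^sup>2)) \<partial>lborel \<partial>lborel)"
  proof (rule lborel_pair.Fubini')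
    have "(\<lambda>(\<eta>, w). ennreal (mehler (t * norm (\<eta>::'d)) (norm \<eta>) x w * exp (- (1 / 4) * (norm \<eta>)\<^sup>2))) \<in> borel_measurable (borel \<Otimes>\<^sub>M borel)"
      unfolding case_prod_beta' by measurable
    then show "(\<lambda>(\<eta>, w). ennreal (mehler (t * norm (\<eta>::'d)) (norm \<eta>) x w * exp (- (1 / 4) * (norm \<eta>)\<^sup>2))) \<in> borel_measurable (lborel \<Otimes>\<^sub>M lborel)"
      by (simp cong: measurable_cong_sets)
  qed
  also have "\<dots> = (\<integral>\<^sup>+(\<eta>::'d). ennreal (mehler_total t x (norm \<eta>) * exp (- (1 / 4) * (norm \<eta>)\<^sup>2)) \<partial>lborel)"
  proof (rule nn_integral_cong_AE)
    show "AE (\<eta>::'d) in lborel. (\<integral>\<^sup>+w. ennreal (mehler (t * norm \<eta>) (norm \<eta>) x w * exp (- (1 / 4) * (norm \<eta>)\<^sup>2)) \<partial>lborel) = ennreal (mehler_total t x (norm \<eta>) * exp (- (1 / 4) * (norm \<eta>)\<^sup>2))"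
      using AE_lborel_nonzero
    proof eventually_elim
      case (elim \<eta>)
      have "(\<integral>\<^sup>+w. ennreal (mehler (t * norm \<eta>) (norm \<eta>) x w * exp (- (1 / 4) * (norm \<eta>)\<^sup>2)) \<partial>lborel) = (\<integral>\<^sup>+w. ennreal (mehler (t * norm \<eta>) (norm \<eta>) x w) * ennreal (exp (- (1 / 4) * (norm \<eta>)\<^sup>2)) \<partial>lborel)"
        by (intro nn_integral_cong ennreal_mult) (auto simp: mehler_nonneg)
      also have "\<dots> = (\<integral>\<^sup>+w. ennreal (mehler (t * norm \<eta>) (norm \<eta>) x w) \<partial>lborel) * ennreal (exp (- (1 / 4) * (norm \<eta>)\<^sup>2))"
        by (rule nn_integral_multc) measurable
      also have "(\<integral>\<^sup>+w. ennreal (mehler (t * norm \<eta>) (norm \<eta>) x w) \<partial>lborel) = ennreal (mehler_total t x (norm \<eta>))"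
        unfolding mehler_total_def using t elim by (intro mehler_mass) auto
      also have "ennreal (mehler_total t x (norm \<eta>)) * ennreal (exp (- (1 / 4) * (norm \<eta>)\<^sup>2)) = ennreal (mehler_total t x (norm \<eta>) * exp (- (1 / 4) * (norm \<eta>)\<^sup>2))"
        using t by (intro ennreal_mult[symmetric] mehler_total_bounds) auto
      finally show ?case .
    qed
  qed
  finally show ?thesis .
qed

lemma fourier_mehler_pair_measurable:
  fixes x :: "'n::euclidean_space" and y :: "'d::euclidean_space"
  assumes [measurable]: "g \<in> borel_measurable borel" "h \<in> borel_measurable borel"
  shows "(\<lambda>q. ennreal (fourier_mehler t x (fst q) (y - snd q) * g (y - snd q)) * h (fst q)) \<in> borel_measurable lborel"
proof -
  have "(\<lambda>q. ennreal (fourier_mehler t x (fst q) (y - snd q) * g (y - snd q)) * h (fst q)) \<in> borel_measurable (borel \<Otimes>\<^sub>M borel)"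
    by measurable
  then show ?thesis by (simp add: borel_prod)
qed

text \<open>Obtained as a complement: on both sides the Gaussian part and the defect add up to 1,
  and the Gaussian parts agree. Cancelling a finite summand takes the place of a subtraction in
  \<open>ennreal\<close>.\<close>

lemma nn_integral_fourier_mehler_defect:
  fixes x :: "'n::euclidean_space" and y :: "'d::euclidean_space"
  assumes t: "0 < t"
  shows "(\<integral>\<^sup>+q. ennreal (fourier_mehler t x (fst q) (y - snd q) * (1 - exp (- (norm (y - snd q))\<^sup>2))) \<partial>lborel) =
    ennreal (pi powr (real DIM('d) / 2) / (2 * pi) ^ DIM('d)) * (\<integral>\<^sup>+(\<eta>::'d). ennreal ((1 - mehler_total t x (norm \<eta>)) * exp (- (1 / 4) * (norm \<eta>)\<^sup>2)) \<partial>lborel)"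
    (is "?I1 = ?b * ?J1")
proof -
  let ?I2 = "\<integral>\<^sup>+q. ennreal (fourier_mehler t x (fst q) (y - snd q) * exp (- (norm (y - snd q))\<^sup>2)) \<partial>lborel"
  let ?J2 = "\<integral>\<^sup>+(\<eta>::'d). ennreal (mehler_total t x (norm \<eta>) * exp (- (1 / 4) * (norm \<eta>)\<^sup>2)) \<partial>lborel"
  note k0 = fourier_mehler_nonneg[OF t]
  note m01 = mehler_total_bounds[OF less_imp_le[OF t] norm_ge_zero]
  have "?I2 + ?I1 = (\<integral>\<^sup>+q. ennreal (fourier_mehler t x (fst q) (y - snd q) * exp (- (norm (y - snd q))\<^sup>2)) + ennreal (fourier_mehler t x (fst q) (y - snd q) * (1 - exp (- (norm (y - snd q))\<^sup>2))) \<partial>lborel)"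
    using fourier_mehler_pair_measurable[of "\<lambda>v. exp (- (norm v)\<^sup>2)" "\<lambda>_. 1" t x y]
      fourier_mehler_pair_measurable[of "\<lambda>v. 1 - exp (- (norm v)\<^sup>2)" "\<lambda>_. 1" t x y]
    by (intro nn_integral_add[symmetric]) simp_all
  also have "\<dots> = (\<integral>\<^sup>+q. ennreal (fourier_mehler t x (fst q) (y - snd q)) \<partial>lborel)"
    by (intro nn_integral_cong, subst ennreal_plus[symmetric]) (auto simp: k0 right_diff_distrib intro!: mult_nonneg_nonneg mult_left_le)
  finally have I: "?I2 + ?I1 = 1" unfolding fourier_mehler_mass[OF t] .
  have "?J2 + ?J1 = (\<integral>\<^sup>+(\<eta>::'d). ennreal (mehler_total t x (norm \<eta>) * exp (- (1 / 4) * (norm \<eta>)\<^sup>2)) + ennreal ((1 - mehler_total t x (norm \<eta>)) * exp (- (1 / 4) * (norm \<eta>)\<^sup>2)) \<partial>lborel)"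
    by (rule nn_integral_add[symmetric]) measurable
  also have "\<dots> = (\<integral>\<^sup>+(\<eta>::'d). ennreal (exp (- (1 / 4) * (norm \<eta>)\<^sup>2)) \<partial>lborel)"
  proof (intro nn_integral_cong)
    fix \<eta> :: 'd
    have "ennreal (mehler_total t x (norm \<eta>) * exp (- (1 / 4) * (norm \<eta>)\<^sup>2)) + ennreal ((1 - mehler_total t x (norm \<eta>)) * exp (- (1 / 4) * (norm \<eta>)\<^sup>2)) =
       ennreal (mehler_total t x (norm \<eta>) * exp (- (1 / 4) * (norm \<eta>)\<^sup>2) + (1 - mehler_total t x (norm \<eta>)) * exp (- (1 / 4) * (norm \<eta>)\<^sup>2))"
      using m01[of x \<eta>] by (intro ennreal_plus[symmetric]) auto
    then show "ennreal (mehler_total t x (norm \<eta>) * exp (- (1 / 4) * (norm \<eta>)\<^sup>2)) + ennreal ((1 - mehler_total t x (norm \<eta>)) * exp (- (1 / 4) * (norm \<eta>)\<^sup>2)) = ennreal (exp (- (1 / 4) * (norm \<eta>)\<^sup>2))"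
      by (simp add: algebra_simps)
  qed
  also have "\<dots> = ennreal ((pi / (1 / 4)) powr (real DIM('d) / 2))" by (rule nn_integral_gaussian) simp
  finally have "?b * (?J2 + ?J1) = ?b * ennreal ((pi / (1 / 4)) powr (real DIM('d) / 2))" by simp
  also have "\<dots> = ennreal (pi powr (real DIM('d) / 2) / (2 * pi) ^ DIM('d) * (pi / (1 / 4)) powr (real DIM('d) / 2))"
    by (rule ennreal_mult[symmetric]) auto
  also have "\<dots> = 1" unfolding gaussian_normalization by simp
  finally have "?I2 + ?b * ?J1 = 1"
    unfolding nn_integral_fourier_mehler_regularized[OF t] by (simp add: distrib_left)
  with I have "?I2 + ?I1 = ?I2 + ?b * ?J1" by simp
  moreover have "?I2 \<noteq> \<top>"
  proof
    assume "?I2 = \<top>"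
    with I show False by simp
  qed
  ultimately show ?thesis by (simp only: ennreal_add_left_cancel) auto
qed

lemma fourier_mehler_defect_tendsto:
  fixes x :: "'n::euclidean_space" and y :: "'d::euclidean_space"
  assumes X: "\<And>n. 0 < X n" "X \<longlonglongrightarrow> 0"
  shows "(\<lambda>n. \<integral>\<^sup>+q. ennreal (fourier_mehler (X n) x (fst q) (y - snd q) * (1 - exp (- (norm (y - snd q))\<^sup>2))) \<partial>lborel) \<longlonglongrightarrow> 0"
proof -
  note m01 = mehler_total_bounds[OF less_imp_le[OF X(1)] norm_ge_zero]
  have "(\<lambda>n. \<integral>\<^sup>+(\<eta>::'d). ennreal ((1 - mehler_total (X n) x (norm \<eta>)) * exp (- (1 / 4) * (norm \<eta>)\<^sup>2)) \<partial>lborel) \<longlonglongrightarrow> 0"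
  proof (rule nn_integral_dominated[where w="\<lambda>\<eta>. ennreal (exp (- (1 / 4) * (norm \<eta>)\<^sup>2))"])
    show "AE (\<eta>::'d) in lborel. ennreal ((1 - mehler_total (X n) x (norm \<eta>)) * exp (- (1 / 4) * (norm \<eta>)\<^sup>2)) \<le> ennreal (exp (- (1 / 4) * (norm \<eta>)\<^sup>2))" for n
    proof (rule AE_I2)
      fix \<eta> :: 'd
      have "(1 - mehler_total (X n) x (norm \<eta>)) * exp (- (1 / 4) * (norm \<eta>)\<^sup>2) \<le> 1 * exp (- (1 / 4) * (norm \<eta>)\<^sup>2)"
        using m01[of n x \<eta>] by (intro mult_right_mono) auto
      then show "ennreal ((1 - mehler_total (X n) x (norm \<eta>)) * exp (- (1 / 4) * (norm \<eta>)\<^sup>2)) \<le> ennreal (exp (- (1 / 4) * (norm \<eta>)\<^sup>2))"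
        by (intro ennreal_leI) simp
    qed
    have "(\<integral>\<^sup>+(\<eta>::'d). ennreal (exp (- (1 / 4) * (norm \<eta>)\<^sup>2)) \<partial>lborel) = ennreal ((pi / (1 / 4)) powr (real DIM('d) / 2))" by (rule nn_integral_gaussian) simp
    then show "(\<integral>\<^sup>+(\<eta>::'d). ennreal (exp (- (1 / 4) * (norm \<eta>)\<^sup>2)) \<partial>lborel) < \<top>" by simp
    show "AE (\<eta>::'d) in lborel. (\<lambda>n. ennreal ((1 - mehler_total (X n) x (norm \<eta>)) * exp (- (1 / 4) * (norm \<eta>)\<^sup>2))) \<longlonglongrightarrow> 0"
    proof (rule AE_I2)
      fix \<eta> :: 'd
      have 0: "(\<lambda>n. X n * norm \<eta>) \<longlonglongrightarrow> 0" by (rule tendsto_mult_left_zero[OF X(2)])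
      have "(\<lambda>n. mehler_total (X n) x (norm \<eta>)) \<longlonglongrightarrow> cosh 0 powr (- (real DIM('n) / 2)) * exp (- (norm \<eta> / 2) * (norm x)\<^sup>2 * tanh 0)"
        unfolding mehler_total_def by (intro tendsto_mult tendsto_powr tendsto_exp tendsto_const tendsto_cosh tendsto_tanh 0) auto
      then have "(\<lambda>n. (1 - mehler_total (X n) x (norm \<eta>)) * exp (- (1 / 4) * (norm \<eta>)\<^sup>2)) \<longlonglongrightarrow> (1 - cosh 0 powr (- (real DIM('n) / 2)) * exp (- (norm \<eta> / 2) * (norm x)\<^sup>2 * tanh 0)) * exp (- (1 / 4) * (norm \<eta>)\<^sup>2)"
        by (intro tendsto_mult tendsto_diff tendsto_const)
      then show "(\<lambda>n. ennreal ((1 - mehler_total (X n) x (norm \<eta>)) * exp (- (1 / 4) * (norm \<eta>)\<^sup>2))) \<longlonglongrightarrow> 0"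
        by (intro tendsto_ennrealI[where x=0, simplified]) simp
    qed
  qed measurable
  then have "(\<lambda>n. ennreal (pi powr (real DIM('d) / 2) / (2 * pi) ^ DIM('d)) * (\<integral>\<^sup>+(\<eta>::'d). ennreal ((1 - mehler_total (X n) x (norm \<eta>)) * exp (- (1 / 4) * (norm \<eta>)\<^sup>2)) \<partial>lborel)) \<longlonglongrightarrow> ennreal (pi powr (real DIM('d) / 2) / (2 * pi) ^ DIM('d)) * 0"
    by (intro ennreal_tendsto_cmult) auto
  then show ?thesis unfolding nn_integral_fourier_mehler_defect[OF X(1)] by simp
qed

text \<open>Integrating out y leaves the free heat kernel in x. Half of its exponent is spent on the
  decay at distance a, the other half stays integrable; the change of variance costs the factor
  2^(N/2), with N the dimension of x.\<close>

lemma fourier_mehler_far_le: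
  fixes x :: "'n::euclidean_space" and y :: "'d::euclidean_space"
  assumes t: "0 < t" and a: "0 < a"
  shows "(\<integral>\<^sup>+q. ennreal (fourier_mehler t x (fst q) (y - snd q)) * indicator {w. a \<le> norm (x - w)} (fst q) \<partial>lborel)
    \<le> ennreal (2 powr (real DIM('n) / 2) * exp (- (a\<^sup>2 / 4 * inverse t)))"
proof -
  define b where "b = (1 / (2 * pi * t)) powr (real DIM('n) / 2)"
  have "(\<integral>\<^sup>+q. ennreal (fourier_mehler t x (fst q) (y - snd q)) * indicator {w. a \<le> norm (x - w)} (fst q) \<partial>lborel) =
      (\<integral>\<^sup>+w. \<integral>\<^sup>+z. ennreal (fourier_mehler t x w (y - z)) * indicator {w. a \<le> norm (x - w)} w \<partial>lborel \<partial>lborel)"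
    by (rule nn_integral_lborel_pair[of "\<lambda>w z. ennreal (fourier_mehler t x w (y - z)) * indicator {w. a \<le> norm (x - w)} w"]) measurable
  also have "\<dots> \<le> (\<integral>\<^sup>+w. ennreal ((b * exp (- (a\<^sup>2 / 4 * inverse t))) * exp (- (1 / (4 * t)) * (norm (x - w))\<^sup>2)) \<partial>lborel)"
  proof (intro nn_integral_mono)
    fix w
    have "(\<integral>\<^sup>+z. ennreal (fourier_mehler t x w (y - z)) * indicator {w. a \<le> norm (x - w)} w \<partial>lborel) = (\<integral>\<^sup>+z. ennreal (fourier_mehler t x w (y - z)) \<partial>lborel) * indicator {w. a \<le> norm (x - w)} w"
      by (rule nn_integral_multc) measurable
    also have "(\<integral>\<^sup>+z. ennreal (fourier_mehler t x w (y - z)) \<partial>lborel) = (\<integral>\<^sup>+z. ennreal (fourier_mehler t x w (z::'d)) \<partial>lborel)"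
      by (rule nn_integral_lborel_reflect) measurable
    also have "\<dots> = ennreal (b * exp (- (1 / (2 * t)) * (norm (x - w))\<^sup>2))"
      unfolding b_def by (rule nn_integral_fourier_mehler[OF t])
    also have "\<dots> * indicator {w. a \<le> norm (x - w)} w \<le> ennreal ((b * exp (- (a\<^sup>2 / 4 * inverse t))) * exp (- (1 / (4 * t)) * (norm (x - w))\<^sup>2))"
    proof (cases "a \<le> norm (x - w)")
      case True
      then have "a\<^sup>2 \<le> (norm (x - w))\<^sup>2" using a by (intro power_mono) auto
      then have "a\<^sup>2 * (1 / (4 * t)) \<le> (norm (x - w))\<^sup>2 * (1 / (4 * t))" using t by (intro mult_right_mono) auto
      moreover have "(norm (x - w))\<^sup>2 * (1 / (2 * t)) = (norm (x - w))\<^sup>2 * (1 / (4 * t)) + (norm (x - w))\<^sup>2 * (1 / (4 * t))"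
        using t by (simp add: field_simps)
      moreover have "a\<^sup>2 / 4 * inverse t = a\<^sup>2 * (1 / (4 * t))" by (simp add: inverse_eq_divide)
      ultimately have "- (1 / (2 * t)) * (norm (x - w))\<^sup>2 \<le> - (a\<^sup>2 / 4 * inverse t) + - (1 / (4 * t)) * (norm (x - w))\<^sup>2"
        by (simp only: mult.commute[of _ "(norm (x - w))\<^sup>2"] mult_minus_right)
      then have "exp (- (1 / (2 * t)) * (norm (x - w))\<^sup>2) \<le> exp (- (a\<^sup>2 / 4 * inverse t)) * exp (- (1 / (4 * t)) * (norm (x - w))\<^sup>2)"
        unfolding exp_add[symmetric] by (simp only: exp_le_cancel_iff)
      then have "b * exp (- (1 / (2 * t)) * (norm (x - w))\<^sup>2) \<le> (b * exp (- (a\<^sup>2 / 4 * inverse t))) * exp (- (1 / (4 * t)) * (norm (x - w))\<^sup>2)"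
        unfolding mult.assoc by (intro mult_left_mono) (auto simp: b_def)
      then show ?thesis using True by (simp add: ennreal_leI)
    qed simp
    finally show "(\<integral>\<^sup>+z. ennreal (fourier_mehler t x w (y - z)) * indicator {w. a \<le> norm (x - w)} w \<partial>lborel) \<le> ennreal ((b * exp (- (a\<^sup>2 / 4 * inverse t))) * exp (- (1 / (4 * t)) * (norm (x - w))\<^sup>2))" .
  qed
  also have "\<dots> = (\<integral>\<^sup>+(w::'n). ennreal ((b * exp (- (a\<^sup>2 / 4 * inverse t))) * exp (- (1 / (4 * t)) * (norm w)\<^sup>2)) \<partial>lborel)"
    by (rule nn_integral_lborel_reflect) measurable
  also have "\<dots> = ennreal (b * exp (- (a\<^sup>2 / 4 * inverse t))) * (\<integral>\<^sup>+(w::'n). ennreal (exp (- (1 / (4 * t)) * (norm w)\<^sup>2)) \<partial>lborel)"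
    by (rule nn_integral_cmult_ennreal) (auto simp: b_def)
  also have "(\<integral>\<^sup>+(w::'n). ennreal (exp (- (1 / (4 * t)) * (norm w)\<^sup>2)) \<partial>lborel) = ennreal ((pi / (1 / (4 * t))) powr (real DIM('n) / 2))"
    using t by (intro nn_integral_gaussian) auto
  also have "ennreal (b * exp (- (a\<^sup>2 / 4 * inverse t))) * ennreal ((pi / (1 / (4 * t))) powr (real DIM('n) / 2)) =
      ennreal ((b * (pi / (1 / (4 * t))) powr (real DIM('n) / 2)) * exp (- (a\<^sup>2 / 4 * inverse t)))"
    by (subst ennreal_mult[symmetric]) (auto simp: b_def mult_ac)
  also have "b * (pi / (1 / (4 * t))) powr (real DIM('n) / 2) = 2 powr (real DIM('n) / 2)"
    unfolding b_def powr_mult[symmetric] using t by simp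
  finally show ?thesis .
qed

text \<open>Outside a ball of radius e one of the two components is at distance at least e / 2. In x
  the Gaussian tail applies. In y the kernel is accessible through Gaussian tests, so a Chebyshev
  argument with the weight 1 - exp (- |y - z|^2) is used.\<close>

lemma fourier_mehler_concentrates:
  fixes x :: "'n::euclidean_space" and y :: "'d::euclidean_space"
  assumes A: "open A" "(x, y) \<in> A"
  shows "((\<lambda>t. \<integral>\<^sup>+q. ennreal (fourier_mehler t x (fst q) (y - snd q)) * indicator (- A) q \<partial>lborel) \<longlongrightarrow> 0) (at_right 0)"
  unfolding tendsto_at_iff_sequentially comp_def
proof (intro allI impI)
  fix X :: "nat \<Rightarrow> real" assume X0: "\<forall>i. X i \<in> {0<..} - {0}" and X: "X \<longlonglongrightarrow> 0"
  have Xp: "0 < X n" for n using X0 by auto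
  obtain e where e: "0 < e" "ball (x, y) e \<subseteq> A" using A open_contains_ball by blast
  define a where "a = e / 2"
  have a: "0 < a" using e by (simp add: a_def)
  \<comment> \<open>Normalises the Chebyshev weight to be at least 1 at distances from a
    onwards.\<close>
  define c where "c = 1 / (1 - exp (- a\<^sup>2))"
  have ea: "0 < 1 - exp (- a\<^sup>2)" using a by simp
  then have c: "0 \<le> c" by (simp add: c_def)
  let ?D = "\<lambda>n. \<integral>\<^sup>+q. ennreal (fourier_mehler (X n) x (fst q) (y - snd q) * (1 - exp (- (norm (y - snd q))\<^sup>2))) \<partial>lborel"
  let ?E = "\<lambda>n. ennreal (2 powr (real DIM('n) / 2) * exp (- (a\<^sup>2 / 4 * inverse (X n))))"
  have [measurable]: "A \<in> sets borel" using A by simp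
  have bound: "(\<integral>\<^sup>+q. ennreal (fourier_mehler (X n) x (fst q) (y - snd q)) * indicator (- A) q \<partial>lborel) \<le> ?E n + ennreal c * ?D n" for n
  proof -
    have "(\<integral>\<^sup>+q. ennreal (fourier_mehler (X n) x (fst q) (y - snd q)) * indicator (- A) q \<partial>lborel) \<le>
      (\<integral>\<^sup>+q. ennreal (fourier_mehler (X n) x (fst q) (y - snd q)) * indicator {w. a \<le> norm (x - w)} (fst q) +
        ennreal c * ennreal (fourier_mehler (X n) x (fst q) (y - snd q) * (1 - exp (- (norm (y - snd q))\<^sup>2))) \<partial>lborel)"
    proof (intro nn_integral_mono)
      fix q :: "'n \<times> 'd"
      define f where "f = fourier_mehler (X n) x (fst q) (y - snd q)"
      have f: "0 \<le> f" unfolding f_def by (rule fourier_mehler_nonneg[OF Xp])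
      show "ennreal f * indicator (- A) q \<le> ennreal f * indicator {w. a \<le> norm (x - w)} (fst q) + ennreal c * ennreal (f * (1 - exp (- (norm (y - snd q))\<^sup>2)))"
      proof (cases "q \<in> A \<or> a \<le> norm (x - fst q)")
        case True
        then show ?thesis by (auto simp: indicator_def)
      next
        case False
        have "a \<le> norm (y - snd q)"
        proof (rule ccontr)
          assume "\<not> a \<le> norm (y - snd q)"
          moreover have "dist (x, y) q \<le> norm (x - fst q) + norm (y - snd q)"
            using sqrt_sum_squares_le_sum[of "norm (x - fst q)" "norm (y - snd q)"] by (cases q) (simp add: dist_norm norm_Pair)
          ultimately have "dist (x, y) q < e" using False by (simp add: a_def)
          then show False using e False by auto
        qed
        then have "a\<^sup>2 \<le> (norm (y - snd q))\<^sup>2" using a by (intro power_mono) auto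
        then have "1 - exp (- a\<^sup>2) \<le> 1 - exp (- (norm (y - snd q))\<^sup>2)" by simp
        then have "c * (1 - exp (- a\<^sup>2)) \<le> c * (1 - exp (- (norm (y - snd q))\<^sup>2))" using c by (rule mult_left_mono)
        then have "1 \<le> c * (1 - exp (- (norm (y - snd q))\<^sup>2))" using ea by (simp add: c_def)
        then have "f * 1 \<le> f * (c * (1 - exp (- (norm (y - snd q))\<^sup>2)))" using f by (rule mult_left_mono)
        then have "f \<le> c * (f * (1 - exp (- (norm (y - snd q))\<^sup>2)))" by (simp only: mult_1_right mult.left_commute)
        then have "ennreal f \<le> ennreal c * ennreal (f * (1 - exp (- (norm (y - snd q))\<^sup>2)))"
          using c f by (subst ennreal_mult[symmetric]) (auto intro!: ennreal_leI mult_nonneg_nonneg)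
        then show ?thesis using False by simp
      qed
    qed
    also have "\<dots> = (\<integral>\<^sup>+q. ennreal (fourier_mehler (X n) x (fst q) (y - snd q)) * indicator {w. a \<le> norm (x - w)} (fst q) \<partial>lborel) + ennreal c * ?D n"
      using fourier_mehler_pair_measurable[of "\<lambda>_. 1" "indicator {w. a \<le> norm (x - w)}" "X n" x y]
        fourier_mehler_pair_measurable[of "\<lambda>v. 1 - exp (- (norm v)\<^sup>2)" "\<lambda>_. 1" "X n" x y]
      by (simp add: nn_integral_add nn_integral_cmult)
    also have "\<dots> \<le> ?E n + ennreal c * ?D n" by (intro add_right_mono fourier_mehler_far_le Xp a)
    finally show ?thesis .
  qed
  have "filterlim (\<lambda>n. inverse (X n)) at_top sequentially" using X Xp by (intro filterlim_inverse_at_top) auto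
  then have "filterlim (\<lambda>n. a\<^sup>2 / 4 * inverse (X n)) at_top sequentially"
    using a by (intro filterlim_tendsto_pos_mult_at_top[OF tendsto_const]) auto
  then have "(\<lambda>n. exp (- (a\<^sup>2 / 4 * inverse (X n)))) \<longlonglongrightarrow> 0"
    by (intro filterlim_compose[OF exp_at_bot] filterlim_uminus_at_bot_at_top[THEN filterlim_compose])
  then have "?E \<longlonglongrightarrow> ennreal (2 powr (real DIM('n) / 2) * 0)" by (intro tendsto_ennrealI tendsto_mult tendsto_const)
  moreover have "(\<lambda>n. ennreal c * ?D n) \<longlonglongrightarrow> ennreal c * 0"
    by (intro ennreal_tendsto_cmult fourier_mehler_defect_tendsto Xp X) auto
  ultimately have "(\<lambda>n. ?E n + ennreal c * ?D n) \<longlonglongrightarrow> ennreal (2 powr (real DIM('n) / 2) * 0) + ennreal c * 0"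
    by (rule tendsto_add)
  then have conv: "(\<lambda>n. ?E n + ennreal c * ?D n) \<longlonglongrightarrow> 0" by simp
  show "(\<lambda>n. \<integral>\<^sup>+q. ennreal (fourier_mehler (X n) x (fst q) (y - snd q)) * indicator (- A) q \<partial>lborel) \<longlonglongrightarrow> 0"
  proof (rule tendsto_sandwich[OF _ _ tendsto_const conv])
    show "\<forall>\<^sub>F n in sequentially. (\<integral>\<^sup>+q. ennreal (fourier_mehler (X n) x (fst q) (y - snd q)) * indicator (- A) q \<partial>lborel) \<le> ?E n + ennreal c * ?D n"
      by (intro always_eventually allI bound)
  qed simp
qed

lemma markov_kernel_fourier_mehler:
  "\<exists>c. markov_kernel (\<lambda>t (q::'n::euclidean_space \<times> 'd::euclidean_space) q'. fourier_mehler t (fst q) (fst q') (snd q - snd q'))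
     ((real DIM('n) + 2 * real DIM('d)) / 2) c"
proof
  define C where "C = 1 / (2 * pi) ^ DIM('d) * ((1 / pi) powr (real DIM('n) / 2) * (8 * real DIM('d)) ^ DIM('d))"
  \<comment> \<open>The maximum with 1 meets the lower bound on the constant that the locale
    demands.\<close>
  show "markov_kernel (\<lambda>t (q::'n \<times> 'd) q'. fourier_mehler t (fst q) (fst q') (snd q - snd q'))
     ((real DIM('n) + 2 * real DIM('d)) / 2) (max 1 C)"
  proof
    have "1 \<le> (a + 2 * b) / 2" if "1 \<le> a" "1 \<le> b" for a b :: real
    proof -
      have "2 \<le> a + 2 * b" using that by linarith
      then show ?thesis by simp
    qed
    then show "1 \<le> (real DIM('n) + 2 * real DIM('d)) / 2" by this (simp_all add: Suc_le_eq)
    show "(\<lambda>x. fourier_mehler (fst x) (fst (fst (snd x))) (fst (snd (snd x))) (snd (fst (snd x)) - snd (snd (snd x))))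
        \<in> borel_measurable (borel \<Otimes>\<^sub>M ((borel :: ('n \<times> 'd) measure) \<Otimes>\<^sub>M borel))"
      unfolding borel_prod[symmetric] by measurable
    fix t :: real and q q' :: "'n \<times> 'd"
    show "fourier_mehler t (fst q) (fst q') (snd q - snd q') = fourier_mehler t (fst q') (fst q) (snd q' - snd q)"
      using fourier_mehler_commute[of t "fst q" "fst q'" "snd q - snd q'"] by simp
    assume t: "0 < t"
    show "0 \<le> fourier_mehler t (fst q) (fst q') (snd q - snd q')" by (rule fourier_mehler_nonneg[OF t])
    have "fourier_mehler t (fst q) (fst q') (snd q - snd q') \<le> C * t powr (- ((real DIM('n) + 2 * real DIM('d)) / 2))"
      unfolding C_def by (rule fourier_mehler_le[OF t])
    also have "\<dots> \<le> max 1 C * t powr (- ((real DIM('n) + 2 * real DIM('d)) / 2))" by (intro mult_right_mono) auto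
    finally show "fourier_mehler t (fst q) (fst q') (snd q - snd q') \<le> max 1 C * t powr (- ((real DIM('n) + 2 * real DIM('d)) / 2))" .
    show "(\<integral>\<^sup>+q'. ennreal (fourier_mehler t (fst q) (fst q') (snd q - snd q')) \<partial>lborel) = 1" by (rule fourier_mehler_mass[OF t])
    show "((\<lambda>s. fourier_mehler s (fst q) (fst q') (snd q - snd q')) \<longlongrightarrow> fourier_mehler t (fst q) (fst q') (snd q - snd q')) (at t)"
      by (rule fourier_mehler_tendsto[OF t])
  next
    fix A and q :: "'n \<times> 'd" assume "open A" "q \<in> A"
    then show "((\<lambda>t. \<integral>\<^sup>+q'. ennreal (fourier_mehler t (fst q) (fst q') (snd q - snd q')) * indicator (- A) q' \<partial>lborel) \<longlongrightarrow> 0) (at_right 0)"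
      by (intro fourier_mehler_concentrates) auto
  qed simp
qed

text \<open>Of the factor (2 pi)^(-(N + 2k)/2), the part (2 pi)^(-N/2) belongs to the normalisation
  of the Mehler kernel and (2 pi)^(-k) to the inverse Fourier transform. The integrand is absolutely
  integrable, so the real part passes under the integral and produces the cosine.\<close>

lemma grushin_kernel_eq_fourier_mehler:
  fixes x w :: "real^'n" and y :: "real^'k"
  assumes t: "0 < t"
  shows "grushin_kernel x w y t = fourier_mehler t x w y"
proof -
  define m where "m = real CARD('n) / 2"
  define g where "g \<xi> = mehler (t * norm \<xi>) (norm \<xi>) x w" for \<xi> :: "real^'k"
  have [measurable]: "g \<in> borel_measurable borel" unfolding g_def by measurable
  define F where "F \<xi> = of_real ((2 * pi) powr m * g \<xi>) * exp (\<i> * of_real (\<xi> \<bullet> y))" for \<xi>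
  have F: "of_real ((norm \<xi> / sinh (norm \<xi> * t)) powr (real CARD('n) / 2)) *
      exp (\<i> * of_real (\<xi> \<bullet> y) - of_real (norm \<xi> / 2 * (((norm x)\<^sup>2 + (norm w)\<^sup>2) * (cosh (norm \<xi> * t) / sinh (norm \<xi> * t)) - 2 * (x \<bullet> w) * (1 / sinh (norm \<xi> * t)))))
      = F \<xi>" for \<xi>
  proof -
    define s where "s = sinh (norm \<xi> * t)"
    define E where "E = norm \<xi> / 2 * (((norm x)\<^sup>2 + (norm w)\<^sup>2) * (cosh (norm \<xi> * t) / s) - 2 * (x \<bullet> w) * (1 / s))"
    have E: "- (norm \<xi> / 2) * ((((norm x)\<^sup>2 + (norm w)\<^sup>2) * cosh (norm \<xi> * t) - 2 * (x \<bullet> w)) / s) = - E"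
      by (simp add: E_def diff_divide_distrib)
    have "norm \<xi> / (2 * pi * s) = norm \<xi> / s / (2 * pi)" by simp
    then have "(norm \<xi> / (2 * pi * s)) powr m = (norm \<xi> / s) powr m / (2 * pi) powr m" by (simp only: powr_divide)
    then have "(2 * pi) powr m * g \<xi> = (norm \<xi> / s) powr m * exp (- E)"
      unfolding g_def mehler_def mult.commute[of t] s_def[symmetric] E m_def by simp
    then have "F \<xi> = of_real ((norm \<xi> / s) powr m) * (of_real (exp (- E)) * exp (\<i> * of_real (\<xi> \<bullet> y)))"
      unfolding F_def by (simp only: of_real_mult mult.assoc)
    also have "of_real (exp (- E)) * exp (\<i> * of_real (\<xi> \<bullet> y)) = exp (\<i> * of_real (\<xi> \<bullet> y) - of_real E)"
      by (simp add: exp_of_real[symmetric] exp_add[symmetric])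
    finally show ?thesis by (simp only: E_def s_def m_def)
  qed
  have Re: "Re (F \<xi>) = (2 * pi) powr m * (g \<xi> * cos (\<xi> \<bullet> y))" for \<xi> by (simp add: F_def Re_exp)
  have "integrable lborel F"
  proof (rule Bochner_Integration.integrable_bound)
    show "integrable lborel (\<lambda>\<xi>. (2 * pi) powr m * g \<xi>)"
      unfolding g_def using mehler_integrable(1)[OF t, of x w, where 'd="real^'k"] by (intro integrable_mult_right)
    show "F \<in> borel_measurable lborel" unfolding F_def by measurable
    show "AE \<xi> in lborel. norm (F \<xi>) \<le> norm ((2 * pi) powr m * g \<xi>)" by (rule AE_I2) (simp add: F_def norm_mult)
  qed
  from integral_Re[OF this] have a: "Re (\<integral>\<xi>. F \<xi> \<partial>lborel) = (2 * pi) powr m * (\<integral>\<xi>. g \<xi> * cos (\<xi> \<bullet> y) \<partial>lborel)"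
    unfolding Re by simp
  have b: "1 / (2 * pi) powr ((real CARD('n) + 2 * real CARD('k)) / 2) * (2 * pi) powr m = 1 / (2 * pi) ^ CARD('k)"
  proof -
    have "(real CARD('n) + 2 * real CARD('k)) / 2 = m + real CARD('k)" by (simp add: m_def)
    then have "(2 * pi) powr ((real CARD('n) + 2 * real CARD('k)) / 2) = (2 * pi) powr m * (2 * pi) ^ CARD('k)"
      by (simp only: powr_add) (simp add: powr_realpow)
    then show ?thesis by (simp only:) simp
  qed
  show ?thesis
    unfolding grushin_kernel_def F a fourier_mehler_def g_def[symmetric] by (simp only: mult.assoc[symmetric] b) simp
qed

lemma grushin_semigroup_eq:
  fixes \<phi> :: "(real^'n) \<times> (real^'k) \<Rightarrow> real"
  assumes "0 \<le> t" "markov_kernel (\<lambda>t (q :: (real^'n) \<times> (real^'k)) q'. fourier_mehler t (fst q) (fst q') (snd q - snd q')) D c"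
  shows "grushin_semigroup t \<phi> = markov_kernel.S (\<lambda>t q q'. fourier_mehler t (fst q) (fst q') (snd q - snd q')) t \<phi>"
  using assms(1) unfolding grushin_semigroup_def markov_kernel.S_def[OF assms(2)]
  by (auto simp: fun_eq_iff case_prod_beta' grushin_kernel_eq_fourier_mehler)

text \<open>Equality is asked for on the space of the measure only: the two descriptions of the
  semigroup are shown to agree for nonnegative times, and t - s is nonnegative exactly on the
  restricted interval.\<close>

lemma has_Lp_integral_cong:
  assumes "\<And>\<tau>. \<tau> \<in> space M \<Longrightarrow> g \<tau> = h \<tau>"
  shows "has_Lp_integral p M g I \<longleftrightarrow> has_Lp_integral p M h I"
proof -
  have 1: "(AE \<tau> in M. g \<tau> \<in> Lp p) \<longleftrightarrow> (AE \<tau> in M. h \<tau> \<in> Lp p)"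
    by (rule AE_cong) (simp add: assms)
  have 2: "(AE \<tau> in M. (\<lambda>n. Lp_norm p (\<lambda>z. g \<tau> z - s n \<tau> z)) \<longlonglongrightarrow> 0) \<longleftrightarrow> (AE \<tau> in M. (\<lambda>n. Lp_norm p (\<lambda>z. h \<tau> z - s n \<tau> z)) \<longlonglongrightarrow> 0)" for s
    by (rule AE_cong) (simp add: assms)
  have 3: "(\<integral>\<^sup>+\<tau>. ennreal (Lp_norm p (\<lambda>z. g \<tau> z - s n \<tau> z)) \<partial>M) = (\<integral>\<^sup>+\<tau>. ennreal (Lp_norm p (\<lambda>z. h \<tau> z - s n \<tau> z)) \<partial>M)" for s and n :: nat
    by (rule nn_integral_cong) (simp add: assms)
  show ?thesis unfolding has_Lp_integral_def 1 2 3 ..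
qed

lemma mild_solution_iff_mild:
  fixes u :: "real \<Rightarrow> (real^'n) \<times> (real^'k) \<Rightarrow> real"
  assumes k: "markov_kernel (\<lambda>t (q :: (real^'n) \<times> (real^'k)) q'. fourier_mehler t (fst q) (fst q') (snd q - snd q')) D c"
  shows "mild_solution p \<rho> T u0 u \<longleftrightarrow> markov_kernel.mild (\<lambda>t q q'. fourier_mehler t (fst q) (fst q') (snd q - snd q')) p \<rho> T u0 u"
proof -
  have "has_Lp_integral p (restrict_space lborel {0..t}) (\<lambda>s. grushin_semigroup (t - s) (nonlinearity \<rho> (u s))) I \<longleftrightarrow>
      has_Lp_integral p (restrict_space lborel {0..t}) (\<lambda>s. markov_kernel.S (\<lambda>t q q'. fourier_mehler t (fst q) (fst q') (snd q - snd q')) (t - s) (nonlinearity \<rho> (u s))) I" for t I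
    by (rule has_Lp_integral_cong) (simp add: space_restrict_space grushin_semigroup_eq[OF _ k])
  then show ?thesis
    unfolding mild_solution_def markov_kernel.mild_def[OF k] by (simp add: grushin_semigroup_eq[OF _ k])
qed

text \<open>The constant of the dependence estimate is chosen after a bound \<open>M\<close> on both
  solutions, because the nonlinearity is only locally Lipschitz. For given \<open>T\<close> and
  \<open>M\<close> it serves all data \<open>v0\<close> and all pairs of solutions.\<close>

theorem theorem3p3:
  fixes \<rho> p :: real and u0 :: "(real^'n) \<times> (real^'k) \<Rightarrow> real"
  assumes "\<rho> > 1" and "1 \<le> p"
    and "p > (real CARD('n) + 2 * real CARD('k)) / 2 * (\<rho> - 1)"
    and "u0 \<in> Lp p"
  shows "(\<exists>T>0. \<exists>u. mild_solution p \<rho> T u0 u \<and> u \<in> X_space p \<rho> T \<inter> E_space p T \<and>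
            (\<forall>v. mild_solution p \<rho> T u0 v \<longrightarrow>
                 (\<forall>t\<in>{0..T}. AE z in lborel. v t z = u t z))) \<and>
         (\<forall>T>0. \<forall>M. \<exists>C. \<forall>v0\<in>Lp p. \<forall>u v.
            mild_solution p \<rho> T u0 u \<and> mild_solution p \<rho> T v0 v \<and>
            (\<forall>t\<in>{0..T}. Lp_norm p (u t) \<le> M \<and> Lp_norm p (v t) \<le> M) \<longrightarrow>
            (\<forall>t\<in>{0..T}. Lp_norm p (\<lambda>z. u t z - v t z) \<le> C * Lp_norm p (\<lambda>z. u0 z - v0 z)))"
proof -
  define D where "D = (real CARD('n) + 2 * real CARD('k)) / 2"
  obtain c where k: "markov_kernel (\<lambda>t (q :: (real^'n) \<times> (real^'k)) q'. fourier_mehler t (fst q) (fst q') (snd q - snd q')) D c"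
    using markov_kernel_fourier_mehler[where 'n="real^'n" and 'd="real^'k"] by (auto simp: D_def)
  interpret markov_kernel "\<lambda>t (q :: (real^'n) \<times> (real^'k)) q'. fourier_mehler t (fst q) (fst q') (snd q - snd q')" D c
    by (rule k)
  note mild = mild_solution_iff_mild[OF k]
  have D: "D * (\<rho> - 1) < p" using assms by (simp add: D_def)
  have alpha: "grushin_alpha TYPE('n) TYPE('k) p \<rho> = D / (\<rho> * p) * (\<rho> - 1)"
    by (simp add: grushin_alpha_def D_def)
  from mild_existence[OF assms(1,2) D assms(4)] obtain T u where T: "0 < T" and u: "mild p \<rho> T u0 u"
    and X: "Lp_continuous_on (\<rho> * p) {0<..T} u"
      "bdd_above ((\<lambda>t. t powr (D / (\<rho> * p) * (\<rho> - 1)) * Lp_norm (\<rho> * p) (u t)) ` {0<..T})"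
    by blast
  have "u \<in> X_space p \<rho> T" unfolding X_space_def alpha using X by simp
  moreover have "u \<in> E_space p T" using u by (simp add: mild_def)
  moreover have "AE z in lborel. v t z = u t z" if "mild p \<rho> T u0 v" "t \<in> {0..T}" for v t
    by (rule mild_unique[OF assms(1,2) D assms(4) T u that])
  ultimately have "\<exists>T>0. \<exists>u. mild p \<rho> T u0 u \<and> u \<in> X_space p \<rho> T \<inter> E_space p T \<and>
      (\<forall>v. mild p \<rho> T u0 v \<longrightarrow> (\<forall>t\<in>{0..T}. AE z in lborel. v t z = u t z))"
    using T u by blast
  moreover have "\<exists>C. \<forall>v0\<in>Lp p. \<forall>u v. mild p \<rho> T u0 u \<and> mild p \<rho> T v0 v \<and>
      (\<forall>t\<in>{0..T}. Lp_norm p (u t) \<le> M \<and> Lp_norm p (v t) \<le> M) \<longrightarrow>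
      (\<forall>t\<in>{0..T}. Lp_norm p (\<lambda>z. u t z - v t z) \<le> C * Lp_norm p (\<lambda>z. u0 z - v0 z))" if "0 < T" for T M
    by (rule mild_stability[OF assms(1,2) D assms(4) that])
  ultimately show ?thesis unfolding mild by blast
qed

end
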